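(* Let $d\ge 2$ and let $\mathcal{P}$ be a Poisson point process of intensity one in $\mathbb{R}^d$. For $n\ge 1$ let $(V_n,E_n)$ be the complete graph on the finite point set $\mathcal{P}\cap[-n,n]^d$, each edge weighted by its Euclidean length, let $M_n$ be the total weight of a minimal spanning tree of $(V_n,E_n)$, and let $\mu_n$ be the law of $(M_n-\mathbb{E}(M_n))/\sqrt{\mathrm{Var}(M_n)}$. Let $G$ denote the standard normal distribution on $\mathbb{R}$. (i) If $d=2$, there is a constant $\beta>0$ such that for every $p>1$ and every $n\ge 1$, $$\mathcal{D}(\mu_n,G)\le c_1\, n^{-\frac{\beta}{4(\beta+p)}},$$ where $c_1>0$ depends only on $p$. (ii) If $d\ge 3$, then for every $p>1$ and every $n\ge 2$, $$\mathcal{D}(\mu_n,G)\le c_2\,(\log n)^{-\frac{d}{8p}},$$ where $c_2>0$ depends only on $p$ and $d$. Moreover, both bounds continue to hold if $\mathcal{D}(\mu_n,G)$ is replaced by $\sqrt{\mathcal{W}(\mu_n,G)}$.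
   Context: For probability measures $\mu_1,\mu_2$ on $\mathbb{R}$, the Kolmogorov distance is $\mathcal{D}(\mu_1,\mu_2)=\sup_{x\in\mathbb{R}}|\mu_1(-\infty,x]-\mu_2(-\infty,x]|$, and the Kantorovich–Wasserstein distance is $\mathcal{W}(\mu_1,\mu_2)=\sup\{|\int f\,d\mu_1-\int f\,d\mu_2| : f \text{ Lipschitz with Lipschitz constant at most }1\}$. A minimal spanning tree of a finite connected edge-weighted graph is a spanning tree minimizing the sum of its edge weights. *)

theory Defs
  imports "HOL-Probability.Probability"
begin

section \<open>Poisson point process of intensity one in R^d\<close>

text \<open>A (simple) point process is modelled as a random locally finite set of points
  P :: 'w => real^'d set on a probability space M.  It is a Poisson process of
  intensity one if for every bounded Borel set B the count card (P w \<inter> B) is a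
  random variable with Poisson distribution of mean Leb(B), and counts of pairwise
  disjoint bounded Borel sets are independent.\<close>

definition poisson_process_1 :: "'w measure \<Rightarrow> ('w \<Rightarrow> (real^'d) set) \<Rightarrow> bool" where
  "poisson_process_1 M P \<longleftrightarrow>
     prob_space M \<and>
     (\<forall>w\<in>space M. \<forall>B. bounded B \<longrightarrow> finite (P w \<inter> B)) \<and>
     (\<forall>B \<in> sets lborel. bounded B \<longrightarrow>
        (\<lambda>w. card (P w \<inter> B)) \<in> measurable M (count_space UNIV) \<and>
        (\<forall>k::nat. measure M {w\<in>space M. card (P w \<inter> B) = k}
                   = measure lborel B ^ k / fact k * exp (- measure lborel B))) \<and>
     (\<forall>(I::nat set) B. finite I \<longrightarrow> (\<forall>i\<in>I. B i \<in> sets lborel \<and> bounded (B i)) \<longrightarrow>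
        disjoint_family_on B I \<longrightarrow>
        prob_space.indep_vars M (\<lambda>_. count_space UNIV) (\<lambda>i w. card (P w \<inter> B i)) I)"

section \<open>Minimal spanning trees of the complete Euclidean graph\<close>

definition edge_length :: "('a::metric_space) set \<Rightarrow> real" where
  "edge_length e = (SOME r. \<exists>x y. e = {x, y} \<and> r = dist x y)"

definition complete_edges :: "'a set \<Rightarrow> 'a set set" where
  "complete_edges V = {{x, y} | x y. x \<in> V \<and> y \<in> V \<and> x \<noteq> y}"

definition graph_connected :: "'a set \<Rightarrow> 'a set set \<Rightarrow> bool" where
  "graph_connected V T \<longleftrightarrow> (\<forall>x\<in>V. \<forall>y\<in>V. (x, y) \<in> {(a, b). {a, b} \<in> T}\<^sup>*)"

definition has_cycle :: "'a set set \<Rightarrow> bool" where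
  "has_cycle T \<longleftrightarrow> (\<exists>vs. 3 \<le> length vs \<and> distinct vs \<and>
      (\<forall>i < length vs. {vs ! i, vs ! ((i + 1) mod length vs)} \<in> T))"

definition spanning_tree :: "'a set \<Rightarrow> 'a set set \<Rightarrow> bool" where
  "spanning_tree V T \<longleftrightarrow> T \<subseteq> complete_edges V \<and> graph_connected V T \<and> \<not> has_cycle T"

text \<open>Total edge length of a minimal spanning tree of the complete graph on a finite
  point set V, edges weighted by Euclidean length.\<close>
definition mst_weight :: "('a::metric_space) set \<Rightarrow> real" where
  "mst_weight V = Min ((\<lambda>T. \<Sum>e\<in>T. edge_length e) ` {T. spanning_tree V T})"

section \<open>Distances between probability measures on R\<close>

definition kolmogorov_dist :: "real measure \<Rightarrow> real measure \<Rightarrow> real" where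
  "kolmogorov_dist \<mu>1 \<mu>2 = (SUP x. \<bar>measure \<mu>1 {..x} - measure \<mu>2 {..x}\<bar>)"

definition wasserstein_dist :: "real measure \<Rightarrow> real measure \<Rightarrow> real" where
  "wasserstein_dist \<mu>1 \<mu>2 =
     Sup {\<bar>(\<integral>x. f x \<partial>\<mu>1) - (\<integral>x. f x \<partial>\<mu>2)\<bar> | f. 1-lipschitz_on UNIV f}"

definition std_normal :: "real measure" where
  "std_normal = density lborel std_normal_density"

section \<open>The MST functional of the Poisson process on [-n,n]^d\<close>

definition cube :: "nat \<Rightarrow> (real^'d) set" where
  "cube n = {x. \<forall>i. \<bar>x $ i\<bar> \<le> real n}"

definition mst_stat :: "('w \<Rightarrow> (real^'d) set) \<Rightarrow> nat \<Rightarrow> 'w \<Rightarrow> real" where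
  "mst_stat P n w = mst_weight (P w \<inter> cube n)"

text \<open>Law of (M_n - E M_n) / sqrt (Var M_n).\<close>
definition normalized_law :: "'w measure \<Rightarrow> ('w \<Rightarrow> real) \<Rightarrow> real measure" where
  "normalized_law M X = distr M borel
     (\<lambda>w. (X w - prob_space.expectation M X) / sqrt (prob_space.variance M X))"

end

theory Submission
  imports Defs
begin

text \<open>
  By Kruskal's algorithm the weight of a minimal spanning tree of \<open>V\<close> is the integral over
  \<open>r \<in> [0, \<rho>]\<close> of the number of components of the graph joining points at distance at
  most \<open>r\<close>, minus \<open>\<rho>\<close>, for any \<open>\<rho>\<close> above the diameter of \<open>V\<close>. If no large cube is free of
  points, a much smaller cutoff \<open>\<rho>\<close> already gives the exact weight, so with overwhelming probability
  the weight is a functional of range \<open>\<rho>\<close>. The change of that functional when a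
  point is added is monotone in the window, because the number of components is supermodular for far
  points.

  Monotonicity replaces the percolation estimates usually needed to show that the add-one cost
  stabilises. By Russo's formula the derivative in the density of the mean, per volume, is the mean
  add-one cost up to a boundary term, and the mean per volume hardly depends on the
  box; comparing two box sizes by the mean value theorem in the density, and using that a change of
  density is a change of scale, the mean add-one cost at window \<open>K\<close> is within \<open>O(\<rho>\<^sup>2 / K)\<close>
  of its limit, while the growth of the mean with the density makes it positive. By the
  Efron-Stein inequality the functional is then close in \<open>L\<^sup>2\<close> to the sum of its restrictions to
  disjoint blocks, with a variance of the order of the volume. Lindeberg's method applies to the
  independent blocks and gives a polynomial rate \<open>n\<^bsup>-1/100\<^esup>\<close> for the Wasserstein distance, in every
  dimension. Discretising the Poisson process to the occupied cells of a fine mesh reduces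
  all of this to Bernoulli random subsets of the integer lattice.
\<close>

section \<open>Connected components of geometric graphs\<close>

text \<open>The mean value theorem yields one unspecified density, while the rate is wanted at
  intensity one. On cells of a given mesh a density is a mesh and hence a scale: a density between
  the occupation probabilities of the meshes \<open>h\<close> and \<open>2 * h\<close> becomes a
  cutoff somewhere between \<rho> and 2\<rho>. A second form of supermodularity repairs this: the
  gain in mean add-one cost from enlarging the window also increases with the cutoff, so a bound at
  the unspecified cutoff bounds the gain at \<rho>. Monotonicity also turns second moments into
  first ones. Away from block boundaries the discrepancy between global and local add-one cost is
  nonnegative and bounded, so its mean square, which the Efron-Stein inequality asks for, is at most
  a constant times its mean. With n about m^50 the cutoff is of order m and the relative L2 errors
  are of order m^(-1/2), hence 1/100; the power 50 leaves room for the third moments of blocks of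
  half side about m^7. A square root for the Kolmogorov distance gives 1/200, which meets both
  stated rates: \<beta> may be chosen small, and powers of n beat powers of log n.\<close>

definition rel_comps :: "('a \<times> 'a) set \<Rightarrow> 'a set \<Rightarrow> 'a set set" where
  "rel_comps R V = (\<lambda>x. R\<^sup>* `` {x}) ` V"

lemma sym_rtrancl_class_eq:
  assumes "sym R" "(x, y) \<in> R\<^sup>*"
  shows "R\<^sup>* `` {x} = R\<^sup>* `` {y}"
proof -
  have "(y, x) \<in> R\<^sup>*"
    using assms by (meson sym_rtrancl symD)
  then show ?thesis
    using assms(2) by (auto intro: rtrancl_trans)
qed

lemma rtrancl_class_eq_iff:
  assumes "sym R"
  shows "R\<^sup>* `` {x} = R\<^sup>* `` {y} \<longleftrightarrow> (x, y) \<in> R\<^sup>*"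
  using sym_rtrancl_class_eq[OF assms] by blast

lemma finite_rel_comps [simp]: "finite V \<Longrightarrow> finite (rel_comps R V)"
  by (simp add: rel_comps_def)

text \<open>A map that sends related points to connected points induces a map from classes to
  classes, and the last hypothesis makes it onto. Changes of radius, changes of edge set and
  roundings of the points are all compared through it.\<close>

lemma card_rel_comps_hom:
  assumes "finite V" "sym R'"
    and "\<And>x y. (x, y) \<in> R \<Longrightarrow> (f x, f y) \<in> R'\<^sup>*"
    and "\<And>y. y \<in> V' \<Longrightarrow> \<exists>x\<in>V. (y, f x) \<in> R'\<^sup>*"
  shows "card (rel_comps R' V') \<le> card (rel_comps R V)"
proof -
  have f: "(f x, f y) \<in> R'\<^sup>*" if "(x, y) \<in> R\<^sup>*" for x y
    using that
  proof (induction rule: rtrancl_induct)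
    case (step y z)
    then show ?case
      using assms(3) rtrancl_trans by metis
  qed simp
  have "rel_comps R' V' \<subseteq> (\<lambda>C. R'\<^sup>* `` (f ` C)) ` rel_comps R V"
  proof
    fix D assume "D \<in> rel_comps R' V'"
    then obtain y where y: "y \<in> V'" "D = R'\<^sup>* `` {y}"
      by (auto simp: rel_comps_def)
    then obtain x where x: "x \<in> V" "(y, f x) \<in> R'\<^sup>*"
      using assms(4) by blast
    have D: "D = R'\<^sup>* `` {f x}"
      using y x sym_rtrancl_class_eq[OF assms(2)] by simp
    have "R'\<^sup>* `` (f ` (R\<^sup>* `` {x})) = R'\<^sup>* `` {f x}"
      using f by (auto intro: rtrancl_trans)
    then show "D \<in> (\<lambda>C. R'\<^sup>* `` (f ` C)) ` rel_comps R V"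
      using x D by (auto simp: rel_comps_def image_iff intro!: bexI[of _ x])
  qed
  then have "card (rel_comps R' V') \<le> card ((\<lambda>C. R'\<^sup>* `` (f ` C)) ` rel_comps R V)"
    using assms(1) by (intro card_mono) auto
  also have "\<dots> \<le> card (rel_comps R V)"
    using assms(1) by (intro card_image_le) auto
  finally show ?thesis .
qed

text \<open>A path may cross the new edge many times, but one crossing suffices: after a second
  crossing the path is back on the side it came from.\<close>

lemma rtrancl_insert_edge:
  assumes "(x, y) \<in> (R \<union> {(a, b), (b, a)})\<^sup>*" "sym R"
  shows "(x, y) \<in> R\<^sup>* \<or> (x, a) \<in> R\<^sup>* \<and> (b, y) \<in> R\<^sup>* \<or> (x, b) \<in> R\<^sup>* \<and> (a, y) \<in> R\<^sup>*"
  using assms(1)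
proof (induction rule: rtrancl_induct)
  case (step y z)
  have s: "(u, v) \<in> R\<^sup>* \<Longrightarrow> (v, u) \<in> R\<^sup>*" for u v
    using assms(2) by (meson sym_rtrancl symD)
  from step.hyps(2) consider "(y, z) \<in> R" | "y = a" "z = b" | "y = b" "z = a"
    by auto
  then show ?case
  proof cases
    case 1
    then show ?thesis
      using step.IH rtrancl_into_rtrancl by metis
  next
    case 2
    then show ?thesis
      using step.IH s by (metis rtrancl.rtrancl_refl rtrancl_trans)
  next
    case 3
    then show ?thesis
      using step.IH s by (metis rtrancl.rtrancl_refl rtrancl_trans)
  qed
qed simp

lemma sym_insert_edge: "sym R \<Longrightarrow> sym (R \<union> {(a, b), (b, a)})"
  by (auto simp: sym_def)

lemma rel_comps_insert_edge_same:
  assumes "sym R" "(a, b) \<in> R\<^sup>*"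
  shows "(R \<union> {(a, b), (b, a)})\<^sup>* = R\<^sup>*"
proof -
  have "(b, a) \<in> R\<^sup>*"
    using assms by (meson sym_rtrancl symD)
  then have "R \<union> {(a, b), (b, a)} \<subseteq> R\<^sup>*"
    using assms by auto
  then show ?thesis
    by (meson Un_upper1 rtrancl_subset)
qed

lemma card_rel_comps_insert_edge:
  assumes "finite V" "sym R" "a \<in> V" "b \<in> V" "(a, b) \<notin> R\<^sup>*"
  shows "card (rel_comps R V) = Suc (card (rel_comps (R \<union> {(a, b), (b, a)}) V))"
proof -
  let ?R' = "R \<union> {(a, b), (b, a)}"
  let ?g = "\<lambda>C. ?R'\<^sup>* `` C" and ?Cb = "R\<^sup>* `` {b}"
  have sym': "sym ?R'"
    using assms(2) by (rule sym_insert_edge)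
  have sub: "R\<^sup>* \<subseteq> ?R'\<^sup>*"
    by (rule rtrancl_mono) auto
  have gc: "?g (R\<^sup>* `` {x}) = ?R'\<^sup>* `` {x}" for x
    using sub by (auto intro: rtrancl_trans)
  have ab: "?R'\<^sup>* `` {a} = ?R'\<^sup>* `` {b}"
    by (intro sym_rtrancl_class_eq[OF sym']) auto
  \<comment> \<open>The class of \<open>b\<close> is the one that disappears; on the remaining
    classes, enlarging the relation is a bijection onto the new classes.\<close>
  have inj: "inj_on ?g (rel_comps R V - {?Cb})"
  proof (rule inj_onI)
    fix C D assume C: "C \<in> rel_comps R V - {?Cb}" and D: "D \<in> rel_comps R V - {?Cb}"
      and eq: "?g C = ?g D"
    obtain x where x: "x \<in> V" "C = R\<^sup>* `` {x}" using C by (auto simp: rel_comps_def)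
    obtain y where y: "y \<in> V" "D = R\<^sup>* `` {y}" using D by (auto simp: rel_comps_def)
    have "(x, y) \<in> ?R'\<^sup>*"
      using eq x y gc rtrancl_class_eq_iff[OF sym'] by simp
    moreover have "(x, b) \<notin> R\<^sup>*" "(y, b) \<notin> R\<^sup>*"
      using C D x y rtrancl_class_eq_iff[OF assms(2)] by auto
    moreover have "(b, y) \<notin> R\<^sup>*"
      using \<open>(y, b) \<notin> R\<^sup>*\<close> assms(2) by (meson sym_rtrancl symD)
    ultimately have "(x, y) \<in> R\<^sup>*"
      using rtrancl_insert_edge[OF _ assms(2)] by metis
    then show "C = D"
      using x y sym_rtrancl_class_eq[OF assms(2)] by simp
  qed
  have img: "?g ` (rel_comps R V - {?Cb}) = rel_comps ?R' V"
  proof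
    show "?g ` (rel_comps R V - {?Cb}) \<subseteq> rel_comps ?R' V"
      using gc by (auto simp: rel_comps_def)
    show "rel_comps ?R' V \<subseteq> ?g ` (rel_comps R V - {?Cb})"
    proof
      fix D assume "D \<in> rel_comps ?R' V"
      then obtain x where x: "x \<in> V" "D = ?R'\<^sup>* `` {x}"
        by (auto simp: rel_comps_def)
      define y where "y = (if R\<^sup>* `` {x} = ?Cb then a else x)"
      have "R\<^sup>* `` {y} \<noteq> ?Cb"
        using assms(5) rtrancl_class_eq_iff[OF assms(2)] by (auto simp: y_def)
      moreover have "?R'\<^sup>* `` {y} = D"
      proof (cases "R\<^sup>* `` {x} = ?Cb")
        case True
        then have "?R'\<^sup>* `` {x} = ?R'\<^sup>* `` {b}"
          using gc[of x] gc[of b] by simp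
        then show ?thesis
          using True ab x by (simp add: y_def)
      qed (simp add: y_def x)
      moreover have "y \<in> V"
        using x assms by (simp add: y_def)
      ultimately show "D \<in> ?g ` (rel_comps R V - {?Cb})"
        using gc by (intro image_eqI[of _ _ "R\<^sup>* `` {y}"]) (auto simp: rel_comps_def)
    qed
  qed
  have "card (rel_comps ?R' V) = card (rel_comps R V - {?Cb})"
    using card_image[OF inj] img by simp
  moreover have "?Cb \<in> rel_comps R V"
    using assms by (auto simp: rel_comps_def)
  ultimately show ?thesis
    using assms(1) by (metis card_Suc_Diff1 finite_rel_comps)
qed

section \<open>Components of the graph joining points within distance r\<close>

definition near_rel :: "real \<Rightarrow> 'a::metric_space set \<Rightarrow> ('a \<times> 'a) set" where
  "near_rel r V = {(x, y). x \<in> V \<and> y \<in> V \<and> dist x y \<le> r}"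

definition ncomp :: "real \<Rightarrow> 'a::metric_space set \<Rightarrow> nat" where
  "ncomp r V = card (rel_comps (near_rel r V) V)"

lemma sym_near_rel: "sym (near_rel r V)"
  by (auto simp: near_rel_def sym_def dist_commute)

lemma near_rel_mono: "V \<subseteq> V' \<Longrightarrow> r \<le> r' \<Longrightarrow> near_rel r V \<subseteq> near_rel r' V'"
  by (auto simp: near_rel_def)

lemma near_rel_class_subset:
  "(x, y) \<in> (near_rel r V)\<^sup>* \<Longrightarrow> x \<in> V \<Longrightarrow> y \<in> V"
  by (induction rule: rtrancl_induct) (auto simp: near_rel_def)

lemma ncomp_empty [simp]: "ncomp r {} = 0"
  by (simp add: ncomp_def rel_comps_def)

lemma ncomp_le_card: "finite V \<Longrightarrow> ncomp r V \<le> card V"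
  unfolding ncomp_def rel_comps_def by (rule card_image_le)

lemma ncomp_pos: "finite V \<Longrightarrow> V \<noteq> {} \<Longrightarrow> 0 < ncomp r V"
  unfolding ncomp_def rel_comps_def by (simp add: card_gt_0_iff)

lemma ncomp_map_le:
  assumes "finite V" "\<And>x. x \<in> V \<Longrightarrow> f x \<in> V'"
    and "\<And>x y. x \<in> V \<Longrightarrow> y \<in> V \<Longrightarrow> dist x y \<le> r \<Longrightarrow> dist (f x) (f y) \<le> r'"
    and "\<And>y. y \<in> V' \<Longrightarrow> \<exists>x\<in>V. (y, f x) \<in> (near_rel r' V')\<^sup>*"
  shows "ncomp r' V' \<le> ncomp r V"
  unfolding ncomp_def
  by (rule card_rel_comps_hom[OF assms(1) sym_near_rel _ assms(4)])
     (use assms(2,3) in \<open>auto simp: near_rel_def intro!: r_into_rtrancl\<close>)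

lemma ncomp_antimono: "finite V \<Longrightarrow> r \<le> r' \<Longrightarrow> ncomp r' V \<le> ncomp r V"
  by (rule ncomp_map_le[where f = id]) auto

lemma ncomp_eq_1I:
  assumes "finite V" "x \<in> V" "\<And>y. y \<in> V \<Longrightarrow> (x, y) \<in> (near_rel r V)\<^sup>*"
  shows "ncomp r V = 1"
proof -
  have "rel_comps (near_rel r V) V = {(near_rel r V)\<^sup>* `` {x}}"
    using assms sym_rtrancl_class_eq[OF sym_near_rel] unfolding rel_comps_def by fastforce
  then show ?thesis
    by (simp add: ncomp_def)
qed

text \<open>The components that merge into a single one when a new point \<open>z\<close> joins the
  points of \<open>V\<close>.\<close>

definition touching :: "real \<Rightarrow> 'a::metric_space set \<Rightarrow> 'a \<Rightarrow> 'a set set" where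
  "touching r V z = {C \<in> rel_comps (near_rel r V) V. \<exists>x\<in>C. dist z x \<le> r}"

lemma finite_touching [simp]: "finite V \<Longrightarrow> finite (touching r V z)"
  by (simp add: touching_def)

text \<open>The touched components and \<open>z\<close> become one class \<open>?Z\<close>, and all
  other classes stay as they are. The additive form avoids truncated subtraction of natural
  numbers.\<close>

lemma ncomp_insert:
  assumes V: "finite V" "z \<notin> V"
  shows "ncomp r (insert z V) + card (touching r V z) = ncomp r V + 1"
proof -
  let ?R = "near_rel r V" and ?R' = "near_rel r (insert z V)"
  let ?T = "touching r V z"
  let ?Z = "insert z (\<Union>?T)"
  have sub: "?R\<^sup>* \<subseteq> ?R'\<^sup>*"
    by (rule rtrancl_mono) (auto simp: near_rel_def)
  have far: "?R'\<^sup>* `` {x} = ?R\<^sup>* `` {x}" if x: "x \<in> V" "?R\<^sup>* `` {x} \<notin> ?T" for x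
  proof -
    have "(x, y) \<in> ?R\<^sup>*" if "(x, y) \<in> ?R'\<^sup>*" for y
      using that
    proof (induction rule: rtrancl_induct)
      case (step y w)
      have "y \<in> V"
        using step.IH x(1) near_rel_class_subset by metis
      moreover have "\<not> dist z y \<le> r"
        using x step.IH unfolding touching_def rel_comps_def by auto
      ultimately have "(y, w) \<in> ?R"
        using step.hyps(2) by (auto simp: near_rel_def dist_commute)
      then show ?case
        using step.IH by (rule rtrancl_into_rtrancl[rotated])
    qed simp
    then show ?thesis
      using sub by blast
  qed
  have near: "?R'\<^sup>* `` {z} = ?Z"
  proof
    show "?R'\<^sup>* `` {z} \<subseteq> ?Z"
    proof
      fix y assume "y \<in> ?R'\<^sup>* `` {z}"
      then have "(z, y) \<in> ?R'\<^sup>*" by simp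
      then show "y \<in> ?Z"
      proof (induction rule: rtrancl_induct)
        case (step y w)
        show ?case
        proof (cases "w = z")
          case False
          then have w: "w \<in> V"
            using step.hyps(2) by (auto simp: near_rel_def)
          show ?thesis
          proof (cases "y = z")
            case True
            then have "?R\<^sup>* `` {w} \<in> ?T"
              using step.hyps(2) w by (auto simp: near_rel_def touching_def rel_comps_def)
            then show ?thesis by blast
          next
            case False
            then obtain C where C: "C \<in> ?T" "y \<in> C"
              using step.IH by blast
            then obtain u where u: "u \<in> V" "C = ?R\<^sup>* `` {u}"
              by (auto simp: touching_def rel_comps_def)
            have "y \<in> V"
              using C u near_rel_class_subset by fastforce
            then have "(y, w) \<in> ?R"
              using step.hyps(2) w by (auto simp: near_rel_def)
            then have "w \<in> C"
              using C u by (auto intro: rtrancl_into_rtrancl)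
            then show ?thesis using C by blast
          qed
        qed simp
      qed simp
    qed
    show "?Z \<subseteq> ?R'\<^sup>* `` {z}"
    proof
      fix y assume "y \<in> ?Z"
      then consider "y = z" | C where "C \<in> ?T" "y \<in> C" by blast
      then show "y \<in> ?R'\<^sup>* `` {z}"
      proof cases
        case 2
        then obtain u where u: "u \<in> V" "C = ?R\<^sup>* `` {u}"
          by (auto simp: touching_def rel_comps_def)
        obtain x where x: "x \<in> C" "dist z x \<le> r"
          using 2 by (auto simp: touching_def)
        have "x \<in> V"
          using x u near_rel_class_subset by fastforce
        then have "(z, x) \<in> ?R'"
          using x by (simp add: near_rel_def)
        moreover have "(x, y) \<in> ?R'\<^sup>*"
        proof -
          have "(x, u) \<in> ?R\<^sup>*"
            using x u sym_near_rel by (metis Image_singleton_iff sym_rtrancl symD)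
          then have "(x, y) \<in> ?R\<^sup>*"
            using 2(2) u rtrancl_trans[of x u ?R y] by simp
          then show ?thesis using sub by blast
        qed
        ultimately have "(z, y) \<in> ?R'\<^sup>*"
          by (rule converse_rtrancl_into_rtrancl)
        then show ?thesis by simp
      qed simp
    qed
  qed
  have tch: "?R'\<^sup>* `` {x} = ?Z" if x: "x \<in> V" "?R\<^sup>* `` {x} \<in> ?T" for x
  proof -
    have "x \<in> ?Z" using x by blast
    then have "(z, x) \<in> ?R'\<^sup>*"
      using near by blast
    then show ?thesis
      using sym_rtrancl_class_eq[OF sym_near_rel] near by metis
  qed
  have eq: "rel_comps ?R' (insert z V) = insert ?Z (rel_comps ?R V - ?T)"
  proof
    show "rel_comps ?R' (insert z V) \<subseteq> insert ?Z (rel_comps ?R V - ?T)"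
    proof
      fix C assume "C \<in> rel_comps ?R' (insert z V)"
      then consider "C = ?R'\<^sup>* `` {z}" | x where "x \<in> V" "C = ?R'\<^sup>* `` {x}"
        by (auto simp: rel_comps_def)
      then show "C \<in> insert ?Z (rel_comps ?R V - ?T)"
      proof cases
        case 1
        then show ?thesis using near by simp
      next
        case 2
        then show ?thesis
          using tch far by (cases "?R\<^sup>* `` {x} \<in> ?T") (auto simp: rel_comps_def)
      qed
    qed
    have "?Z \<in> rel_comps ?R' (insert z V)"
      using near by (auto simp: rel_comps_def)
    moreover have "C \<in> rel_comps ?R' (insert z V)" if C: "C \<in> rel_comps ?R V - ?T" for C
    proof -
      obtain x where "x \<in> V" "C = ?R\<^sup>* `` {x}"
        using C unfolding rel_comps_def by blast
      then show ?thesis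
        using far[of x] C by (auto simp: rel_comps_def)
    qed
    ultimately show "insert ?Z (rel_comps ?R V - ?T) \<subseteq> rel_comps ?R' (insert z V)"
      by blast
  qed
  have "?Z \<notin> rel_comps ?R V"
  proof
    assume "?Z \<in> rel_comps ?R V"
    then obtain x where "x \<in> V" "?Z = ?R\<^sup>* `` {x}"
      by (auto simp: rel_comps_def)
    then have "z \<in> V"
      using near_rel_class_subset by blast
    then show False using V by simp
  qed
  then have "ncomp r (insert z V) = Suc (card (rel_comps ?R V - ?T))"
    using V by (simp add: ncomp_def eq)
  also have "card (rel_comps ?R V - ?T) = ncomp r V - card ?T"
    using V by (simp add: ncomp_def card_Diff_subset touching_def)
  finally show ?thesis
    using card_mono[of "rel_comps ?R V" ?T] V by (simp add: ncomp_def touching_def)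
qed

text \<open>A touched component of \<open>V'\<close> has a point within \<open>r\<close> of
  \<open>z\<close>. The added points are farther away, so this point is in \<open>V\<close> and its
  component in \<open>V\<close> is touched as well. Enlarging components thus carries the touched
  ones of \<open>V\<close> onto all those of \<open>V'\<close>: far points can only merge
  them.\<close>

lemma card_touching_antimono:
  assumes "finite V'" "V \<subseteq> V'" "\<And>x. x \<in> V' - V \<Longrightarrow> r < dist z x"
  shows "card (touching r V' z) \<le> card (touching r V z)"
proof -
  let ?R = "near_rel r V" and ?R' = "near_rel r V'"
  have sub: "?R\<^sup>* \<subseteq> ?R'\<^sup>*"
    using near_rel_mono[OF assms(2)] by (simp add: rtrancl_mono)
  have fin: "finite V" using assms finite_subset by blast
  have "touching r V' z \<subseteq> (\<lambda>C. ?R'\<^sup>* `` C) ` touching r V z"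
  proof
    fix C' assume "C' \<in> touching r V' z"
    then obtain u x where u: "u \<in> V'" "C' = ?R'\<^sup>* `` {u}" and x: "x \<in> C'" "dist z x \<le> r"
      by (auto simp: touching_def rel_comps_def)
    have "x \<in> V'"
      using u x near_rel_class_subset by fastforce
    then have xV: "x \<in> V"
      using assms(3) x by force
    have "C' = ?R'\<^sup>* `` {x}"
      using u x sym_rtrancl_class_eq[OF sym_near_rel] by fastforce
    moreover have "?R'\<^sup>* `` (?R\<^sup>* `` {x}) = ?R'\<^sup>* `` {x}"
      using sub by (auto intro: rtrancl_trans)
    moreover have "?R\<^sup>* `` {x} \<in> touching r V z"
      using xV x by (auto simp: touching_def rel_comps_def)
    ultimately show "C' \<in> (\<lambda>C. ?R'\<^sup>* `` C) ` touching r V z"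
      by (metis image_eqI)
  qed
  then show ?thesis
    by (rule surj_card_le[OF finite_touching[OF fin]])
qed

text \<open>A new point changes the count by one minus the number of touched components, and this
  number can only drop when far points are added. An added point within distance \<open>r\<close> of
  \<open>z\<close> could form a touched component of its own, which is why the added points have to
  be far.\<close>

lemma ncomp_supermodular:
  assumes "finite V'" "V \<subseteq> V'" "z \<notin> V'" "\<And>x. x \<in> V' - V \<Longrightarrow> r < dist z x"
  shows "real (ncomp r (insert z V)) - ncomp r V \<le> real (ncomp r (insert z V')) - ncomp r V'"
proof -
  have "finite V" "z \<notin> V" using assms finite_subset by auto
  then show ?thesis
    using ncomp_insert[of V z r] ncomp_insert[of V' z r] card_touching_antimono[OF assms(1,2,4)] assms
    by simp
qed

lemma ncomp_insert_le: "finite V \<Longrightarrow> ncomp r (insert z V) \<le> ncomp r V + 1"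
  using ncomp_insert[of V z r] by (cases "z \<in> V") (auto simp: insert_absorb)

text \<open>Two points of \<open>V\<close> within distance \<open>r\<close> lie in the same
  component, so representatives of distinct touched components are \<open>r\<close>-separated inside
  the ball of radius \<open>r\<close> about \<open>z\<close>. A packing bound then limits their
  number independently of \<open>V\<close>.\<close>

lemma touching_representatives:
  assumes "finite V"
  obtains X where "X \<subseteq> V" "card X = card (touching r V z)" "\<And>x. x \<in> X \<Longrightarrow> dist z x \<le> r"
    "\<And>x y. x \<in> X \<Longrightarrow> y \<in> X \<Longrightarrow> x \<noteq> y \<Longrightarrow> r < dist x y"
proof -
  let ?R = "near_rel r V"
  have "\<forall>C\<in>touching r V z. \<exists>x. x \<in> C \<and> dist z x \<le> r"
    by (auto simp: touching_def)
  then obtain g where g: "\<And>C. C \<in> touching r V z \<Longrightarrow> g C \<in> C \<and> dist z (g C) \<le> r"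
    by metis
  have cls: "g C \<in> V \<and> C = ?R\<^sup>* `` {g C}" if "C \<in> touching r V z" for C
  proof -
    obtain u where "u \<in> V" "C = ?R\<^sup>* `` {u}"
      using \<open>C \<in> touching r V z\<close> by (auto simp: touching_def rel_comps_def)
    then show ?thesis
      using g[OF \<open>C \<in> touching r V z\<close>] near_rel_class_subset
        sym_rtrancl_class_eq[OF sym_near_rel, of u "g C" r V] by auto
  qed
  have inj: "inj_on g (touching r V z)"
    using cls by (metis inj_onI)
  show thesis
  proof (rule that[of "g ` touching r V z"])
    show "r < dist x y" if xy: "x \<in> g ` touching r V z" "y \<in> g ` touching r V z" "x \<noteq> y" for x y
    proof (rule ccontr)
      assume "\<not> r < dist x y"
      then have "(x, y) \<in> ?R"
        using xy cls by (auto simp: near_rel_def)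
      then have "?R\<^sup>* `` {x} = ?R\<^sup>* `` {y}"
        by (intro sym_rtrancl_class_eq[OF sym_near_rel]) auto
      then show False
        using xy cls by force
    qed
  qed (use g cls card_image[OF inj] in auto)
qed

lemma ncomp_insert_ge_local:
  assumes "finite V" "z \<notin> V"
  shows "real (ncomp r (insert z V)) \<ge> ncomp r V + 1 - real (card {x \<in> V. dist z x \<le> r})"
proof -
  obtain X where X: "X \<subseteq> V" "card X = card (touching r V z)" "\<And>x. x \<in> X \<Longrightarrow> dist z x \<le> r"
    using touching_representatives[OF assms(1), of r z] by metis
  have "card X \<le> card {x \<in> V. dist z x \<le> r}"
    using X assms by (intro card_mono) auto
  then show ?thesis
    using ncomp_insert[OF assms, of r] X by simp
qed

lemma ncomp_Un_le:
  assumes "finite A" "finite B"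
  shows "ncomp r (A \<union> B) \<le> ncomp r A + ncomp r B"
proof -
  let ?R = "near_rel r (A \<union> B)"
  have sub: "(near_rel r A)\<^sup>* \<subseteq> ?R\<^sup>*" "(near_rel r B)\<^sup>* \<subseteq> ?R\<^sup>*"
    by (rule rtrancl_mono, rule near_rel_mono, simp_all)+
  have "?R\<^sup>* `` ((near_rel r A)\<^sup>* `` {x}) = ?R\<^sup>* `` {x}"
    "?R\<^sup>* `` ((near_rel r B)\<^sup>* `` {x}) = ?R\<^sup>* `` {x}" for x
    using sub by (auto intro: rtrancl_trans)
  then have "rel_comps ?R (A \<union> B) \<subseteq>
      (\<lambda>C. ?R\<^sup>* `` C) ` (rel_comps (near_rel r A) A \<union> rel_comps (near_rel r B) B)"
    by (auto simp: rel_comps_def image_Un image_image)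
  then have "ncomp r (A \<union> B) \<le> card (rel_comps (near_rel r A) A \<union> rel_comps (near_rel r B) B)"
    unfolding ncomp_def using assms by (intro surj_card_le) auto
  also have "\<dots> \<le> ncomp r A + ncomp r B"
    unfolding ncomp_def by (rule card_Un_le)
  finally show ?thesis .
qed

lemma ncomp_Un_ge_far:
  assumes "finite A" "finite B" "0 \<le> r" "\<And>x y. x \<in> A \<Longrightarrow> y \<in> B \<Longrightarrow> r < dist x y"
  shows "ncomp r A + ncomp r B \<le> ncomp r (A \<union> B)"
  using assms(2,4)
proof (induction B rule: finite_induct)
  case (insert z B)
  have z: "z \<notin> A"
    using insert.prems[of z z] assms(3) by auto
  \<comment> \<open>Supermodularity with the points of \<open>A\<close> in the role of the far
    ones.\<close>
  have "real (ncomp r (insert z B)) - ncomp r B \<le> real (ncomp r (insert z (A \<union> B))) - ncomp r (A \<union> B)"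
    using insert z assms(1) by (intro ncomp_supermodular) (auto simp: dist_commute)
  moreover have "ncomp r A + ncomp r B \<le> ncomp r (A \<union> B)"
    using insert by auto
  ultimately show ?case by simp
qed simp

text \<open>Any two points of \<open>V\<close> are joined by a segment inside \<open>C\<close>.
  Steps of length at most \<open>r / 3\<close> along it, each with a point of \<open>V\<close>
  within \<open>r / 3\<close>, give consecutive points of \<open>V\<close> within \<open>r\<close>
  of each other.\<close>

lemma ncomp_near_convex_cover:
  fixes V :: "'a::real_normed_vector set"
  assumes "finite V" "V \<noteq> {}" "convex C" "V \<subseteq> C" "0 < r"
    and cov: "\<And>q. q \<in> C \<Longrightarrow> \<exists>a\<in>V. dist q a \<le> r / 3"
  shows "ncomp r V = 1"
proof -
  obtain x where x: "x \<in> V" using assms by blast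
  have "(x, y) \<in> (near_rel r V)\<^sup>*" if y: "y \<in> V" for y
  proof -
    obtain N :: nat where N: "norm (y - x) / (r / 3) < N"
      using reals_Archimedean2 by blast
    have "N > 0"
      using N assms(5) by (metis divide_nonneg_pos gr0I less_numeral_extra(3) norm_ge_zero not_less of_nat_0 zero_less_divide_iff zero_less_numeral)
    define q where "q i = x + (real i / N) *\<^sub>R (y - x)" for i
    have qC: "q i \<in> C" if "i \<le> N" for i
    proof -
      have "q i = (1 - real i / N) *\<^sub>R x + (real i / N) *\<^sub>R y"
        by (simp add: q_def algebra_simps)
      then show ?thesis
        using that assms(3,4) x y \<open>N > 0\<close> by (auto intro!: convexD)
    qed
    have step: "dist (q i) (q (Suc i)) \<le> r / 3" for i
    proof -
      have "q (Suc i) - q i = (1 / N) *\<^sub>R (y - x)"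
        by (simp add: q_def algebra_simps add_divide_distrib)
      then have "dist (q i) (q (Suc i)) = norm (y - x) / N"
        by (simp add: dist_commute[of "q i"]) (simp add: dist_norm)
      also have "\<dots> \<le> r / 3"
        using N \<open>N > 0\<close> assms(5) by (simp add: field_simps)
      finally show ?thesis .
    qed
    have "\<exists>a\<in>V. dist (q i) a \<le> r / 3 \<and> (x, a) \<in> (near_rel r V)\<^sup>*" if "i \<le> N" for i
      using that
    proof (induction i)
      case 0
      then show ?case
        using x assms(5) by (auto simp: q_def intro!: bexI[of _ x])
    next
      case (Suc i)
      then obtain a where a: "a \<in> V" "dist (q i) a \<le> r / 3" "(x, a) \<in> (near_rel r V)\<^sup>*"
        by auto
      obtain b where b: "b \<in> V" "dist (q (Suc i)) b \<le> r / 3"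
        using cov qC Suc.prems by blast
      have "dist a b \<le> r"
        using a(2) b(2) step[of i] dist_triangle[of a b "q i"] dist_triangle[of "q i" b "q (Suc i)"]
        by (simp add: dist_commute)
      then have "(a, b) \<in> near_rel r V"
        using a b by (simp add: near_rel_def)
      then show ?case
        using a b by (meson rtrancl_into_rtrancl)
    qed
    from this[of N] obtain a where a: "a \<in> V" "dist (q N) a \<le> r / 3" "(x, a) \<in> (near_rel r V)\<^sup>*"
      by auto
    have "q N = y" using \<open>N > 0\<close> by (simp add: q_def)
    then have "(a, y) \<in> near_rel r V"
      using a y assms(5) by (simp add: near_rel_def dist_commute)
    then show ?thesis
      using a(3) by (rule rtrancl_into_rtrancl[rotated])
  qed
  then show ?thesis
    using ncomp_eq_1I[OF assms(1) x] by blast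
qed

section \<open>Integrated component counts and minimal spanning trees\<close>

definition cint :: "real \<Rightarrow> 'a::metric_space set \<Rightarrow> real" where
  "cint \<rho> V = integral {0..\<rho>} (\<lambda>r. real (ncomp r V))"

lemma ncomp_integrable [simp]:
  assumes "finite V"
  shows "(\<lambda>r. real (ncomp r V)) integrable_on {a..b}"
proof -
  have "(\<lambda>r. - real (ncomp r V)) integrable_on {a..b}"
    using ncomp_antimono[OF assms] by (intro integrable_on_mono_on) (auto simp: mono_on_def)
  then show ?thesis
    using integrable_neg by fastforce
qed

lemma cint_empty [simp]: "cint \<rho> {} = 0"
  by (simp add: cint_def)

lemma cint_zero [simp]: "cint 0 V = 0"
  by (simp add: cint_def)

lemma cint_nonneg: "finite V \<Longrightarrow> 0 \<le> cint \<rho> V"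
  unfolding cint_def by (intro integral_nonneg) auto

lemma cint_split:
  assumes "finite V" "0 \<le> \<rho>" "\<rho> \<le> \<rho>'"
  shows "cint \<rho>' V = cint \<rho> V + integral {\<rho>..\<rho>'} (\<lambda>r. real (ncomp r V))"
  unfolding cint_def
  using Henstock_Kurzweil_Integration.integral_combine[OF assms(2,3) ncomp_integrable[OF assms(1)]] by simp

lemma integral_le_const_real:
  fixes f :: "real \<Rightarrow> real"
  assumes "f integrable_on {a..b}" "a \<le> b" "\<And>x. a \<le> x \<Longrightarrow> x \<le> b \<Longrightarrow> f x \<le> c"
  shows "integral {a..b} f \<le> (b - a) * c"
proof -
  have "integral {a..b} f \<le> integral {a..b} (\<lambda>_. c)"
    using assms by (intro integral_le) auto
  then show ?thesis using assms(2) by simp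
qed

lemma cint_mono: "finite V \<Longrightarrow> 0 \<le> \<rho> \<Longrightarrow> \<rho> \<le> \<rho>' \<Longrightarrow> cint \<rho> V \<le> cint \<rho>' V"
  using cint_split[of V \<rho> \<rho>'] integral_nonneg[OF ncomp_integrable] by force

lemma cint_le:
  assumes "finite V" "0 \<le> \<rho>"
  shows "cint \<rho> V \<le> \<rho> * card V"
  unfolding cint_def using integral_le_const_real[OF ncomp_integrable] ncomp_le_card assms
  by (metis diff_zero of_nat_le_iff)

lemma cint_diff_le:
  assumes "finite V" "0 \<le> \<rho>" "\<rho> \<le> \<rho>'"
  shows "cint \<rho>' V \<le> cint \<rho> V + (\<rho>' - \<rho>) * card V"
  using cint_split[OF assms] integral_le_const_real[OF ncomp_integrable[OF assms(1)] assms(3), of "card V"]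
    ncomp_le_card[OF assms(1)] by simp

text \<open>The count stays at one beyond the radius of connection, so
  \<open>cint \<rho> V - \<rho>\<close> no longer depends on \<rho>. This is what allows a short
  cutoff in place of the diameter.\<close>

lemma cint_diff_connected:
  assumes "finite V" "0 \<le> \<rho>" "\<rho> \<le> \<rho>'" "ncomp \<rho> V = 1"
  shows "cint \<rho>' V = cint \<rho> V + (\<rho>' - \<rho>)"
proof -
  have "V \<noteq> {}" using assms(4) by auto
  then have "real (ncomp r V) = 1" if "\<rho> \<le> r" for r
    using ncomp_pos[OF assms(1), of r] ncomp_antimono[OF assms(1) that] assms(4) by linarith
  then have "integral {\<rho>..\<rho>'} (\<lambda>r. real (ncomp r V)) = integral {\<rho>..\<rho>'} (\<lambda>r. 1)"
    by (intro Henstock_Kurzweil_Integration.integral_cong) simp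
  then show ?thesis
    using cint_split[OF assms(1-3)] assms(3) by simp
qed

lemma cint_integral_le:
  assumes "finite V" "finite V'" "0 \<le> \<rho>"
    and "\<And>r. 0 \<le> r \<Longrightarrow> r \<le> \<rho> \<Longrightarrow> real (ncomp r V) \<le> real (ncomp r V') + c"
  shows "cint \<rho> V \<le> cint \<rho> V' + c * \<rho>"
proof -
  have "integral {0..\<rho>} (\<lambda>r. real (ncomp r V)) \<le> integral {0..\<rho>} (\<lambda>r. real (ncomp r V') + c)"
    using assms by (intro integral_le integrable_add) auto
  also have "\<dots> = cint \<rho> V' + c * \<rho>"
    using assms by (subst Henstock_Kurzweil_Integration.integral_add) (auto simp: cint_def)
  finally show ?thesis by (simp add: cint_def)
qed

lemma cint_insert_le:
  assumes "finite V" "0 \<le> \<rho>"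
  shows "cint \<rho> (insert z V) \<le> cint \<rho> V + \<rho>"
proof -
  have "real (ncomp r (insert z V)) \<le> real (ncomp r V) + 1" for r
    using ncomp_insert_le[OF assms(1), of r z] by linarith
  then show ?thesis
    using cint_integral_le[of "insert z V" V \<rho> 1] assms by simp
qed

text \<open>A crude bound for the number of points at distance at most \<open>r\<close> from a given point that have
  mutual distances above \<open>r\<close>, hence for the number of components touched by a new point.\<close>

definition kiss :: "'d::finite itself \<Rightarrow> real" where
  "kiss _ = (2 * real CARD('d) + 1) ^ CARD('d)"

lemma kiss_ge_1: "1 \<le> kiss TYPE('d::finite)"
  by (simp add: kiss_def)

text \<open>Rounding the coordinates relative to \<open>z\<close> to mesh
  \<open>r / CARD('d)\<close> is injective, since two points in one cell would have l1 distance at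
  most \<open>r\<close>. Within distance \<open>r\<close> of \<open>z\<close> each rounded
  coordinate takes at most \<open>2 * CARD('d) + 1\<close> values.\<close>

lemma card_separated_le_kiss:
  fixes X :: "(real^'d) set"
  assumes "finite X" "\<And>x. x \<in> X \<Longrightarrow> dist z x \<le> r"
    and sep: "\<And>x y. x \<in> X \<Longrightarrow> y \<in> X \<Longrightarrow> x \<noteq> y \<Longrightarrow> r < dist x y"
  shows "real (card X) \<le> kiss TYPE('d)"
proof (cases "0 < r")
  case False
  then have "X \<subseteq> {z}"
    using assms(2) zero_le_dist by (metis dist_le_zero_iff insertI1 not_less order_trans subsetI)
  then have "card X \<le> 1"
    using card_mono[of "{z}" X] by simp
  then show ?thesis
    using kiss_ge_1[where 'd = 'd] by linarith
next
  case True
  let ?D = "CARD('d)"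
  define g :: "real^'d \<Rightarrow> 'd \<Rightarrow> int" where "g x = (\<lambda>i. \<lfloor>(x $ i - z $ i) * ?D / r\<rfloor>)" for x
  have D: "0 < real ?D" by simp
  have "inj_on g X"
  proof (rule inj_onI, rule ccontr)
    fix x y assume xy: "x \<in> X" "y \<in> X" "g x = g y" "x \<noteq> y"
    have close: "\<bar>(x - y) $ i\<bar> < r / ?D" for i
    proof -
      have "\<bar>(x $ i - z $ i) * ?D / r - (y $ i - z $ i) * ?D / r\<bar> < 1"
        using fun_cong[OF xy(3), of i] unfolding g_def by linarith
      also have "(x $ i - z $ i) * ?D / r - (y $ i - z $ i) * ?D / r = (x - y) $ i * (?D / r)"
        by (simp add: diff_divide_distrib left_diff_distrib)
      finally have "\<bar>(x - y) $ i\<bar> * (?D / r) < 1"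
        using True by (simp add: abs_mult)
      then show ?thesis
        using True D by (simp add: field_simps)
    qed
    have "dist x y \<le> (\<Sum>i\<in>UNIV. \<bar>(x - y) $ i\<bar>)"
      unfolding dist_norm by (rule norm_le_l1_cart)
    also have "\<dots> \<le> (\<Sum>i\<in>(UNIV::'d set). r / ?D)"
      using close by (intro sum_mono less_imp_le) auto
    also have "\<dots> = r" by simp
    finally show False using sep xy by force
  qed
  moreover have "g ` X \<subseteq> PiE UNIV (\<lambda>_. {- int ?D .. int ?D})"
  proof -
    have "- int ?D \<le> g x i \<and> g x i \<le> int ?D" if x: "x \<in> X" for x i
    proof -
      have "\<bar>(z - x) $ i\<bar> \<le> r"
        using component_le_norm_cart[of "z - x" i] assms(2)[OF x] by (simp add: dist_norm)
      then have "\<bar>x $ i - z $ i\<bar> * ?D / r \<le> ?D"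
        using True D by (simp add: field_simps)
      then have "\<bar>(x $ i - z $ i) * ?D / r\<bar> \<le> ?D"
        using True by (simp add: abs_mult)
      then have "- real ?D \<le> (x $ i - z $ i) * ?D / r" "(x $ i - z $ i) * ?D / r \<le> ?D"
        by linarith+
      then show ?thesis
        unfolding g_def by (simp add: le_floor_iff floor_le_iff)
    qed
    then show ?thesis by auto
  qed
  ultimately have "card X \<le> card (PiE (UNIV::'d set) (\<lambda>_. {- int ?D .. int ?D}))"
    by (intro card_inj_on_le) (auto intro!: finite_PiE)
  also have "\<dots> = (2 * ?D + 1) ^ ?D"
    by (simp add: card_PiE nat_add_distrib nat_mult_distrib)
  finally have "real (card X) \<le> real ((2 * ?D + 1) ^ ?D)"
    by (simp only: of_nat_le_iff)
  also have "\<dots> = kiss TYPE('d)"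
    unfolding kiss_def of_nat_power by (simp add: add.commute)
  finally show ?thesis .
qed

lemma ncomp_insert_ge:
  fixes V :: "(real^'d) set"
  assumes "finite V"
  shows "real (ncomp r V) \<le> ncomp r (insert z V) + kiss TYPE('d)"
proof (cases "z \<in> V")
  case True
  then show ?thesis
    using kiss_ge_1[where 'd = 'd] by (simp add: insert_absorb)
next
  case False
  obtain X where X: "X \<subseteq> V" "card X = card (touching r V z)" "\<And>x. x \<in> X \<Longrightarrow> dist z x \<le> r"
    "\<And>x y. x \<in> X \<Longrightarrow> y \<in> X \<Longrightarrow> x \<noteq> y \<Longrightarrow> r < dist x y"
    using touching_representatives[OF assms] by metis
  then have "real (card X) \<le> kiss TYPE('d)"
    using assms finite_subset by (intro card_separated_le_kiss) auto
  then show ?thesis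
    using ncomp_insert[OF assms False, of r] X(2) by simp
qed

lemma cint_insert_ge:
  fixes V :: "(real^'d) set"
  assumes "finite V" "0 \<le> \<rho>"
  shows "cint \<rho> V \<le> cint \<rho> (insert z V) + kiss TYPE('d) * \<rho>"
  using assms ncomp_insert_ge[OF assms(1)] by (intro cint_integral_le) auto

lemma cint_Un_bounds:
  fixes V :: "(real^'d) set"
  assumes "finite V" "finite B" "0 \<le> \<rho>"
  shows "cint \<rho> V \<le> cint \<rho> (V \<union> B) + kiss TYPE('d) * \<rho> * card B"
    and "cint \<rho> (V \<union> B) \<le> cint \<rho> V + \<rho> * card B"
  using assms(2)
proof (induction B rule: finite_induct)
  case (insert z B)
  {
    case 1
    show ?case
      using insert cint_insert_ge[of "V \<union> B" \<rho> z] assms by (simp add: algebra_simps)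
  next
    case 2
    show ?case
      using insert cint_insert_le[of "V \<union> B" \<rho> z] assms by (simp add: algebra_simps)
  }
qed auto

text \<open>The difference of the two sides is the supermodularity of the counts, integrated over
  the radii between \<rho> and \<open>\<rho>'\<close>. So the gain in add-one cost from enlarging
  the window increases with the cutoff; for \<rho> equal to zero this is monotonicity in the window
  itself.\<close>

lemma cint_supermodular:
  assumes "finite V'" "V \<subseteq> V'" "z \<notin> V'" "\<And>x. x \<in> V' - V \<Longrightarrow> \<rho>' < dist z x" "0 \<le> \<rho>" "\<rho> \<le> \<rho>'"
  shows "cint \<rho> (insert z V') - cint \<rho> V' - (cint \<rho> (insert z V) - cint \<rho> V)
    \<le> cint \<rho>' (insert z V') - cint \<rho>' V' - (cint \<rho>' (insert z V) - cint \<rho>' V)"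
proof -
  let ?I = "\<lambda>W. integral {\<rho>..\<rho>'} (\<lambda>r. real (ncomp r W))"
  have fin: "finite V" using assms finite_subset by auto
  have "?I (insert z V) + ?I V' \<le> ?I (insert z V') + ?I V"
  proof -
    have "integral {\<rho>..\<rho>'} (\<lambda>r. real (ncomp r (insert z V)) + real (ncomp r V'))
        \<le> integral {\<rho>..\<rho>'} (\<lambda>r. real (ncomp r (insert z V')) + real (ncomp r V))"
    proof (intro integral_le integrable_add ncomp_integrable)
      fix r assume r: "r \<in> {\<rho>..\<rho>'}"
      have "real (ncomp r (insert z V)) - ncomp r V \<le> real (ncomp r (insert z V')) - ncomp r V'"
      proof (rule ncomp_supermodular[OF assms(1-3)])
        show "r < dist z x" if "x \<in> V' - V" for x
          using assms(4)[OF that] r by auto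
      qed
      then show "real (ncomp r (insert z V)) + real (ncomp r V')
          \<le> real (ncomp r (insert z V')) + real (ncomp r V)" by simp
    qed (use assms fin in auto)
    then show ?thesis
      using assms fin by (subst (asm) (1 2) Henstock_Kurzweil_Integration.integral_add) auto
  qed
  then show ?thesis
    using assms fin by (simp add: cint_split[of _ \<rho> \<rho>'])
qed

lemma cint_Un_le:
  assumes "finite A" "finite B" "0 \<le> \<rho>"
  shows "cint \<rho> (A \<union> B) \<le> cint \<rho> A + cint \<rho> B"
proof -
  have "integral {0..\<rho>} (\<lambda>r. real (ncomp r (A \<union> B)))
      \<le> integral {0..\<rho>} (\<lambda>r. real (ncomp r A) + real (ncomp r B))"
    using assms ncomp_Un_le[OF assms(1,2)] by (intro integral_le integrable_add) (auto simp flip: of_nat_add)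
  then show ?thesis
    using assms by (subst (asm) Henstock_Kurzweil_Integration.integral_add) (auto simp: cint_def)
qed

lemma cint_Un_ge_far:
  assumes "finite A" "finite B" "0 \<le> \<rho>" "\<And>x y. x \<in> A \<Longrightarrow> y \<in> B \<Longrightarrow> \<rho> < dist x y"
  shows "cint \<rho> A + cint \<rho> B \<le> cint \<rho> (A \<union> B)"
proof -
  have "integral {0..\<rho>} (\<lambda>r. real (ncomp r A) + real (ncomp r B))
      \<le> integral {0..\<rho>} (\<lambda>r. real (ncomp r (A \<union> B)))"
  proof (intro integral_le integrable_add)
    fix r assume "r \<in> {0..\<rho>}"
    then have "ncomp r A + ncomp r B \<le> ncomp r (A \<union> B)"
      using assms by (intro ncomp_Un_ge_far) (auto intro: le_less_trans)
    then show "real (ncomp r A) + real (ncomp r B) \<le> real (ncomp r (A \<union> B))"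
      by simp
  qed (use assms in auto)
  then show ?thesis
    using assms by (subst (asm) Henstock_Kurzweil_Integration.integral_add) (auto simp: cint_def)
qed

text \<open>Remove the points \<open>N\<close> of \<open>A\<close> that may be near
  \<open>B\<close>, split the two far-apart sets, then put \<open>N\<close> back. Removal loses at
  most \<rho> per point, and reinsertion at most \<open>kiss\<close> times \<rho> per point.\<close>

lemma cint_Un_ge:
  fixes A B :: "(real^'d) set"
  assumes "finite A" "finite B" "0 \<le> \<rho>" "N \<subseteq> A"
    and "\<And>x y. x \<in> A - N \<Longrightarrow> y \<in> B \<Longrightarrow> \<rho> < dist x y"
  shows "cint \<rho> A + cint \<rho> B - (kiss TYPE('d) + 1) * \<rho> * card N \<le> cint \<rho> (A \<union> B)"
proof -
  have N: "finite N" using assms finite_subset by auto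
  have "cint \<rho> A \<le> cint \<rho> (A - N) + \<rho> * card N"
    using cint_Un_bounds(2)[of "A - N" N \<rho>] assms N by (simp add: Un_absorb2)
  moreover have "cint \<rho> (A - N) + cint \<rho> B \<le> cint \<rho> ((A - N) \<union> B)"
    using assms by (intro cint_Un_ge_far) auto
  moreover have "cint \<rho> ((A - N) \<union> B) \<le> cint \<rho> (A \<union> B) + kiss TYPE('d) * \<rho> * card N"
  proof -
    have "(A - N) \<union> B \<union> N = A \<union> B" using assms by auto
    then show ?thesis
      using cint_Un_bounds(1)[of "(A - N) \<union> B" N \<rho>] assms N by simp
  qed
  ultimately show ?thesis by (simp add: algebra_simps)
qed

lemma cint_scaled:
  assumes "0 < \<eta>"
  shows "\<eta> * cint (\<rho> / \<eta>) V = integral {0..\<rho>} (\<lambda>r. real (ncomp (r / \<eta>) V))"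
proof -
  have "(\<lambda>x. x / (1 / \<eta>)) ` {0..\<rho> / \<eta>} = {0..\<rho>}"
  proof -
    have "(\<lambda>x. x / (1 / \<eta>)) ` {0..\<rho> / \<eta>} = (*) \<eta> ` {0..\<rho> / \<eta>}"
      by (simp add: mult.commute)
    also have "\<dots> = {0..\<rho>}"
      using assms by (subst image_mult_atLeastAtMost) auto
    finally show ?thesis .
  qed
  then show ?thesis
    using integral_stretch_real[of "1 / \<eta>" 0 "\<rho> / \<eta>" "\<lambda>r. real (ncomp r V)"] assms
    by (simp add: cint_def)
qed

text \<open>Shifting the argument by \<delta> leaves only an initial interval of length \<delta>
  uncompared, and there \<open>f\<close> is at most \<open>c\<close>. When \<delta> exceeds \<rho>,
  that interval is everything.\<close>

lemma integral_stability:
  fixes f g :: "real \<Rightarrow> real"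
  assumes int: "\<And>a b. f integrable_on {a..b}" "\<And>a b. g integrable_on {a..b}"
    and "0 \<le> \<delta>" "0 \<le> \<rho>" "\<And>r. f r \<le> c" "\<And>r. 0 \<le> g r"
    and le: "\<And>r. 0 \<le> r \<Longrightarrow> f (r + \<delta>) \<le> g r" and "0 \<le> c"
  shows "integral {0..\<rho>} f \<le> integral {0..\<rho>} g + \<delta> * c"
proof (cases "\<delta> \<le> \<rho>")
  case True
  have "integral {0..\<rho>} f = integral {0..\<delta>} f + integral {\<delta>..\<rho>} f"
    using Henstock_Kurzweil_Integration.integral_combine[OF assms(3) True int(1)] by simp
  moreover have "integral {0..\<delta>} f \<le> \<delta> * c"
    using integral_le_const_real[of f 0 \<delta> c] assms by auto
  moreover have "integral {\<delta>..\<rho>} f = integral {0..\<rho> - \<delta>} (\<lambda>r. f (r + \<delta>))"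
    using integral_shift_real_ivl[of \<delta> \<delta> \<rho> f] by simp
  moreover have "integral {0..\<rho> - \<delta>} (\<lambda>r. f (r + \<delta>)) \<le> integral {0..\<rho> - \<delta>} g"
    using integrable_shift_real_ivl[OF int(1), of \<delta> \<delta> \<rho>] le by (intro integral_le int(2)) auto
  moreover have "integral {0..\<rho> - \<delta>} g \<le> integral {0..\<rho>} g"
    using assms True by (intro integral_subset_le) auto
  ultimately show ?thesis by linarith
next
  case False
  have "integral {0..\<rho>} f \<le> \<rho> * c"
    using integral_le_const_real[of f 0 \<rho> c] assms by auto
  also have "\<dots> \<le> \<delta> * c"
    using False assms by (intro mult_right_mono) auto
  finally show ?thesis
    using integral_nonneg[of g "{0..\<rho>}"] assms by (smt (verit))
qed

lemma ncomp_scaled_integrable: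
  assumes "finite V" "0 < \<eta>"
  shows "(\<lambda>r. real (ncomp (r / \<eta>) V)) integrable_on {a..b}"
proof -
  have "(\<lambda>r. - real (ncomp (r / \<eta>) V)) integrable_on {a..b}"
    using ncomp_antimono[OF assms(1)] assms(2)
    by (intro integrable_on_mono_on) (auto simp: mono_on_def divide_right_mono)
  then show ?thesis
    using integrable_neg by fastforce
qed

text \<open>The rescaled map distorts distances by at most \<delta>, so components at radius
  \<open>r\<close> are sent into components at radius \<open>r + \<delta>\<close>, and a section of
  the map does the same in the other direction. Points identified by the map are within \<delta> of
  each other, hence connected at the larger radius. Each comparison costs \<delta> times the largest
  possible count.\<close>

lemma cint_map_stable:
  assumes V: "finite V" and \<eta>: "0 < \<eta>" and \<rho>: "0 \<le> \<rho>" and \<delta>: "0 \<le> \<delta>"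
    and up: "\<And>x y. x \<in> V \<Longrightarrow> y \<in> V \<Longrightarrow> \<eta> * dist (\<phi> x) (\<phi> y) \<le> dist x y + \<delta>"
    and lo: "\<And>x y. x \<in> V \<Longrightarrow> y \<in> V \<Longrightarrow> dist x y \<le> \<eta> * dist (\<phi> x) (\<phi> y) + \<delta>"
  shows "\<bar>cint \<rho> V - \<eta> * cint (\<rho> / \<eta>) (\<phi> ` V)\<bar> \<le> \<delta> * card V"
proof -
  let ?f = "\<lambda>r. real (ncomp r V)" and ?g = "\<lambda>r. real (ncomp (r / \<eta>) (\<phi> ` V))"
  have "?g (r + \<delta>) \<le> ?f r" for r
  proof -
    have "ncomp ((r + \<delta>) / \<eta>) (\<phi> ` V) \<le> ncomp r V"
    proof (rule ncomp_map_le[OF V, where f = \<phi>])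
      show "dist (\<phi> x) (\<phi> y) \<le> (r + \<delta>) / \<eta>" if "x \<in> V" "y \<in> V" "dist x y \<le> r" for x y
        using up[OF that(1,2)] that(3) \<eta> by (simp add: field_simps)
    qed auto
    then show ?thesis by simp
  qed
  then have 1: "integral {0..\<rho>} ?g \<le> integral {0..\<rho>} ?f + \<delta> * card V"
    using V \<eta> \<rho> \<delta> ncomp_le_card[of "\<phi> ` V"] card_image_le[OF V, of \<phi>]
    by (intro integral_stability ncomp_scaled_integrable) (auto intro: order_trans)
  have "?f (r + \<delta>) \<le> ?g r" if r: "0 \<le> r" for r
  proof -
    have "\<exists>s. \<forall>y\<in>\<phi> ` V. s y \<in> V \<and> \<phi> (s y) = y"
      by (intro bchoice) auto
    then obtain s where s: "\<And>y. y \<in> \<phi> ` V \<Longrightarrow> s y \<in> V \<and> \<phi> (s y) = y"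
      by blast
    have "ncomp (r + \<delta>) V \<le> ncomp (r / \<eta>) (\<phi> ` V)"
    proof (rule ncomp_map_le[where f = s])
      show "dist (s x) (s y) \<le> r + \<delta>" if "x \<in> \<phi> ` V" "y \<in> \<phi> ` V" "dist x y \<le> r / \<eta>" for x y
      proof -
        have "\<eta> * dist x y \<le> r"
          using that(3) \<eta> by (simp add: field_simps)
        then show ?thesis
          using lo[of "s x" "s y"] s[OF that(1)] s[OF that(2)] by simp
      qed
      show "\<exists>x\<in>\<phi> ` V. (y, s x) \<in> (near_rel (r + \<delta>) V)\<^sup>*" if y: "y \<in> V" for y
      proof -
        have "dist y (s (\<phi> y)) \<le> \<delta>"
          using lo[of y "s (\<phi> y)"] s[of "\<phi> y"] y by auto
        then have "(y, s (\<phi> y)) \<in> near_rel (r + \<delta>) V"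
          using s[of "\<phi> y"] y r by (auto simp: near_rel_def)
        then show ?thesis using y by blast
      qed
    qed (use V s in auto)
    then show ?thesis by simp
  qed
  then have 2: "integral {0..\<rho>} ?f \<le> integral {0..\<rho>} ?g + \<delta> * card V"
    using V \<eta> \<rho> \<delta> ncomp_le_card[OF V]
    by (intro integral_stability ncomp_scaled_integrable) auto
  show ?thesis
    using 1 2 cint_scaled[OF \<eta>, of \<rho> "\<phi> ` V"] by (simp add: cint_def abs_le_iff)
qed

lemma ncomp_translate: "finite V \<Longrightarrow> ncomp r ((+) (c::'a::real_normed_vector) ` V) = ncomp r V"
proof (rule antisym)
  show "ncomp r ((+) c ` V) \<le> ncomp r V" if "finite V" for V and c :: 'a
    using that by (intro ncomp_map_le[where f = "(+) c"]) auto
  from this[of "(+) c ` V" "- c"] show "finite V \<Longrightarrow> ncomp r V \<le> ncomp r ((+) c ` V)"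
    by (simp add: image_image)
qed

lemma cint_translate: "finite V \<Longrightarrow> cint \<rho> ((+) (c::'a::real_normed_vector) ` V) = cint \<rho> V"
  by (simp add: cint_def ncomp_translate)

lemma cint_insert_ge_local:
  assumes "finite V" "z \<notin> V" "0 \<le> \<rho>"
  shows "cint \<rho> V + \<rho> * (1 - real (card {x \<in> V. dist z x \<le> \<rho>})) \<le> cint \<rho> (insert z V)"
proof -
  have "cint \<rho> V \<le> cint \<rho> (insert z V) + (real (card {x \<in> V. dist z x \<le> \<rho>}) - 1) * \<rho>"
  proof (rule cint_integral_le)
    fix r assume r: "0 \<le> r" "r \<le> \<rho>"
    have "card {x \<in> V. dist z x \<le> r} \<le> card {x \<in> V. dist z x \<le> \<rho>}"
      using r assms by (intro card_mono) auto
    then show "real (ncomp r V) \<le> ncomp r (insert z V) + (real (card {x \<in> V. dist z x \<le> \<rho>}) - 1)"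
      using ncomp_insert_ge_local[OF assms(1,2), of r] by simp
  qed (use assms in auto)
  then show ?thesis by (simp add: algebra_simps)
qed

section \<open>Spanning trees, Kruskal's algorithm and the integral formula for the weight\<close>

definition edge_rel :: "'a set set \<Rightarrow> ('a \<times> 'a) set" where
  "edge_rel T = {(a, b). {a, b} \<in> T}"

lemma sym_edge_rel: "sym (edge_rel T)"
  by (auto simp: edge_rel_def sym_def insert_commute)

lemma edge_rel_insert: "edge_rel (insert {a, b} T) = edge_rel T \<union> {(a, b), (b, a)}"
  by (auto simp: edge_rel_def doubleton_eq_iff)

lemma edge_rel_mono: "S \<subseteq> T \<Longrightarrow> edge_rel S \<subseteq> edge_rel T"
  by (auto simp: edge_rel_def)

lemma edge_length_pair [simp]: "edge_length {x, y} = dist x y"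
  unfolding edge_length_def
proof (rule some_equality)
  show "r = dist x y" if "\<exists>x' y'. {x, y} = {x', y'} \<and> r = dist x' y'" for r
    using that by (auto simp: doubleton_eq_iff dist_commute)
qed blast

lemma finite_complete_edges: "finite V \<Longrightarrow> finite (complete_edges V)"
  by (rule finite_subset[of _ "Pow V"]) (auto simp: complete_edges_def)

lemma complete_edgesE:
  assumes "e \<in> complete_edges V"
  obtains a b where "e = {a, b}" "a \<in> V" "b \<in> V" "a \<noteq> b"
  using assms by (auto simp: complete_edges_def)

definition edge_comps :: "'a set \<Rightarrow> 'a set set \<Rightarrow> nat" where
  "edge_comps V T = card (rel_comps (edge_rel T) V)"

lemma edge_comps_empty [simp]: "edge_comps V {} = card V"
  by (simp add: edge_comps_def rel_comps_def edge_rel_def card_image)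

lemma edge_comps_cong: "(edge_rel S)\<^sup>* = (edge_rel T)\<^sup>* \<Longrightarrow> edge_comps V S = edge_comps V T"
  by (simp add: edge_comps_def rel_comps_def)

lemma edge_comps_short:
  "edge_comps V {e \<in> complete_edges V. edge_length e \<le> r} = ncomp r V" if "0 \<le> r"
proof -
  let ?E = "{e \<in> complete_edges V. edge_length e \<le> r}"
  have "edge_rel ?E \<subseteq> near_rel r V"
    by (auto simp: edge_rel_def near_rel_def complete_edges_def doubleton_eq_iff dist_commute)
  moreover have "near_rel r V \<subseteq> (edge_rel ?E)\<^sup>*"
  proof
    fix p assume "p \<in> near_rel r V"
    then obtain a b where p: "p = (a, b)" "a \<in> V" "b \<in> V" "dist a b \<le> r"
      by (auto simp: near_rel_def)
    show "p \<in> (edge_rel ?E)\<^sup>*"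
    proof (cases "a = b")
      case False
      then have "p \<in> edge_rel ?E"
        using p by (auto simp: edge_rel_def complete_edges_def)
      then show ?thesis by (auto simp: p)
    qed (simp add: p)
  qed
  ultimately have "(edge_rel ?E)\<^sup>* = (near_rel r V)\<^sup>*"
    by (rule rtrancl_subset[symmetric])
  then show ?thesis
    by (simp add: edge_comps_def ncomp_def rel_comps_def)
qed

lemma edge_comps_insert:
  assumes "finite V" "a \<in> V" "b \<in> V"
  shows "edge_comps V T \<le> edge_comps V (insert {a, b} T) + 1"
    and "(a, b) \<notin> (edge_rel T)\<^sup>* \<Longrightarrow> edge_comps V T = edge_comps V (insert {a, b} T) + 1"
    and "(a, b) \<in> (edge_rel T)\<^sup>* \<Longrightarrow> (edge_rel (insert {a, b} T))\<^sup>* = (edge_rel T)\<^sup>*"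
proof -
  show 2: "(a, b) \<notin> (edge_rel T)\<^sup>* \<Longrightarrow> edge_comps V T = edge_comps V (insert {a, b} T) + 1"
    using card_rel_comps_insert_edge[OF assms(1) sym_edge_rel assms(2,3)]
    by (simp add: edge_comps_def edge_rel_insert)
  show 3: "(a, b) \<in> (edge_rel T)\<^sup>* \<Longrightarrow> (edge_rel (insert {a, b} T))\<^sup>* = (edge_rel T)\<^sup>*"
    using rel_comps_insert_edge_same[OF sym_edge_rel] by (simp add: edge_rel_insert)
  show "edge_comps V T \<le> edge_comps V (insert {a, b} T) + 1"
    using 2 3 edge_comps_cong[of "insert {a, b} T" T V] by (cases "(a, b) \<in> (edge_rel T)\<^sup>*") auto
qed

lemma edge_comps_Un_le:
  assumes "finite V" "finite S" "S \<subseteq> complete_edges V"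
  shows "edge_comps V T \<le> edge_comps V (T \<union> S) + card S"
  using assms(2,3)
proof (induction S rule: finite_induct)
  case (insert e S)
  then obtain a b where "e = {a, b}" "a \<in> V" "b \<in> V"
    by (meson complete_edgesE insert_subset)
  then show ?case
    using edge_comps_insert(1)[OF assms(1), of a b "T \<union> S"] insert by simp
qed simp

lemma edge_comps_antimono:
  assumes "finite V" "S \<subseteq> T"
  shows "edge_comps V T \<le> edge_comps V S"
  unfolding edge_comps_def
  by (rule card_rel_comps_hom[OF assms(1) sym_edge_rel, where f = id])
     (use edge_rel_mono[OF assms(2)] in auto)

lemma graph_connected_iff: "graph_connected V T \<longleftrightarrow> (\<forall>x\<in>V. \<forall>y\<in>V. (x, y) \<in> (edge_rel T)\<^sup>*)"
  by (simp add: graph_connected_def edge_rel_def)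

lemma edge_comps_connected:
  assumes "finite V" "V \<noteq> {}" "graph_connected V T"
  shows "edge_comps V T = 1"
proof -
  obtain x where x: "x \<in> V" using assms by blast
  have "(edge_rel T)\<^sup>* `` {y} = (edge_rel T)\<^sup>* `` {x}" if "y \<in> V" for y
    using assms(3) x that sym_rtrancl_class_eq[OF sym_edge_rel] by (metis graph_connected_iff)
  then have "rel_comps (edge_rel T) V = {(edge_rel T)\<^sup>* `` {x}}"
    using x unfolding rel_comps_def by blast
  then show ?thesis by (simp add: edge_comps_def)
qed

text \<open>The cycle has to use the new edge, and its other edges form a path between the two ends
  of that edge.\<close>

lemma has_cycle_insertD:
  assumes "has_cycle (insert {a, b} T)" "\<not> has_cycle T"
  shows "(a, b) \<in> (edge_rel T)\<^sup>*"
proof -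
  obtain vs where vs: "3 \<le> length vs" "distinct vs"
    "\<And>i. i < length vs \<Longrightarrow> {vs ! i, vs ! ((i + 1) mod length vs)} \<in> insert {a, b} T"
    using assms(1) unfolding has_cycle_def by blast
  let ?n = "length vs"
  obtain i where i: "i < ?n" "{vs ! i, vs ! ((i + 1) mod ?n)} \<notin> T"
    using assms(2) vs unfolding has_cycle_def by blast
  then have e: "{vs ! i, vs ! ((i + 1) mod ?n)} = {a, b}"
    using vs(3) by blast
  have n: "?n > 0" using vs by linarith
  have other: "{vs ! j, vs ! ((j + 1) mod ?n)} \<in> T" if j: "j < ?n" "j \<noteq> i" for j
  proof -
    have "{vs ! j, vs ! ((j + 1) mod ?n)} \<noteq> {vs ! i, vs ! ((i + 1) mod ?n)}"
    proof
      assume eq: "{vs ! j, vs ! ((j + 1) mod ?n)} = {vs ! i, vs ! ((i + 1) mod ?n)}"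
      have "vs ! j \<noteq> vs ! i"
        using j i vs(2) by (simp add: nth_eq_iff_index_eq)
      then have "vs ! j = vs ! ((i + 1) mod ?n)" "vs ! ((j + 1) mod ?n) = vs ! i"
        using eq by (auto simp: doubleton_eq_iff)
      then have "j = (i + 1) mod ?n" "(j + 1) mod ?n = i"
        using vs(2) j i n by (auto simp: nth_eq_iff_index_eq)
      \<comment> \<open>Two distinct positions can carry the same edge only if two steps along the
        cycle return to the start; length at least three excludes this.\<close>
      then have "(i + 2) mod ?n = i"
        using mod_add_left_eq[of "i + 1" ?n 1] by simp
      moreover have "(i + 2) mod ?n = (if i + 2 < ?n then i + 2 else i + 2 - ?n)"
        using i vs(1) by (simp add: le_mod_geq)
      ultimately show False
        using vs(1) i by (auto split: if_splits)
    qed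
    then show ?thesis
      using vs(3)[OF j(1)] e by auto
  qed
  have path: "(vs ! ((i + 1) mod ?n), vs ! ((i + 1 + k) mod ?n)) \<in> (edge_rel T)\<^sup>*" if "k < ?n" for k
    using that
  proof (induction k)
    case (Suc k)
    let ?j = "(i + 1 + k) mod ?n"
    have "?j \<noteq> i"
    proof
      assume "?j = i"
      moreover have "?j = (if i + 1 + k < ?n then i + 1 + k else i + 1 + k - ?n)"
        using i Suc.prems by (simp add: le_mod_geq)
      ultimately show False
        using Suc.prems i by (auto split: if_splits)
    qed
    then have "{vs ! ?j, vs ! ((?j + 1) mod ?n)} \<in> T"
      using n by (intro other) auto
    moreover have "(?j + 1) mod ?n = (i + 1 + Suc k) mod ?n"
      by (simp add: mod_Suc_eq)
    ultimately have "(vs ! ?j, vs ! ((i + 1 + Suc k) mod ?n)) \<in> edge_rel T"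
      by (simp add: edge_rel_def)
    then show ?case
      using Suc by (auto intro: rtrancl_into_rtrancl)
  qed simp
  have "(i + 1 + (?n - 1)) mod ?n = i"
    using n i by simp
  then have "(vs ! ((i + 1) mod ?n), vs ! i) \<in> (edge_rel T)\<^sup>*"
    using path[of "?n - 1"] n by simp
  moreover from this have "(vs ! i, vs ! ((i + 1) mod ?n)) \<in> (edge_rel T)\<^sup>*"
    by (rule symD[OF sym_rtrancl[OF sym_edge_rel]])
  ultimately show ?thesis
    using e by (auto simp: doubleton_eq_iff)
qed

text \<open>Edges are taken by increasing length and kept when they join two components. The
  invariant is stated at every level \<open>r\<close> at once: tree edges up to length
  \<open>r\<close> and components at level \<open>r\<close> together number \<open>card V\<close>.
  Sortedness makes it inductive, because at a level that admits the new edge all earlier edges are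
  already present.\<close>

lemma kruskal_forest:
  assumes V: "finite V"
  shows "sorted (map edge_length es) \<Longrightarrow> distinct es \<Longrightarrow> set es \<subseteq> complete_edges V \<Longrightarrow>
    \<exists>T \<subseteq> set es. \<not> has_cycle T \<and> (edge_rel T)\<^sup>* = (edge_rel (set es))\<^sup>* \<and>
      (\<forall>r. card {e \<in> T. edge_length e \<le> r} + edge_comps V {e \<in> set es. edge_length e \<le> r} = card V)"
proof (induction es rule: rev_induct)
  case Nil
  have "\<not> has_cycle {}" by (auto simp: has_cycle_def) (metis gr0I length_greater_0_conv less_nat_zero_code list.size(3) not_numeral_le_zero)
  then show ?case by (auto simp: edge_rel_def)
next
  case (snoc e es)
  have srt: "sorted (map edge_length es)" "\<And>x. x \<in> set es \<Longrightarrow> edge_length x \<le> edge_length e"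
    using snoc.prems(1) by (auto simp: sorted_append)
  obtain T where T: "T \<subseteq> set es" "\<not> has_cycle T" "(edge_rel T)\<^sup>* = (edge_rel (set es))\<^sup>*"
    "\<And>r. card {e \<in> T. edge_length e \<le> r} + edge_comps V {e \<in> set es. edge_length e \<le> r} = card V"
    using snoc srt by auto
  have finT: "finite T" using T(1) finite_subset by blast
  obtain a b where ab: "e = {a, b}" "a \<in> V" "b \<in> V" "a \<noteq> b"
    using snoc.prems(3) by (auto elim: complete_edgesE)
  have eT: "e \<notin> T" using T(1) snoc.prems(2) by auto
  have all: "{x \<in> set es. edge_length x \<le> r} = set es" if "edge_length e \<le> r" for r
    using srt(2) that by fastforce
  have allT: "{x \<in> T. edge_length x \<le> r} = T" if "edge_length e \<le> r" for r
    using all[OF that] T(1) by blast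
  show ?case
  proof (cases "(a, b) \<in> (edge_rel T)\<^sup>*")
    case True
    have same: "(edge_rel (set (es @ [e])))\<^sup>* = (edge_rel (set es))\<^sup>*"
      using True T(3) edge_comps_insert(3)[OF V ab(2,3), of "set es"] ab(1) by simp
    have "edge_comps V {x \<in> set (es @ [e]). edge_length x \<le> r} = edge_comps V {x \<in> set es. edge_length x \<le> r}" for r
    proof (cases "edge_length e \<le> r")
      case True
      then have "{x \<in> set (es @ [e]). edge_length x \<le> r} = set (es @ [e])"
        using all by auto
      then show ?thesis
        using all[OF True] edge_comps_cong[OF same] by simp
    next
      case False
      then have "{x \<in> set (es @ [e]). edge_length x \<le> r} = {x \<in> set es. edge_length x \<le> r}"
        by auto
      then show ?thesis by simp
    qed
    then show ?thesis
      using T same by (intro exI[of _ T]) auto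
  next
    case False
    have cyc: "\<not> has_cycle (insert e T)"
      using has_cycle_insertD[of a b T] False T(2) ab(1) by blast
    have reach: "(edge_rel (insert e T))\<^sup>* = (edge_rel (set (es @ [e])))\<^sup>*"
    proof -
      have "(edge_rel T \<union> {(a, b), (b, a)})\<^sup>* = (edge_rel (set es) \<union> {(a, b), (b, a)})\<^sup>*"
        using T(3) by (metis rtrancl_Un_rtrancl rtrancl_idemp rtrancl_trancl_absorb sup.commute)
      then show ?thesis
        using ab(1) by (simp add: edge_rel_insert)
    qed
    have "card {x \<in> insert e T. edge_length x \<le> r} + edge_comps V {x \<in> set (es @ [e]). edge_length x \<le> r} = card V" for r
    proof (cases "edge_length e \<le> r")
      case True
      then have eq: "{x \<in> set (es @ [e]). edge_length x \<le> r} = insert {a, b} (set es)"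
        "{x \<in> insert e T. edge_length x \<le> r} = insert e T"
        using all allT ab(1) by auto
      have "edge_comps V (set es) = edge_comps V (insert {a, b} (set es)) + 1"
        using False T(3) by (intro edge_comps_insert(2)[OF V ab(2,3)]) simp
      then show ?thesis
        unfolding eq using T(4)[of r] all[OF True] allT[OF True] eT finT by simp
    next
      case False
      then have eq: "{x \<in> set (es @ [e]). edge_length x \<le> r} = {x \<in> set es. edge_length x \<le> r}"
        "{x \<in> insert e T. edge_length x \<le> r} = {x \<in> T. edge_length x \<le> r}"
        by auto
      then show ?thesis using T(4)[of r] by simp
    qed
    then show ?thesis
      using cyc reach T(1) by (intro exI[of _ "insert e T"]) auto
  qed
qed

text \<open>Layer-cake formula: each length is the integral of the indicator that the level lies
  below it.\<close>

lemma sum_edge_length_eq_integral: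
  assumes "finite T" "0 \<le> \<rho>" "\<And>e. e \<in> T \<Longrightarrow> 0 \<le> edge_length e \<and> edge_length e \<le> \<rho>"
  shows "((\<lambda>r. real (card {e \<in> T. r < edge_length e})) has_integral (\<Sum>e\<in>T. edge_length e)) {0..\<rho>}"
proof -
  have "((\<lambda>r. if r < edge_length e then 1 else 0::real) has_integral edge_length e) {0..\<rho>}" if "e \<in> T" for e
  proof -
    have "((\<lambda>_. 1::real) has_integral (edge_length e - 0)) {0..edge_length e}"
      using has_integral_const_real[of "1::real" 0 "edge_length e"] assms(3)[OF that] by simp
    then have "((\<lambda>r. if r \<in> {0..edge_length e} then 1 else 0::real) has_integral edge_length e) {0..\<rho>}"
      using assms(3)[OF that] by (subst has_integral_restrict) auto
    then show ?thesis
      by (rule has_integral_spike[OF negligible_sing[of "edge_length e"], rotated]) auto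
  qed
  then have "((\<lambda>r. \<Sum>e\<in>T. if r < edge_length e then 1 else 0::real) has_integral (\<Sum>e\<in>T. edge_length e)) {0..\<rho>}"
    by (intro has_integral_sum assms(1)) auto
  moreover have "(\<Sum>e\<in>T. if r < edge_length e then 1 else 0::real) = real (card {e \<in> T. r < edge_length e})" for r
    using assms(1) by (simp add: sum.If_cases Int_def)
  ultimately show ?thesis by simp
qed

text \<open>In any spanning tree the edges longer than \<open>r\<close> must join the components at
  radius \<open>r\<close>, so there are at least \<open>ncomp r V - 1\<close> of them; the tree from
  Kruskal's algorithm attains equality at every \<open>r\<close> simultaneously. Integrating over
  \<open>r\<close> gives the bound for all trees and the value for the optimal one. The empty set is
  excluded because its count is zero rather than one.\<close>

theorem mst_weight_eq_cint:
  assumes V: "finite V" "V \<noteq> {}" and \<rho>: "0 \<le> \<rho>" "\<And>x y. x \<in> V \<Longrightarrow> y \<in> V \<Longrightarrow> dist x y \<le> \<rho>"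
  shows "mst_weight V = cint \<rho> V - \<rho>"
proof -
  let ?E = "complete_edges V" and ?w = "\<lambda>T. \<Sum>e\<in>T. edge_length e"
  have finE: "finite ?E" using V finite_complete_edges by blast
  have len: "0 \<le> edge_length e \<and> edge_length e \<le> \<rho>" if "e \<in> ?E" for e
    using that \<rho> by (auto elim!: complete_edgesE)
  have int: "integral {0..\<rho>} (\<lambda>r. real (ncomp r V) - 1) = cint \<rho> V - \<rho>"
    using V \<rho> by (subst Henstock_Kurzweil_Integration.integral_diff) (auto simp: cint_def)
  have lower: "cint \<rho> V - \<rho> \<le> ?w T" if T: "spanning_tree V T" for T
  proof -
    have TE: "T \<subseteq> ?E" and con: "graph_connected V T"
      using T by (auto simp: spanning_tree_def)
    have finT: "finite T" using TE finE finite_subset by blast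
    have w: "((\<lambda>r. real (card {e \<in> T. r < edge_length e})) has_integral ?w T) {0..\<rho>}"
      using finT \<rho>(1) TE len by (intro sum_edge_length_eq_integral) auto
    have "integral {0..\<rho>} (\<lambda>r. real (ncomp r V) - 1) \<le> integral {0..\<rho>} (\<lambda>r. real (card {e \<in> T. r < edge_length e}))"
    proof (intro integral_le integrable_diff has_integral_integrable[OF w])
      fix r assume r: "r \<in> {0..\<rho>}"
      let ?S = "{e \<in> T. r < edge_length e}"
      have "ncomp r V = edge_comps V {e \<in> ?E. edge_length e \<le> r}"
        using r by (simp add: edge_comps_short)
      also have "\<dots> \<le> edge_comps V ({e \<in> ?E. edge_length e \<le> r} \<union> ?S) + card ?S"
        using finT TE by (intro edge_comps_Un_le V) auto
      also have "edge_comps V ({e \<in> ?E. edge_length e \<le> r} \<union> ?S) \<le> edge_comps V T"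
        using TE by (intro edge_comps_antimono V) auto
      also have "edge_comps V T = 1"
        using V con by (rule edge_comps_connected)
      finally show "real (ncomp r V) - 1 \<le> real (card ?S)" by linarith
    qed (use V in auto)
    then show ?thesis
      using int integral_unique[OF w] by simp
  qed
  obtain es0 where es0: "set es0 = ?E" "distinct es0"
    using finite_distinct_list[OF finE] by blast
  define es where "es = sort_key edge_length es0"
  have es: "set es = ?E" "distinct es" "sorted (map edge_length es)"
    using es0 by (auto simp: es_def)
  obtain T where T: "T \<subseteq> ?E" "\<not> has_cycle T" "(edge_rel T)\<^sup>* = (edge_rel ?E)\<^sup>*"
    "\<And>r. card {e \<in> T. edge_length e \<le> r} + edge_comps V {e \<in> ?E. edge_length e \<le> r} = card V"
    using kruskal_forest[OF V(1) es(3,2)] es(1) by auto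
  have finT: "finite T" using T(1) finE finite_subset by blast
  have "{e \<in> ?E. edge_length e \<le> \<rho>} = ?E" "{e \<in> T. edge_length e \<le> \<rho>} = T"
    using len T(1) by auto
  moreover have conE: "graph_connected V ?E"
    unfolding graph_connected_iff
  proof (intro ballI)
    fix x y assume "x \<in> V" "y \<in> V"
    then show "(x, y) \<in> (edge_rel ?E)\<^sup>*"
      by (cases "x = y") (auto simp: edge_rel_def complete_edges_def)
  qed
  ultimately have cT: "card T + 1 = card V"
    using T(4)[of \<rho>] edge_comps_connected[OF V conE] by simp
  have st: "spanning_tree V T"
    using T conE by (simp add: spanning_tree_def graph_connected_iff)
  have w: "((\<lambda>r. real (card {e \<in> T. r < edge_length e})) has_integral ?w T) {0..\<rho>}"
    using finT \<rho>(1) T len by (intro sum_edge_length_eq_integral) auto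
  have "real (card {e \<in> T. r < edge_length e}) = real (ncomp r V) - 1" if "0 \<le> r" for r
  proof -
    have "card T = card {e \<in> T. edge_length e \<le> r} + card {e \<in> T. r < edge_length e}"
      using finT by (subst card_Un_disjoint[symmetric]) (auto intro: arg_cong[where f = card])
    then show ?thesis
      using T(4)[of r] cT edge_comps_short[OF that, of V] by linarith
  qed
  then have "integral {0..\<rho>} (\<lambda>r. real (card {e \<in> T. r < edge_length e})) = integral {0..\<rho>} (\<lambda>r. real (ncomp r V) - 1)"
    by (intro Henstock_Kurzweil_Integration.integral_cong) auto
  then have wT: "?w T = cint \<rho> V - \<rho>"
    using int integral_unique[OF w] by simp
  have "finite {T. spanning_tree V T}"
    by (rule finite_subset[of _ "Pow ?E"]) (use finE in \<open>auto simp: spanning_tree_def\<close>)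
  then show ?thesis
    unfolding mst_weight_def using st wT lower by (intro Min_eqI) (auto intro: rev_image_eqI)
qed

lemma mst_weight_empty [simp]: "mst_weight {} = 0"
proof -
  have "{T. spanning_tree ({}::'a set) T} = {{}}"
    by (auto simp: spanning_tree_def complete_edges_def graph_connected_def has_cycle_def)
       (metis gr0I length_greater_0_conv less_nat_zero_code list.size(3) not_numeral_le_zero)
  then show ?thesis by (simp add: mst_weight_def)
qed

section \<open>Functions of Bernoulli random sets\<close>

text \<open>Expectation over a Bernoulli random subset, zero by convention if \<open>\<Lambda>\<close> is infinite.\<close>

definition Ep :: "real \<Rightarrow> 'a set \<Rightarrow> ('a set \<Rightarrow> real) \<Rightarrow> real" where
  "Ep p \<Lambda> f = (\<Sum>A\<in>Pow \<Lambda>. p ^ card A * (1 - p) ^ card (\<Lambda> - A) * f A)"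

lemma Ep_empty [simp]: "Ep p {} f = f {}"
  by (simp add: Ep_def)

text \<open>Conditioning on one site drives the inductions over \<Lambda> below. The recursion also
  exhibits the expectation as a polynomial in \<open>p\<close>, which is what makes it
  differentiable in the density.\<close>

lemma Ep_insert:
  assumes "finite \<Lambda>" "z \<notin> \<Lambda>"
  shows "Ep p (insert z \<Lambda>) f = p * Ep p \<Lambda> (\<lambda>A. f (insert z A)) + (1 - p) * Ep p \<Lambda> f"
proof -
  have inj: "inj_on (insert z) (Pow \<Lambda>)"
    using assms(2) by (auto simp: inj_on_def)
  have "Ep p (insert z \<Lambda>) f =
      (\<Sum>A\<in>Pow \<Lambda>. p ^ card A * (1 - p) ^ card (insert z \<Lambda> - A) * f A) +
      (\<Sum>A\<in>insert z ` Pow \<Lambda>. p ^ card A * (1 - p) ^ card (insert z \<Lambda> - A) * f A)"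
    unfolding Ep_def Pow_insert using assms by (intro sum.union_disjoint) auto
  also have "(\<Sum>A\<in>Pow \<Lambda>. p ^ card A * (1 - p) ^ card (insert z \<Lambda> - A) * f A) = (1 - p) * Ep p \<Lambda> f"
    unfolding Ep_def sum_distrib_left
  proof (rule sum.cong)
    fix A assume "A \<in> Pow \<Lambda>"
    then have "insert z \<Lambda> - A = insert z (\<Lambda> - A)" "z \<notin> \<Lambda> - A"
      using assms by auto
    then show "p ^ card A * (1 - p) ^ card (insert z \<Lambda> - A) * f A = (1 - p) * (p ^ card A * (1 - p) ^ card (\<Lambda> - A) * f A)"
      using assms by simp
  qed simp
  also have "(\<Sum>A\<in>insert z ` Pow \<Lambda>. p ^ card A * (1 - p) ^ card (insert z \<Lambda> - A) * f A)
      = p * Ep p \<Lambda> (\<lambda>A. f (insert z A))"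
    unfolding Ep_def sum_distrib_left sum.reindex[OF inj]
  proof (rule sum.cong)
    fix A assume A: "A \<in> Pow \<Lambda>"
    then have "insert z \<Lambda> - insert z A = \<Lambda> - A" "z \<notin> A" "finite A"
      using assms finite_subset by auto
    then show "((\<lambda>A. p ^ card A * (1 - p) ^ card (insert z \<Lambda> - A) * f A) \<circ> insert z) A =
        p * (p ^ card A * (1 - p) ^ card (\<Lambda> - A) * f (insert z A))"
      using assms by simp
  qed simp
  finally show ?thesis by simp
qed

lemma Ep_cong: "(\<And>A. A \<subseteq> \<Lambda> \<Longrightarrow> f A = g A) \<Longrightarrow> Ep p \<Lambda> f = Ep p \<Lambda> g"
  by (simp add: Ep_def)

lemma Ep_add: "Ep p \<Lambda> (\<lambda>A. f A + g A) = Ep p \<Lambda> f + Ep p \<Lambda> g"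
  by (simp add: Ep_def algebra_simps sum.distrib)

lemma Ep_diff: "Ep p \<Lambda> (\<lambda>A. f A - g A) = Ep p \<Lambda> f - Ep p \<Lambda> g"
  by (simp add: Ep_def algebra_simps sum_subtractf)

lemma Ep_cmult: "Ep p \<Lambda> (\<lambda>A. c * f A) = c * Ep p \<Lambda> f"
  by (simp add: Ep_def sum_distrib_left mult_ac)

lemma Ep_sum: "Ep p \<Lambda> (\<lambda>A. \<Sum>i\<in>I. f i A) = (\<Sum>i\<in>I. Ep p \<Lambda> (f i))"
  unfolding Ep_def sum_distrib_left by (rule sum.swap)

lemma Ep_const [simp]: "finite \<Lambda> \<Longrightarrow> Ep p \<Lambda> (\<lambda>_. c) = c"
  by (induction \<Lambda> rule: finite_induct) (auto simp: Ep_insert algebra_simps)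

lemma Ep_mono:
  "0 \<le> p \<Longrightarrow> p \<le> 1 \<Longrightarrow> (\<And>A. A \<subseteq> \<Lambda> \<Longrightarrow> f A \<le> g A) \<Longrightarrow> Ep p \<Lambda> f \<le> Ep p \<Lambda> g"
  unfolding Ep_def by (intro sum_mono mult_left_mono) auto

lemma Ep_nonneg: "0 \<le> p \<Longrightarrow> p \<le> 1 \<Longrightarrow> (\<And>A. A \<subseteq> \<Lambda> \<Longrightarrow> 0 \<le> f A) \<Longrightarrow> 0 \<le> Ep p \<Lambda> f"
  unfolding Ep_def by (intro sum_nonneg mult_nonneg_nonneg) auto

lemma Ep_abs_le:
  assumes "0 \<le> p" "p \<le> 1"
  shows "\<bar>Ep p \<Lambda> f\<bar> \<le> Ep p \<Lambda> (\<lambda>A. \<bar>f A\<bar>)"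
proof -
  have "Ep p \<Lambda> f \<le> Ep p \<Lambda> (\<lambda>A. \<bar>f A\<bar>)" "Ep p \<Lambda> (\<lambda>A. (-1) * f A) \<le> Ep p \<Lambda> (\<lambda>A. \<bar>f A\<bar>)"
    using assms by (intro Ep_mono; auto)+
  then show ?thesis
    unfolding Ep_cmult by linarith
qed

lemma Ep_Un:
  assumes "finite \<Lambda>\<^sub>1" "finite \<Lambda>\<^sub>2" "\<Lambda>\<^sub>1 \<inter> \<Lambda>\<^sub>2 = {}"
  shows "Ep p (\<Lambda>\<^sub>1 \<union> \<Lambda>\<^sub>2) f = Ep p \<Lambda>\<^sub>1 (\<lambda>A. Ep p \<Lambda>\<^sub>2 (\<lambda>B. f (A \<union> B)))"
  using assms(1,3)
proof (induction \<Lambda>\<^sub>1 arbitrary: f rule: finite_induct)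
  case (insert z \<Lambda>)
  then show ?case
    using assms(2) by (simp add: Ep_insert)
qed simp

lemma Ep_restrict:
  assumes "finite \<Lambda>'" "\<Lambda> \<subseteq> \<Lambda>'"
  shows "Ep p \<Lambda>' (\<lambda>A. f (A \<inter> \<Lambda>)) = Ep p \<Lambda> f"
proof -
  have fin: "finite \<Lambda>" "finite (\<Lambda>' - \<Lambda>)" using assms finite_subset by auto
  have "Ep p \<Lambda>' (\<lambda>A. f (A \<inter> \<Lambda>)) = Ep p (\<Lambda> \<union> (\<Lambda>' - \<Lambda>)) (\<lambda>A. f (A \<inter> \<Lambda>))"
    using assms(2) by (simp add: Un_absorb1)
  also have "\<dots> = Ep p \<Lambda> (\<lambda>A. Ep p (\<Lambda>' - \<Lambda>) (\<lambda>B. f ((A \<union> B) \<inter> \<Lambda>)))"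
    using fin by (intro Ep_Un) auto
  also have "\<dots> = Ep p \<Lambda> f"
  proof (rule Ep_cong)
    fix A assume "A \<subseteq> \<Lambda>"
    then have "Ep p (\<Lambda>' - \<Lambda>) (\<lambda>B. f ((A \<union> B) \<inter> \<Lambda>)) = Ep p (\<Lambda>' - \<Lambda>) (\<lambda>_. f A)"
      by (intro Ep_cong arg_cong[where f = f]) auto
    then show "Ep p (\<Lambda>' - \<Lambda>) (\<lambda>B. f ((A \<union> B) \<inter> \<Lambda>)) = f A"
      using fin by simp
  qed
  finally show ?thesis .
qed

lemma Ep_image:
  assumes "finite \<Lambda>" "inj_on h \<Lambda>"
  shows "Ep p (h ` \<Lambda>) f = Ep p \<Lambda> (\<lambda>A. f (h ` A))"
  using assms
proof (induction \<Lambda> arbitrary: f rule: finite_induct)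
  case (insert z \<Lambda>)
  then have "h z \<notin> h ` \<Lambda>" by auto
  then show ?case
    using insert by (simp add: Ep_insert)
qed simp

lemma Ep_square_le:
  assumes "0 \<le> p" "p \<le> 1" "finite \<Lambda>"
  shows "(Ep p \<Lambda> f)\<^sup>2 \<le> Ep p \<Lambda> (\<lambda>A. (f A)\<^sup>2)"
proof -
  let ?m = "Ep p \<Lambda> f"
  have "0 \<le> Ep p \<Lambda> (\<lambda>A. (f A - ?m)\<^sup>2)"
    using assms by (intro Ep_nonneg) auto
  also have "(\<lambda>A. (f A - ?m)\<^sup>2) = (\<lambda>A. (f A)\<^sup>2 + ((-2 * ?m) * f A + ?m\<^sup>2))"
    by (auto simp: power2_eq_square algebra_simps)
  also have "Ep p \<Lambda> \<dots> = Ep p \<Lambda> (\<lambda>A. (f A)\<^sup>2) - ?m\<^sup>2"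
    using assms by (subst Ep_add, subst Ep_add, subst Ep_cmult) (simp add: power2_eq_square)
  finally show ?thesis by simp
qed

section \<open>Variance bounds and the derivative in the density\<close>

definition Vp :: "real \<Rightarrow> 'a set \<Rightarrow> ('a set \<Rightarrow> real) \<Rightarrow> real" where
  "Vp p \<Lambda> f = Ep p \<Lambda> (\<lambda>A. (f A)\<^sup>2) - (Ep p \<Lambda> f)\<^sup>2"

text \<open>The add-one cost at \<open>z\<close>, written so that its value does not depend on
  whether \<open>z\<close> lies in \<open>A\<close>. Its mean over all sites therefore equals its
  mean over the sites other than \<open>z\<close>.\<close>

definition flip_diff :: "'a \<Rightarrow> ('a set \<Rightarrow> real) \<Rightarrow> 'a set \<Rightarrow> real" where
  "flip_diff z f A = f (insert z A) - f (A - {z})"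

lemma Vp_centered:
  assumes "finite \<Lambda>"
  shows "Ep p \<Lambda> (\<lambda>A. (f A - Ep p \<Lambda> f)\<^sup>2) = Vp p \<Lambda> f"
proof -
  let ?m = "Ep p \<Lambda> f"
  have "(\<lambda>A. (f A - ?m)\<^sup>2) = (\<lambda>A. (f A)\<^sup>2 + ((-2 * ?m) * f A + ?m\<^sup>2))"
    by (auto simp: power2_eq_square algebra_simps)
  then have "Ep p \<Lambda> (\<lambda>A. (f A - ?m)\<^sup>2) = Ep p \<Lambda> (\<lambda>A. (f A)\<^sup>2 + ((-2 * ?m) * f A + ?m\<^sup>2))"
    by (simp only:)
  also have "\<dots> = Vp p \<Lambda> f"
    unfolding Ep_add Ep_cmult Ep_const[OF assms] by (simp add: Vp_def power2_eq_square)
  finally show ?thesis .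
qed

lemma Vp_le_Ep_square: "Vp p \<Lambda> f \<le> Ep p \<Lambda> (\<lambda>A. (f A)\<^sup>2)"
  by (simp add: Vp_def)

lemma Vp_cmult: "Vp p \<Lambda> (\<lambda>A. c * f A) = c\<^sup>2 * Vp p \<Lambda> f"
  by (simp add: Vp_def Ep_cmult power_mult_distrib right_diff_distrib)

text \<open>Law of total variance, conditioning on all sites other than \<open>z\<close>: the first
  term is the mean conditional variance, the second the variance of the conditional mean.\<close>

lemma Vp_insert:
  assumes "finite \<Lambda>" "z \<notin> \<Lambda>"
  shows "Vp p (insert z \<Lambda>) f = p * (1 - p) * Ep p \<Lambda> (\<lambda>A. (f (insert z A) - f A)\<^sup>2)
    + Vp p \<Lambda> (\<lambda>A. p * f (insert z A) + (1 - p) * f A)"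
proof -
  have "p * Ep p \<Lambda> (\<lambda>A. (f (insert z A))\<^sup>2) + (1 - p) * Ep p \<Lambda> (\<lambda>A. (f A)\<^sup>2)
    = Ep p \<Lambda> (\<lambda>A. p * (1 - p) * (f (insert z A) - f A)\<^sup>2 + (p * f (insert z A) + (1 - p) * f A)\<^sup>2)"
    unfolding Ep_cmult[symmetric] Ep_add[symmetric]
    by (rule Ep_cong) (simp add: power2_eq_square algebra_simps)
  then show ?thesis
    using assms by (simp add: Vp_def Ep_insert Ep_add Ep_cmult)
qed

lemma flip_diff_insert:
  assumes "y \<noteq> z"
  shows "flip_diff y (\<lambda>A. f (insert z A)) A = flip_diff y f (insert z A)"
proof -
  have "insert z (insert y A) = insert y (insert z A)" "insert z (A - {y}) = insert z A - {y}"
    using assms by auto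
  then show ?thesis by (simp add: flip_diff_def)
qed

lemma flip_diff_lin:
  "flip_diff y (\<lambda>A. a * f A + b * g A) A = a * flip_diff y f A + b * flip_diff y g A"
  by (simp add: flip_diff_def algebra_simps)

lemma flip_diff_minus: "flip_diff y (\<lambda>A. f A - g A) A = flip_diff y f A - flip_diff y g A"
  by (simp add: flip_diff_def)

lemma Ep_flip_diff_new:
  assumes "finite \<Lambda>" "z \<notin> \<Lambda>"
  shows "Ep p (insert z \<Lambda>) (\<lambda>A. h (flip_diff z f A)) = Ep p \<Lambda> (\<lambda>A. h (f (insert z A) - f A))"
proof -
  have "flip_diff z f A = f (insert z A) - f A" "flip_diff z f (insert z A) = f (insert z A) - f A"
    if "A \<subseteq> \<Lambda>" for A
  proof -
    have "z \<notin> A" using that assms(2) by auto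
    then show "flip_diff z f A = f (insert z A) - f A" "flip_diff z f (insert z A) = f (insert z A) - f A"
      by (simp_all add: flip_diff_def)
  qed
  then have "Ep p \<Lambda> (\<lambda>A. h (flip_diff z f (insert z A))) = Ep p \<Lambda> (\<lambda>A. h (f (insert z A) - f A))"
    "Ep p \<Lambda> (\<lambda>A. h (flip_diff z f A)) = Ep p \<Lambda> (\<lambda>A. h (f (insert z A) - f A))"
    by (auto intro!: Ep_cong)
  then show ?thesis
    using assms by (simp add: Ep_insert algebra_simps)
qed

lemma convex_square:
  fixes p x y :: real
  assumes "0 \<le> p" "p \<le> 1"
  shows "(p * x + (1 - p) * y)\<^sup>2 \<le> p * x\<^sup>2 + (1 - p) * y\<^sup>2"
proof -
  have "p * x\<^sup>2 + (1 - p) * y\<^sup>2 - (p * x + (1 - p) * y)\<^sup>2 = p * (1 - p) * (x - y)\<^sup>2"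
    by (simp add: power2_eq_square algebra_simps)
  also have "\<dots> \<ge> 0" using assms by simp
  finally show ?thesis by linarith
qed

text \<open>Averaging over one site splits off the exact contribution of that site, and by convexity
  of the square the averaged function has no larger mean squared flips at the other sites.\<close>

theorem Efron_Stein:
  assumes p: "0 \<le> p" "p \<le> 1" and "finite \<Lambda>"
  shows "Vp p \<Lambda> f \<le> p * (1 - p) * (\<Sum>z\<in>\<Lambda>. Ep p \<Lambda> (\<lambda>A. (flip_diff z f A)\<^sup>2))"
  using assms(3)
proof (induction \<Lambda> arbitrary: f rule: finite_induct)
  case (insert z \<Lambda>)
  let ?g = "\<lambda>A. p * f (insert z A) + (1 - p) * f A"
  have "Ep p \<Lambda> (\<lambda>A. (flip_diff y ?g A)\<^sup>2) \<le> Ep p (insert z \<Lambda>) (\<lambda>A. (flip_diff y f A)\<^sup>2)" if "y \<in> \<Lambda>" for y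
  proof -
    have "y \<noteq> z" using that insert by auto
    have "Ep p \<Lambda> (\<lambda>A. (flip_diff y ?g A)\<^sup>2)
        \<le> Ep p \<Lambda> (\<lambda>A. p * (flip_diff y f (insert z A))\<^sup>2 + (1 - p) * (flip_diff y f A)\<^sup>2)"
      using p convex_square[OF p] \<open>y \<noteq> z\<close>
      by (intro Ep_mono) (auto simp: flip_diff_lin flip_diff_insert)
    then show ?thesis
      using insert by (simp add: Ep_insert Ep_add Ep_cmult)
  qed
  then have "p * (1 - p) * (\<Sum>y\<in>\<Lambda>. Ep p \<Lambda> (\<lambda>A. (flip_diff y ?g A)\<^sup>2))
      \<le> p * (1 - p) * (\<Sum>y\<in>\<Lambda>. Ep p (insert z \<Lambda>) (\<lambda>A. (flip_diff y f A)\<^sup>2))"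
    using p by (intro mult_left_mono sum_mono) auto
  then show ?case
    using insert.IH[of ?g] insert(1,2) Ep_flip_diff_new[of \<Lambda> z p "\<lambda>x. x\<^sup>2" f]
    by (simp add: Vp_insert algebra_simps)
qed (simp add: Vp_def)

text \<open>The sum is the first-order part of the orthogonal decomposition of \<open>f\<close> over
  independent sites. In the induction, averaging over a site keeps the mean flips at the other sites
  unchanged, and Jensen's inequality handles the site split off.\<close>

theorem Vp_ge_sum_flip:
  assumes p: "0 \<le> p" "p \<le> 1" and "finite \<Lambda>"
  shows "p * (1 - p) * (\<Sum>z\<in>\<Lambda>. (Ep p \<Lambda> (flip_diff z f))\<^sup>2) \<le> Vp p \<Lambda> f"
  using assms(3)
proof (induction \<Lambda> arbitrary: f rule: finite_induct)
  case (insert z \<Lambda>)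
  let ?g = "\<lambda>A. p * f (insert z A) + (1 - p) * f A"
  have "Ep p \<Lambda> (flip_diff y ?g) = Ep p (insert z \<Lambda>) (flip_diff y f)" if "y \<in> \<Lambda>" for y
  proof -
    have "y \<noteq> z" using that insert by auto
    then have "flip_diff y ?g = (\<lambda>A. p * flip_diff y f (insert z A) + (1 - p) * flip_diff y f A)"
      by (auto simp: flip_diff_lin flip_diff_insert)
    then show ?thesis
      using insert by (simp add: Ep_insert Ep_add Ep_cmult)
  qed
  then have eq: "(\<Sum>y\<in>\<Lambda>. (Ep p \<Lambda> (flip_diff y ?g))\<^sup>2) = (\<Sum>y\<in>\<Lambda>. (Ep p (insert z \<Lambda>) (flip_diff y f))\<^sup>2)"
    by simp
  have "(Ep p (insert z \<Lambda>) (flip_diff z f))\<^sup>2 \<le> Ep p \<Lambda> (\<lambda>A. (f (insert z A) - f A)\<^sup>2)"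
    using Ep_square_le[OF p insert(1), of "\<lambda>A. f (insert z A) - f A"]
      Ep_flip_diff_new[OF insert(1,2), of p "\<lambda>x. x" f] by simp
  then have "p * (1 - p) * (Ep p (insert z \<Lambda>) (flip_diff z f))\<^sup>2 \<le> p * (1 - p) * Ep p \<Lambda> (\<lambda>A. (f (insert z A) - f A)\<^sup>2)"
    using p by (intro mult_left_mono) auto
  then show ?case
    using insert.IH[of ?g] insert(1,2) eq by (simp add: Vp_insert algebra_simps)
qed (simp add: Vp_def)

text \<open>The product rule at the split site produces the mean flip there; at the other sites the
  induction hypothesis applies to both conditionings.\<close>

theorem Russo:
  assumes "finite \<Lambda>"
  shows "((\<lambda>p. Ep p \<Lambda> f) has_real_derivative (\<Sum>z\<in>\<Lambda>. Ep p \<Lambda> (flip_diff z f))) (at p)"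
  using assms
proof (induction \<Lambda> arbitrary: f rule: finite_induct)
  case (insert z \<Lambda>)
  have "((\<lambda>p. p * Ep p \<Lambda> (\<lambda>A. f (insert z A)) + (1 - p) * Ep p \<Lambda> f) has_real_derivative
     (p * (\<Sum>y\<in>\<Lambda>. Ep p \<Lambda> (flip_diff y (\<lambda>A. f (insert z A)))) + Ep p \<Lambda> (\<lambda>A. f (insert z A))
       + ((1 - p) * (\<Sum>y\<in>\<Lambda>. Ep p \<Lambda> (flip_diff y f)) - Ep p \<Lambda> f))) (at p)"
    by (rule derivative_eq_intros insert.IH refl | simp)+
  moreover have "p * (\<Sum>y\<in>\<Lambda>. Ep p \<Lambda> (flip_diff y (\<lambda>A. f (insert z A)))) + Ep p \<Lambda> (\<lambda>A. f (insert z A))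
       + ((1 - p) * (\<Sum>y\<in>\<Lambda>. Ep p \<Lambda> (flip_diff y f)) - Ep p \<Lambda> f)
     = (\<Sum>y\<in>insert z \<Lambda>. Ep p (insert z \<Lambda>) (flip_diff y f))"
  proof -
    have "Ep p (insert z \<Lambda>) (flip_diff y f)
        = p * Ep p \<Lambda> (flip_diff y (\<lambda>A. f (insert z A))) + (1 - p) * Ep p \<Lambda> (flip_diff y f)" if "y \<in> \<Lambda>" for y
    proof -
      have "y \<noteq> z" using that insert(2) by auto
      then have "flip_diff y (\<lambda>A. f (insert z A)) = (\<lambda>A. flip_diff y f (insert z A))"
        by (auto simp: flip_diff_insert)
      then show ?thesis
        using insert(1,2) by (simp add: Ep_insert)
    qed
    then have "(\<Sum>y\<in>\<Lambda>. Ep p (insert z \<Lambda>) (flip_diff y f))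
        = p * (\<Sum>y\<in>\<Lambda>. Ep p \<Lambda> (flip_diff y (\<lambda>A. f (insert z A)))) + (1 - p) * (\<Sum>y\<in>\<Lambda>. Ep p \<Lambda> (flip_diff y f))"
      by (simp add: sum.distrib sum_distrib_left)
    moreover have "Ep p (insert z \<Lambda>) (flip_diff z f) = Ep p \<Lambda> (\<lambda>A. f (insert z A)) - Ep p \<Lambda> f"
      using Ep_flip_diff_new[OF insert(1,2), of p "\<lambda>x. x" f] by (simp add: Ep_diff)
    ultimately show ?thesis
      using insert(1,2) by simp
  qed
  ultimately have "((\<lambda>p. p * Ep p \<Lambda> (\<lambda>A. f (insert z A)) + (1 - p) * Ep p \<Lambda> f) has_real_derivative
      (\<Sum>y\<in>insert z \<Lambda>. Ep p (insert z \<Lambda>) (flip_diff y f))) (at p)"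
    by (simp only:)
  then show ?case
    unfolding Ep_insert[OF insert(1,2), of _ f, symmetric] .
qed simp

lemma Ep_card: "finite \<Lambda> \<Longrightarrow> Ep p \<Lambda> (\<lambda>A. real (card A)) = p * card \<Lambda>"
proof (induction \<Lambda> rule: finite_induct)
  case (insert z \<Lambda>)
  have "Ep p \<Lambda> (\<lambda>A. real (card (insert z A))) = Ep p \<Lambda> (\<lambda>A. real (card A) + 1)"
    using insert finite_subset[OF _ insert(1)] by (intro Ep_cong) (auto simp: card_insert_if)
  then show ?case
    using insert by (simp add: Ep_insert Ep_add algebra_simps)
qed simp

text \<open>The shifts by 1 and 2 provide the slack that the induction over sites consumes,
  uniformly in \<open>p\<close>.\<close>

lemma Ep_card_pow:
  assumes p: "0 \<le> p" "p \<le> 1" and "finite \<Lambda>"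
  shows "Ep p \<Lambda> (\<lambda>A. real (card A) ^ 2) \<le> (p * card \<Lambda> + 1) ^ 2"
    and "Ep p \<Lambda> (\<lambda>A. real (card A) ^ 3) \<le> (p * card \<Lambda> + 2) ^ 3"
  using assms(3)
proof (induction \<Lambda> rule: finite_induct)
  case (insert z \<Lambda>)
  have ci: "Ep p \<Lambda> (\<lambda>A. real (card (insert z A)) ^ k) = Ep p \<Lambda> (\<lambda>A. (real (card A) + 1) ^ k)" for k
    using insert finite_subset[OF _ insert(1)] by (intro Ep_cong) (auto simp: card_insert_if add.commute)
  let ?\<mu> = "p * card \<Lambda>"
  have \<mu>: "0 \<le> ?\<mu>" using p by simp
  have E1: "Ep p \<Lambda> (\<lambda>A. real (card A)) = ?\<mu>" using insert Ep_card by blast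
  have e2: "Ep p \<Lambda> (\<lambda>A. (real (card A) + 1) ^ 2) = Ep p \<Lambda> (\<lambda>A. real (card A) ^ 2) + (2 * ?\<mu> + 1)"
    using insert(1) E1 by (simp add: power2_sum Ep_add Ep_cmult)
  have e3: "Ep p \<Lambda> (\<lambda>A. (real (card A) + 1) ^ 3)
      = Ep p \<Lambda> (\<lambda>A. real (card A) ^ 3) + (3 * Ep p \<Lambda> (\<lambda>A. real (card A) ^ 2) + 3 * ?\<mu> + 1)"
  proof -
    have "(\<lambda>A::'a set. (real (card A) + 1) ^ 3) = (\<lambda>A. real (card A) ^ 3 + (3 * real (card A) ^ 2 + (3 * real (card A) + 1)))"
      by (simp add: power3_eq_cube power2_eq_square algebra_simps)
    then show ?thesis
      using insert(1) E1 by (simp add: Ep_add Ep_cmult)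
  qed
  have cs: "p * card (insert z \<Lambda>) = ?\<mu> + p"
    using insert by (simp add: algebra_simps)
  {
    case 1
    have "Ep p (insert z \<Lambda>) (\<lambda>A. real (card A) ^ 2) = Ep p \<Lambda> (\<lambda>A. real (card A) ^ 2) + p * (2 * ?\<mu> + 1)"
      by (simp only: Ep_insert[OF insert(1,2)] ci e2) (simp add: algebra_simps)
    also have "\<dots> \<le> (?\<mu> + 1) ^ 2 + p * (2 * ?\<mu> + 1)"
      using insert by simp
    also have "\<dots> \<le> (?\<mu> + p + 1) ^ 2"
      using p \<mu> by (simp add: power2_eq_square algebra_simps)
    finally show ?case using cs by simp
  next
    case 2
    have "Ep p (insert z \<Lambda>) (\<lambda>A. real (card A) ^ 3) = Ep p \<Lambda> (\<lambda>A. real (card A) ^ 3)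
        + p * (3 * Ep p \<Lambda> (\<lambda>A. real (card A) ^ 2) + 3 * ?\<mu> + 1)"
      by (simp only: Ep_insert[OF insert(1,2)] ci e3) (simp add: algebra_simps)
    also have "\<dots> \<le> (?\<mu> + 2) ^ 3 + p * (3 * (?\<mu> + 1) ^ 2 + 3 * ?\<mu> + 1)"
      using insert p by (intro add_mono mult_left_mono) auto
    also have "\<dots> \<le> (?\<mu> + 2) ^ 3 + p * (3 * (?\<mu> + 2) ^ 2)"
      using p \<mu> by (intro add_mono mult_left_mono) (auto simp: power2_eq_square algebra_simps)
    also have "\<dots> \<le> (?\<mu> + p + 2) ^ 3"
    proof -
      have "(?\<mu> + p + 2) ^ 3 = (?\<mu> + 2) ^ 3 + p * (3 * (?\<mu> + 2) ^ 2) + (3 * p ^ 2 * (?\<mu> + 2) + p ^ 3)"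
        by (simp add: power3_eq_cube power2_eq_square algebra_simps)
      moreover have "0 \<le> 3 * p ^ 2 * (?\<mu> + 2) + p ^ 3" using p \<mu> by simp
      ultimately show ?thesis by linarith
    qed
    finally show ?case using cs by simp
  }
qed auto

lemma Ep_avoid:
  assumes "finite \<Lambda>" "D \<subseteq> \<Lambda>"
  shows "Ep p \<Lambda> (\<lambda>A. if A \<inter> D = {} then f A else 0) = (1 - p) ^ card D * Ep p (\<Lambda> - D) f"
proof -
  have fin: "finite D" "finite (\<Lambda> - D)" using assms finite_subset by auto
  have one: "Ep p D (\<lambda>A. if A = {} then c else 0) = (1 - p) ^ card D * c" for c
    using fin(1)
  proof (induction D rule: finite_induct)
    case (insert z D)
    then show ?case by (simp add: Ep_insert Ep_const)
  qed simp
  have "Ep p \<Lambda> (\<lambda>A. if A \<inter> D = {} then f A else 0)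
      = Ep p ((\<Lambda> - D) \<union> D) (\<lambda>A. if A \<inter> D = {} then f A else 0)"
    using assms(2) by (simp add: Un_absorb2)
  also have "\<dots> = Ep p (\<Lambda> - D) (\<lambda>A. Ep p D (\<lambda>B. if (A \<union> B) \<inter> D = {} then f (A \<union> B) else 0))"
    using fin by (intro Ep_Un) auto
  also have "\<dots> = Ep p (\<Lambda> - D) (\<lambda>A. (1 - p) ^ card D * f A)"
  proof (rule Ep_cong)
    fix A assume A: "A \<subseteq> \<Lambda> - D"
    have "Ep p D (\<lambda>B. if (A \<union> B) \<inter> D = {} then f (A \<union> B) else 0) = Ep p D (\<lambda>B. if B = {} then f A else 0)"
    proof (rule Ep_cong)
      fix B assume "B \<subseteq> D"
      then have "(A \<union> B) \<inter> D = B" using A by auto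
      then show "(if (A \<union> B) \<inter> D = {} then f (A \<union> B) else 0) = (if B = {} then f A else 0)" by auto
    qed
    then show "Ep p D (\<lambda>B. if (A \<union> B) \<inter> D = {} then f (A \<union> B) else 0) = (1 - p) ^ card D * f A"
      by (simp add: one)
  qed
  finally show ?thesis by (simp add: Ep_cmult)
qed

section \<open>Add-one costs on the integer lattice\<close>

text \<open>Half open, so that boxes with lattice centres spaced by \<open>2 * k\<close> tile the
  lattice without overlap and each has \<open>(2 * k) ^ CARD('d)\<close> points.\<close>

definition lbox :: "real^'d \<Rightarrow> nat \<Rightarrow> (real^'d) set" where
  "lbox c k = {x. \<forall>i. x $ i \<in> \<int> \<and> c $ i - real k \<le> x $ i \<and> x $ i < c $ i + real k}"

definition lattice_pt :: "real^'d \<Rightarrow> bool" where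
  "lattice_pt x \<longleftrightarrow> (\<forall>i. x $ i \<in> \<int>)"

text \<open>The centres whose box of half side \<open>t\<close> stays inside the box of half side
  \<open>k\<close> about the origin. The upper bound is closed because boxes are open above.\<close>

definition linner :: "nat \<Rightarrow> nat \<Rightarrow> (real^'d) set" where
  "linner k t = {x. \<forall>i. x $ i \<in> \<int> \<and> - real k + real t \<le> x $ i \<and> x $ i \<le> real k - real t}"

lemma lboxD:
  assumes "x \<in> lbox c k"
  shows "x $ i \<in> \<int>" "c $ i - real k \<le> x $ i" "x $ i < c $ i + real k"
  using assms by (auto simp: lbox_def)

lemma lboxI:
  assumes "\<And>i. x $ i \<in> \<int>" "\<And>i. c $ i - real k \<le> x $ i" "\<And>i. x $ i < c $ i + real k"
  shows "x \<in> lbox c k"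
  using assms by (simp add: lbox_def)

lemma coords_set_eq: "{x::real^'d. \<forall>i. x $ i \<in> S i} = vec_lambda ` PiE UNIV S"
proof
  show "{x::real^'d. \<forall>i. x $ i \<in> S i} \<subseteq> vec_lambda ` PiE UNIV S"
  proof
    fix x :: "real^'d" assume "x \<in> {x. \<forall>i. x $ i \<in> S i}"
    then show "x \<in> vec_lambda ` PiE UNIV S"
      by (intro image_eqI[of _ _ "vec_nth x"]) auto
  qed
qed auto

lemma card_coords_set: "card {x::real^'d. \<forall>i. x $ i \<in> S} = card S ^ CARD('d)"
proof -
  have "inj_on vec_lambda (PiE (UNIV :: 'd set) (\<lambda>_. S))"
    by (auto simp: inj_on_def vec_eq_iff)
  then show ?thesis
    unfolding coords_set_eq[of "\<lambda>_. S"] by (simp add: card_image card_PiE)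
qed

lemma finite_coords_set: "finite S \<Longrightarrow> finite {x::real^'d. \<forall>i. x $ i \<in> S}"
  unfolding coords_set_eq[of "\<lambda>_. S"] by (intro finite_imageI finite_PiE) auto

lemma Ints_interval: "{r::real. r \<in> \<int> \<and> of_int a \<le> r \<and> r < of_int b} = of_int ` {a..<b}"
  by (auto elim!: Ints_cases)

lemma Ints_closed_interval: "{r::real. r \<in> \<int> \<and> of_int a \<le> r \<and> r \<le> of_int b} = of_int ` {a..b}"
  by (auto elim!: Ints_cases)

lemma card_lbox0 [simp]: "card (lbox (0::real^'d) k) = (2 * k) ^ CARD('d)"
  and finite_lbox0: "finite (lbox (0::real^'d) k)"
proof -
  have S: "{r::real. r \<in> \<int> \<and> - real k \<le> r \<and> r < real k} = of_int ` {- int k..<int k}"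
    using Ints_interval[of "- int k" "int k"] by simp
  have eq: "lbox (0::real^'d) k = {x. \<forall>i. x $ i \<in> {r::real. r \<in> \<int> \<and> - real k \<le> r \<and> r < real k}}"
    by (simp add: lbox_def)
  have "card {r::real. r \<in> \<int> \<and> - real k \<le> r \<and> r < real k} = 2 * k"
    unfolding S by (simp add: card_image inj_on_def)
  then show "card (lbox (0::real^'d) k) = (2 * k) ^ CARD('d)"
    unfolding eq card_coords_set by simp
  show "finite (lbox (0::real^'d) k)"
    unfolding eq by (intro finite_coords_set) (simp add: S)
qed

lemma lbox_translate: "lattice_pt c \<Longrightarrow> lbox c k = (+) c ` lbox 0 k"
proof -
  assume c: "lattice_pt c"
  have "x - c \<in> lbox 0 k" if "x \<in> lbox c k" for x
    using that c by (auto simp: lbox_def lattice_pt_def algebra_simps)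
  moreover have "c + y \<in> lbox c k" if "y \<in> lbox 0 k" for y
    using that c by (auto simp: lbox_def lattice_pt_def)
  ultimately show "lbox c k = (+) c ` lbox 0 k"
    by (force simp: image_iff)
qed

lemma finite_lbox [simp]: "finite (lbox (c::real^'d) k)"
proof (rule finite_subset)
  let ?S = "\<Union>i. {r::real. r \<in> \<int> \<and> c $ i - real k \<le> r \<and> r < c $ i + real k}"
  have "finite {r::real. r \<in> \<int> \<and> c $ i - real k \<le> r \<and> r < c $ i + real k}" for i
  proof (rule finite_subset)
    show "{r::real. r \<in> \<int> \<and> c $ i - real k \<le> r \<and> r < c $ i + real k}
      \<subseteq> of_int ` {\<lfloor>c $ i - real k\<rfloor>..\<lceil>c $ i + real k\<rceil>}"
      by (auto elim!: Ints_cases simp: floor_le_iff le_ceiling_iff)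
  qed auto
  then show "finite {x::real^'d. \<forall>i. x $ i \<in> ?S}"
    by (intro finite_coords_set) auto
qed (auto simp: lbox_def)

lemma card_lbox: "lattice_pt (c::real^'d) \<Longrightarrow> card (lbox c k) = (2 * k) ^ CARD('d)"
  by (subst lbox_translate) (simp_all add: card_image)

lemma lbox_lattice_pt: "x \<in> lbox c k \<Longrightarrow> lattice_pt x"
  by (simp add: lbox_def lattice_pt_def)

lemma linner_lattice_pt: "x \<in> linner k t \<Longrightarrow> lattice_pt x"
  by (simp add: linner_def lattice_pt_def)

lemma linner_lbox_subset: "x \<in> linner k t \<Longrightarrow> lbox x t \<subseteq> lbox 0 k"
proof
  fix y assume x: "x \<in> linner k t" and y: "y \<in> lbox x t"
  have "y $ i \<in> \<int> \<and> - real k \<le> y $ i \<and> y $ i < real k" for i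
    using spec[OF x[unfolded linner_def mem_Collect_eq], of i]
      spec[OF y[unfolded lbox_def mem_Collect_eq], of i] by auto
  then show "y \<in> lbox 0 k" by (simp add: lbox_def)
qed

lemma linner_subset: "1 \<le> t \<Longrightarrow> linner k t \<subseteq> lbox 0 k"
proof
  fix x assume t: "1 \<le> t" and x: "x \<in> linner k t"
  have "x $ i \<in> \<int> \<and> - real k \<le> x $ i \<and> x $ i < real k" for i
    using spec[OF x[unfolded linner_def mem_Collect_eq], of i] t by auto
  then show "x \<in> lbox 0 k" by (simp add: lbox_def)
qed

lemma lbox_far:
  assumes "lattice_pt y" "y \<notin> lbox x t"
  shows "real t \<le> dist x y"
proof -
  obtain i where "y $ i < x $ i - real t \<or> x $ i + real t \<le> y $ i"
    using assms by (auto simp: lattice_pt_def lbox_def not_le not_less)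
  then have "real t \<le> \<bar>(x - y) $ i\<bar>" by auto
  also have "\<dots> \<le> dist x y"
    unfolding dist_norm by (rule component_le_norm_cart)
  finally show ?thesis .
qed

text \<open>By Bernoulli's inequality the inner box loses at most the fraction
  \<open>CARD('d) * t / k\<close>. When \<open>t\<close> exceeds \<open>k\<close>, this fraction is
  above one and the bound is trivial.\<close>

lemma card_lboundary:
  assumes "1 \<le> t" "1 \<le> k"
  shows "real (card (lbox (0::real^'d) k - linner k t)) \<le> (2 * real k) ^ CARD('d) * (CARD('d) * t / k)"
proof (cases "t \<le> k")
  case False
  have "card (lbox (0::real^'d) k - linner k t) \<le> card (lbox (0::real^'d) k)"
    by (intro card_mono finite_lbox) auto
  then have "real (card (lbox (0::real^'d) k - linner k t)) \<le> real ((2 * k) ^ CARD('d))"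
    by (simp only: card_lbox0 of_nat_le_iff)
  also have "\<dots> = (2 * real k) ^ CARD('d) * 1" by simp
  also have "\<dots> \<le> (2 * real k) ^ CARD('d) * (CARD('d) * t / k)"
  proof (rule mult_left_mono)
    have "1 * real k \<le> real CARD('d) * real t"
      using False by (intro mult_mono) auto
    then show "1 \<le> CARD('d) * t / k" using assms by (simp add: field_simps)
  qed simp
  finally show ?thesis .
next
  case True
  let ?D = "CARD('d)"
  have S: "{r::real. r \<in> \<int> \<and> - real k + real t \<le> r \<and> r \<le> real k - real t}
      = of_int ` {- int k + int t .. int k - int t}"
    using Ints_closed_interval[of "- int k + int t" "int k - int t"] by simp
  have "card {r::real. r \<in> \<int> \<and> - real k + real t \<le> r \<and> r \<le> real k - real t} = 2 * (k - t) + 1"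
    unfolding S using True by (simp add: card_image inj_on_def)
  moreover have "linner k t = {x::real^'d. \<forall>i. x $ i \<in> {r::real. r \<in> \<int> \<and> - real k + real t \<le> r \<and> r \<le> real k - real t}}"
    by (simp add: linner_def)
  ultimately have card: "card (linner k t :: (real^'d) set) = (2 * (k - t) + 1) ^ ?D"
    by (simp only: card_coords_set)
  have "finite (linner k t :: (real^'d) set)"
    using linner_subset[OF assms(1)] finite_lbox finite_subset by blast
  then have "card (lbox (0::real^'d) k - linner k t) = (2 * k) ^ ?D - (2 * (k - t) + 1) ^ ?D"
    by (subst card_Diff_subset[OF _ linner_subset[OF assms(1)]]) (simp_all only: card card_lbox0)
  moreover have "(2 * (k - t) + 1) ^ ?D \<le> (2 * k) ^ ?D"
    using True assms by (intro power_mono) auto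
  ultimately have eq: "real (card (lbox (0::real^'d) k - linner k t))
      = (2 * real k) ^ ?D - (2 * (real k - real t) + 1) ^ ?D"
    using True by (simp add: of_nat_diff add.commute)
  have "(2 * real k) ^ ?D * (1 + real ?D * (- (real t / real k)))
      \<le> (2 * real k) ^ ?D * (1 + (- (real t / real k))) ^ ?D"
    using True assms by (intro mult_left_mono Bernoulli_inequality) (auto simp: field_simps)
  also have "\<dots> = (2 * real k * (1 + (- (real t / real k)))) ^ ?D"
    by (simp only: power_mult_distrib)
  also have "\<dots> \<le> (2 * (real k - real t) + 1) ^ ?D"
    using True assms by (intro power_mono) (auto simp: field_simps)
  finally show ?thesis
    unfolding eq by (simp add: algebra_simps)
qed

section \<open>Mean add-one costs and the derivative of the mean functional\<close>

definition lattice_cost :: "'d::finite itself \<Rightarrow> real \<Rightarrow> real \<Rightarrow> nat \<Rightarrow> real" where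
  "lattice_cost _ p \<rho> k = Ep p (lbox (0::real^'d) k) (flip_diff 0 (cint \<rho>))"

definition lattice_mean :: "'d::finite itself \<Rightarrow> real \<Rightarrow> real \<Rightarrow> nat \<Rightarrow> real" where
  "lattice_mean _ \<rho> p k = Ep p (lbox (0::real^'d) k) (cint \<rho>)"

lemma flip_cint_bounds:
  fixes A :: "(real^'d) set"
  assumes "finite A" "0 \<le> \<rho>"
  shows "flip_diff z (cint \<rho>) A \<le> \<rho>" "- (kiss TYPE('d) * \<rho>) \<le> flip_diff z (cint \<rho>) A"
proof -
  have "insert z A = insert z (A - {z})" by auto
  then show "flip_diff z (cint \<rho>) A \<le> \<rho>" "- (kiss TYPE('d) * \<rho>) \<le> flip_diff z (cint \<rho>) A"
    using cint_insert_le[of "A - {z}" \<rho> z] cint_insert_ge[of "A - {z}" \<rho> z] assms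
    by (simp_all add: flip_diff_def)
qed

lemma flip_cint_mono:
  assumes "finite A" "A' \<subseteq> A" "\<And>x. x \<in> A - A' \<Longrightarrow> \<rho>' < dist z x" "0 \<le> \<rho>" "\<rho> \<le> \<rho>'"
  shows "flip_diff z (cint \<rho>) A - flip_diff z (cint \<rho>) A' \<le> flip_diff z (cint \<rho>') A - flip_diff z (cint \<rho>') A'"
proof -
  have "insert z A = insert z (A - {z})" "insert z A' = insert z (A' - {z})" by auto
  then show ?thesis
    unfolding flip_diff_def
    using cint_supermodular[of "A - {z}" "A' - {z}" z \<rho>' \<rho>] assms by fastforce
qed

lemma flip_cint_mono0:
  assumes "finite A" "A' \<subseteq> A" "\<And>x. x \<in> A - A' \<Longrightarrow> \<rho> < dist z x" "0 \<le> \<rho>"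
  shows "flip_diff z (cint \<rho>) A' \<le> flip_diff z (cint \<rho>) A"
  using flip_cint_mono[OF assms(1-3) order_refl assms(4)] by (simp add: flip_diff_def)

text \<open>Enlarging the window by points beyond the cutoff raises the add-one cost pointwise,
  hence in mean. This ordering lets the costs at different sites of a box be squeezed between costs
  in windows centred at the site, which by translation are costs at the origin.\<close>

lemma Ep_flip_mono0:
  assumes "0 \<le> p" "p \<le> 1" "finite \<Lambda>'" "\<Lambda> \<subseteq> \<Lambda>'" "\<And>x. x \<in> \<Lambda>' - \<Lambda> \<Longrightarrow> \<rho> < dist z x" "0 \<le> \<rho>"
  shows "Ep p \<Lambda> (flip_diff z (cint \<rho>)) \<le> Ep p \<Lambda>' (flip_diff z (cint \<rho>))"
proof -
  have "Ep p \<Lambda>' (\<lambda>A. flip_diff z (cint \<rho>) (A \<inter> \<Lambda>)) \<le> Ep p \<Lambda>' (\<lambda>A. flip_diff z (cint \<rho>) A)"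
    using assms finite_subset by (intro Ep_mono flip_cint_mono0) auto
  then show ?thesis
    using assms by (simp add: Ep_restrict)
qed

lemma Ep_flip_bounds:
  fixes \<Lambda> :: "(real^'d) set"
  assumes "0 \<le> p" "p \<le> 1" "finite \<Lambda>" "0 \<le> \<rho>"
  shows "Ep p \<Lambda> (flip_diff z (cint \<rho>)) \<le> \<rho>" "- (kiss TYPE('d) * \<rho>) \<le> Ep p \<Lambda> (flip_diff z (cint \<rho>))"
proof -
  have "Ep p \<Lambda> (flip_diff z (cint \<rho>)) \<le> Ep p \<Lambda> (\<lambda>_. \<rho>)"
    "Ep p \<Lambda> (\<lambda>_. - (kiss TYPE('d) * \<rho>)) \<le> Ep p \<Lambda> (flip_diff z (cint \<rho>))"
    using assms by (intro Ep_mono flip_cint_bounds; blast intro: finite_subset)+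
  then show "Ep p \<Lambda> (flip_diff z (cint \<rho>)) \<le> \<rho>" "- (kiss TYPE('d) * \<rho>) \<le> Ep p \<Lambda> (flip_diff z (cint \<rho>))"
    using assms(3) by simp_all
qed

lemma Ep_translate:
  assumes "lattice_pt c"
  shows "Ep p (lbox c k) f = Ep p (lbox 0 k) (\<lambda>A. f ((+) c ` A))"
  unfolding lbox_translate[OF assms] by (rule Ep_image) auto

lemma Ep_flip_translate:
  fixes z :: "real^'d"
  assumes "lattice_pt z"
  shows "Ep p (lbox z k) (flip_diff z (cint \<rho>)) = lattice_cost TYPE('d) p \<rho> k"
  unfolding lattice_cost_def Ep_translate[OF assms]
proof (rule Ep_cong)
  fix A assume "A \<subseteq> lbox (0::real^'d) k"
  then have fin: "finite A" using finite_lbox finite_subset by blast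
  have "insert z ((+) z ` A) = (+) z ` insert 0 A" "(+) z ` A - {z} = (+) z ` (A - {0})" by auto
  then show "flip_diff z (cint \<rho>) ((+) z ` A) = flip_diff 0 (cint \<rho>) A"
    using fin by (simp only: flip_diff_def cint_translate finite_insert finite_Diff)
qed

lemma Ep_cint_translate:
  fixes z :: "real^'d"
  assumes "lattice_pt z"
  shows "Ep p (lbox z k) (cint \<rho>) = lattice_mean TYPE('d) \<rho> p k"
  unfolding lattice_mean_def Ep_translate[OF assms]
  using finite_subset[OF _ finite_lbox] by (intro Ep_cong cint_translate) auto

lemma lattice_mean_deriv:
  "((\<lambda>p. lattice_mean TYPE('d::finite) \<rho> p k) has_real_derivative
     (\<Sum>z\<in>lbox (0::real^'d) k. Ep p (lbox 0 k) (flip_diff z (cint \<rho>)))) (at p)"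
  unfolding lattice_mean_def by (rule Russo) simp

lemma sum_le_split:
  fixes f :: "'a \<Rightarrow> real" and a b :: real
  assumes "finite S" "\<And>z. z \<in> S \<Longrightarrow> z \<in> I \<Longrightarrow> f z \<le> a" "\<And>z. z \<in> S \<Longrightarrow> z \<notin> I \<Longrightarrow> f z \<le> a + b"
  shows "sum f S \<le> card S * a + card (S - I) * b"
proof -
  have "sum f S \<le> (\<Sum>z\<in>S. a + (if z \<in> I then 0 else b))"
    using assms by (intro sum_mono) auto
  also have "\<dots> = card S * a + card (S - I) * b"
    using assms(1) by (simp add: sum.distrib sum.If_cases set_diff_eq Int_def Compl_eq)
  finally show ?thesis .
qed

lemma sum_ge_split:
  fixes f :: "'a \<Rightarrow> real" and a b :: real
  assumes "finite S" "\<And>z. z \<in> S \<Longrightarrow> z \<in> I \<Longrightarrow> a \<le> f z" "\<And>z. z \<in> S \<Longrightarrow> z \<notin> I \<Longrightarrow> a - b \<le> f z"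
  shows "card S * a - card (S - I) * b \<le> sum f S"
proof -
  have "sum (\<lambda>z. - f z) S \<le> card S * (- a) + card (S - I) * b"
    using assms by (intro sum_le_split) (auto simp: algebra_simps)
  then show ?thesis by (simp add: sum_negf)
qed

text \<open>By Russo's formula the sum is the derivative of the mean in the density. The box lies
  inside the window of half side \<open>2 * k\<close> about any of its sites, and for an inner site
  the difference is beyond the cutoff, so monotonicity bounds the cost. Boundary sites are charged
  \<open>kiss + 1\<close> times \<rho>, the full range of the cost.\<close>

lemma lattice_mean_deriv_le:
  fixes \<rho> :: real and k t :: nat
  assumes p: "0 \<le> p" "p \<le> 1" and "0 \<le> \<rho>" "\<rho> < real t" "1 \<le> k"
  shows "(\<Sum>z\<in>lbox (0::real^'d) k. Ep p (lbox 0 k) (flip_diff z (cint \<rho>)))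
    \<le> (2 * real k) ^ CARD('d) * (lattice_cost TYPE('d) p \<rho> (2 * k) + (kiss TYPE('d) + 1) * \<rho> * (CARD('d) * t / k))"
proof -
  let ?K = "kiss TYPE('d)" and ?a = "lattice_cost TYPE('d) p \<rho> (2 * k)"
  have a: "- (?K * \<rho>) \<le> ?a"
    unfolding lattice_cost_def using assms by (intro Ep_flip_bounds) auto
  have t: "1 \<le> t" using assms by linarith
  have "(\<Sum>z\<in>lbox (0::real^'d) k. Ep p (lbox 0 k) (flip_diff z (cint \<rho>)))
     \<le> card (lbox (0::real^'d) k) * ?a + card (lbox (0::real^'d) k - linner k t) * ((?K + 1) * \<rho>)"
  proof (rule sum_le_split)
    fix z :: "real^'d" assume z: "z \<in> lbox 0 k" "z \<in> linner k t"
    have "lbox 0 k \<subseteq> lbox z (2 * k)"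
    proof
      fix x :: "real^'d" assume x: "x \<in> lbox 0 k"
      show "x \<in> lbox z (2 * k)"
      proof (rule lboxI)
        fix i
        show "x $ i \<in> \<int>" "z $ i - real (2 * k) \<le> x $ i" "x $ i < z $ i + real (2 * k)"
          using lboxD[OF x, of i] lboxD[OF z(1), of i] by auto
      qed
    qed
    then have "Ep p (lbox 0 k) (flip_diff z (cint \<rho>)) \<le> Ep p (lbox z (2 * k)) (flip_diff z (cint \<rho>))"
    proof (intro Ep_flip_mono0 p)
      fix x assume "x \<in> lbox z (2 * k) - lbox 0 k"
      then have "real t \<le> dist z x"
        using linner_lbox_subset[OF z(2)] lbox_lattice_pt by (intro lbox_far) auto
      then show "\<rho> < dist z x" using assms by linarith
    qed (use assms in auto)
    then show "Ep p (lbox 0 k) (flip_diff z (cint \<rho>)) \<le> ?a"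
      using Ep_flip_translate[of z p "2 * k" \<rho>] lbox_lattice_pt[OF z(1)] by simp
  next
    fix z :: "real^'d"
    have "Ep p (lbox 0 k) (flip_diff z (cint \<rho>)) \<le> \<rho>"
      using assms by (intro Ep_flip_bounds) auto
    then show "Ep p (lbox 0 k) (flip_diff z (cint \<rho>)) \<le> ?a + (?K + 1) * \<rho>"
      using a by (simp add: algebra_simps)
  qed simp
  also have "\<dots> \<le> (2 * real k) ^ CARD('d) * ?a + (2 * real k) ^ CARD('d) * (CARD('d) * t / k) * ((?K + 1) * \<rho>)"
    using card_lboundary[OF t assms(5), where 'd = 'd] assms kiss_ge_1[where 'd = 'd]
    by (intro add_mono[OF eq_refl] mult_right_mono) auto
  finally show ?thesis by (simp add: algebra_simps)
qed

text \<open>The companion bound: around an inner site the box contains the window of half side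
  \<open>t\<close> about that site.\<close>

lemma lattice_mean_deriv_ge:
  fixes \<rho> :: real and k t :: nat
  assumes p: "0 \<le> p" "p \<le> 1" and "0 \<le> \<rho>" "\<rho> < real t" "1 \<le> k"
  shows "(2 * real k) ^ CARD('d) * (lattice_cost TYPE('d) p \<rho> t - (kiss TYPE('d) + 1) * \<rho> * (CARD('d) * t / k))
    \<le> (\<Sum>z\<in>lbox (0::real^'d) k. Ep p (lbox 0 k) (flip_diff z (cint \<rho>)))"
proof -
  let ?K = "kiss TYPE('d)" and ?a = "lattice_cost TYPE('d) p \<rho> t"
  have a: "?a \<le> \<rho>"
    unfolding lattice_cost_def using assms by (intro Ep_flip_bounds) auto
  have t: "1 \<le> t" using assms by linarith
  have "(2 * real k) ^ CARD('d) * ?a - (2 * real k) ^ CARD('d) * (CARD('d) * t / k) * ((?K + 1) * \<rho>)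
    \<le> card (lbox (0::real^'d) k) * ?a - card (lbox (0::real^'d) k - linner k t) * ((?K + 1) * \<rho>)"
    using card_lboundary[OF t assms(5), where 'd = 'd] assms kiss_ge_1[where 'd = 'd]
    by (intro diff_mono[OF eq_refl] mult_right_mono) auto
  also have "\<dots> \<le> (\<Sum>z\<in>lbox (0::real^'d) k. Ep p (lbox 0 k) (flip_diff z (cint \<rho>)))"
  proof (rule sum_ge_split)
    fix z :: "real^'d" assume z: "z \<in> lbox 0 k" "z \<in> linner k t"
    have "Ep p (lbox z t) (flip_diff z (cint \<rho>)) \<le> Ep p (lbox 0 k) (flip_diff z (cint \<rho>))"
    proof (intro Ep_flip_mono0 p linner_lbox_subset[OF z(2)])
      fix x assume "x \<in> lbox 0 k - lbox z t"
      then have "real t \<le> dist z x"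
        using lbox_lattice_pt by (intro lbox_far) auto
      then show "\<rho> < dist z x" using assms by linarith
    qed (use assms in auto)
    then show "?a \<le> Ep p (lbox 0 k) (flip_diff z (cint \<rho>))"
      using Ep_flip_translate[of z p t \<rho>] lbox_lattice_pt[OF z(1)] by simp
  next
    fix z :: "real^'d"
    have "- (?K * \<rho>) \<le> Ep p (lbox 0 k) (flip_diff z (cint \<rho>))"
      using assms by (intro Ep_flip_bounds) auto
    then show "?a - (?K + 1) * \<rho> \<le> Ep p (lbox 0 k) (flip_diff z (cint \<rho>))"
      using a by (simp add: algebra_simps)
  qed simp
  finally show ?thesis by (simp add: algebra_simps)
qed

section \<open>Tilings by boxes and comparison of the functional with its tiles\<close>

definition tile_centers :: "nat \<Rightarrow> nat \<Rightarrow> (real^'d) set" where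
  "tile_centers m k = {c. \<forall>i. c $ i \<in> (\<lambda>j. (2 * real j + 1) * real k - real m * real k) ` {..<m}}"

lemma tile_centers_lattice_pt: "c \<in> tile_centers m k \<Longrightarrow> lattice_pt c"
proof -
  assume c: "c \<in> tile_centers m k"
  have "c $ i \<in> \<int>" for i
  proof -
    obtain j where "c $ i = (2 * real j + 1) * real k - real m * real k"
      using c by (auto simp: tile_centers_def image_iff)
    then show ?thesis by simp
  qed
  then show ?thesis by (simp add: lattice_pt_def)
qed

lemma finite_tile_centers [simp]: "finite (tile_centers m k)"
  unfolding tile_centers_def by (intro finite_coords_set) auto

lemma card_tile_centers: "1 \<le> k \<Longrightarrow> card (tile_centers m k :: (real^'d) set) = m ^ CARD('d)"
  unfolding tile_centers_def card_coords_set by (subst card_image) (auto simp: inj_on_def)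

lemma tiles_Union:
  assumes "1 \<le> k"
  shows "lbox (0::real^'d) (m * k) = (\<Union>c\<in>tile_centers m k. lbox c k)"
proof
  show "lbox (0::real^'d) (m * k) \<subseteq> (\<Union>c\<in>tile_centers m k. lbox c k)"
  proof
    fix x :: "real^'d" assume x: "x \<in> lbox 0 (m * k)"
    define j where "j i = nat \<lfloor>(x $ i + real m * real k) / (2 * real k)\<rfloor>" for i
    define c :: "real^'d" where "c = (\<chi> i. (2 * real (j i) + 1) * real k - real m * real k)"
    have xi: "x $ i \<in> \<int>" "- (real m * real k) \<le> x $ i" "x $ i < real m * real k" for i
      using x by (auto simp: lbox_def)
    have j: "real (j i) \<le> (x $ i + real m * real k) / (2 * real k)"
      "(x $ i + real m * real k) / (2 * real k) < real (j i) + 1" for i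
    proof -
      have "0 \<le> (x $ i + real m * real k) / (2 * real k)"
        using xi[of i] assms by (intro divide_nonneg_pos) auto
      then show "real (j i) \<le> (x $ i + real m * real k) / (2 * real k)"
        "(x $ i + real m * real k) / (2 * real k) < real (j i) + 1"
        unfolding j_def by linarith+
    qed
    have k: "0 < 2 * real k" using assms by simp
    have j1: "real (j i) * (2 * real k) \<le> x $ i + real m * real k" for i
      using j(1)[of i] k by (simp only: pos_le_divide_eq)
    have j2: "x $ i + real m * real k < (real (j i) + 1) * (2 * real k)" for i
      using j(2)[of i] k by (simp only: pos_divide_less_eq)
    have "j i < m" for i
    proof -
      have "real (j i) * (2 * real k) < real m * (2 * real k)"
        using j1[of i] xi(3)[of i] by linarith
      then show ?thesis using k by simp
    qed
    then have "c \<in> tile_centers m k"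
      by (auto simp: tile_centers_def c_def)
    moreover have "x \<in> lbox c k"
      using j1 j2 xi(1) by (auto simp: lbox_def c_def algebra_simps)
    ultimately show "x \<in> (\<Union>c\<in>tile_centers m k. lbox c k)" by blast
  qed
  show "(\<Union>c\<in>tile_centers m k. lbox c k) \<subseteq> lbox (0::real^'d) (m * k)"
  proof
    fix x :: "real^'d" assume "x \<in> (\<Union>c\<in>tile_centers m k. lbox c k)"
    then obtain c where c: "c \<in> tile_centers m k" "x \<in> lbox c k" by blast
    have "- (real m * real k) \<le> x $ i \<and> x $ i < real m * real k" for i
    proof -
      obtain j where j: "j < m" "c $ i = (2 * real j + 1) * real k - real m * real k"
        using c(1) by (auto simp: tile_centers_def)
      have "c $ i - real k \<le> x $ i" "x $ i < c $ i + real k"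
        using c(2) by (auto simp: lbox_def)
      moreover define q where "q = real j * real k"
      moreover have "0 \<le> q" by (simp add: q_def)
      moreover have "c $ i = 2 * q + real k - real m * real k"
        by (simp add: j(2) q_def algebra_simps)
      moreover have "q + real k \<le> real m * real k"
      proof -
        have "(real j + 1) * real k \<le> real m * real k"
          using j(1) by (intro mult_right_mono) auto
        then show ?thesis by (simp add: q_def algebra_simps)
      qed
      ultimately show ?thesis by linarith
    qed
    then show "x \<in> lbox 0 (m * k)"
      using c(2) by (auto simp: lbox_def)
  qed
qed

lemma tiles_disjoint:
  assumes "c \<in> tile_centers m k" "c' \<in> tile_centers m k" "c \<noteq> c'"
  shows "lbox c k \<inter> lbox c' k = {}"
proof (rule ccontr)
  assume "lbox c k \<inter> lbox c' k \<noteq> {}"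
  then obtain x where x: "x \<in> lbox c k" "x \<in> lbox c' k" by blast
  obtain i where i: "c $ i \<noteq> c' $ i"
    using assms(3) by (auto simp: vec_eq_iff)
  obtain j j' where j: "c $ i = (2 * real j + 1) * real k - real m * real k"
    "c' $ i = (2 * real j' + 1) * real k - real m * real k"
    using assms(1,2) unfolding tile_centers_def by blast
  have "\<bar>c $ i - c' $ i\<bar> < 2 * real k"
    using lboxD[OF x(1), of i] lboxD[OF x(2), of i] by linarith
  then have "\<bar>2 * real k * (real j - real j')\<bar> < 2 * real k"
    using j by (simp add: algebra_simps)
  then have "real k * \<bar>real j - real j'\<bar> < real k * 1"
    by (simp add: abs_mult)
  then have "\<bar>real j - real j'\<bar> < 1"
    using mult_less_cancel_left_pos[of "real k" _ 1] by (cases "k = 0") auto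
  then have "j = j'" by linarith
  then show False using i j by simp
qed

lemma cint_UN_le:
  assumes "finite C" "\<And>c. c \<in> C \<Longrightarrow> finite (B c)" "0 \<le> \<rho>"
  shows "cint \<rho> (\<Union>c\<in>C. B c) \<le> (\<Sum>c\<in>C. cint \<rho> (B c))"
  using assms(1,2)
proof (induction C rule: finite_induct)
  case (insert c C)
  then have "cint \<rho> (B c \<union> (\<Union>c\<in>C. B c)) \<le> cint \<rho> (B c) + cint \<rho> (\<Union>c\<in>C. B c)"
    using assms(3) by (intro cint_Un_le) auto
  then show ?case
    using insert by auto
qed simp

lemma cint_UN_ge:
  fixes B :: "'i \<Rightarrow> (real^'d) set"
  assumes "finite C" "\<And>c. c \<in> C \<Longrightarrow> finite (B c)" "0 \<le> \<rho>" "\<And>c. c \<in> C \<Longrightarrow> N c \<subseteq> B c"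
    and "\<And>c c' x y. c \<in> C \<Longrightarrow> c' \<in> C \<Longrightarrow> c \<noteq> c' \<Longrightarrow> x \<in> B c - N c \<Longrightarrow> y \<in> B c' \<Longrightarrow> \<rho> < dist x y"
  shows "(\<Sum>c\<in>C. cint \<rho> (B c)) - (kiss TYPE('d) + 1) * \<rho> * (\<Sum>c\<in>C. real (card (N c))) \<le> cint \<rho> (\<Union>c\<in>C. B c)"
  using assms(1,2,4,5)
proof (induction C rule: finite_induct)
  case (insert c C)
  have "cint \<rho> (B c) + cint \<rho> (\<Union>c\<in>C. B c) - (kiss TYPE('d) + 1) * \<rho> * card (N c) \<le> cint \<rho> (B c \<union> (\<Union>c\<in>C. B c))"
  proof (rule cint_Un_ge)
    show "\<rho> < dist x y" if "x \<in> B c - N c" "y \<in> (\<Union>c\<in>C. B c)" for x y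
      using that insert.prems(3)[of c _ x y] insert.hyps(2) by blast
  qed (use insert assms(3) in auto)
  moreover have "(\<Sum>c\<in>C. cint \<rho> (B c)) - (kiss TYPE('d) + 1) * \<rho> * (\<Sum>c\<in>C. real (card (N c))) \<le> cint \<rho> (\<Union>c\<in>C. B c)"
  proof (rule insert.IH)
    show "\<rho> < dist x y" if "c \<in> C" "c' \<in> C" "c \<noteq> c'" "x \<in> B c - N c" "y \<in> B c'" for c c' x y
      using insert.prems(3)[of c c' x y] that by simp
  qed (use insert.prems in auto)
  ultimately show ?case
    using insert(1,2) by (simp add: algebra_simps)
qed simp

text \<open>Outside this set, a point of the tile has its whole box of half side \<open>t\<close>
  inside the tile and is therefore at distance at least \<open>t\<close> from all lattice points of
  other tiles.\<close>

definition tile_boundary :: "nat \<Rightarrow> nat \<Rightarrow> real^'d \<Rightarrow> (real^'d) set" where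
  "tile_boundary k t c = (+) c ` (lbox 0 k - linner k t)"

lemma tile_boundary_far:
  assumes "lattice_pt c" "x \<in> lbox c k - tile_boundary k t c" "lattice_pt y" "y \<notin> lbox c k"
  shows "real t \<le> dist x y"
proof -
  obtain u where u: "x = c + u" "u \<in> lbox 0 k" "u \<in> linner k t"
    using assms(2) unfolding lbox_translate[OF assms(1)] tile_boundary_def by auto
  have "y \<notin> lbox x t"
  proof
    assume "y \<in> lbox x t"
    then have "y - c \<in> lbox u t"
      using assms(1) u by (auto simp: lbox_def lattice_pt_def algebra_simps)
    then have "y - c \<in> lbox 0 k"
      using linner_lbox_subset[OF u(3)] by blast
    then show False
      using assms(4) unfolding lbox_translate[OF assms(1)] by (force simp: image_iff)
  qed
  then show ?thesis
    using assms(3) by (intro lbox_far)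
qed

lemma finite_tile_boundary [simp]: "finite (tile_boundary k t c)"
  by (simp add: tile_boundary_def)

lemma tile_boundary_subset: "lattice_pt c \<Longrightarrow> tile_boundary k t c \<subseteq> lbox c k"
  using lbox_translate[of c k] by (auto simp: tile_boundary_def)

lemma card_tile_boundary: "card (tile_boundary k t (c::real^'d)) = card (lbox (0::real^'d) k - linner k t)"
  unfolding tile_boundary_def by (rule card_image) (simp add: inj_on_def)

lemma cint_tiles:
  fixes A :: "(real^'d) set"
  assumes "1 \<le> k" "A \<subseteq> lbox 0 (m * k)" "0 \<le> \<rho>" "\<rho> < real t"
  shows "cint \<rho> A \<le> (\<Sum>c\<in>tile_centers m k. cint \<rho> (A \<inter> lbox c k))"
    and "(\<Sum>c\<in>tile_centers m k. cint \<rho> (A \<inter> lbox c k))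
       - (kiss TYPE('d) + 1) * \<rho> * (\<Sum>c\<in>tile_centers m k. real (card (A \<inter> tile_boundary k t c))) \<le> cint \<rho> A"
proof -
  have fin: "finite A" using assms finite_lbox finite_subset by blast
  have A: "A = (\<Union>c\<in>tile_centers m k. A \<inter> lbox c k)"
    using assms(2) tiles_Union[OF assms(1), of m, where 'd = 'd] by auto
  have "cint \<rho> (\<Union>c\<in>tile_centers m k. A \<inter> lbox c k) \<le> (\<Sum>c\<in>tile_centers m k. cint \<rho> (A \<inter> lbox c k))"
    using fin assms by (intro cint_UN_le) auto
  then show "cint \<rho> A \<le> (\<Sum>c\<in>tile_centers m k. cint \<rho> (A \<inter> lbox c k))"
    using A by simp
  have "(\<Sum>c\<in>tile_centers m k. cint \<rho> (A \<inter> lbox c k))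
       - (kiss TYPE('d) + 1) * \<rho> * (\<Sum>c\<in>tile_centers m k. real (card (A \<inter> tile_boundary k t c)))
       \<le> cint \<rho> (\<Union>c\<in>tile_centers m k. A \<inter> lbox c k)"
  proof (rule cint_UN_ge)
    fix c c' x y assume c: "c \<in> tile_centers m k" "c' \<in> tile_centers m k" "c \<noteq> c'"
      "x \<in> A \<inter> lbox c k - A \<inter> tile_boundary k t c" "y \<in> A \<inter> lbox c' k"
    then have "y \<notin> lbox c k" using tiles_disjoint[OF c(1-3)] by auto
    then have "real t \<le> dist x y"
      using c tile_centers_lattice_pt[OF c(1)] lbox_lattice_pt[of y c' k]
      by (intro tile_boundary_far[of c]) auto
    then show "\<rho> < dist x y" using assms by linarith
  next
    show "A \<inter> tile_boundary k t c \<subseteq> A \<inter> lbox c k" if "c \<in> tile_centers m k" for c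
      using tile_boundary_subset[OF tile_centers_lattice_pt[OF that]] by blast
  qed (use fin assms in auto)
  then show "(\<Sum>c\<in>tile_centers m k. cint \<rho> (A \<inter> lbox c k))
       - (kiss TYPE('d) + 1) * \<rho> * (\<Sum>c\<in>tile_centers m k. real (card (A \<inter> tile_boundary k t c))) \<le> cint \<rho> A"
    using A by simp
qed

text \<open>Splitting a box into tiles can only add components, and it adds at most a multiple of
  the number of boundary points. Their mean number per tile is \<open>p\<close> times the size of
  the boundary, so the error term keeps the factor \<open>p\<close>.\<close>

lemma lattice_mean_tiles:
  assumes p: "0 \<le> p" "p \<le> 1" and "1 \<le> k" "0 \<le> \<rho>" "\<rho> < real t"
  shows "lattice_mean TYPE('d::finite) \<rho> p (m * k) \<le> real m ^ CARD('d) * lattice_mean TYPE('d) \<rho> p k"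
    and "real m ^ CARD('d) * (lattice_mean TYPE('d) \<rho> p k
        - (kiss TYPE('d) + 1) * \<rho> * (p * ((2 * real k) ^ CARD('d) * (CARD('d) * t / k)))) \<le> lattice_mean TYPE('d) \<rho> p (m * k)"
proof -
  let ?L = "lbox (0::real^'d) (m * k)" and ?C = "tile_centers m k :: (real^'d) set"
  have sub: "lbox c k \<subseteq> ?L" if "c \<in> ?C" for c
    using that tiles_Union[OF assms(3)] by blast
  have E: "Ep p ?L (\<lambda>A. \<Sum>c\<in>?C. cint \<rho> (A \<inter> lbox c k)) = real m ^ CARD('d) * lattice_mean TYPE('d) \<rho> p k"
  proof -
    have "Ep p ?L (\<lambda>A. cint \<rho> (A \<inter> lbox c k)) = lattice_mean TYPE('d) \<rho> p k" if "c \<in> ?C" for c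
      using Ep_restrict[OF finite_lbox sub[OF that], of p "cint \<rho>"]
        Ep_cint_translate[OF tile_centers_lattice_pt[OF that]] by simp
    then show ?thesis
      using card_tile_centers[OF assms(3), of m, where 'd = 'd] by (simp add: Ep_sum)
  qed
  have "lattice_mean TYPE('d) \<rho> p (m * k) \<le> Ep p ?L (\<lambda>A. \<Sum>c\<in>?C. cint \<rho> (A \<inter> lbox c k))"
    unfolding lattice_mean_def using assms cint_tiles(1) by (intro Ep_mono p) blast
  then show "lattice_mean TYPE('d) \<rho> p (m * k) \<le> real m ^ CARD('d) * lattice_mean TYPE('d) \<rho> p k"
    using E by simp
  let ?K = "(kiss TYPE('d) + 1) * \<rho>"
  have K: "0 \<le> ?K" using kiss_ge_1[where 'd = 'd] assms by simp
  have B: "Ep p ?L (\<lambda>A. ?K * (\<Sum>c\<in>?C. real (card (A \<inter> tile_boundary k t c))))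
      \<le> ?K * (real m ^ CARD('d) * (p * ((2 * real k) ^ CARD('d) * (CARD('d) * t / k))))"
  proof -
    have "Ep p ?L (\<lambda>A. real (card (A \<inter> tile_boundary k t c))) = p * card (tile_boundary k t c)" if "c \<in> ?C" for c
      using Ep_restrict[of ?L "tile_boundary k t c" p "\<lambda>A. real (card A)"] sub[OF that]
        tile_boundary_subset[OF tile_centers_lattice_pt[OF that]] Ep_card[of "tile_boundary k t c" p]
      by force
    then have "Ep p ?L (\<lambda>A. \<Sum>c\<in>?C. real (card (A \<inter> tile_boundary k t c)))
        = real m ^ CARD('d) * (p * card (lbox (0::real^'d) k - linner k t))"
      using card_tile_centers[OF assms(3), of m, where 'd = 'd] by (simp add: Ep_sum card_tile_boundary)
    also have "\<dots> \<le> real m ^ CARD('d) * (p * ((2 * real k) ^ CARD('d) * (CARD('d) * t / k)))"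
      using assms by (intro mult_left_mono card_lboundary) auto
    finally show ?thesis
      unfolding Ep_cmult using K by (intro mult_left_mono) auto
  qed
  have "Ep p ?L (\<lambda>A. (\<Sum>c\<in>?C. cint \<rho> (A \<inter> lbox c k)) - ?K * (\<Sum>c\<in>?C. real (card (A \<inter> tile_boundary k t c))))
     \<le> lattice_mean TYPE('d) \<rho> p (m * k)"
    unfolding lattice_mean_def using assms cint_tiles(2) by (intro Ep_mono p) blast
  then show "real m ^ CARD('d) * (lattice_mean TYPE('d) \<rho> p k
        - (kiss TYPE('d) + 1) * \<rho> * (p * ((2 * real k) ^ CARD('d) * (CARD('d) * t / k)))) \<le> lattice_mean TYPE('d) \<rho> p (m * k)"
    using E B by (simp only: Ep_diff) (simp add: algebra_simps)
qed

text \<open>The means per volume of the boxes of half sides \<open>k\<close> and \<open>D k\<close> differ by a boundary term for every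
  density, so the mean value theorem provides a density at which their derivatives, which are
  averages of add-one costs, are close.\<close>

lemma rate_lattice:
  assumes p: "0 \<le> p\<^sub>1" "p\<^sub>1 < p\<^sub>2" "p\<^sub>2 \<le> 1" and \<rho>: "0 \<le> \<rho>" "\<rho> < real t" "\<rho> < real D" and k: "1 \<le> k"
  shows "\<exists>p. p\<^sub>1 < p \<and> p < p\<^sub>2 \<and> lattice_cost TYPE('d::finite) p \<rho> D - lattice_cost TYPE('d) p \<rho> (2 * k)
    \<le> (kiss TYPE('d) + 1) * \<rho> * (CARD('d) * t / k) * (2 + p\<^sub>1 / (p\<^sub>2 - p\<^sub>1))"
proof -
  let ?n = "CARD('d)" and ?G = "lattice_mean TYPE('d) \<rho>" and ?K = "(kiss TYPE('d) + 1) * \<rho>"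
  let ?dG = "\<lambda>p k. \<Sum>z\<in>lbox (0::real^'d) k. Ep p (lbox 0 k) (flip_diff z (cint \<rho>))"
  have D: "1 \<le> D" "1 \<le> t" using \<rho> by linarith+
  have K: "0 \<le> ?K" using kiss_ge_1[where 'd = 'd] \<rho> by simp
  define v where "v = (2 * real k) ^ ?n"
  define w where "w = (2 * real (D * k)) ^ ?n"
  have v: "0 < v" using k by (simp add: v_def)
  have wv: "w = real D ^ ?n * v" by (simp add: v_def w_def power_mult_distrib)
  have w: "0 < w" using v D by (simp add: wv)
  define H where "H p = ?G p (D * k) / w - ?G p k / v" for p
  have H': "(H has_real_derivative (?dG p (D * k) / w - ?dG p k / v)) (at p)" for p
    unfolding H_def by (intro DERIV_diff DERIV_cdivide lattice_mean_deriv)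
  obtain p where p12: "p\<^sub>1 < p" "p < p\<^sub>2" and mvt: "H p\<^sub>2 - H p\<^sub>1 = (p\<^sub>2 - p\<^sub>1) * (?dG p (D * k) / w - ?dG p k / v)"
    using MVT2[OF p(2), of H "\<lambda>p. ?dG p (D * k) / w - ?dG p k / v"] H' by blast
  have pp: "0 \<le> p" "p \<le> 1" using p12 p by auto
  \<comment> \<open>Subadditivity is free of error, so only the lower end of the interval of
    densities pays a boundary term. That term carries the factor \<open>p\<^sub>1\<close>, whence
    the ratio \<open>p\<^sub>1 / (p\<^sub>2 - p\<^sub>1)\<close> in the bound.\<close>
  have H2: "H p\<^sub>2 \<le> 0"
  proof -
    have "?G p\<^sub>2 (D * k) \<le> real D ^ ?n * ?G p\<^sub>2 k"
      using p k \<rho> by (intro lattice_mean_tiles(1)) auto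
    then have "?G p\<^sub>2 (D * k) / w \<le> real D ^ ?n * ?G p\<^sub>2 k / w"
      using w by (intro divide_right_mono) auto
    then show ?thesis
      using D v by (simp add: H_def wv)
  qed
  have H1: "- H p\<^sub>1 \<le> ?K * (p\<^sub>1 * (?n * t / k))"
  proof -
    have "real D ^ ?n * (?G p\<^sub>1 k - ?K * (p\<^sub>1 * (v * (?n * t / k)))) \<le> ?G p\<^sub>1 (D * k)"
      unfolding v_def using p k \<rho> by (intro lattice_mean_tiles(2)) auto
    then have "real D ^ ?n * (?G p\<^sub>1 k - ?K * (p\<^sub>1 * (v * (?n * t / k)))) / w \<le> ?G p\<^sub>1 (D * k) / w"
      using w by (intro divide_right_mono) auto
    moreover have "real D ^ ?n * (?G p\<^sub>1 k - ?K * (p\<^sub>1 * (v * (?n * t / k)))) / w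
        = ?G p\<^sub>1 k / v - ?K * (p\<^sub>1 * (?n * t / k))"
      using D v by (simp add: wv diff_divide_distrib)
    ultimately show ?thesis by (simp add: H_def)
  qed
  \<comment> \<open>In the box of half side \<open>D * k\<close> the margin is taken equal to the
    window \<open>D\<close>; relative to that box it is only \<open>1 / k\<close>.\<close>
  have lo: "lattice_cost TYPE('d) p \<rho> D - ?K * (?n * t / k) \<le> ?dG p (D * k) / w"
  proof -
    have "w * (lattice_cost TYPE('d) p \<rho> D - ?K * (?n * D / real (D * k))) \<le> ?dG p (D * k)"
      unfolding w_def using pp \<rho> D k by (intro lattice_mean_deriv_ge) auto
    then have "lattice_cost TYPE('d) p \<rho> D - ?K * (?n * D / real (D * k)) \<le> ?dG p (D * k) / w"
      using w by (simp only: pos_le_divide_eq mult.commute)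
    moreover have "?K * (?n * D / real (D * k)) \<le> ?K * (?n * t / k)"
      using K D k by (intro mult_left_mono) (auto simp: field_simps)
    ultimately show ?thesis by linarith
  qed
  have hi: "?dG p k / v \<le> lattice_cost TYPE('d) p \<rho> (2 * k) + ?K * (?n * t / k)"
  proof -
    have "?dG p k \<le> v * (lattice_cost TYPE('d) p \<rho> (2 * k) + ?K * (?n * t / k))"
      unfolding v_def using pp \<rho> k by (intro lattice_mean_deriv_le) auto
    then show ?thesis
      using v by (simp only: pos_divide_le_eq mult.commute)
  qed
  have "?dG p (D * k) / w - ?dG p k / v = (H p\<^sub>2 - H p\<^sub>1) / (p\<^sub>2 - p\<^sub>1)"
    using mvt p by simp
  also have "\<dots> \<le> ?K * (p\<^sub>1 * (?n * t / k)) / (p\<^sub>2 - p\<^sub>1)"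
    using H1 H2 p by (intro divide_right_mono) auto
  finally have diff: "?dG p (D * k) / w - ?dG p k / v \<le> ?K * (p\<^sub>1 * (?n * t / k)) / (p\<^sub>2 - p\<^sub>1)" .
  have arith: "a - b \<le> 2 * X + Y" if "a - X \<le> u" "v \<le> b + X" "u - v \<le> Y" for a b u v X Y :: real
    using that by linarith
  have "lattice_cost TYPE('d) p \<rho> D - lattice_cost TYPE('d) p \<rho> (2 * k)
      \<le> 2 * (?K * (?n * t / k)) + ?K * (p\<^sub>1 * (?n * t / k)) / (p\<^sub>2 - p\<^sub>1)"
    by (rule arith[OF lo hi diff])
  also have "\<dots> = ?K * (?n * t / k) * (2 + p\<^sub>1 / (p\<^sub>2 - p\<^sub>1))"
    unfolding distrib_left by (simp add: mult_ac)
  finally show ?thesis using p12 by blast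
qed

lemma lattice_mean_increment_lattice:
  assumes p: "0 \<le> p\<^sub>1" "p\<^sub>1 < p\<^sub>2" "p\<^sub>2 \<le> 1" and \<rho>: "0 \<le> \<rho>" "\<rho> < real t" and k: "1 \<le> k"
  shows "\<exists>p. p\<^sub>1 < p \<and> p < p\<^sub>2 \<and>
    (lattice_mean TYPE('d::finite) \<rho> p\<^sub>2 k - lattice_mean TYPE('d) \<rho> p\<^sub>1 k) \<le> (p\<^sub>2 - p\<^sub>1) * ((2 * real k) ^ CARD('d) *
      (lattice_cost TYPE('d) p \<rho> (2 * k) + (kiss TYPE('d) + 1) * \<rho> * (CARD('d) * t / k)))"
proof -
  let ?dG = "\<lambda>p. \<Sum>z\<in>lbox (0::real^'d) k. Ep p (lbox 0 k) (flip_diff z (cint \<rho>))"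
  obtain p where p12: "p\<^sub>1 < p" "p < p\<^sub>2"
    and mvt: "lattice_mean TYPE('d) \<rho> p\<^sub>2 k - lattice_mean TYPE('d) \<rho> p\<^sub>1 k = (p\<^sub>2 - p\<^sub>1) * ?dG p"
    using MVT2[OF p(2), of "\<lambda>p. lattice_mean TYPE('d) \<rho> p k" ?dG] lattice_mean_deriv by blast
  have "?dG p \<le> (2 * real k) ^ CARD('d) *
      (lattice_cost TYPE('d) p \<rho> (2 * k) + (kiss TYPE('d) + 1) * \<rho> * (CARD('d) * t / k))"
    using p p12 \<rho> k by (intro lattice_mean_deriv_le) auto
  then show ?thesis
    using p12 mvt p by (intro exI[of _ p]) (auto intro!: mult_left_mono)
qed

lemma card_lattice_ball:
  fixes z :: "real^'d"
  assumes "0 \<le> r" "lattice_pt z" "\<And>x. x \<in> \<Lambda> \<Longrightarrow> lattice_pt x"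
  shows "real (card {x \<in> \<Lambda>. dist z x \<le> r}) \<le> (2 * r + 1) ^ CARD('d)"
proof -
  let ?S = "of_int ` {- \<lfloor>r\<rfloor>..\<lfloor>r\<rfloor>} :: real set"
  have "(\<lambda>x. x - z) ` {x \<in> \<Lambda>. dist z x \<le> r} \<subseteq> {x. \<forall>i. x $ i \<in> ?S}"
  proof (clarsimp)
    fix x i assume x: "x \<in> \<Lambda>" "dist z x \<le> r"
    have "x $ i \<in> \<int>" "z $ i \<in> \<int>"
      using assms x by (auto simp: lattice_pt_def)
    then obtain j where j: "x $ i - z $ i = of_int j"
      by (metis Ints_cases Ints_diff)
    have "\<bar>(x - z) $ i\<bar> \<le> r"
      using component_le_norm_cart[of "x - z" i] x by (simp add: dist_norm norm_minus_commute)
    then have "\<bar>real_of_int j\<bar> \<le> r" using j by simp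
    then have "- \<lfloor>r\<rfloor> \<le> j" "j \<le> \<lfloor>r\<rfloor>" by linarith+
    then show "x $ i - z $ i \<in> ?S" using j by auto
  qed
  then have "card ((\<lambda>x. x - z) ` {x \<in> \<Lambda>. dist z x \<le> r}) \<le> card {x::real^'d. \<forall>i. x $ i \<in> ?S}"
    by (intro card_mono finite_coords_set) auto
  also have "\<dots> = nat (2 * \<lfloor>r\<rfloor> + 1) ^ CARD('d)"
    unfolding card_coords_set using assms by (subst card_image) (auto simp: inj_on_def)
  finally have "real (card {x \<in> \<Lambda>. dist z x \<le> r}) \<le> real (nat (2 * \<lfloor>r\<rfloor> + 1) ^ CARD('d))"
    by (subst (asm) card_image) (auto simp: inj_on_def simp del: of_nat_power)
  also have "\<dots> \<le> (2 * r + 1) ^ CARD('d)"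
    unfolding of_nat_power using assms by (intro power_mono) auto
  finally show ?thesis .
qed

text \<open>At low density a new point has on average at most half a neighbour within
  \<open>r\<close>. At each radius up to \<open>r\<close> it adds one component and merges at most
  as many as it has neighbours, which is a mean gain of at least \<open>r / 2\<close> in the
  integral.\<close>

lemma Ep_cint_ge:
  fixes \<Lambda> :: "(real^'d) set" and p r \<rho> :: real
  assumes p: "0 \<le> p" "p \<le> 1" and "finite \<Lambda>" "\<And>x. x \<in> \<Lambda> \<Longrightarrow> lattice_pt x"
    and "0 \<le> r" "r \<le> \<rho>" "p * (2 * r + 1) ^ CARD('d) \<le> 1 / 2"
  shows "r * (p * card \<Lambda>) / 2 \<le> Ep p \<Lambda> (cint \<rho>)"
proof -
  have "r * (p * card \<Lambda>) / 2 \<le> Ep p \<Lambda> (cint r)"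
    using assms(3,4)
  proof (induction \<Lambda> rule: finite_induct)
    case (insert z \<Lambda>)
    let ?N = "{x \<in> \<Lambda>. dist z x \<le> r}"
    have EN: "Ep p \<Lambda> (\<lambda>A. real (card {x \<in> A. dist z x \<le> r})) \<le> 1 / 2"
    proof -
      have "Ep p \<Lambda> (\<lambda>A. real (card {x \<in> A. dist z x \<le> r})) = Ep p \<Lambda> (\<lambda>A. real (card (A \<inter> ?N)))"
        by (intro Ep_cong arg_cong[where f = real] arg_cong[where f = card]) auto
      also have "\<dots> = p * card ?N"
        using insert(1) Ep_restrict[of \<Lambda> ?N p "\<lambda>A. real (card A)"] Ep_card[of ?N p] by auto
      also have "\<dots> \<le> p * (2 * r + 1) ^ CARD('d)"
        using insert.prems assms by (intro mult_left_mono card_lattice_ball) auto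
      finally show ?thesis using assms by simp
    qed
    have "Ep p \<Lambda> (cint r) + r * (1 - Ep p \<Lambda> (\<lambda>A. real (card {x \<in> A. dist z x \<le> r})))
        = Ep p \<Lambda> (\<lambda>A. cint r A + r * (1 - real (card {x \<in> A. dist z x \<le> r})))"
      using insert(1) by (simp add: Ep_add Ep_cmult Ep_diff)
    also have "\<dots> \<le> Ep p \<Lambda> (\<lambda>A. cint r (insert z A))"
      using insert finite_subset assms by (intro Ep_mono p cint_insert_ge_local) auto
    finally have "Ep p \<Lambda> (cint r) + r * (1 - Ep p \<Lambda> (\<lambda>A. real (card {x \<in> A. dist z x \<le> r})))
        \<le> Ep p \<Lambda> (\<lambda>A. cint r (insert z A))" .
    moreover have "r * (1 / 2) \<le> r * (1 - Ep p \<Lambda> (\<lambda>A. real (card {x \<in> A. dist z x \<le> r})))"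
      using EN assms(5) by (intro mult_left_mono) auto
    ultimately have "Ep p \<Lambda> (cint r) + r * (1 / 2) \<le> Ep p \<Lambda> (\<lambda>A. cint r (insert z A))"
      by linarith
    then have "p * (Ep p \<Lambda> (cint r) + r * (1 / 2)) + (1 - p) * Ep p \<Lambda> (cint r) \<le> Ep p (insert z \<Lambda>) (cint r)"
      using insert p by (simp add: Ep_insert mult_left_mono)
    then show ?case
      using insert by (simp add: algebra_simps)
  qed simp
  also have "\<dots> \<le> Ep p \<Lambda> (cint \<rho>)"
    using assms finite_subset by (intro Ep_mono p cint_mono) auto
  finally show ?thesis .
qed

section \<open>Discretisation of the Poisson process\<close>

definition Qbox :: "real \<Rightarrow> (real^'d) set" where
  "Qbox K = {x. \<forall>i. - K \<le> x $ i \<and> x $ i < K}"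

definition lcell :: "real \<Rightarrow> real^'d \<Rightarrow> (real^'d) set" where
  "lcell \<eta> z = {x. \<forall>i. \<eta> * z $ i \<le> x $ i \<and> x $ i < \<eta> * z $ i + \<eta>}"

definition lround :: "real \<Rightarrow> real^'d \<Rightarrow> real^'d" where
  "lround \<eta> x = (\<chi> i. of_int \<lfloor>x $ i / \<eta>\<rfloor>)"

text \<open>The probability that a cell of side \<open>\<eta>\<close> contains a Poisson point.\<close>

definition pocc :: "'d::finite itself \<Rightarrow> real \<Rightarrow> real" where
  "pocc _ \<eta> = 1 - exp (- (\<eta> ^ CARD('d)))"

lemma lround_lattice_pt: "lattice_pt (lround \<eta> x)"
  by (simp add: lattice_pt_def lround_def)

lemma lround_eq_iff:
  assumes "0 < \<eta>" "lattice_pt z"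
  shows "lround \<eta> x = z \<longleftrightarrow> x \<in> lcell \<eta> z"
proof -
  have "of_int \<lfloor>x $ i / \<eta>\<rfloor> = z $ i \<longleftrightarrow> \<eta> * z $ i \<le> x $ i \<and> x $ i < \<eta> * z $ i + \<eta>" for i
  proof -
    obtain j where j: "z $ i = of_int j"
      using assms(2) unfolding lattice_pt_def by (meson Ints_cases)
    have "\<lfloor>x $ i / \<eta>\<rfloor> = j \<longleftrightarrow> of_int j \<le> x $ i / \<eta> \<and> x $ i / \<eta> < of_int j + 1"
      by (rule floor_eq_iff)
    also have "\<dots> \<longleftrightarrow> \<eta> * of_int j \<le> x $ i \<and> x $ i < \<eta> * of_int j + \<eta>"
      using assms(1) by (simp add: pos_le_divide_eq pos_divide_less_eq algebra_simps)
    finally show ?thesis by (simp add: j)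
  qed
  then show ?thesis
    by (simp add: lround_def vec_eq_iff lcell_def)
qed

lemma lround_mem_lcell: "0 < \<eta> \<Longrightarrow> x \<in> lcell \<eta> (lround \<eta> x)"
  using lround_eq_iff lround_lattice_pt by blast

lemma lround_lbox_iff:
  assumes "0 < \<eta>"
  shows "lround \<eta> x \<in> lbox 0 k \<longleftrightarrow> x \<in> Qbox (\<eta> * real k)"
proof -
  have "- real k \<le> real_of_int \<lfloor>x $ i / \<eta>\<rfloor> \<and> real_of_int \<lfloor>x $ i / \<eta>\<rfloor> < real k
      \<longleftrightarrow> - (\<eta> * real k) \<le> x $ i \<and> x $ i < \<eta> * real k" for i
  proof -
    have "of_int (- int k) \<le> real_of_int \<lfloor>x $ i / \<eta>\<rfloor> \<longleftrightarrow> of_int (- int k) \<le> x $ i / \<eta>"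
      by (simp only: of_int_le_iff le_floor_iff)
    moreover have "real_of_int \<lfloor>x $ i / \<eta>\<rfloor> < of_int (int k) \<longleftrightarrow> x $ i / \<eta> < of_int (int k)"
      by (simp only: of_int_less_iff floor_less_iff)
    ultimately show ?thesis
      using assms by (simp add: pos_le_divide_eq pos_divide_less_eq mult.commute)
  qed
  then show ?thesis
    by (simp add: lbox_def lround_def Qbox_def)
qed

text \<open>Each coordinate is rounded down by less than \<eta>, so differences of coordinates
  change by at most \<eta>, and the sum of the coordinate errors bounds the norm.\<close>

lemma lround_dist:
  fixes \<eta> :: real
  assumes "0 < \<eta>"
  shows "\<bar>\<eta> * dist (lround \<eta> x) (lround \<eta> y) - dist x (y::real^'d)\<bar> \<le> CARD('d) * \<eta>"
proof -
  let ?u = "\<eta> *\<^sub>R (lround \<eta> x - lround \<eta> y)" and ?v = "x - y"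
  have "\<bar>(?u - ?v) $ i\<bar> \<le> \<eta>" for i
    using lround_mem_lcell[OF assms, of x] lround_mem_lcell[OF assms, of y]
    unfolding lcell_def mem_Collect_eq by (auto simp: algebra_simps abs_le_iff dest!: spec[of _ i])
  then have "(\<Sum>i\<in>UNIV. \<bar>(?u - ?v) $ i\<bar>) \<le> (\<Sum>i\<in>(UNIV::'d set). \<eta>)"
    by (intro sum_mono) auto
  then have "norm (?u - ?v) \<le> CARD('d) * \<eta>"
    using norm_le_l1_cart[of "?u - ?v"] by simp
  moreover have "\<bar>norm ?u - norm ?v\<bar> \<le> norm (?u - ?v)"
    by (rule norm_triangle_ineq3)
  ultimately show ?thesis
    using assms by (simp add: dist_norm)
qed

lemma cint_lround:
  fixes V :: "(real^'d) set" and \<eta> \<rho> :: real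
  assumes "finite V" "0 < \<eta>" "0 \<le> \<rho>"
  shows "\<bar>cint \<rho> V - \<eta> * cint (\<rho> / \<eta>) (lround \<eta> ` V)\<bar> \<le> CARD('d) * \<eta> * card V"
  using lround_dist[OF assms(2)] assms
  by (intro cint_map_stable) (auto simp: abs_le_iff algebra_simps)

lemma Qbox_borel [measurable]: "Qbox K \<in> sets borel"
proof -
  have "Qbox K = (\<Inter>i. {x::real^'d. - K \<le> x $ i} \<inter> {x. x $ i < K})"
    by (auto simp: Qbox_def)
  also have "\<dots> \<in> sets borel" by measurable
  finally show ?thesis .
qed

lemma lcell_borel [measurable]: "lcell \<eta> (z::real^'d) \<in> sets borel"
proof -
  have "lcell \<eta> z = (\<Inter>i. {x::real^'d. \<eta> * z $ i \<le> x $ i} \<inter> {x. x $ i < \<eta> * z $ i + \<eta>})"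
    by (auto simp: lcell_def)
  also have "\<dots> \<in> sets borel" by measurable
  finally show ?thesis .
qed

lemma lcell_between:
  "box (\<eta> *\<^sub>R z) (\<eta> *\<^sub>R z + (\<chi> i. \<eta>)) \<subseteq> lcell \<eta> z" "lcell \<eta> z \<subseteq> cbox (\<eta> *\<^sub>R z) (\<eta> *\<^sub>R z + (\<chi> i. \<eta>))"
  by (auto simp: lcell_def mem_box_cart less_imp_le)

lemma Qbox_subset_cbox: "Qbox K \<subseteq> cbox (\<chi> i. - K) (\<chi> i. K)"
  by (auto simp: Qbox_def mem_box_cart less_imp_le)

lemma bounded_Qbox [simp]: "bounded (Qbox K)"
  using Qbox_subset_cbox bounded_cbox bounded_subset by blast

lemma bounded_lcell [simp]: "bounded (lcell \<eta> z)"
  using lcell_between(2) bounded_cbox bounded_subset by blast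

lemma measure_lcell:
  assumes "0 < \<eta>"
  shows "measure lborel (lcell \<eta> (z::real^'d)) = \<eta> ^ CARD('d)"
proof -
  let ?a = "\<eta> *\<^sub>R z" and ?b = "\<eta> *\<^sub>R z + (\<chi> i. \<eta>)"
  have ne: "cbox ?a ?b \<noteq> {}"
    using assms by (auto simp: interval_ne_empty_cart less_imp_le)
  have c: "measure lborel (cbox ?a ?b) = \<eta> ^ CARD('d)"
    using content_cbox_cart[OF ne] by simp
  have "measure lborel (box ?a ?b) = measure lborel (cbox ?a ?b)"
    by (simp add: measure_lborel_box_eq measure_lborel_cbox_eq)
  moreover have "measure lborel (box ?a ?b) \<le> measure lborel (lcell \<eta> z)"
    using emeasure_bounded_finite[OF bounded_lcell] by (intro measure_mono_fmeasurable lcell_between) (auto simp: fmeasurable_def)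
  moreover have "measure lborel (lcell \<eta> z) \<le> measure lborel (cbox ?a ?b)"
    using emeasure_lborel_cbox_finite by (intro measure_mono_fmeasurable lcell_between) (auto simp: fmeasurable_def)
  ultimately show ?thesis using c by linarith
qed

lemma pocc_bounds:
  assumes "0 \<le> \<eta>"
  shows "0 \<le> pocc TYPE('d::finite) \<eta>" "pocc TYPE('d) \<eta> < 1" "pocc TYPE('d) \<eta> \<le> \<eta> ^ CARD('d)"
  using assms exp_ge_add_one_self[of "- (\<eta> ^ CARD('d))"] by (simp_all add: pocc_def)

lemma pocc_ge_half:
  assumes "0 \<le> \<eta>" "\<eta> \<le> 1"
  shows "\<eta> ^ CARD('d::finite) / 2 \<le> pocc TYPE('d) \<eta>"
proof -
  let ?x = "\<eta> ^ CARD('d)"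
  have x: "0 \<le> ?x" "?x \<le> 1" using assms by (auto intro: power_le_one)
  have "exp (- ?x) = 1 / exp ?x" by (simp add: exp_minus inverse_eq_divide)
  also have "\<dots> \<le> 1 / (1 + ?x)"
    using x exp_ge_add_one_self[of ?x] by (intro divide_left_mono) auto
  also have "\<dots> \<le> 1 - ?x / 2"
    using x by (simp add: field_simps) (metis mult_left_le power2_eq_square)
  finally show ?thesis by (simp add: pocc_def)
qed

text \<open>An upper bound, not the exact value, for the second moment of the number of points in
  \<open>Qbox K\<close>, whose mean is \<open>(2 * K) ^ CARD('d)\<close>.\<close>

definition second_moment :: "'d::finite itself \<Rightarrow> real \<Rightarrow> real" where
  "second_moment _ K = ((2 * K) ^ CARD('d) + 1)\<^sup>2"

section \<open>Poisson points and the random set of occupied cells\<close>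

locale unit_poisson =
  fixes M :: "'w measure" and P :: "'w \<Rightarrow> (real^'d) set"
  assumes pp: "poisson_process_1 M P"
begin

sublocale prob_space M
  using pp by (simp add: poisson_process_1_def)

lemma finite_pts: "w \<in> space M \<Longrightarrow> bounded B \<Longrightarrow> finite (P w \<inter> B)"
  using pp by (simp add: poisson_process_1_def)

lemma count_measurable:
  "B \<in> sets borel \<Longrightarrow> bounded B \<Longrightarrow> (\<lambda>w. card (P w \<inter> B)) \<in> measurable M (count_space UNIV)"
  using pp by (simp add: poisson_process_1_def)

lemma count_zero_prob:
  assumes "B \<in> sets borel" "bounded B"
  shows "prob {w \<in> space M. card (P w \<inter> B) = 0} = exp (- measure lborel B)"
proof -
  have "prob {w \<in> space M. card (P w \<inter> B) = k} = measure lborel B ^ k / fact k * exp (- measure lborel B)" for k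
    using pp assms unfolding poisson_process_1_def sets_lborel by blast
  from this[of 0] show ?thesis by simp
qed

lemma counts_indep:
  fixes B :: "nat \<Rightarrow> (real^'d) set"
  assumes "finite I" "\<And>i. i \<in> I \<Longrightarrow> B i \<in> sets borel \<and> bounded (B i)" "disjoint_family_on B I"
  shows "indep_vars (\<lambda>_. count_space UNIV) (\<lambda>i w. card (P w \<inter> B i)) I"
  using pp[unfolded poisson_process_1_def, THEN conjunct2, THEN conjunct2, THEN conjunct2, rule_format,
    OF assms(1) _ assms(3)] assms(2) by (simp add: sets_lborel)

definition lpts :: "real \<Rightarrow> (real^'d) set \<Rightarrow> 'w \<Rightarrow> (real^'d) set" where
  "lpts \<eta> B w = lround \<eta> ` (P w \<inter> B)"

lemma lpts_subset: "0 < \<eta> \<Longrightarrow> B \<subseteq> Qbox (\<eta> * real k) \<Longrightarrow> lpts \<eta> B w \<subseteq> lbox 0 k"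
  using lround_lbox_iff by (fastforce simp: lpts_def)

lemma mem_lpts_iff:
  assumes "0 < \<eta>" "lattice_pt z" "w \<in> space M" "bounded B"
  shows "z \<in> lpts \<eta> B w \<longleftrightarrow> 0 < card (P w \<inter> (B \<inter> lcell \<eta> z))"
proof -
  have "finite (P w \<inter> (B \<inter> lcell \<eta> z))"
    using assms by (intro finite_pts bounded_Int) auto
  then have "0 < card (P w \<inter> (B \<inter> lcell \<eta> z)) \<longleftrightarrow> P w \<inter> (B \<inter> lcell \<eta> z) \<noteq> {}"
    by (simp add: card_gt_0_iff)
  also have "\<dots> \<longleftrightarrow> (\<exists>x\<in>P w \<inter> B. lround \<eta> x = z)"
    by (auto simp: lround_eq_iff[OF assms(1,2)])
  also have "\<dots> \<longleftrightarrow> z \<in> lpts \<eta> B w"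
    by (auto simp: lpts_def)
  finally show ?thesis by simp
qed

text \<open>Finitely many cell counts decide the set of occupied cells. This yields measurability
  and, through independence over disjoint cells, the law of that set.\<close>

lemma lpts_eq_iff:
  assumes "0 < \<eta>" "B \<subseteq> Qbox (\<eta> * real k)" "A \<subseteq> lbox 0 k" "w \<in> space M"
  shows "lpts \<eta> B w = A \<longleftrightarrow> (\<forall>z\<in>lbox 0 k. (0 < card (P w \<inter> (B \<inter> lcell \<eta> z))) = (z \<in> A))"
proof -
  have bB: "bounded B" using assms(2) bounded_Qbox bounded_subset by blast
  have "lpts \<eta> B w = A \<longleftrightarrow> (\<forall>z\<in>lbox 0 k. (z \<in> lpts \<eta> B w) = (z \<in> A))"
    using lpts_subset[OF assms(1,2), of w] assms(3) by blast
  also have "\<dots> \<longleftrightarrow> (\<forall>z\<in>lbox 0 k. (0 < card (P w \<inter> (B \<inter> lcell \<eta> z))) = (z \<in> A))"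
    using mem_lpts_iff[OF assms(1) lbox_lattice_pt assms(4) bB] by simp
  finally show ?thesis .
qed

lemma lpts_event:
  assumes "0 < \<eta>" "B \<subseteq> Qbox (\<eta> * real k)" "B \<in> sets borel"
  shows "{w \<in> space M. lpts \<eta> B w = A} \<in> sets M"
proof (cases "A \<subseteq> lbox 0 k")
  case False
  then have none: "{w \<in> space M. lpts \<eta> B w = A} = {}"
    using lpts_subset[OF assms(1,2)] by auto
  show ?thesis
    unfolding none by (rule sets.empty_sets)
next
  case True
  have bB: "bounded B" using assms(2) bounded_Qbox bounded_subset by blast
  have [measurable]: "(\<lambda>w. card (P w \<inter> (B \<inter> lcell \<eta> z))) \<in> measurable M (count_space UNIV)" for z
    using assms(3) bB by (intro count_measurable bounded_Int sets.Int lcell_borel) auto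
  have "{w \<in> space M. lpts \<eta> B w = A}
      = {w \<in> space M. \<forall>z\<in>lbox 0 k. (0 < card (P w \<inter> (B \<inter> lcell \<eta> z))) = (z \<in> A)}"
    using lpts_eq_iff[OF assms(1,2) True] by blast
  also have "\<dots> \<in> sets M"
  proof (rule sets.sets_Collect_finite_All)
    show "{w \<in> space M. (0 < card (P w \<inter> (B \<inter> lcell \<eta> z))) = (z \<in> A)} \<in> events" for z
      by measurable
  qed simp
  finally show ?thesis .
qed

lemma lpts_fun_eq:
  assumes "0 < \<eta>" "B \<subseteq> Qbox (\<eta> * real k)" "w \<in> space M"
  shows "f (lpts \<eta> B w) = (\<Sum>A\<in>Pow (lbox 0 k). f A * indicator {w \<in> space M. lpts \<eta> B w = A} w :: real)"
proof -
  have "(\<Sum>A\<in>Pow (lbox 0 k). f A * indicator {w \<in> space M. lpts \<eta> B w = A} w)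
     = (\<Sum>A\<in>Pow (lbox 0 k). if A = lpts \<eta> B w then f A else 0 :: real)"
    using assms(3) by (intro sum.cong) auto
  also have "\<dots> = f (lpts \<eta> B w)"
    using lpts_subset[OF assms(1,2)] by (subst sum.delta) auto
  finally show ?thesis by simp
qed

lemma lpts_fun_integrable:
  fixes f :: "(real^'d) set \<Rightarrow> real"
  assumes "0 < \<eta>" "B \<subseteq> Qbox (\<eta> * real k)" "B \<in> sets borel"
  shows "integrable M (\<lambda>w. f (lpts \<eta> B w))"
    and "expectation (\<lambda>w. f (lpts \<eta> B w)) = (\<Sum>A\<in>Pow (lbox 0 k). f A * prob {w \<in> space M. lpts \<eta> B w = A})"
proof -
  let ?E = "\<lambda>A. {w \<in> space M. lpts \<eta> B w = A}"
  have ev[measurable]: "?E A \<in> sets M" for A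
    using lpts_event[OF assms] .
  have int: "integrable M (\<lambda>w. f A * indicator (?E A) w)" for A
    by (intro integrable_mult_right integrable_real_indicator ev) (simp add: emeasure_eq_measure)
  have "integrable M (\<lambda>w. f (lpts \<eta> B w)) \<longleftrightarrow> integrable M (\<lambda>w. \<Sum>A\<in>Pow (lbox 0 k). f A * indicator (?E A) w)"
    using lpts_fun_eq[OF assms(1,2)] by (rule Bochner_Integration.integrable_cong[OF refl])
  then show "integrable M (\<lambda>w. f (lpts \<eta> B w))"
    using Bochner_Integration.integrable_sum[OF int] by (simp only:)
  have "expectation (\<lambda>w. f (lpts \<eta> B w)) = expectation (\<lambda>w. \<Sum>A\<in>Pow (lbox 0 k). f A * indicator (?E A) w)"
    using lpts_fun_eq[OF assms(1,2)] by (rule Bochner_Integration.integral_cong[OF refl])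
  also have "\<dots> = (\<Sum>A\<in>Pow (lbox 0 k). f A * prob (?E A))"
    using int by (subst Bochner_Integration.integral_sum) auto
  finally show "expectation (\<lambda>w. f (lpts \<eta> B w)) = (\<Sum>A\<in>Pow (lbox 0 k). f A * prob (?E A))" .
qed

text \<open>The occupied cells form a Bernoulli set: disjoint cells are occupied independently, each
  with the probability that a Poisson count of mean \<open>\<eta> ^ CARD('d)\<close> is
  positive.\<close>

lemma lpts_prob:
  assumes \<eta>: "0 < \<eta>" and k: "1 \<le> k" and A: "A \<subseteq> lbox 0 k"
  shows "prob {w \<in> space M. lpts \<eta> (Qbox (\<eta> * real k)) w = A}
    = pocc TYPE('d) \<eta> ^ card A * (1 - pocc TYPE('d) \<eta>) ^ card (lbox 0 k - A)"
proof -
  let ?L = "lbox (0::real^'d) k" and ?p = "pocc TYPE('d) \<eta>"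
  \<comment> \<open>Independence of counts is stated for families indexed by natural numbers, so the
    cells are enumerated.\<close>
  obtain e where e: "bij_betw e {0..<card ?L} ?L"
    using ex_bij_betw_nat_finite[OF finite_lbox] by blast
  let ?I = "{0..<card ?L}"
  define X where "X i w = card (P w \<inter> lcell \<eta> (e i))" for i w
  define S :: "nat \<Rightarrow> nat set" where "S i = (if e i \<in> A then {0<..} else {0})" for i
  have eL: "e i \<in> ?L" if "i \<in> ?I" for i
    using e that by (rule bij_betw_apply)
  have lat: "lattice_pt (e i)" if "i \<in> ?I" for i
    using eL[OF that] by (rule lbox_lattice_pt)
  have disj: "disjoint_family_on (\<lambda>i. lcell \<eta> (e i)) ?I"
    unfolding disjoint_family_on_def
  proof (intro ballI impI)
    fix i j assume ij: "i \<in> ?I" "j \<in> ?I" "i \<noteq> j"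
    have "e i \<noteq> e j"
      using e ij by (auto simp: bij_betw_def inj_on_def)
    then show "lcell \<eta> (e i) \<inter> lcell \<eta> (e j) = {}"
      unfolding disjoint_iff
      by (simp flip: lround_eq_iff[OF \<eta> lat[OF ij(1)]] lround_eq_iff[OF \<eta> lat[OF ij(2)]])
  qed
  have ind: "indep_vars (\<lambda>_. count_space UNIV) X ?I"
    unfolding X_def by (rule counts_indep) (use disj in auto)
  have ne: "?I \<noteq> {}" using k by auto
  have cellQ: "Qbox (\<eta> * real k) \<inter> lcell \<eta> z = lcell \<eta> z" if "z \<in> ?L" for z
  proof -
    have "x \<in> Qbox (\<eta> * real k)" if x: "x \<in> lcell \<eta> z" for x
    proof -
      have "lround \<eta> x = z"
        using x by (simp add: lround_eq_iff[OF \<eta> lbox_lattice_pt[OF \<open>z \<in> ?L\<close>]])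
      then show ?thesis
        using \<open>z \<in> ?L\<close> by (simp flip: lround_lbox_iff[OF \<eta>])
    qed
    then show ?thesis by blast
  qed
  have "{w \<in> space M. lpts \<eta> (Qbox (\<eta> * real k)) w = A}
      = {w \<in> space M. \<forall>z\<in>?L. (0 < card (P w \<inter> lcell \<eta> z)) = (z \<in> A)}"
    using lpts_eq_iff[OF \<eta> order_refl A] cellQ by auto
  also have "\<dots> = {w \<in> space M. \<forall>i\<in>?I. (0 < X i w) = (e i \<in> A)}"
  proof -
    have "(\<forall>z\<in>e ` ?I. Q z) \<longleftrightarrow> (\<forall>i\<in>?I. Q (e i))" for Q
      by blast
    then have "(\<forall>z\<in>?L. Q z) \<longleftrightarrow> (\<forall>i\<in>?I. Q (e i))" for Q
      unfolding bij_betw_imp_surj_on[OF e] .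
    then show ?thesis by (simp only: X_def)
  qed
  also have "\<dots> = (\<Inter>i\<in>?I. X i -` S i \<inter> space M)"
  proof -
    have "m \<in> S i \<longleftrightarrow> (0 < m) = (e i \<in> A)" for m i
      by (simp add: S_def)
    then show ?thesis
      using ne by auto
  qed
  finally have "prob {w \<in> space M. lpts \<eta> (Qbox (\<eta> * real k)) w = A} = (\<Prod>i\<in>?I. prob (X i -` S i \<inter> space M))"
    using indep_varsD_finite[OF ind ne, of S] by simp
  also have "\<dots> = (\<Prod>i\<in>?I. if e i \<in> A then ?p else 1 - ?p)"
  proof (rule prod.cong)
    fix i assume i: "i \<in> ?I"
    have meas: "X i \<in> measurable M (count_space UNIV)"
      unfolding X_def by (intro count_measurable) auto
    have zero: "prob (X i -` {0} \<inter> space M) = 1 - ?p"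
    proof -
      have "X i -` {0} \<inter> space M = {w \<in> space M. card (P w \<inter> lcell \<eta> (e i)) = 0}"
        by (auto simp: X_def)
      then show ?thesis
        using count_zero_prob[of "lcell \<eta> (e i)"] measure_lcell[OF \<eta>, of "e i"] by (simp add: pocc_def)
    qed
    have "X i -` {0<..} \<inter> space M = space M - (X i -` {0} \<inter> space M)" by auto
    moreover have "X i -` {0} \<inter> space M \<in> events"
      using meas by (intro measurable_sets) auto
    ultimately have "prob (X i -` {0<..} \<inter> space M) = ?p"
      using zero by (simp add: prob_compl)
    then show "prob (X i -` S i \<inter> space M) = (if e i \<in> A then ?p else 1 - ?p)"
      using zero by (simp add: S_def)
  qed simp
  also have "\<dots> = (\<Prod>z\<in>?L. if z \<in> A then ?p else 1 - ?p)"
    using e by (rule prod.reindex_bij_betw)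
  also have "\<dots> = ?p ^ card A * (1 - ?p) ^ card (?L - A)"
  proof -
    have "?L \<inter> {z. z \<in> A} = A" "?L \<inter> - {z. z \<in> A} = ?L - A"
      using A by auto
    then show ?thesis
      by (simp add: prod.If_cases)
  qed
  finally show ?thesis .
qed

lemma expectation_lpts:
  assumes "0 < \<eta>" "1 \<le> k"
  shows "expectation (\<lambda>w. f (lpts \<eta> (Qbox (\<eta> * real k)) w)) = Ep (pocc TYPE('d) \<eta>) (lbox 0 k) f"
proof -
  have "expectation (\<lambda>w. f (lpts \<eta> (Qbox (\<eta> * real k)) w))
     = (\<Sum>A\<in>Pow (lbox 0 k). f A * prob {w \<in> space M. lpts \<eta> (Qbox (\<eta> * real k)) w = A})"
    using assms by (intro lpts_fun_integrable(2)) auto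
  also have "\<dots> = Ep (pocc TYPE('d) \<eta>) (lbox 0 k) f"
    unfolding Ep_def using assms by (intro sum.cong) (auto simp: lpts_prob)
  finally show ?thesis .
qed

lemma bounded_in_Qbox:
  assumes "bounded (B :: (real^'d) set)"
  obtains K where "0 < K" "\<And>\<eta> k. K \<le> \<eta> * real k \<Longrightarrow> B \<subseteq> Qbox (\<eta> * real k)"
proof -
  obtain b where b: "\<And>x. x \<in> B \<Longrightarrow> norm x \<le> b"
    using assms by (auto simp: bounded_iff)
  show thesis
  proof (rule that[of "\<bar>b\<bar> + 1"])
    fix \<eta> k assume le: "\<bar>b\<bar> + 1 \<le> \<eta> * real k"
    show "B \<subseteq> Qbox (\<eta> * real k)"
    proof
      fix x assume "x \<in> B"
      then have "\<bar>x $ i\<bar> \<le> b" for i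
        using b component_le_norm_cart[of x i] by fastforce
      then have "- (\<eta> * real k) \<le> x $ i \<and> x $ i < \<eta> * real k" for i
        using le abs_le_iff[of "x $ i" b] by (smt (verit, best))
      then show "x \<in> Qbox (\<eta> * real k)" by (simp add: Qbox_def)
    qed
  qed simp
qed

lemma lpts_measurable:
  fixes f :: "(real^'d) set \<Rightarrow> real"
  assumes "0 < \<eta>" "B \<in> sets borel" "bounded B"
  shows "(\<lambda>w. f (lpts \<eta> B w)) \<in> borel_measurable M"
proof -
  obtain K where K: "0 < K" "\<And>\<eta> k. K \<le> \<eta> * real k \<Longrightarrow> B \<subseteq> Qbox (\<eta> * real k)"
    using bounded_in_Qbox[OF assms(3)] by blast
  obtain k :: nat where "K / \<eta> < real k" using reals_Archimedean2 by blast
  then have "B \<subseteq> Qbox (\<eta> * real k)"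
    using assms(1) by (intro K) (simp add: field_simps)
  then show ?thesis
    using lpts_fun_integrable(1)[OF assms(1) _ assms(2)] by blast
qed

text \<open>As the mesh tends to zero, the functional is the pointwise limit of functionals of the
  occupied cells, each determined by finitely many counts. The finite set \<open>S\<close> makes
  room for an inserted origin.\<close>

lemma cint_measurable:
  fixes S :: "(real^'d) set"
  assumes "0 \<le> \<rho>" "finite S" "B \<in> sets borel" "bounded B"
  shows "(\<lambda>w. cint \<rho> (S \<union> (P w \<inter> B))) \<in> borel_measurable M"
proof (rule borel_measurable_LIMSEQ_real)
  let ?\<eta> = "\<lambda>j. 1 / real (Suc j)"
  let ?g = "\<lambda>j A. ?\<eta> j * cint (\<rho> / ?\<eta> j) (lround (?\<eta> j) ` S \<union> A)"
  show "(\<lambda>w. ?g j (lpts (?\<eta> j) B w)) \<in> borel_measurable M" for j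
    using assms by (intro lpts_measurable) auto
  show "(\<lambda>j. ?g j (lpts (?\<eta> j) B w)) \<longlonglongrightarrow> cint \<rho> (S \<union> (P w \<inter> B))" if w: "w \<in> space M" for w
  proof (rule LIM_zero_cancel, rule Lim_null_comparison)
    let ?V = "S \<union> (P w \<inter> B)"
    have fin: "finite ?V" using assms finite_pts[OF w] by auto
    have "\<bar>?g j (lpts (?\<eta> j) B w) - cint \<rho> ?V\<bar> \<le> CARD('d) * ?\<eta> j * card ?V" for j
      using cint_lround[OF fin, of "?\<eta> j" \<rho>] assms
      by (simp add: lpts_def image_Un abs_minus_commute)
    then show "\<forall>\<^sub>F j in sequentially. norm (?g j (lpts (?\<eta> j) B w) - cint \<rho> ?V) \<le> CARD('d) * ?\<eta> j * card ?V"
      by (intro always_eventually allI) (simp only: real_norm_def)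
    show "(\<lambda>j. CARD('d) * ?\<eta> j * card ?V) \<longlonglongrightarrow> 0"
      using tendsto_mult[OF tendsto_mult[OF tendsto_const LIMSEQ_Suc[OF lim_1_over_n]] tendsto_const,
        of "real CARD('d)" "real (card ?V)"] by simp
  qed
qed

lemma eventually_inj_lround:
  assumes "finite (V :: (real^'d) set)"
  shows "\<forall>\<^sub>F \<eta> in at_right 0. inj_on (lround \<eta>) V"
proof -
  have "\<forall>\<^sub>F \<eta> in at_right 0. x \<noteq> y \<longrightarrow> lround \<eta> x \<noteq> lround \<eta> y" for x y :: "real^'d"
  proof (cases "x = y")
    case False
    let ?e = "dist x y / CARD('d)"
    have "0 < ?e" using False by simp
    then have "\<forall>\<^sub>F \<eta> in at_right 0. 0 < \<eta> \<and> \<eta> < ?e"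
      by (simp add: eventually_at_right_field) (rule exI[of _ ?e], auto)
    then show ?thesis
    proof (rule eventually_mono)
      fix \<eta> assume \<eta>: "0 < \<eta> \<and> \<eta> < ?e"
      then have "CARD('d) * \<eta> < dist x y"
        by (simp add: pos_less_divide_eq mult.commute)
      then show "x \<noteq> y \<longrightarrow> lround \<eta> x \<noteq> lround \<eta> y"
        using lround_dist[of \<eta> x y] \<eta> by auto
    qed
  qed simp
  then have "\<forall>\<^sub>F \<eta> in at_right 0. \<forall>x\<in>V. \<forall>y\<in>V. x \<noteq> y \<longrightarrow> lround \<eta> x \<noteq> lround \<eta> y"
    using assms by (intro eventually_ball_finite ballI) auto
  then show ?thesis
    by (rule eventually_mono) (auto simp: inj_on_def)
qed

text \<open>For a small mesh rounding is injective on the finitely many points of the box, so the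
  number of occupied cells converges to the number of points. Fatou's lemma carries the binomial
  bound over to the limit.\<close>

lemma count_second_moment:
  assumes K: "0 < K"
  shows "integrable M (\<lambda>w. (real (card (P w \<inter> Qbox K)))\<^sup>2)"
    and "expectation (\<lambda>w. (real (card (P w \<inter> Qbox K)))\<^sup>2) \<le> second_moment TYPE('d) K"
proof -
  let ?N = "\<lambda>w. real (card (P w \<inter> Qbox K))"
  define \<eta> where "\<eta> j = K / real (Suc j)" for j
  have \<eta>: "0 < \<eta> j" "\<eta> j * real (Suc j) = K" for j
    using K by (simp_all add: \<eta>_def)
  have "\<eta> \<longlonglongrightarrow> 0"
    using tendsto_mult_right_zero[OF LIMSEQ_Suc[OF lim_1_over_n], of K] by (simp add: \<eta>_def[abs_def])
  then have lim: "filterlim \<eta> (at_right 0) sequentially"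
    unfolding filterlim_at using \<eta>(1) by (auto intro!: always_eventually simp: less_imp_neq[symmetric])
  have [measurable]: "?N \<in> borel_measurable M"
    using count_measurable[of "Qbox K"] by (auto intro: measurable_compose)
  have [measurable]: "(\<lambda>w. real (card (lpts (\<eta> j) (Qbox K) w))) \<in> borel_measurable M" for j
    using \<eta> by (intro lpts_measurable) auto
  have le: "(\<integral>\<^sup>+ w. ennreal ((real (card (lpts (\<eta> j) (Qbox K) w)))\<^sup>2) \<partial>M) \<le> ennreal (second_moment TYPE('d) K)" for j
  proof -
    have "(\<integral>\<^sup>+ w. ennreal ((real (card (lpts (\<eta> j) (Qbox K) w)))\<^sup>2) \<partial>M)
       = ennreal (expectation (\<lambda>w. (real (card (lpts (\<eta> j) (Qbox (\<eta> j * real (Suc j))) w)))\<^sup>2))"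
      unfolding \<eta>(2) using lpts_fun_integrable(1)[of "\<eta> j" "Qbox K" "Suc j" "\<lambda>A. (real (card A))\<^sup>2"] \<eta>
      by (intro nn_integral_eq_integral) auto
    also have "expectation (\<lambda>w. (real (card (lpts (\<eta> j) (Qbox (\<eta> j * real (Suc j))) w)))\<^sup>2)
        = Ep (pocc TYPE('d) (\<eta> j)) (lbox (0::real^'d) (Suc j)) (\<lambda>A. (real (card A))\<^sup>2)"
      by (rule expectation_lpts[OF \<eta>(1), where f = "\<lambda>A. (real (card A))\<^sup>2"]) simp
    also have "\<dots> \<le> (pocc TYPE('d) (\<eta> j) * real (card (lbox (0::real^'d) (Suc j))) + 1)\<^sup>2"
      using pocc_bounds[where 'd = 'd, of "\<eta> j"] \<eta>(1)[of j] by (intro Ep_card_pow(1)) auto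
    also have "\<dots> \<le> second_moment TYPE('d) K"
    proof -
      have "pocc TYPE('d) (\<eta> j) * real (card (lbox (0::real^'d) (Suc j))) \<le> \<eta> j ^ CARD('d) * real (card (lbox (0::real^'d) (Suc j)))"
        using pocc_bounds(3)[where 'd = 'd, of "\<eta> j"] \<eta>(1)[of j] by (intro mult_right_mono) auto
      also have "\<dots> = (2 * (\<eta> j * real (Suc j))) ^ CARD('d)"
        unfolding card_lbox0 of_nat_power power_mult_distrib[symmetric] by (simp add: mult_ac)
      finally have "pocc TYPE('d) (\<eta> j) * real (card (lbox (0::real^'d) (Suc j))) \<le> (2 * K) ^ CARD('d)"
        by (simp only: \<eta>(2))
      then show ?thesis
        unfolding second_moment_def using pocc_bounds(1)[where 'd = 'd, of "\<eta> j"] \<eta>(1)[of j]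
        by (intro power_mono) auto
    qed
    finally show ?thesis by (simp add: ennreal_leI)
  qed
  have "(\<integral>\<^sup>+ w. ennreal ((?N w)\<^sup>2) \<partial>M)
      = (\<integral>\<^sup>+ w. liminf (\<lambda>j. ennreal ((real (card (lpts (\<eta> j) (Qbox K) w)))\<^sup>2)) \<partial>M)"
  proof (rule nn_integral_cong)
    fix w assume w: "w \<in> space M"
    have "\<forall>\<^sub>F j in sequentially. inj_on (lround (\<eta> j)) (P w \<inter> Qbox K)"
      using eventually_inj_lround[OF finite_pts[OF w bounded_Qbox]] lim by (rule eventually_compose_filterlim)
    then have "\<forall>\<^sub>F j in sequentially. ennreal ((real (card (lpts (\<eta> j) (Qbox K) w)))\<^sup>2) = ennreal ((?N w)\<^sup>2)"
      by (rule eventually_mono) (simp add: lpts_def card_image)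
    then have "(\<lambda>j. ennreal ((real (card (lpts (\<eta> j) (Qbox K) w)))\<^sup>2)) \<longlonglongrightarrow> ennreal ((?N w)\<^sup>2)"
      by (rule tendsto_eventually)
    then show "ennreal ((?N w)\<^sup>2) = liminf (\<lambda>j. ennreal ((real (card (lpts (\<eta> j) (Qbox K) w)))\<^sup>2))"
      using lim_imp_Liminf[OF sequentially_bot] by metis
  qed
  also have "\<dots> \<le> liminf (\<lambda>j. \<integral>\<^sup>+ w. ennreal ((real (card (lpts (\<eta> j) (Qbox K) w)))\<^sup>2) \<partial>M)"
    by (rule nn_integral_liminf) simp
  also have "\<dots> \<le> ennreal (second_moment TYPE('d) K)"
    using le by (intro Liminf_le) auto
  finally have fin: "(\<integral>\<^sup>+ w. ennreal ((?N w)\<^sup>2) \<partial>M) \<le> ennreal (second_moment TYPE('d) K)" .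
  then show int: "integrable M (\<lambda>w. (?N w)\<^sup>2)"
    by (intro integrableI_nonneg) (auto intro: le_less_trans)
  have "ennreal (expectation (\<lambda>w. (?N w)\<^sup>2)) \<le> ennreal (second_moment TYPE('d) K)"
    using fin nn_integral_eq_integral[OF int] by simp
  then show "expectation (\<lambda>w. (?N w)\<^sup>2) \<le> second_moment TYPE('d) K"
    by (simp add: second_moment_def)
qed

lemma count_expectation:
  assumes K: "0 < K"
  shows "integrable M (\<lambda>w. real (card (P w \<inter> Qbox K)))"
    and "expectation (\<lambda>w. real (card (P w \<inter> Qbox K))) \<le> second_moment TYPE('d) K"
proof -
  let ?N = "\<lambda>w. real (card (P w \<inter> Qbox K))"
  have sq: "real n \<le> (real n)\<^sup>2" for n :: nat
    by (cases n) (simp_all add: power2_eq_square)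
  have [measurable]: "?N \<in> borel_measurable M"
    using count_measurable[of "Qbox K"] by (auto intro: measurable_compose)
  show int: "integrable M ?N"
    by (rule Bochner_Integration.integrable_bound[OF count_second_moment(1)[OF K]]) (use sq in auto)
  have "expectation ?N \<le> expectation (\<lambda>w. (?N w)\<^sup>2)"
    using int count_second_moment(1)[OF K] sq by (intro integral_mono) auto
  then show "expectation ?N \<le> second_moment TYPE('d) K"
    using count_second_moment(2)[OF K] by linarith
qed

end

section \<open>Add-one costs for the Poisson process\<close>

text \<open>Discretisation errors are linear in the mesh; letting the mesh tend to zero removes
  them.\<close>

lemma le_by_linear_error:
  fixes x y c e :: real
  assumes "0 < e" "\<And>h. 0 < h \<Longrightarrow> h < e \<Longrightarrow> x \<le> y + c * h"
  shows "x \<le> y"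
proof (rule tendsto_lowerbound)
  show "((\<lambda>h. y + c * h) \<longlongrightarrow> y) (at_right 0)"
    by (auto intro!: tendsto_eq_intros)
  show "\<forall>\<^sub>F h in at_right 0. x \<le> y + c * h"
    using assms by (auto simp: eventually_at_right_field intro!: exI[of _ e])
qed simp

text \<open>Turns an unspecified density, as produced by the mean value theorem, into a
  mesh.\<close>

lemma pocc_between:
  assumes "0 \<le> \<eta>\<^sub>1" "\<eta>\<^sub>1 \<le> \<eta>\<^sub>2" "pocc TYPE('d::finite) \<eta>\<^sub>1 \<le> p" "p \<le> pocc TYPE('d) \<eta>\<^sub>2"
  shows "\<exists>\<eta>. \<eta>\<^sub>1 \<le> \<eta> \<and> \<eta> \<le> \<eta>\<^sub>2 \<and> p = pocc TYPE('d) \<eta>"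
proof -
  have "\<exists>\<eta>\<ge>\<eta>\<^sub>1. \<eta> \<le> \<eta>\<^sub>2 \<and> pocc TYPE('d) \<eta> = p"
    unfolding pocc_def using assms by (intro IVT') (auto simp: pocc_def intro!: continuous_intros)
  then show ?thesis by blast
qed

text \<open>For \<open>x\<close> the volume of a small cell the two probabilities are
  \<open>1 - exp (- x)\<close> and \<open>1 - exp (- (2 ^ CARD('d) * x))\<close>. Their gap is
  comparable to the smaller one, which keeps \<open>p\<^sub>1 / (p\<^sub>2 - p\<^sub>1)\<close>
  bounded by 2.\<close>

lemma pocc_double:
  assumes "0 < \<eta>" "\<eta> \<le> 1 / 2"
  defines "p\<^sub>1 \<equiv> pocc TYPE('d::finite) \<eta>" and "p\<^sub>2 \<equiv> pocc TYPE('d) (2 * \<eta>)"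
  shows "0 < p\<^sub>1" "p\<^sub>1 / 2 \<le> p\<^sub>2 - p\<^sub>1" "p\<^sub>2 - p\<^sub>1 \<le> 2 ^ CARD('d) * p\<^sub>1"
proof -
  define x where "x = \<eta> ^ CARD('d)"
  have x: "0 < x" using assms by (simp add: x_def)
  have "x \<le> \<eta> ^ 1"
    unfolding x_def using assms by (intro power_decreasing) auto
  then have x2: "x \<le> 1 / 2" using assms by simp
  have p1: "p\<^sub>1 = 1 - exp (- x)" by (simp add: p\<^sub>1_def pocc_def x_def)
  have p2: "p\<^sub>2 = 1 - exp (- (2 ^ CARD('d) * x))"
    by (simp add: p\<^sub>2_def pocc_def x_def power_mult_distrib)
  show "0 < p\<^sub>1" using x by (simp add: p1)
  have "(2::real) ^ 1 \<le> 2 ^ CARD('d)" by (intro power_increasing) auto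
  then have "exp (- (2 ^ CARD('d) * x)) \<le> exp (- (2 * x))"
    using x by (simp add: mult_right_mono)
  also have "exp (- (2 * x)) = exp (- x) * exp (- x)"
    by (simp flip: exp_add)
  finally have "p\<^sub>1 * exp (- x) \<le> p\<^sub>2 - p\<^sub>1"
    by (simp add: p1 p2 algebra_simps)
  moreover have "1 / 2 \<le> exp (- x)"
    using exp_ge_add_one_self[of "- x"] x2 by linarith
  then have "p\<^sub>1 * (1 / 2) \<le> p\<^sub>1 * exp (- x)"
    using \<open>0 < p\<^sub>1\<close> by (intro mult_left_mono) auto
  ultimately show "p\<^sub>1 / 2 \<le> p\<^sub>2 - p\<^sub>1" by linarith
  have "exp (- (2 ^ CARD('d) * x)) = exp (- x) ^ (2 ^ CARD('d))"
    by (simp flip: exp_of_nat_mult)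
  also have "exp (- x) = 1 + (- p\<^sub>1)" by (simp add: p1)
  also have "(1 + (- p\<^sub>1)) ^ (2 ^ CARD('d)) \<ge> 1 + real (2 ^ CARD('d)) * (- p\<^sub>1)"
    by (rule Bernoulli_inequality) (simp add: p1)
  finally show "p\<^sub>2 - p\<^sub>1 \<le> 2 ^ CARD('d) * p\<^sub>1"
    using \<open>0 < p\<^sub>1\<close> by (simp add: p2)
qed

lemma second_moment_mono: "0 \<le> K \<Longrightarrow> K \<le> K' \<Longrightarrow> second_moment TYPE('d::finite) K \<le> second_moment TYPE('d) K'"
  unfolding second_moment_def by (intro power_mono add_mono) auto

lemma second_moment_nonneg: "0 \<le> second_moment TYPE('d::finite) K"
  by (simp add: second_moment_def)

section \<open>Add-one costs of the Poisson process and their lattice approximation\<close>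

context unit_poisson
begin

definition poisson_cost :: "real \<Rightarrow> real \<Rightarrow> real" where
  "poisson_cost \<rho> K = expectation (\<lambda>w. cint \<rho> (insert 0 (P w \<inter> Qbox K)) - cint \<rho> (P w \<inter> Qbox K))"

definition poisson_mean :: "real \<Rightarrow> real \<Rightarrow> real" where
  "poisson_mean \<rho> K = expectation (\<lambda>w. cint \<rho> (P w \<inter> Qbox K))"

lemma finite_ptsQ [simp]: "w \<in> space M \<Longrightarrow> finite (P w \<inter> Qbox K)"
  by (rule finite_pts) auto

lemma cintQ_measurable [measurable]:
  assumes "0 \<le> \<rho>"
  shows "(\<lambda>w. cint \<rho> (P w \<inter> Qbox K)) \<in> borel_measurable M"
    and "(\<lambda>w. cint \<rho> (insert 0 (P w \<inter> Qbox K))) \<in> borel_measurable M"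
  using cint_measurable[OF assms, of "{}" "Qbox K"] cint_measurable[OF assms, of "{0}" "Qbox K"] by auto

lemma cintQ_integrable:
  assumes "0 \<le> \<rho>" "0 < K"
  shows "integrable M (\<lambda>w. cint \<rho> (P w \<inter> Qbox K))"
proof (rule Bochner_Integration.integrable_bound)
  show "integrable M (\<lambda>w. \<rho> * real (card (P w \<inter> Qbox K)))"
    using count_expectation(1)[OF assms(2)] by simp
  show "AE w in M. norm (cint \<rho> (P w \<inter> Qbox K)) \<le> norm (\<rho> * real (card (P w \<inter> Qbox K)))"
  proof (rule AE_I2)
    fix w assume w: "w \<in> space M"
    show "norm (cint \<rho> (P w \<inter> Qbox K)) \<le> norm (\<rho> * real (card (P w \<inter> Qbox K)))"
      using cint_nonneg[OF finite_ptsQ[OF w], of \<rho> K] cint_le[OF finite_ptsQ[OF w] assms(1), of K] by simp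
  qed
qed (use assms in measurable)

lemma add_cost_bounds:
  assumes "0 \<le> \<rho>" "finite V"
  shows "cint \<rho> (insert 0 V) - cint \<rho> V \<le> \<rho>"
    and "- (kiss TYPE('d) * \<rho>) \<le> cint \<rho> (insert 0 V) - cint \<rho> (V :: (real^'d) set)"
  using cint_insert_le[OF assms(2,1), of 0] cint_insert_ge[OF assms(2,1), of 0] by auto

lemma poisson_cost_integrable:
  assumes "0 \<le> \<rho>"
  shows "integrable M (\<lambda>w. cint \<rho> (insert 0 (P w \<inter> Qbox K)) - cint \<rho> (P w \<inter> Qbox K))"
proof (rule integrable_const_bound)
  show "AE w in M. norm (cint \<rho> (insert 0 (P w \<inter> Qbox K)) - cint \<rho> (P w \<inter> Qbox K)) \<le> kiss TYPE('d) * \<rho>"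
  proof (rule AE_I2)
    fix w assume "w \<in> space M"
    moreover have "\<rho> \<le> kiss TYPE('d) * \<rho>"
      using kiss_ge_1[where 'd = 'd] assms by (simp add: mult_le_cancel_right1)
    ultimately show "norm (cint \<rho> (insert 0 (P w \<inter> Qbox K)) - cint \<rho> (P w \<inter> Qbox K)) \<le> kiss TYPE('d) * \<rho>"
      using add_cost_bounds[OF assms finite_ptsQ, of w K] by (simp add: abs_le_iff)
  qed
qed (use assms in measurable)

lemma add_cost_mono:
  assumes "finite V'" "V \<subseteq> V'" "\<And>x. x \<in> V' - V \<Longrightarrow> \<rho>' < norm x" "0 \<le> \<rho>" "\<rho> \<le> \<rho>'"
  shows "cint \<rho> (insert 0 V') - cint \<rho> V' - (cint \<rho> (insert 0 V) - cint \<rho> V)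
    \<le> cint \<rho>' (insert 0 V') - cint \<rho>' V' - (cint \<rho>' (insert 0 V) - cint \<rho>' (V :: (real^'d) set))"
proof (cases "0 \<in> V'")
  case True
  then have "0 \<in> V"
    using assms(3)[of 0] assms(4,5) by force
  then show ?thesis
    using True by (simp add: insert_absorb)
next
  case False
  then show ?thesis
    using assms by (intro cint_supermodular) auto
qed

lemma Qbox_far: "x \<notin> Qbox K \<Longrightarrow> K \<le> norm (x :: real^'d)"
proof -
  assume "x \<notin> Qbox K"
  then obtain i where "x $ i < - K \<or> K \<le> x $ i" by (auto simp: Qbox_def not_le not_less)
  then have "K \<le> \<bar>x $ i\<bar>" by linarith
  then show ?thesis using component_le_norm_cart[of x i] by linarith
qed

lemma Qbox_mono: "K \<le> K' \<Longrightarrow> Qbox K \<subseteq> (Qbox K' :: (real^'d) set)"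
proof
  fix x :: "real^'d" assume le: "K \<le> K'" and x: "x \<in> Qbox K"
  have "- K' \<le> x $ i \<and> x $ i < K'" for i
    using spec[OF x[unfolded Qbox_def mem_Collect_eq], of i] le by linarith
  then show "x \<in> Qbox K'" by (simp add: Qbox_def)
qed

text \<open>Supermodularity in window and cutoff, integrated. It transfers a bound on the growth of
  the cost with the window from a larger, possibly unspecified, cutoff to a smaller one.\<close>

lemma poisson_cost_mono:
  assumes "0 \<le> \<rho>" "\<rho> \<le> \<rho>'" "\<rho>' < K" "K \<le> K'"
  shows "poisson_cost \<rho> K' - poisson_cost \<rho> K \<le> poisson_cost \<rho>' K' - poisson_cost \<rho>' K"
proof -
  let ?f = "\<lambda>\<rho> K w. cint \<rho> (insert 0 (P w \<inter> Qbox K)) - cint \<rho> (P w \<inter> Qbox K)"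
  have int: "integrable M (?f \<rho> K)" "integrable M (?f \<rho> K')" "integrable M (?f \<rho>' K)" "integrable M (?f \<rho>' K')"
    using assms by (auto intro!: poisson_cost_integrable)
  have "expectation (\<lambda>w. ?f \<rho> K' w - ?f \<rho> K w) \<le> expectation (\<lambda>w. ?f \<rho>' K' w - ?f \<rho>' K w)"
  proof (rule integral_mono)
    fix w assume w: "w \<in> space M"
    show "?f \<rho> K' w - ?f \<rho> K w \<le> ?f \<rho>' K' w - ?f \<rho>' K w"
    proof (rule add_cost_mono)
      show "\<rho>' < norm x" if "x \<in> P w \<inter> Qbox K' - P w \<inter> Qbox K" for x
        using Qbox_far[of x K] that assms by auto
    qed (use w assms Qbox_mono[OF assms(4)] in auto)
  qed (use int in auto)
  then show ?thesis
    using int by (simp add: poisson_cost_def)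
qed

lemma poisson_cost_mono_window:
  assumes "0 \<le> \<rho>" "\<rho> < K" "K \<le> K'"
  shows "poisson_cost \<rho> K \<le> poisson_cost \<rho> K'"
  using poisson_cost_mono[of 0 \<rho> K K'] assms by (simp add: poisson_cost_def)

lemma poisson_mean_approx:
  fixes \<rho> \<eta> :: real
  assumes "0 \<le> \<rho>" "0 < \<eta>" "1 \<le> k"
  shows "\<bar>poisson_mean \<rho> (\<eta> * real k) - \<eta> * lattice_mean TYPE('d) (\<rho> / \<eta>) (pocc TYPE('d) \<eta>) k\<bar>
    \<le> CARD('d) * \<eta> * second_moment TYPE('d) (\<eta> * real k)"
proof -
  let ?Q = "Qbox (\<eta> * real k)"
  have K: "0 < \<eta> * real k" using assms by simp
  have int: "integrable M (\<lambda>w. cint \<rho> (P w \<inter> ?Q))" "integrable M (\<lambda>w. \<eta> * cint (\<rho> / \<eta>) (lpts \<eta> ?Q w))"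
    using assms K by (auto intro!: cintQ_integrable lpts_fun_integrable(1))
  have lattice_mean: "\<eta> * lattice_mean TYPE('d) (\<rho> / \<eta>) (pocc TYPE('d) \<eta>) k = expectation (\<lambda>w. \<eta> * cint (\<rho> / \<eta>) (lpts \<eta> ?Q w))"
    using expectation_lpts[OF assms(2,3), of "cint (\<rho> / \<eta>)"] by (simp add: lattice_mean_def)
  have "\<bar>poisson_mean \<rho> (\<eta> * real k) - \<eta> * lattice_mean TYPE('d) (\<rho> / \<eta>) (pocc TYPE('d) \<eta>) k\<bar>
      = \<bar>expectation (\<lambda>w. cint \<rho> (P w \<inter> ?Q) - \<eta> * cint (\<rho> / \<eta>) (lpts \<eta> ?Q w))\<bar>"
    unfolding lattice_mean poisson_mean_def using int by simp
  also have "\<dots> \<le> expectation (\<lambda>w. \<bar>cint \<rho> (P w \<inter> ?Q) - \<eta> * cint (\<rho> / \<eta>) (lpts \<eta> ?Q w)\<bar>)"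
    by (rule integral_abs_bound)
  also have "\<dots> \<le> expectation (\<lambda>w. CARD('d) * \<eta> * real (card (P w \<inter> ?Q)))"
  proof (rule integral_mono)
    show "\<bar>cint \<rho> (P w \<inter> ?Q) - \<eta> * cint (\<rho> / \<eta>) (lpts \<eta> ?Q w)\<bar> \<le> CARD('d) * \<eta> * real (card (P w \<inter> ?Q))"
      if "w \<in> space M" for w
      unfolding lpts_def using that assms by (intro cint_lround) auto
  qed (use int count_expectation(1)[OF K] in auto)
  also have "\<dots> \<le> CARD('d) * \<eta> * second_moment TYPE('d) (\<eta> * real k)"
    using count_expectation[OF K] assms by (simp add: mult_left_mono)
  finally show ?thesis .
qed

lemma lround_zero [simp]: "lround \<eta> 0 = 0"
  by (simp add: lround_def vec_eq_iff)

text \<open>There are two errors. Rounding changes distances by at most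
  \<open>CARD('d) * \<eta>\<close>. Moreover the cell of the origin is occupied with probability at
  most \<eta>; inserting the origin then has no effect on the lattice, whereas
  \<open>lattice_cost\<close> disregards the state of that site.\<close>

lemma poisson_cost_approx:
  fixes \<rho> \<eta> :: real
  assumes "0 \<le> \<rho>" "0 < \<eta>" "\<eta> \<le> 1" "1 \<le> k"
  shows "\<bar>poisson_cost \<rho> (\<eta> * real k) - \<eta> * lattice_cost TYPE('d) (pocc TYPE('d) \<eta>) (\<rho> / \<eta>) k\<bar>
    \<le> \<eta> * (CARD('d) * (2 * second_moment TYPE('d) (\<eta> * real k) + 1) + kiss TYPE('d) * \<rho>)"
proof -
  let ?Q = "Qbox (\<eta> * real k)" and ?p = "pocc TYPE('d) \<eta>" and ?L = "lbox (0::real^'d) k"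
  let ?c = "\<lambda>V. cint \<rho> (insert 0 V) - cint \<rho> V"
  let ?f = "\<lambda>A::(real^'d) set. cint (\<rho> / \<eta>) (insert 0 A) - cint (\<rho> / \<eta>) A"
  have K: "0 < \<eta> * real k" using assms by simp
  have p: "0 \<le> ?p" "?p \<le> 1" "?p \<le> \<eta>"
  proof -
    show "0 \<le> ?p" "?p \<le> 1" using pocc_bounds[where 'd = 'd, of \<eta>] assms by auto
    have "\<eta> ^ CARD('d) \<le> \<eta> ^ 1"
      using assms by (intro power_decreasing) auto
    then show "?p \<le> \<eta>"
      using pocc_bounds(3)[where 'd = 'd, of \<eta>] assms by simp
  qed
  have int: "integrable M (\<lambda>w. ?c (P w \<inter> ?Q))" "integrable M (\<lambda>w. \<eta> * ?f (lpts \<eta> ?Q w))"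
    using assms K by (auto intro!: poisson_cost_integrable lpts_fun_integrable(1)[where f = ?f])
  have Ef: "expectation (\<lambda>w. \<eta> * ?f (lpts \<eta> ?Q w)) = \<eta> * Ep ?p ?L ?f"
    using expectation_lpts[OF assms(2,4), of ?f] by simp
  have "0 \<in> ?L" using assms(4) by (simp add: lbox_def)
  then have L: "?L = insert 0 (?L - {0})" by blast
  have "Ep ?p ?L ?f = (1 - ?p) * Ep ?p (?L - {0}) ?f"
    by (subst L, subst Ep_insert) auto
  moreover have "lattice_cost TYPE('d) ?p (\<rho> / \<eta>) k = Ep ?p (?L - {0}) ?f"
    unfolding lattice_cost_def using Ep_flip_diff_new[of "?L - {0}" 0 ?p "\<lambda>x. x" "cint (\<rho> / \<eta>)"] L by simp
  ultimately have EfaD: "Ep ?p ?L ?f = (1 - ?p) * lattice_cost TYPE('d) ?p (\<rho> / \<eta>) k" by simp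
  have aDb: "\<bar>lattice_cost TYPE('d) ?p (\<rho> / \<eta>) k\<bar> \<le> kiss TYPE('d) * (\<rho> / \<eta>)"
  proof -
    have "1 * (\<rho> / \<eta>) \<le> kiss TYPE('d) * (\<rho> / \<eta>)"
      using assms by (intro mult_right_mono kiss_ge_1) auto
    moreover have "lattice_cost TYPE('d) ?p (\<rho> / \<eta>) k \<le> \<rho> / \<eta>" "- (kiss TYPE('d) * (\<rho> / \<eta>)) \<le> lattice_cost TYPE('d) ?p (\<rho> / \<eta>) k"
      unfolding lattice_cost_def using assms p by (intro Ep_flip_bounds; simp)+
    ultimately show ?thesis by linarith
  qed
  have "\<bar>poisson_cost \<rho> (\<eta> * real k) - \<eta> * Ep ?p ?L ?f\<bar>
      = \<bar>expectation (\<lambda>w. ?c (P w \<inter> ?Q) - \<eta> * ?f (lpts \<eta> ?Q w))\<bar>"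
    unfolding Ef[symmetric] poisson_cost_def by (subst Bochner_Integration.integral_diff[OF int]) simp
  also have "\<dots> \<le> expectation (\<lambda>w. \<bar>?c (P w \<inter> ?Q) - \<eta> * ?f (lpts \<eta> ?Q w)\<bar>)"
    by (rule integral_abs_bound)
  also have "\<dots> \<le> expectation (\<lambda>w. CARD('d) * \<eta> * (2 * real (card (P w \<inter> ?Q)) + 1))"
  proof (rule integral_mono)
    show "integrable M (\<lambda>w. \<bar>?c (P w \<inter> ?Q) - \<eta> * ?f (lpts \<eta> ?Q w)\<bar>)"
      by (rule integrable_abs[OF Bochner_Integration.integrable_diff[OF int]])
    show "integrable M (\<lambda>w. CARD('d) * \<eta> * (2 * real (card (P w \<inter> ?Q)) + 1))"
      using count_expectation(1)[OF K] by simp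
    fix w assume w: "w \<in> space M"
    let ?V = "P w \<inter> ?Q"
    have 1: "\<bar>cint \<rho> ?V - \<eta> * cint (\<rho> / \<eta>) (lround \<eta> ` ?V)\<bar> \<le> CARD('d) * \<eta> * card ?V"
      using w assms by (intro cint_lround) auto
    have "\<bar>cint \<rho> (insert 0 ?V) - \<eta> * cint (\<rho> / \<eta>) (lround \<eta> ` insert 0 ?V)\<bar> \<le> CARD('d) * \<eta> * card (insert 0 ?V)"
      using w assms by (intro cint_lround) auto
    also have "\<dots> \<le> CARD('d) * \<eta> * (real (card ?V) + 1)"
    proof (intro mult_left_mono)
      show "real (card (insert 0 ?V)) \<le> real (card ?V) + 1"
        using card_insert_le_m1[of "Suc (card ?V)" ?V 0] w by (simp add: card_insert_if)
    qed (use assms in auto)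
    finally have 2: "\<bar>cint \<rho> (insert 0 ?V) - \<eta> * cint (\<rho> / \<eta>) (insert 0 (lround \<eta> ` ?V))\<bar> \<le> CARD('d) * \<eta> * (real (card ?V) + 1)"
      by simp
    show "\<bar>?c ?V - \<eta> * ?f (lpts \<eta> ?Q w)\<bar> \<le> CARD('d) * \<eta> * (2 * real (card ?V) + 1)"
      using 1 2 unfolding lpts_def by (simp add: algebra_simps abs_le_iff)
  qed
  also have "\<dots> = CARD('d) * \<eta> * (2 * expectation (\<lambda>w. real (card (P w \<inter> ?Q))) + 1)"
    using count_expectation(1)[OF K] by (simp add: prob_space)
  also have "\<dots> \<le> CARD('d) * \<eta> * (2 * second_moment TYPE('d) (\<eta> * real k) + 1)"
    using count_expectation(2)[OF K] assms by (intro mult_left_mono add_mono) auto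
  finally have A: "\<bar>poisson_cost \<rho> (\<eta> * real k) - \<eta> * Ep ?p ?L ?f\<bar>
      \<le> CARD('d) * \<eta> * (2 * second_moment TYPE('d) (\<eta> * real k) + 1)" .
  have "\<eta> * Ep ?p ?L ?f - \<eta> * lattice_cost TYPE('d) ?p (\<rho> / \<eta>) k = - (\<eta> * ?p * lattice_cost TYPE('d) ?p (\<rho> / \<eta>) k)"
    unfolding EfaD by (simp add: algebra_simps)
  then have "\<bar>\<eta> * Ep ?p ?L ?f - \<eta> * lattice_cost TYPE('d) ?p (\<rho> / \<eta>) k\<bar> = \<eta> * ?p * \<bar>lattice_cost TYPE('d) ?p (\<rho> / \<eta>) k\<bar>"
    using assms p by (simp add: abs_mult)
  also have "\<dots> \<le> \<eta> * \<eta> * (kiss TYPE('d) * (\<rho> / \<eta>))"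
    using assms p aDb kiss_ge_1[where 'd = 'd] by (intro mult_mono) auto
  also have "\<dots> = \<eta> * (kiss TYPE('d) * \<rho>)" using assms by simp
  finally show ?thesis
    using A by (simp add: algebra_simps)
qed

text \<open>The mean value theorem picks a density between the occupation probabilities of the
  meshes \<open>h\<close> and \<open>2 * h\<close>, that is, some mesh in between. The lattice
  cutoff \<open>\<rho> / h\<close> then means a spatial cutoff \<open>\<rho>'\<close> between \<rho>
  and \<open>2 * \<rho>\<close>. The lattice windows are chosen to work for every such mesh, and
  monotonicity in window and cutoff brings the estimate back to \<rho>, \<open>K\<close> and
  \<open>D\<close>.\<close>

theorem poisson_cost_rate:
  assumes \<rho>: "0 < \<rho>" "2 * \<rho> < K" "K \<le> D"
  shows "poisson_cost \<rho> D - poisson_cost \<rho> K \<le> 128 * CARD('d) * (kiss TYPE('d) + 1) * \<rho>\<^sup>2 / K"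
proof (rule le_by_linear_error)
  let ?\<kappa> = "kiss TYPE('d)" and ?sm = "second_moment TYPE('d) (2 * D + 2)"
  define c where "c = 4 * (CARD('d) * (2 * ?sm + 1) + ?\<kappa> * (2 * \<rho>))"
  \<comment> \<open>The four bounds serve, in turn, \<open>pocc_double\<close>,
    \<open>t \<le> 2 * \<rho> / h\<close>, \<open>k \<ge> K / (8 * h)\<close> and
    \<open>\<rho> / h < 2 * k\<close>.\<close>
  define e where "e = Min {1 / 2, \<rho>, K / 8, (K / 2 - \<rho>) / 2}"
  show "0 < e" using \<rho> by (auto simp: e_def)
  fix h assume h: "0 < h" "h < e"
  have h': "h < 1 / 2" "h < \<rho>" "h < K / 8" "h < (K / 2 - \<rho>) / 2"
    using h(2) by (auto simp: e_def)
  have \<kappa>: "1 \<le> ?\<kappa>" by (rule kiss_ge_1)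
  \<comment> \<open>The mesh may be as large as \<open>2 * h\<close>, and the window of half side
    \<open>2 * k\<close> must stay within \<open>K\<close> even then. Conversely \<open>Dl\<close>
    covers \<open>D\<close> already at the smallest mesh \<open>h\<close>.\<close>
  define k where "k = nat \<lfloor>K / (4 * h)\<rfloor>"
  define Dl where "Dl = nat \<lceil>D / h\<rceil>"
  define t where "t = Suc (nat \<lfloor>\<rho> / h\<rfloor>)"
  have k: "real k \<le> K / (4 * h)" "K / (4 * h) - 1 < real k"
  proof -
    have "0 \<le> K / (4 * h)" using h \<rho> by simp
    then show "real k \<le> K / (4 * h)" "K / (4 * h) - 1 < real k"
      unfolding k_def by linarith+
  qed
  have Dl: "D / h \<le> real Dl" "real Dl < D / h + 1"
  proof -
    have "0 \<le> D / h" using h \<rho> by simp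
    then show "D / h \<le> real Dl" "real Dl < D / h + 1"
      unfolding Dl_def by linarith+
  qed
  have t: "\<rho> / h < real t" "real t \<le> \<rho> / h + 1"
  proof -
    have "0 \<le> \<rho> / h" using h \<rho> by simp
    then show "\<rho> / h < real t" "real t \<le> \<rho> / h + 1"
      unfolding t_def by linarith+
  qed
  have t2: "real t \<le> 2 * \<rho> / h"
  proof -
    have "1 \<le> \<rho> / h" using h h' by simp
    then show ?thesis using t(2) by simp
  qed
  have k8: "K / (8 * h) \<le> real k"
  proof -
    have "1 \<le> K / (8 * h)" using h h' by (simp add: field_simps)
    moreover have "K / (4 * h) = 2 * (K / (8 * h))" by simp
    ultimately show ?thesis using k(2) by linarith
  qed
  have k1: "1 \<le> k"
  proof -
    have "0 < K / (8 * h)" using h \<rho> by simp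
    then have "0 < real k" using k8 by linarith
    then show ?thesis by simp
  qed
  have \<rho>Dl: "\<rho> / h < real Dl"
  proof -
    have "\<rho> / h < D / h" using h \<rho> by (intro divide_strict_right_mono) auto
    then show ?thesis using Dl by linarith
  qed
  let ?p1 = "pocc TYPE('d) h" and ?p2 = "pocc TYPE('d) (2 * h)"
  have p: "0 < ?p1" "?p1 / 2 \<le> ?p2 - ?p1" using pocc_double[where 'd = 'd, of h] h h' by auto
  have "?p2 \<le> 1" using pocc_bounds(2)[where 'd = 'd, of "2 * h"] h by auto
  then obtain q where q: "?p1 < q" "q < ?p2"
    and rate: "lattice_cost TYPE('d) q (\<rho> / h) Dl - lattice_cost TYPE('d) q (\<rho> / h) (2 * k)
      \<le> (?\<kappa> + 1) * (\<rho> / h) * (CARD('d) * t / k) * (2 + ?p1 / (?p2 - ?p1))"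
    using rate_lattice[where 'd = 'd, of ?p1 ?p2 "\<rho> / h" t Dl k] p t \<rho>Dl k1 h \<rho> by auto
  obtain \<eta> where \<eta>: "h \<le> \<eta>" "\<eta> \<le> 2 * h" "q = pocc TYPE('d) \<eta>"
    using pocc_between[where 'd = 'd, of h "2 * h" q] q h by auto
  have \<eta>0: "0 < \<eta>" "\<eta> \<le> 1" using \<eta> h h' by linarith+
  define \<rho>' where "\<rho>' = \<rho> * \<eta> / h"
  have \<rho>': "\<rho> \<le> \<rho>'" "\<rho>' \<le> 2 * \<rho>" "\<rho>' / \<eta> = \<rho> / h"
    using \<eta> \<eta>0 h \<rho> by (auto simp: \<rho>'_def field_simps)
  have X: "(?\<kappa> + 1) * (\<rho> / h) * (CARD('d) * t / k) * (2 + ?p1 / (?p2 - ?p1))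
      \<le> 64 * CARD('d) * (?\<kappa> + 1) * \<rho>\<^sup>2 / K / h"
  proof -
    have r: "2 + ?p1 / (?p2 - ?p1) \<le> 4"
    proof -
      have "0 < ?p2 - ?p1" using p by linarith
      then show ?thesis using p by (simp add: field_simps)
    qed
    have "real (CARD('d) * t) \<le> CARD('d) * (2 * \<rho> / h)"
      unfolding of_nat_mult by (intro mult_left_mono t2) simp
    then have "CARD('d) * t / k \<le> CARD('d) * (2 * \<rho> / h) / (K / (8 * h))"
      using k8 h \<rho> by (intro frac_le) auto
    also have "\<dots> = 16 * CARD('d) * \<rho> / K" using h by simp
    finally have s: "CARD('d) * t / k \<le> 16 * CARD('d) * \<rho> / K" .
    have "(?\<kappa> + 1) * (\<rho> / h) * (CARD('d) * t / k) * (2 + ?p1 / (?p2 - ?p1))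
       \<le> (?\<kappa> + 1) * (\<rho> / h) * (16 * CARD('d) * \<rho> / K) * 4"
      using r s \<kappa> h \<rho> p by (intro mult_mono mult_nonneg_nonneg) auto
    also have "\<dots> = 64 * CARD('d) * (?\<kappa> + 1) * \<rho>\<^sup>2 / K / h"
      by (simp add: power2_eq_square mult_ac)
    finally show ?thesis .
  qed
  have win: "\<rho>' < \<eta> * real (2 * k)" "\<eta> * real (2 * k) \<le> K" "D \<le> \<eta> * real Dl" "\<eta> * real Dl \<le> 2 * D + 2"
  proof -
    have "\<rho> / h < 2 * real k"
    proof -
      have "(\<rho> + 2 * h) / h < (K / 2) / h"
        using h h' by (intro divide_strict_right_mono) auto
      then have "\<rho> / h + 2 < K / (2 * h)" using h by (simp add: add_divide_distrib)
      moreover have "K / (2 * h) = 2 * (K / (4 * h))" by simp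
      ultimately show ?thesis using k(2) by linarith
    qed
    then have "\<eta> * (\<rho> / h) < \<eta> * (2 * real k)"
      using \<eta>0 by (intro mult_strict_left_mono)
    then show "\<rho>' < \<eta> * real (2 * k)" by (simp add: \<rho>'_def mult.commute)
    have "\<eta> * real (2 * k) \<le> (2 * h) * (2 * (K / (4 * h)))"
      using \<eta> \<eta>0 k h \<rho> by (intro mult_mono) auto
    also have "\<dots> = K" using h by simp
    finally show "\<eta> * real (2 * k) \<le> K" .
    have "h * (D / h) \<le> \<eta> * real Dl"
      using \<eta> \<eta>0 Dl h \<rho> by (intro mult_mono) auto
    then show "D \<le> \<eta> * real Dl" using h by simp
    have "\<eta> * real Dl \<le> (2 * h) * (D / h + 1)"
      using \<eta> \<eta>0 Dl h by (intro mult_mono) auto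
    also have "\<dots> = 2 * D + 2 * h" using h by (simp add: field_simps)
    finally show "\<eta> * real Dl \<le> 2 * D + 2" using h' by linarith
  qed
  have "poisson_cost \<rho> D - poisson_cost \<rho> K \<le> poisson_cost \<rho> (\<eta> * real Dl) - poisson_cost \<rho> (\<eta> * real (2 * k))"
    using poisson_cost_mono_window[of \<rho> D "\<eta> * real Dl"] poisson_cost_mono_window[of \<rho> "\<eta> * real (2 * k)" K] win \<rho> \<rho>' by linarith
  also have "\<dots> \<le> poisson_cost \<rho>' (\<eta> * real Dl) - poisson_cost \<rho>' (\<eta> * real (2 * k))"
    using win \<rho> \<rho>' by (intro poisson_cost_mono) auto
  also have "\<dots> \<le> \<eta> * (lattice_cost TYPE('d) q (\<rho> / h) Dl - lattice_cost TYPE('d) q (\<rho> / h) (2 * k)) + c * h"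
  proof -
    have err: "\<bar>poisson_cost \<rho>' (\<eta> * real j) - \<eta> * lattice_cost TYPE('d) q (\<rho> / h) j\<bar> \<le> c * h / 2"
      if "1 \<le> j" "\<eta> * real j \<le> 2 * D + 2" for j
    proof -
      have "\<bar>poisson_cost \<rho>' (\<eta> * real j) - \<eta> * lattice_cost TYPE('d) q (\<rho> / h) j\<bar>
          \<le> \<eta> * (CARD('d) * (2 * second_moment TYPE('d) (\<eta> * real j) + 1) + ?\<kappa> * \<rho>')"
        using poisson_cost_approx[of \<rho>' \<eta> j] \<rho>' \<rho> \<eta>0 that \<eta>(3) by simp
      also have "\<dots> \<le> (2 * h) * (CARD('d) * (2 * ?sm + 1) + ?\<kappa> * (2 * \<rho>))"
        using \<eta> \<eta>0 \<rho> \<rho>' \<kappa> that second_moment_mono[where 'd = 'd, of "\<eta> * real j" "2 * D + 2"]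
          second_moment_nonneg[where 'd = 'd]
        by (intro mult_mono add_mono) auto
      also have "\<dots> = c * h / 2" by (simp add: c_def)
      finally show ?thesis .
    qed
    have "0 < \<rho> / h" using h \<rho> by simp
    then have "1 \<le> Dl" using \<rho>Dl by (cases Dl) auto
    then have e1: "\<bar>poisson_cost \<rho>' (\<eta> * real Dl) - \<eta> * lattice_cost TYPE('d) q (\<rho> / h) Dl\<bar> \<le> c * h / 2"
      using win by (intro err) auto
    have e2: "\<bar>poisson_cost \<rho>' (\<eta> * real (2 * k)) - \<eta> * lattice_cost TYPE('d) q (\<rho> / h) (2 * k)\<bar> \<le> c * h / 2"
      using win k1 \<rho> by (intro err) auto
    show ?thesis
      using e1 e2 unfolding right_diff_distrib by linarith
  qed
  also have "\<eta> * (lattice_cost TYPE('d) q (\<rho> / h) Dl - lattice_cost TYPE('d) q (\<rho> / h) (2 * k))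
      \<le> \<eta> * (64 * CARD('d) * (?\<kappa> + 1) * \<rho>\<^sup>2 / K / h)"
    using rate X \<eta>0 by (intro mult_left_mono) auto
  also have "\<dots> \<le> (2 * h) * (64 * CARD('d) * (?\<kappa> + 1) * \<rho>\<^sup>2 / K / h)"
    using \<eta> h \<rho> \<kappa> by (intro mult_right_mono) auto
  also have "\<dots> = 128 * CARD('d) * (?\<kappa> + 1) * \<rho>\<^sup>2 / K" using h by simp
  finally show "poisson_cost \<rho> D - poisson_cost \<rho> K \<le> 128 * CARD('d) * (?\<kappa> + 1) * \<rho>\<^sup>2 / K + c * h" by linarith
qed

text \<open>Doubling the mesh doubles the scale and at least multiplies the lattice mean by \<open>2\<^bsup>d-1\<^esup>\<close>, up to
  boundary terms. For \<open>d \<ge> 2\<close> the increment is therefore positive, and the mean value theorem turns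
  it into an add-one cost at an intermediate mesh; rescaling that mesh gives \<open>\<rho>'\<close> and \<open>K'\<close>.\<close>

theorem poisson_cost_positive:
  assumes d: "2 \<le> CARD('d)" and \<rho>: "1 \<le> \<rho>"
    and K: "192 * CARD('d) * (kiss TYPE('d) + 1) * 2 ^ CARD('d) * \<rho>\<^sup>2 \<le> K"
  shows "\<exists>\<rho>' K'. \<rho> \<le> \<rho>' \<and> \<rho>' \<le> 2 * \<rho> \<and> 2 * K \<le> K' \<and> K' \<le> 5 * K \<and> 1 / (192 * 2 ^ CARD('d)) \<le> poisson_cost \<rho>' K'"
proof -
  let ?n = "CARD('d)" and ?\<kappa> = "kiss TYPE('d)" and ?sm = "second_moment TYPE('d) (5 * K)"
  have \<kappa>: "1 \<le> ?\<kappa>" by (rule kiss_ge_1)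
  have sm: "0 \<le> ?sm" by (rule second_moment_nonneg)
  have K4: "4 \<le> K" and K0: "0 < K"
  proof -
    have "4 * 1 * 1 * 1 * 1 \<le> 192 * real ?n * (?\<kappa> + 1) * 2 ^ ?n * \<rho>\<^sup>2"
      using \<kappa> \<rho> d by (intro mult_mono) (auto intro: one_le_power)
    then show "4 \<le> K" using order_trans[OF _ K] by simp
    then show "0 < K" by simp
  qed
  \<comment> \<open>The product \<open>c * h\<close> bounds each of the discretisation errors met
    below; \<open>h\<close> is then taken so small that it is at most
    \<open>1 / (64 * 2 ^ CARD('d))\<close>.\<close>
  define c where "c = 4 * ?n * ?sm + 2 * (?n * (2 * ?sm + 1) + ?\<kappa> * (2 * \<rho>))"
  have c: "0 < c" unfolding c_def using sm \<kappa> \<rho> d by (intro add_nonneg_pos mult_pos_pos add_pos_pos) auto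
  define h where "h = min (1 / 8) (1 / (64 * 2 ^ ?n * c))"
  have h: "0 < h" "h \<le> 1 / 8" "c * h \<le> 1 / (64 * 2 ^ ?n)"
  proof -
    show "0 < h" "h \<le> 1 / 8" using c by (auto simp: h_def)
    have "c * h \<le> c * (1 / (64 * 2 ^ ?n * c))"
      using c by (intro mult_left_mono) (auto simp: h_def)
    then show "c * h \<le> 1 / (64 * 2 ^ ?n)" using c by simp
  qed
  define k where "k = nat \<lceil>K / h\<rceil>"
  define t where "t = Suc (nat \<lfloor>\<rho> / h\<rfloor>)"
  have k: "K / h \<le> real k" "real k < K / h + 1"
  proof -
    have "0 \<le> K / h" using h K0 by simp
    then show "K / h \<le> real k" "real k < K / h + 1"
      unfolding k_def by linarith+
  qed
  have kK: "K \<le> h * real k" "h * real k \<le> K + h"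
    using k h by (simp_all add: field_simps)
  have t: "\<rho> / h < real t" "real t \<le> 2 * \<rho> / h"
  proof -
    have "1 \<le> \<rho> / h" using h \<rho> by simp
    moreover from this have "\<rho> / h < real t" "real t \<le> \<rho> / h + 1"
      unfolding t_def by linarith+
    ultimately show "\<rho> / h < real t" "real t \<le> 2 * \<rho> / h" by auto
  qed
  have k1: "1 \<le> k"
  proof -
    have "0 < K / h" using h K0 by simp
    then show ?thesis using k(1) by linarith
  qed
  let ?p1 = "pocc TYPE('d) h" and ?p2 = "pocc TYPE('d) (2 * h)" and ?G = "lattice_mean TYPE('d) (\<rho> / h)"
  define X where "X = (?\<kappa> + 1) * (\<rho> / h) * (?n * t / k)"
  \<comment> \<open>The mean number of occupied cells in the box at mesh \<open>h\<close>, the unit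
    in which the increment of the mean is measured.\<close>
  define U where "U = ?p1 * (2 * real k) ^ ?n"
  define S where "S = ?n * (2 * h) * second_moment TYPE('d) (2 * h * real k)"
  have X0: "0 \<le> X" using \<kappa> \<rho> h by (simp add: X_def)
  have p: "0 < ?p1" "?p1 / 2 \<le> ?p2 - ?p1" "?p2 - ?p1 \<le> 2 ^ ?n * ?p1"
    using pocc_double[where 'd = 'd, of h] h by auto
  have p1le: "?p1 \<le> 1" "?p2 \<le> 1" using pocc_bounds(2)[where 'd = 'd, of h] pocc_bounds(2)[where 'd = 'd, of "2 * h"] h by auto
  have U: "(2 * K) ^ ?n / 2 \<le> U" "0 < U"
  proof -
    have "h ^ ?n / 2 * (2 * real k) ^ ?n \<le> U"
      unfolding U_def using pocc_ge_half[where 'd = 'd, of h] h by (intro mult_right_mono) auto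
    moreover have "(2 * K) ^ ?n \<le> (2 * (h * real k)) ^ ?n"
      using kK K0 by (intro power_mono) auto
    moreover have "(2 * (h * real k)) ^ ?n = h ^ ?n * (2 * real k) ^ ?n"
      unfolding power_mult_distrib[symmetric] by (simp add: mult_ac)
    ultimately show "(2 * K) ^ ?n / 2 \<le> U" by linarith
    show "0 < U" using p k1 by (simp add: U_def)
  qed
  have Xh: "h * X \<le> 2 * ?n * (?\<kappa> + 1) * \<rho>\<^sup>2 / K"
  proof -
    have "real (?n * t) \<le> ?n * (2 * \<rho> / h)"
      unfolding of_nat_mult by (intro mult_left_mono t) simp
    then have "?n * t / k \<le> ?n * (2 * \<rho> / h) / (K / h)"
      using k h K0 \<rho> by (intro frac_le) auto
    also have "\<dots> = 2 * ?n * \<rho> / K" using h by simp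
    finally have "X \<le> (?\<kappa> + 1) * (\<rho> / h) * (2 * ?n * \<rho> / K)"
      unfolding X_def using \<kappa> \<rho> h by (intro mult_left_mono) auto
    then have "h * X \<le> h * ((?\<kappa> + 1) * (\<rho> / h) * (2 * ?n * \<rho> / K))"
      using h by (intro mult_left_mono) auto
    also have "\<dots> = 2 * ?n * (?\<kappa> + 1) * \<rho>\<^sup>2 / K"
      using h by (simp add: power2_eq_square mult_ac)
    finally show ?thesis .
  qed
  obtain q where q: "?p1 < q" "q < ?p2"
    and incr: "?G ?p2 k - ?G ?p1 k \<le> (?p2 - ?p1) * ((2 * real k) ^ ?n * (lattice_cost TYPE('d) q (\<rho> / h) (2 * k) + X))"
    unfolding X_def using lattice_mean_increment_lattice[where 'd = 'd, of ?p1 ?p2 "\<rho> / h" t k] p p1le t k1 h \<rho> by auto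
  let ?a = "lattice_cost TYPE('d) q (\<rho> / h) (2 * k)"
  have S: "S \<le> 2 * ?n * h * ?sm"
  proof -
    have "2 * h * real k \<le> 5 * K" using kK h K4 by linarith
    then show ?thesis
      unfolding S_def using h k1 by (simp add: mult_left_mono second_moment_mono)
  qed
  \<comment> \<open>The same spatial box of half side \<open>2 * h * k\<close> is seen at mesh
    \<open>2 * h\<close> with lattice half side \<open>k\<close> and at mesh \<open>h\<close> with
    lattice half side \<open>2 * k\<close>. Tiling the latter by boxes of half side \<open>k\<close>
    gives the factor \<open>2 ^ CARD('d)\<close>; raising the cutoff from \<rho> to
    \<open>2 * \<rho>\<close> only increases the mean.\<close>
  have G2: "2 ^ ?n * (h * (?G ?p1 k - X * U)) - 2 * S \<le> 2 * h * ?G ?p2 k"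
  proof -
    have "poisson_mean (2 * \<rho>) (2 * h * real k) - S \<le> 2 * h * ?G ?p2 k"
      using poisson_mean_approx[of "2 * \<rho>" "2 * h" k] \<rho> h k1 by (simp add: S_def)
    moreover have "poisson_mean \<rho> (2 * h * real k) \<le> poisson_mean (2 * \<rho>) (2 * h * real k)"
      unfolding poisson_mean_def
    proof (rule integral_mono)
      show "cint \<rho> (P w \<inter> Qbox (2 * h * real k)) \<le> cint (2 * \<rho>) (P w \<inter> Qbox (2 * h * real k))"
        if "w \<in> space M" for w
        using that \<rho> by (intro cint_mono) auto
    qed (use \<rho> h k1 in \<open>auto intro!: cintQ_integrable\<close>)
    moreover have "h * ?G ?p1 (2 * k) - S \<le> poisson_mean \<rho> (2 * h * real k)"
    proof -
      have "\<bar>poisson_mean \<rho> (h * real (2 * k)) - h * ?G ?p1 (2 * k)\<bar> \<le> ?n * h * second_moment TYPE('d) (h * real (2 * k))"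
        using \<rho> h k1 by (intro poisson_mean_approx) auto
      moreover have "?n * h * second_moment TYPE('d) (h * real (2 * k)) \<le> S"
        unfolding S_def using h second_moment_nonneg[where 'd = 'd] by (simp add: mult_ac)
      ultimately show ?thesis by (simp add: mult_ac abs_le_iff)
    qed
    moreover have "h * (2 ^ ?n * (?G ?p1 k - X * U)) \<le> h * ?G ?p1 (2 * k)"
    proof (rule mult_left_mono)
      have "real 2 ^ ?n * (?G ?p1 k - (?\<kappa> + 1) * (\<rho> / h) * (?p1 * ((2 * real k) ^ ?n * (?n * t / k)))) \<le> ?G ?p1 (2 * k)"
        using p p1le t k1 h \<rho> by (intro lattice_mean_tiles(2)) auto
      then show "2 ^ ?n * (?G ?p1 k - X * U) \<le> ?G ?p1 (2 * k)"
        by (simp add: X_def U_def mult_ac)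
    qed (use h in auto)
    ultimately show ?thesis by (simp add: mult_ac)
  qed
  \<comment> \<open>The lattice radius \<open>1 / (8 * h)\<close> is \<open>1 / 8\<close> in space,
    small enough for a site to have at most half a neighbour in mean.\<close>
  have G1: "U / 16 \<le> h * ?G ?p1 k"
  proof -
    have "1 / (8 * h) * (?p1 * card (lbox (0::real^'d) k)) / 2 \<le> ?G ?p1 k"
      unfolding lattice_mean_def
    proof (rule Ep_cint_ge)
      have "?p1 * (2 * (1 / (8 * h)) + 1) ^ ?n \<le> h ^ ?n * (2 * (1 / (8 * h)) + 1) ^ ?n"
        using pocc_bounds(3)[where 'd = 'd, of h] h by (intro mult_right_mono) auto
      also have "\<dots> = (1 / 4 + h) ^ ?n"
        unfolding power_mult_distrib[symmetric] using h by (simp add: algebra_simps)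
      also have "\<dots> \<le> (1 / 2) ^ ?n"
        using h by (intro power_mono) auto
      also have "\<dots> \<le> (1 / 2) ^ 1"
        using d by (intro power_decreasing) auto
      finally show "?p1 * (2 * (1 / (8 * h)) + 1) ^ ?n \<le> 1 / 2" by simp
      show "1 / (8 * h) \<le> \<rho> / h" using h \<rho> by (simp add: field_simps)
    qed (use p p1le h lbox_lattice_pt in auto)
    then have "h * (1 / (8 * h) * (?p1 * card (lbox (0::real^'d) k)) / 2) \<le> h * ?G ?p1 k"
      using h by (intro mult_left_mono) auto
    then show ?thesis using h by (simp add: U_def)
  qed
  have "U / 16 - 2 ^ ?n / 2 * (h * X) * U - S \<le> h * (?G ?p2 k - ?G ?p1 k)"
  proof -
    \<comment> \<open>Dimension at least two enters here: \<open>2 ^ CARD('d) / 2 - 1\<close> is at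
      least one, so doubling the mesh gains a full multiple of the mean.\<close>
    have "(2::real) ^ 2 \<le> 2 ^ ?n" using d by (intro power_increasing) auto
    then have "1 * (h * ?G ?p1 k) \<le> (2 ^ ?n / 2 - 1) * (h * ?G ?p1 k)"
      using G1 U by (intro mult_right_mono) auto
    then show ?thesis
      using G1 G2 by (simp add: algebra_simps)
  qed
  also have "\<dots> \<le> h * ((?p2 - ?p1) * ((2 * real k) ^ ?n * (?a + X)))"
    using incr h by (intro mult_left_mono) auto
  finally have main: "U / 16 - 2 ^ ?n / 2 * (h * X) * U - S \<le> h * ((?p2 - ?p1) * ((2 * real k) ^ ?n * (?a + X)))" .
  have XK: "3 * 2 ^ ?n * (h * X) \<le> 1 / 32"
  proof -
    let ?T = "192 * ?n * (?\<kappa> + 1) * 2 ^ ?n * \<rho>\<^sup>2 / K"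
    have "3 * 2 ^ ?n * (h * X) \<le> 3 * 2 ^ ?n * (2 * ?n * (?\<kappa> + 1) * \<rho>\<^sup>2 / K)"
      using Xh by (intro mult_left_mono) auto
    also have "\<dots> = ?T / 32" by simp
    also have "\<dots> \<le> 1 / 32"
      using K K0 by (intro divide_right_mono) auto
    finally show ?thesis .
  qed
  have SU: "S \<le> U * (1 / (64 * 2 ^ ?n))"
  proof -
    have "2 * ?n * ?sm \<le> c"
    proof -
      have "0 \<le> ?n * ?sm" "0 \<le> ?n * (2 * ?sm + 1)" "0 \<le> ?\<kappa> * (2 * \<rho>)" using sm \<kappa> \<rho> by simp_all
      then show ?thesis unfolding c_def of_nat_mult of_nat_numeral by (simp add: algebra_simps)
    qed
    then have "2 * ?n * ?sm * h \<le> c * h" using h by (intro mult_right_mono) auto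
    then have "S \<le> c * h" using S by (simp add: mult_ac)
    moreover have "1 \<le> U"
    proof -
      have "(2::real) ^ 1 \<le> 2 ^ ?n" by (intro power_increasing) auto
      also have "\<dots> \<le> (2 * K) ^ ?n" using K4 by (intro power_mono) auto
      finally have "2 \<le> (2 * K) ^ ?n" unfolding power_one_right .
      then show ?thesis using U(1) by linarith
    qed
    then have "1 * (1 / (64 * 2 ^ ?n)) \<le> U * (1 / (64 * 2 ^ ?n))"
      by (intro mult_right_mono) auto
    ultimately show ?thesis using h(3) by linarith
  qed
  have aX: "1 / 32 \<le> 2 ^ ?n * (h * (?a + X))"
  proof -
    have XU: "2 ^ ?n / 2 * (h * X) * U \<le> U / 192"
    proof -
      have "2 ^ ?n / 2 * (h * X) \<le> 1 / 192" using XK by (simp add: mult_ac)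
      then have "2 ^ ?n / 2 * (h * X) * U \<le> 1 / 192 * U" using U by (intro mult_right_mono) auto
      also have "\<dots> = U / 192" by simp
      finally show ?thesis .
    qed
    have arith: "u / 32 \<le> R" if "u / 16 - B - S \<le> R" "B \<le> u / 192" "S \<le> C" "C \<le> u * (1 / 64)" "0 < u"
      for u B S C R :: real
      using that by linarith
    have U64: "U * (1 / (64 * 2 ^ ?n)) \<le> U * (1 / 64)"
      using U by (intro mult_left_mono) (auto simp: field_simps)
    have low: "U / 32 \<le> h * ((?p2 - ?p1) * ((2 * real k) ^ ?n * (?a + X)))"
      by (rule arith[OF main XU SU U64 U(2)])
    have "0 < U / 32" using U by simp
    then have "0 < h * ((?p2 - ?p1) * ((2 * real k) ^ ?n * (?a + X)))"
      using low by (rule less_le_trans)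
    then have "0 < (h * (?p2 - ?p1) * (2 * real k) ^ ?n) * (?a + X)"
      by (simp only: mult.assoc)
    moreover have "0 < h * (?p2 - ?p1) * (2 * real k) ^ ?n"
    proof -
      have "0 < ?p2 - ?p1" using p by linarith
      then show ?thesis using h k1 by simp
    qed
    \<comment> \<open>The sign has to be known before \<open>?p2 - ?p1\<close> is replaced by its
      upper bound in the product.\<close>
    ultimately have pos: "0 < ?a + X" by (simp only: zero_less_mult_pos)
    have "h * ((?p2 - ?p1) * ((2 * real k) ^ ?n * (?a + X))) \<le> h * ((2 ^ ?n * ?p1) * ((2 * real k) ^ ?n * (?a + X)))"
      using p pos h by (intro mult_left_mono mult_right_mono) auto
    also have "\<dots> = U * (2 ^ ?n * (h * (?a + X)))"
      by (simp add: U_def mult_ac)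
    finally have "U * (1 / 32) \<le> U * (2 ^ ?n * (h * (?a + X)))"
      using low order_trans[OF low] by simp
    then show ?thesis using U by (simp only: mult_le_cancel_left_pos)
  qed
  have ha: "1 / (48 * 2 ^ ?n) \<le> h * ?a"
  proof -
    have "1 / 48 \<le> 2 ^ ?n * (h * ?a)"
      using aX XK by (simp add: algebra_simps)
    then show ?thesis by (simp add: field_simps)
  qed
  obtain \<eta> where \<eta>: "h \<le> \<eta>" "\<eta> \<le> 2 * h" "q = pocc TYPE('d) \<eta>"
    using pocc_between[where 'd = 'd, of h "2 * h" q] q h by auto
  have \<eta>0: "0 < \<eta>" "\<eta> \<le> 1" using \<eta> h by linarith+
  define \<rho>' where "\<rho>' = \<rho> * \<eta> / h"
  have \<rho>': "\<rho> \<le> \<rho>'" "\<rho>' \<le> 2 * \<rho>" "\<rho>' / \<eta> = \<rho> / h"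
    using \<eta> \<eta>0 h \<rho> by (auto simp: \<rho>'_def field_simps)
  have win: "2 * K \<le> \<eta> * real (2 * k)" "\<eta> * real (2 * k) \<le> 5 * K"
  proof -
    have "h * real k \<le> \<eta> * real k" "\<eta> * real k \<le> 2 * h * real k"
      using \<eta> by (intro mult_right_mono; simp)+
    then show "2 * K \<le> \<eta> * real (2 * k)" "\<eta> * real (2 * k) \<le> 5 * K"
      using kK h K4 by simp_all
  qed
  have "\<bar>poisson_cost \<rho>' (\<eta> * real (2 * k)) - \<eta> * ?a\<bar>
      \<le> \<eta> * (?n * (2 * second_moment TYPE('d) (\<eta> * real (2 * k)) + 1) + ?\<kappa> * \<rho>')"
    using poisson_cost_approx[of \<rho>' \<eta> "2 * k"] \<rho>' \<rho> \<eta>0 k1 \<eta>(3) by simp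
  also have "\<dots> \<le> (2 * h) * (?n * (2 * ?sm + 1) + ?\<kappa> * (2 * \<rho>))"
    using \<eta> \<eta>0 \<rho> \<rho>' \<kappa> win K0 second_moment_mono[where 'd = 'd, of "\<eta> * real (2 * k)" "5 * K"]
      second_moment_nonneg[where 'd = 'd]
    by (intro mult_mono add_mono) auto
  also have "\<dots> \<le> c * h"
  proof -
    have "2 * (?n * (2 * ?sm + 1) + ?\<kappa> * (2 * \<rho>)) \<le> c" using sm by (simp add: c_def)
    then have "2 * (?n * (2 * ?sm + 1) + ?\<kappa> * (2 * \<rho>)) * h \<le> c * h" using h by (intro mult_right_mono) auto
    then show ?thesis by (simp add: mult_ac)
  qed
  finally have "\<eta> * ?a - 1 / (64 * 2 ^ ?n) \<le> poisson_cost \<rho>' (\<eta> * real (2 * k))"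
    using h(3) by linarith
  moreover have "h * ?a \<le> \<eta> * ?a"
  proof (rule mult_right_mono[OF \<eta>(1)])
    have "0 < h * ?a" using ha by (rule less_le_trans[rotated]) simp
    then show "0 \<le> ?a" using h by (simp add: zero_less_mult_iff)
  qed
  moreover have "1 / (48 * 2 ^ ?n) = 1 / (192 * 2 ^ ?n) + 1 / (64 * 2 ^ ?n :: real)" by simp
  ultimately have "1 / (192 * 2 ^ ?n) \<le> poisson_cost \<rho>' (\<eta> * real (2 * k))"
    using ha by linarith
  then show ?thesis
    using \<rho>' win by blast
qed

end

section \<open>Variances over lattice boxes\<close>

lemma tile_subset: "1 \<le> k \<Longrightarrow> c \<in> tile_centers m k \<Longrightarrow> lbox c k \<subseteq> lbox (0::real^'d) (m * k)"
  using tiles_Union[of k m, where 'd = 'd] by blast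

lemma flip_diff_restrict:
  "flip_diff z (\<lambda>A. f (A \<inter> T)) A = (if z \<in> T then flip_diff z f (A \<inter> T) else 0)"
proof (cases "z \<in> T")
  case True
  then have "insert z A \<inter> T = insert z (A \<inter> T)" "(A - {z}) \<inter> T = A \<inter> T - {z}" by auto
  then show ?thesis using True by (simp add: flip_diff_def)
next
  case False
  then have "insert z A \<inter> T = A \<inter> T" "(A - {z}) \<inter> T = A \<inter> T" by auto
  then show ?thesis using False by (simp add: flip_diff_def)
qed

text \<open>Only the tile of \<open>z\<close> reacts to a flip at \<open>z\<close>. Hence the flip
  of the error of the block approximation compares the global add-one cost with the cost inside that
  tile.\<close>

lemma flip_diff_tiles:
  fixes c :: "real^'d" and f :: "(real^'d) set \<Rightarrow> real"
  assumes "c \<in> tile_centers m k" "z \<in> lbox c k"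
  shows "flip_diff z (\<lambda>A. f A - (\<Sum>c\<in>tile_centers m k. f (A \<inter> lbox c k))) A
    = flip_diff z f A - flip_diff z f (A \<inter> lbox c k)"
proof -
  have "flip_diff z (\<lambda>A. \<Sum>c\<in>tile_centers m k. f (A \<inter> lbox c k)) A
      = (\<Sum>c'\<in>tile_centers m k. flip_diff z (\<lambda>A. f (A \<inter> lbox c' k)) A)"
    by (simp add: flip_diff_def sum_subtractf)
  also have "\<dots> = (\<Sum>c'\<in>tile_centers m k. if c' = c then flip_diff z f (A \<inter> lbox c k) else 0)"
  proof (rule sum.cong)
    fix c' :: "real^'d" assume c': "c' \<in> tile_centers m k"
    show "flip_diff z (\<lambda>A. f (A \<inter> lbox c' k)) A = (if c' = c then flip_diff z f (A \<inter> lbox c k) else 0)"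
      using tiles_disjoint[OF assms(1) c'] assms(2) by (auto simp: flip_diff_restrict)
  qed simp
  also have "\<dots> = flip_diff z f (A \<inter> lbox c k)"
    using assms(1) by (subst sum.delta) auto
  finally show ?thesis
    by (simp add: flip_diff_minus)
qed

lemma card_tiles_boundary:
  assumes "1 \<le> t" "1 \<le> k"
  shows "real (card (\<Union>c\<in>tile_centers m k. tile_boundary k t (c::real^'d)))
    \<le> (2 * real (m * k)) ^ CARD('d) * (CARD('d) * t / k)"
proof -
  have "card (\<Union>c\<in>tile_centers m k. tile_boundary k t (c::real^'d))
      \<le> (\<Sum>c\<in>(tile_centers m k :: (real^'d) set). card (tile_boundary k t c))"
    by (rule card_UN_le) simp
  also have "\<dots> = m ^ CARD('d) * card (lbox (0::real^'d) k - linner k t)"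
    using card_tile_centers[OF assms(2), of m, where 'd = 'd] by (simp add: card_tile_boundary)
  finally have "real (card (\<Union>c\<in>tile_centers m k. tile_boundary k t (c::real^'d)))
      \<le> real m ^ CARD('d) * real (card (lbox (0::real^'d) k - linner k t))"
    by (simp only: of_nat_mult[symmetric] of_nat_power[symmetric] of_nat_le_iff)
  also have "\<dots> \<le> real m ^ CARD('d) * ((2 * real k) ^ CARD('d) * (CARD('d) * t / k))"
    by (intro mult_left_mono card_lboundary assms) simp
  also have "\<dots> = (2 * real (m * k)) ^ CARD('d) * (CARD('d) * t / k)"
    by (simp add: power_mult_distrib)
  finally show ?thesis .
qed

lemma sum_plus_indicator:
  fixes a b :: real
  assumes "finite S"
  shows "(\<Sum>z\<in>S. a + (if z \<in> T then b else 0)) = card S * a + card (S \<inter> T) * b"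
  using assms by (simp add: sum.distrib sum.If_cases)

text \<open>By Efron-Stein, mean squared flips suffice. Away from tile boundaries a flip is the
  global minus the local add-one cost, nonnegative by monotonicity and at most
  \<open>kiss + 1\<close> times \<rho>, so its square is at most that constant times the flip
  itself. The mean flip is bounded by a difference of mean costs at two windows. Boundary sites are
  bounded crudely, but they are few.\<close>

lemma block_variance:
  fixes \<rho> p :: real and m k t :: nat
  assumes p: "0 \<le> p" "p \<le> 1" and \<rho>: "0 \<le> \<rho>" "\<rho> < real t" and k: "1 \<le> m" "1 \<le> k" "t \<le> k"
  shows "Vp p (lbox (0::real^'d) (m * k)) (\<lambda>A. cint \<rho> A - (\<Sum>c\<in>tile_centers m k. cint \<rho> (A \<inter> lbox c k)))
    \<le> p * ((2 * real (m * k)) ^ CARD('d) * ((kiss TYPE('d) + 1) * \<rho> * (lattice_cost TYPE('d) p \<rho> (2 * (m * k)) - lattice_cost TYPE('d) p \<rho> t)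
      + (CARD('d) * t / k) * ((kiss TYPE('d) + 1) * \<rho>)\<^sup>2))"
proof -
  let ?L = "lbox (0::real^'d) (m * k)" and ?C = "tile_centers m k :: (real^'d) set"
  let ?R = "(kiss TYPE('d) + 1) * \<rho>"
  let ?f = "\<lambda>A::(real^'d) set. cint \<rho> A - (\<Sum>c\<in>tile_centers m k. cint \<rho> (A \<inter> lbox c k))"
  let ?\<delta> = "lattice_cost TYPE('d) p \<rho> (2 * (m * k)) - lattice_cost TYPE('d) p \<rho> t"
  let ?bd = "\<Union>c\<in>?C. tile_boundary k t c"
  have t: "1 \<le> t" using \<rho> by linarith
  have R: "0 \<le> ?R" using kiss_ge_1[where 'd = 'd] \<rho> by simp
  have \<delta>: "0 \<le> ?\<delta>"
  proof -
    have mk: "k \<le> m * k" using k by simp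
    have "lbox (0::real^'d) t \<subseteq> lbox 0 (2 * (m * k))"
    proof
      fix x :: "real^'d" assume x: "x \<in> lbox 0 t"
      have "t \<le> 2 * (m * k)" using k mk by linarith
      then have "real t \<le> real (2 * (m * k))" by (simp only: of_nat_le_iff)
      then show "x \<in> lbox 0 (2 * (m * k))"
      proof (intro lboxI)
        fix i
        show "x $ i \<in> \<int>" "0 $ i - real (2 * (m * k)) \<le> x $ i" "x $ i < 0 $ i + real (2 * (m * k))"
          using lboxD[OF x, of i] \<open>real t \<le> real (2 * (m * k))\<close> by auto
      qed
    qed
    then show ?thesis
      unfolding lattice_cost_def
    proof -
      assume sub: "lbox (0::real^'d) t \<subseteq> lbox 0 (2 * (m * k))"
      have "\<rho> < dist 0 x" if "x \<in> lbox (0::real^'d) (2 * (m * k)) - lbox 0 t" for x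
        using lbox_far[of x 0 t] lbox_lattice_pt[of x] that \<rho> by fastforce
      then have "Ep p (lbox (0::real^'d) t) (flip_diff 0 (cint \<rho>)) \<le> Ep p (lbox (0::real^'d) (2 * (m * k))) (flip_diff 0 (cint \<rho>))"
        using p \<rho> sub by (intro Ep_flip_mono0) auto
      then show "0 \<le> Ep p (lbox (0::real^'d) (2 * (m * k))) (flip_diff 0 (cint \<rho>)) - Ep p (lbox (0::real^'d) t) (flip_diff 0 (cint \<rho>))"
        by simp
    qed
  qed
  have abs_le: "\<bar>flip_diff z (cint \<rho>) A - flip_diff z (cint \<rho>) A'\<bar> \<le> ?R"
    if "finite A" "finite A'" for z :: "real^'d" and A A'
    using flip_cint_bounds[OF that(1) \<rho>(1), of z] flip_cint_bounds[OF that(2) \<rho>(1), of z]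
    by (simp add: abs_le_iff algebra_simps)
  have sq: "x\<^sup>2 \<le> ?R\<^sup>2" if "\<bar>x\<bar> \<le> ?R" for x
    using that R by (simp add: abs_le_square_iff[symmetric])
  have main: "Ep p ?L (\<lambda>A. (flip_diff z ?f A)\<^sup>2) \<le> ?R * ?\<delta> + (if z \<in> ?bd then ?R\<^sup>2 else 0)" if z: "z \<in> ?L" for z
  proof -
    obtain c where c: "c \<in> ?C" "z \<in> lbox c k"
      using z tiles_Union[OF k(2), of m, where 'd = 'd] by blast
    have finA: "finite A" "finite (A \<inter> lbox c k)" if "A \<subseteq> ?L" for A
      using finite_subset[OF that finite_lbox] by auto
    have fl: "flip_diff z ?f A = flip_diff z (cint \<rho>) A - flip_diff z (cint \<rho>) (A \<inter> lbox c k)" for A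
      by (rule flip_diff_tiles[OF c])
    show ?thesis
    proof (cases "z \<in> ?bd")
      case True
      have "Ep p ?L (\<lambda>A. (flip_diff z ?f A)\<^sup>2) \<le> Ep p ?L (\<lambda>_. ?R\<^sup>2)"
        unfolding fl using abs_le finA by (intro Ep_mono p sq) auto
      then show ?thesis
        using True R \<delta> by (simp add: add_increasing)
    next
      case False
      then have zt: "z \<in> lbox c k - tile_boundary k t c" using c by blast
      have latc: "lattice_pt c" "lattice_pt z"
        using c tile_centers_lattice_pt lbox_lattice_pt by blast+
      have far: "\<rho> < dist z x" if "lattice_pt x" "x \<notin> lbox c k" for x
        using tile_boundary_far[OF latc(1) zt that] \<rho> by linarith
      have sub: "lbox c k \<subseteq> ?L" using tile_subset[OF k(2) c(1)] .
      have pos: "0 \<le> flip_diff z ?f A" if "A \<subseteq> ?L" for A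
      proof -
        have "flip_diff z (cint \<rho>) (A \<inter> lbox c k) \<le> flip_diff z (cint \<rho>) A"
        proof (rule flip_cint_mono0[OF finA(1)[OF that]])
          fix x assume "x \<in> A - A \<inter> lbox c k"
          then have "lattice_pt x" "x \<notin> lbox c k"
            using that lbox_lattice_pt[of x 0 "m * k"] by auto
          then show "\<rho> < dist z x" by (rule far)
        qed (use \<rho> in auto)
        then show ?thesis by (simp add: fl)
      qed
      have "Ep p ?L (\<lambda>A. (flip_diff z ?f A)\<^sup>2) \<le> Ep p ?L (\<lambda>A. ?R * flip_diff z ?f A)"
      proof (rule Ep_mono[OF p])
        fix A assume A: "A \<subseteq> ?L"
        have "flip_diff z ?f A \<le> ?R"
          using abs_le[OF finA[OF A], of z] by (simp add: fl abs_le_iff)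
        then show "(flip_diff z ?f A)\<^sup>2 \<le> ?R * flip_diff z ?f A"
          unfolding power2_eq_square using pos[OF A] by (intro mult_right_mono)
      qed
      also have "\<dots> = ?R * (Ep p ?L (flip_diff z (cint \<rho>)) - Ep p (lbox c k) (flip_diff z (cint \<rho>)))"
        using Ep_restrict[OF finite_lbox sub] by (simp add: Ep_cmult fl Ep_diff)
      \<comment> \<open>The whole box lies in the window of half side \<open>2 * (m * k)\<close>
        about \<open>z\<close>, and the tile contains the window of half side \<open>t\<close> about
        \<open>z\<close>; monotonicity and translation turn both means into costs at the
        origin.\<close>
      also have "\<dots> \<le> ?R * ?\<delta>"
      proof (intro mult_left_mono R diff_mono)
        have "?L \<subseteq> lbox z (2 * (m * k))"
        proof
          fix x assume x: "x \<in> ?L"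
          show "x \<in> lbox z (2 * (m * k))"
          proof (rule lboxI)
            fix i
            show "x $ i \<in> \<int>" "z $ i - real (2 * (m * k)) \<le> x $ i" "x $ i < z $ i + real (2 * (m * k))"
              using lboxD[OF x, of i] lboxD[OF z, of i] by auto
          qed
        qed
        then have "Ep p ?L (flip_diff z (cint \<rho>)) \<le> Ep p (lbox z (2 * (m * k))) (flip_diff z (cint \<rho>))"
        proof (intro Ep_flip_mono0 p)
          fix x assume "x \<in> lbox z (2 * (m * k)) - ?L"
          then have "lattice_pt x" "x \<notin> lbox c k"
            using sub lbox_lattice_pt[of x z "2 * (m * k)"] by auto
          then show "\<rho> < dist z x" by (rule far)
        qed (use \<rho> in auto)
        then show "Ep p ?L (flip_diff z (cint \<rho>)) \<le> lattice_cost TYPE('d) p \<rho> (2 * (m * k))"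
          by (simp add: Ep_flip_translate[OF latc(2)])
        have "lbox z t \<subseteq> lbox c k"
        proof
          fix x assume x: "x \<in> lbox z t"
          obtain u where u: "z = c + u" "u \<in> linner k t"
            using zt unfolding lbox_translate[OF latc(1)] tile_boundary_def by auto
          have "x - c \<in> lbox u t"
            using lboxD[OF x] latc u by (intro lboxI) (auto simp: lattice_pt_def algebra_simps)
          then have "x - c \<in> lbox 0 k" using linner_lbox_subset[OF u(2)] by blast
          then show "x \<in> lbox c k"
            unfolding lbox_translate[OF latc(1)] by (force simp: image_iff)
        qed
        moreover have "\<rho> < dist z x" if "x \<in> lbox c k - lbox z t" for x
          using lbox_far[of x z t] lbox_lattice_pt[of x] that \<rho> by fastforce
        ultimately have "Ep p (lbox z t) (flip_diff z (cint \<rho>)) \<le> Ep p (lbox c k) (flip_diff z (cint \<rho>))"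
          using p \<rho> by (intro Ep_flip_mono0) auto
        then show "lattice_cost TYPE('d) p \<rho> t \<le> Ep p (lbox c k) (flip_diff z (cint \<rho>))"
          by (simp add: Ep_flip_translate[OF latc(2)])
      qed
      finally show ?thesis using False by simp
    qed
  qed
  have "Vp p ?L ?f \<le> p * (1 - p) * (\<Sum>z\<in>?L. Ep p ?L (\<lambda>A. (flip_diff z ?f A)\<^sup>2))"
    by (intro Efron_Stein p) simp
  also have "\<dots> \<le> p * (\<Sum>z\<in>?L. Ep p ?L (\<lambda>A. (flip_diff z ?f A)\<^sup>2))"
  proof (rule mult_right_mono)
    show "p * (1 - p) \<le> p" using p by (simp add: mult_left_le)
    show "0 \<le> (\<Sum>z\<in>?L. Ep p ?L (\<lambda>A. (flip_diff z ?f A)\<^sup>2))"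
      using p by (intro sum_nonneg Ep_nonneg) auto
  qed
  also have "\<dots> \<le> p * ((2 * real (m * k)) ^ CARD('d) * (?R * ?\<delta>) + (2 * real (m * k)) ^ CARD('d) * (CARD('d) * t / k) * ?R\<^sup>2)"
  proof (rule mult_left_mono[OF _ p(1)])
    have "(\<Sum>z\<in>?L. Ep p ?L (\<lambda>A. (flip_diff z ?f A)\<^sup>2)) \<le> (\<Sum>z\<in>?L. ?R * ?\<delta> + (if z \<in> ?bd then ?R\<^sup>2 else 0))"
      by (intro sum_mono main)
    also have "\<dots> = card ?L * (?R * ?\<delta>) + card (?L \<inter> ?bd) * ?R\<^sup>2"
      by (rule sum_plus_indicator) simp
    also have "\<dots> \<le> (2 * real (m * k)) ^ CARD('d) * (?R * ?\<delta>) + (2 * real (m * k)) ^ CARD('d) * (CARD('d) * t / k) * ?R\<^sup>2"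
    proof (intro add_mono mult_right_mono)
      show "real (card ?L) \<le> (2 * real (m * k)) ^ CARD('d)" by simp
      have "card (?L \<inter> ?bd) \<le> card ?bd" by (intro card_mono) auto
      then have "real (card (?L \<inter> ?bd)) \<le> real (card ?bd)" by (simp only: of_nat_le_iff)
      also have "\<dots> \<le> (2 * real (m * k)) ^ CARD('d) * (CARD('d) * t / k)"
        by (rule card_tiles_boundary[OF t k(2)])
      finally show "real (card (?L \<inter> ?bd)) \<le> (2 * real (m * k)) ^ CARD('d) * (CARD('d) * t / k)" .
    qed (use R \<delta> in auto)
    finally show "(\<Sum>z\<in>?L. Ep p ?L (\<lambda>A. (flip_diff z ?f A)\<^sup>2))
        \<le> (2 * real (m * k)) ^ CARD('d) * (?R * ?\<delta>) + (2 * real (m * k)) ^ CARD('d) * (CARD('d) * t / k) * ?R\<^sup>2" .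
  qed
  finally show ?thesis by (simp add: algebra_simps)
qed

text \<open>At an inner site the mean flip is at least the cost in the smaller window
  \<open>t\<close>, and squared mean flips bound the variance from below.\<close>

lemma variance_lower:
  fixes \<rho> p a :: real and n t :: nat
  assumes p: "0 \<le> p" "p \<le> 1" and \<rho>: "0 \<le> \<rho>" "\<rho> < real t" and n: "1 \<le> n"
    and a: "0 \<le> a" "a \<le> lattice_cost TYPE('d::finite) p \<rho> t"
  shows "p * (1 - p) * ((2 * real n) ^ CARD('d) * (1 - CARD('d) * t / n) * a\<^sup>2) \<le> Vp p (lbox (0::real^'d) n) (cint \<rho>)"
proof -
  let ?L = "lbox (0::real^'d) n"
  have t: "1 \<le> t" using \<rho> by linarith
  have in_L: "linner n t \<subseteq> ?L" by (rule linner_subset[OF t])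
  have fin: "finite (linner n t :: (real^'d) set)" using in_L finite_lbox finite_subset by blast
  have "(2 * real n) ^ CARD('d) * (1 - CARD('d) * t / n) * a\<^sup>2 \<le> real (card (linner n t :: (real^'d) set)) * a\<^sup>2"
  proof (intro mult_right_mono)
    have "card ?L = card (linner n t :: (real^'d) set) + card (?L - linner n t)"
      using card_mono[OF finite_lbox in_L] by (simp only: card_Diff_subset[OF fin in_L] le_add_diff_inverse)
    then have "(2 * real n) ^ CARD('d) = real (card (linner n t :: (real^'d) set)) + real (card (?L - linner n t))"
      unfolding card_lbox0 by (metis of_nat_add of_nat_mult of_nat_numeral of_nat_power)
    then show "(2 * real n) ^ CARD('d) * (1 - CARD('d) * t / n) \<le> real (card (linner n t :: (real^'d) set))"
      using card_lboundary[OF t n, where 'd = 'd] by (simp add: algebra_simps)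
  qed simp
  also have "\<dots> = (\<Sum>z\<in>(linner n t :: (real^'d) set). a\<^sup>2)" by simp
  also have "\<dots> \<le> (\<Sum>z\<in>linner n t. (Ep p ?L (flip_diff z (cint \<rho>)))\<^sup>2)"
  proof (rule sum_mono)
    fix z :: "real^'d" assume z: "z \<in> linner n t"
    have "Ep p (lbox z t) (flip_diff z (cint \<rho>)) \<le> Ep p ?L (flip_diff z (cint \<rho>))"
    proof (intro Ep_flip_mono0 p linner_lbox_subset[OF z])
      show "\<rho> < dist z x" if "x \<in> ?L - lbox z t" for x
        using lbox_far[of x z t] lbox_lattice_pt[of x] that \<rho> by fastforce
    qed (use \<rho> in auto)
    then have "a \<le> Ep p ?L (flip_diff z (cint \<rho>))"
      using a Ep_flip_translate[OF linner_lattice_pt[OF z], of p t \<rho>] by simp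
    then show "a\<^sup>2 \<le> (Ep p ?L (flip_diff z (cint \<rho>)))\<^sup>2"
      using a by (intro power_mono) auto
  qed
  also have "\<dots> \<le> (\<Sum>z\<in>?L. (Ep p ?L (flip_diff z (cint \<rho>)))\<^sup>2)"
    using in_L by (intro sum_mono2) auto
  finally have "p * (1 - p) * ((2 * real n) ^ CARD('d) * (1 - CARD('d) * t / n) * a\<^sup>2)
      \<le> p * (1 - p) * (\<Sum>z\<in>?L. (Ep p ?L (flip_diff z (cint \<rho>)))\<^sup>2)"
    using p by (intro mult_left_mono) auto
  also have "\<dots> \<le> Vp p ?L (cint \<rho>)"
    by (intro Vp_ge_sum_flip p) simp
  finally show ?thesis .
qed

section \<open>Connectivity when every tile is occupied, and the rarity of holes\<close>

lemma convex_Qbox: "convex (Qbox K :: (real^'d) set)"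
proof -
  have "Qbox K = (\<Inter>i. {x::real^'d. - K \<le> axis i 1 \<bullet> x} \<inter> {x. axis i 1 \<bullet> x < K})"
    by (auto simp: Qbox_def inner_axis')
  also have "convex \<dots>"
    using convex_halfspace_ge[of "- K"] convex_halfspace_lt
    by (intro convex_INT convex_Int) auto
  finally show ?thesis .
qed

text \<open>Every point of the box is, in each coordinate, within \<open>2 * u + 1\<close> of an
  occupied lattice point: tiles have side \<open>2 * u\<close>, and rounding the point adds one. The
  convex covering criterion then applies with a third of \<rho>.\<close>

lemma occupied_tiles_connected:
  fixes A :: "(real^'d) set"
  assumes m: "1 \<le> m" "1 \<le> u" and A: "A \<subseteq> lbox 0 (m * u)"
    and occ: "\<And>c. c \<in> tile_centers m u \<Longrightarrow> A \<inter> lbox c u \<noteq> {}"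
    and \<rho>: "CARD('d) * (2 * real u + 1) \<le> \<rho> / 3"
  shows "ncomp \<rho> A = 1"
proof (rule ncomp_near_convex_cover)
  have one: "(1::real) * real (m * u) = real (m * u)" by simp
  show "finite A" using A finite_lbox finite_subset by blast
  show "convex (Qbox (real (m * u)) :: (real^'d) set)" by (rule convex_Qbox)
  show "A \<subseteq> Qbox (real (m * u))"
    using A lboxD by (fastforce simp: Qbox_def)
  have "card (tile_centers m u :: (real^'d) set) \<noteq> 0"
    using card_tile_centers[OF m(2), of m, where 'd = 'd] m by simp
  then show "A \<noteq> {}" using occ by fastforce
  have "0 < CARD('d) * (2 * real u + 1)" by simp
  then show "0 < \<rho>" using \<rho> by linarith
  fix q :: "real^'d" assume "q \<in> Qbox (real (m * u))"
  then have "lround 1 q \<in> lbox 0 (m * u)"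
    using lround_lbox_iff[of 1 q "m * u"] by simp
  then obtain c where c: "c \<in> tile_centers m u" "lround 1 q \<in> lbox c u"
    using tiles_Union[OF m(2), of m, where 'd = 'd] by blast
  obtain a where a: "a \<in> A" "a \<in> lbox c u" using occ[OF c(1)] by blast
  have "\<bar>(q - a) $ i\<bar> \<le> 2 * real u + 1" for i
  proof -
    have "\<bar>q $ i - lround 1 q $ i\<bar> \<le> 1"
      unfolding lround_def by simp linarith
    then show ?thesis
      using lboxD[OF c(2), of i] lboxD[OF a(2), of i] by (simp add: abs_le_iff)
  qed
  then have "(\<Sum>i\<in>UNIV. \<bar>(q - a) $ i\<bar>) \<le> (\<Sum>i\<in>(UNIV::'d set). 2 * real u + 1)"
    by (intro sum_mono)
  then have "dist q a \<le> CARD('d) * (2 * real u + 1)"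
    using norm_le_l1_cart[of "q - a"] by (simp add: dist_norm)
  then show "\<exists>a\<in>A. dist q a \<le> \<rho> / 3"
    using a \<rho> by (intro bexI[of _ a]) auto
qed

definition has_hole :: "nat \<Rightarrow> nat \<Rightarrow> (real^'d) set \<Rightarrow> bool" where
  "has_hole m u A \<longleftrightarrow> (\<exists>c\<in>tile_centers m u. A \<inter> lbox c u = {})"

lemma cint_no_hole:
  fixes A :: "(real^'d) set"
  assumes "1 \<le> m" "1 \<le> u" "A \<subseteq> lbox 0 (m * u)" "\<not> has_hole m u A"
    "CARD('d) * (2 * real u + 1) \<le> \<rho> / 3" "\<rho> \<le> \<rho>'"
  shows "cint \<rho>' A - \<rho>' = cint \<rho> A - \<rho>"
proof -
  have "0 < CARD('d) * (2 * real u + 1)" by simp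
  then have "0 \<le> \<rho>" using assms(5) by linarith
  moreover have "ncomp \<rho> A = 1"
    using assms by (intro occupied_tiles_connected[of m u]) (auto simp: has_hole_def)
  moreover have "finite A" using assms(3) finite_lbox finite_subset by blast
  ultimately show ?thesis
    using assms(6) cint_diff_connected[of A \<rho> \<rho>'] by simp
qed

lemma cint_tail_abs:
  assumes "finite A" "0 \<le> \<rho>" "\<rho> \<le> \<rho>'"
  shows "\<bar>(cint \<rho>' A - \<rho>') - (cint \<rho> A - \<rho>)\<bar> \<le> \<rho>' * (1 + card A)"
proof -
  have "cint \<rho> A \<le> cint \<rho>' A" "cint \<rho>' A \<le> cint \<rho> A + (\<rho>' - \<rho>) * card A"
    using cint_mono[OF assms] cint_diff_le[OF assms] by auto
  moreover have "(\<rho>' - \<rho>) * card A \<le> \<rho>' * card A"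
    using assms by (intro mult_right_mono) auto
  moreover have "0 \<le> \<rho>' * card A" using assms by simp
  moreover have "\<rho>' * (1 + card A) = \<rho>' + \<rho>' * card A" by (simp add: algebra_simps)
  ultimately show ?thesis
    unfolding abs_le_iff using assms(2,3) by linarith
qed

text \<open>Union bound over the tiles. On the event that a given tile is empty, the remaining sites
  still form an independent Bernoulli set, so the probability of emptiness factors off the second
  moment of the size.\<close>

lemma hole_second_moment:
  fixes p :: real
  assumes p: "0 \<le> p" "p \<le> 1" and u: "1 \<le> u"
  shows "Ep p (lbox (0::real^'d) (m * u)) (\<lambda>A. if has_hole m u A then (1 + real (card A))\<^sup>2 else 0)
    \<le> real m ^ CARD('d) * ((1 - p) ^ ((2 * u) ^ CARD('d)) * (4 * (p * (2 * real (m * u)) ^ CARD('d) + 1)\<^sup>2))"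
proof -
  let ?L = "lbox (0::real^'d) (m * u)" and ?C = "tile_centers m u :: (real^'d) set"
  let ?g = "\<lambda>A::(real^'d) set. (1 + real (card A))\<^sup>2"
  have mom: "Ep p \<Lambda> ?g \<le> 4 * (p * (2 * real (m * u)) ^ CARD('d) + 1)\<^sup>2" if "\<Lambda> \<subseteq> ?L" for \<Lambda>
  proof -
    have fin: "finite \<Lambda>" using that finite_lbox finite_subset by blast
    have "card \<Lambda> \<le> card ?L" using that by (intro card_mono) auto
    then have card: "real (card \<Lambda>) \<le> (2 * real (m * u)) ^ CARD('d)"
      unfolding card_lbox0 by (metis of_nat_le_iff of_nat_mult of_nat_numeral of_nat_power)
    have "Ep p \<Lambda> ?g \<le> Ep p \<Lambda> (\<lambda>A. 2 + 2 * real (card A) ^ 2)"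
    proof (rule Ep_mono[OF p])
      fix A :: "(real^'d) set"
      have "0 \<le> (1 - real (card A))\<^sup>2" by simp
      then show "?g A \<le> 2 + 2 * real (card A) ^ 2"
        by (simp add: power2_eq_square algebra_simps)
    qed
    also have "\<dots> = 2 + 2 * Ep p \<Lambda> (\<lambda>A. real (card A) ^ 2)"
      using fin by (simp add: Ep_add Ep_cmult)
    also have "\<dots> \<le> 2 + 2 * (p * card \<Lambda> + 1)\<^sup>2"
      using Ep_card_pow(1)[OF p fin] by simp
    also have "\<dots> \<le> 2 + 2 * (p * (2 * real (m * u)) ^ CARD('d) + 1)\<^sup>2"
      using p card by (intro add_left_mono mult_left_mono power_mono add_right_mono) auto
    also have "\<dots> \<le> 4 * (p * (2 * real (m * u)) ^ CARD('d) + 1)\<^sup>2"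
    proof -
      have "1 \<le> (p * (2 * real (m * u)) ^ CARD('d) + 1)\<^sup>2"
        using p by (intro one_le_power) simp
      then show ?thesis by linarith
    qed
    finally show ?thesis .
  qed
  have "Ep p ?L (\<lambda>A. if has_hole m u A then ?g A else 0)
      \<le> Ep p ?L (\<lambda>A. \<Sum>c\<in>?C. if A \<inter> lbox c u = {} then ?g A else 0)"
  proof (rule Ep_mono[OF p])
    fix A :: "(real^'d) set"
    show "(if has_hole m u A then ?g A else 0) \<le> (\<Sum>c\<in>?C. if A \<inter> lbox c u = {} then ?g A else 0)"
    proof (cases "has_hole m u A")
      case True
      then obtain c where c: "c \<in> ?C" "A \<inter> lbox c u = {}" by (auto simp: has_hole_def)
      then have "?g A = (if A \<inter> lbox c u = {} then ?g A else 0)" by simp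
      also have "\<dots> \<le> (\<Sum>c\<in>?C. if A \<inter> lbox c u = {} then ?g A else 0)"
        using c(1) by (intro member_le_sum) auto
      finally show ?thesis using True by simp
    qed (auto intro!: sum_nonneg)
  qed
  also have "\<dots> = (\<Sum>c\<in>?C. (1 - p) ^ card (lbox c u) * Ep p (?L - lbox c u) ?g)"
    unfolding Ep_sum using tile_subset[OF u] by (intro sum.cong Ep_avoid) auto
  also have "\<dots> \<le> (\<Sum>c\<in>?C. (1 - p) ^ ((2 * u) ^ CARD('d)) * (4 * (p * (2 * real (m * u)) ^ CARD('d) + 1)\<^sup>2))"
  proof (rule sum_mono)
    fix c :: "real^'d" assume c: "c \<in> ?C"
    have card: "card (lbox c u) = (2 * u) ^ CARD('d)"
      by (rule card_lbox[OF tile_centers_lattice_pt[OF c]])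
    show "(1 - p) ^ card (lbox c u) * Ep p (?L - lbox c u) ?g
        \<le> (1 - p) ^ ((2 * u) ^ CARD('d)) * (4 * (p * (2 * real (m * u)) ^ CARD('d) + 1)\<^sup>2)"
      unfolding card using p by (intro mult_left_mono mom) auto
  qed
  also have "\<dots> = real m ^ CARD('d) * ((1 - p) ^ ((2 * u) ^ CARD('d)) * (4 * (p * (2 * real (m * u)) ^ CARD('d) + 1)\<^sup>2))"
    using card_tile_centers[OF u, of m, where 'd = 'd] by simp
  finally show ?thesis .
qed

lemma block_third_moment:
  fixes p \<rho> :: real and c :: "real^'d"
  assumes p: "0 \<le> p" "p \<le> 1" and \<rho>: "0 \<le> \<rho>" and c: "lattice_pt c"
  shows "Ep p (lbox c k) (\<lambda>A. (cint \<rho> A) ^ 3) \<le> \<rho> ^ 3 * (p * (2 * real k) ^ CARD('d) + 2) ^ 3"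
proof -
  have "Ep p (lbox c k) (\<lambda>A. (cint \<rho> A) ^ 3) \<le> Ep p (lbox c k) (\<lambda>A. \<rho> ^ 3 * real (card A) ^ 3)"
  proof (rule Ep_mono[OF p])
    fix A assume "A \<subseteq> lbox c k"
    then have "finite A" using finite_lbox finite_subset by blast
    then have "(cint \<rho> A) ^ 3 \<le> (\<rho> * card A) ^ 3"
      using cint_nonneg cint_le \<rho> by (intro power_mono) auto
    then show "(cint \<rho> A) ^ 3 \<le> \<rho> ^ 3 * real (card A) ^ 3"
      by (simp add: power_mult_distrib)
  qed
  also have "\<dots> \<le> \<rho> ^ 3 * (p * card (lbox c k) + 2) ^ 3"
    unfolding Ep_cmult using \<rho> Ep_card_pow(2)[OF p finite_lbox] by (intro mult_left_mono) auto
  finally show ?thesis using c by (simp add: card_lbox)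
qed

section \<open>Lindeberg's method for Lipschitz test functions\<close>

lemma prob_space_std_normal: "prob_space std_normal"
  unfolding std_normal_def using prob_space_normal_density[of 1 0] by simp

lemma space_std_normal [simp]: "space std_normal = UNIV"
  by (simp add: std_normal_def)

lemma sets_std_normal [simp, measurable_cong]: "sets std_normal = sets borel"
  by (simp add: std_normal_def)

lemma measure_std_normal_UNIV [simp]: "measure std_normal UNIV = 1"
  using prob_space.prob_space[OF prob_space_std_normal] by simp

lemma std_normal_integral:
  fixes f :: "real \<Rightarrow> real"
  assumes [measurable]: "f \<in> borel_measurable borel"
  shows "(\<integral>z. f z \<partial>std_normal) = (\<integral>z. std_normal_density z * f z \<partial>lborel)"
    and "integrable std_normal f \<longleftrightarrow> integrable lborel (\<lambda>z. std_normal_density z * f z)"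
  unfolding std_normal_def by (subst integral_density integrable_density; simp)+

lemma std_normal_abs_moments:
  shows "integrable std_normal (\<lambda>z. \<bar>z\<bar> ^ k)" "integrable std_normal (\<lambda>z. z ^ k)"
    and "(\<integral>z. z \<partial>std_normal) = 0" "(\<integral>z. z\<^sup>2 \<partial>std_normal) = 1"
    and "(\<integral>z. \<bar>z\<bar> \<partial>std_normal) \<le> 1" "(\<integral>z. \<bar>z\<bar> ^ 3 \<partial>std_normal) \<le> 2"
proof -
  show "integrable std_normal (\<lambda>z. \<bar>z\<bar> ^ k)" "integrable std_normal (\<lambda>z. z ^ k)"
    using integrable_std_normal_moment_abs integrable_std_normal_moment by (simp_all add: std_normal_integral)
  show "(\<integral>z. z \<partial>std_normal) = 0"
    using integral_std_normal_moment_odd[of 0] by (simp add: std_normal_integral)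
  show "(\<integral>z. z\<^sup>2 \<partial>std_normal) = 1"
    using integral_std_normal_moment_even[of 1] by (simp add: std_normal_integral)
  have "2 / pi \<le> 1" using pi_ge_two by (simp add: field_simps)
  then have s: "sqrt (2 / pi) \<le> 1" by simp
  show "(\<integral>z. \<bar>z\<bar> \<partial>std_normal) \<le> 1"
    using integral_std_normal_moment_abs_odd[of 0] s by (simp add: std_normal_integral)
  show "(\<integral>z. \<bar>z\<bar> ^ 3 \<partial>std_normal) \<le> 2"
    using integral_std_normal_moment_abs_odd[of 1] s by (simp add: std_normal_integral numeral_3_eq_3)
qed

section \<open>Averages against centred Gaussian laws\<close>

definition gauss_avg :: "real \<Rightarrow> (real \<Rightarrow> real) \<Rightarrow> real \<Rightarrow> real" where
  "gauss_avg s g x = (\<integral>z. g (x + s * z) \<partial>std_normal)"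

lemma gauss_avg_integrable:
  assumes [measurable]: "g \<in> borel_measurable borel" and g: "\<And>y. \<bar>g y\<bar> \<le> a + b * \<bar>y\<bar>" and "0 \<le> b"
  shows "integrable std_normal (\<lambda>z. g (x + s * z))"
proof (rule Bochner_Integration.integrable_bound)
  interpret prob_space std_normal by (rule prob_space_std_normal)
  show "integrable std_normal (\<lambda>z. \<bar>a\<bar> + b * \<bar>x\<bar> + b * \<bar>s\<bar> * \<bar>z\<bar>)"
    using std_normal_abs_moments(1)[of 1] by simp
  show "AE z in std_normal. norm (g (x + s * z)) \<le> norm (\<bar>a\<bar> + b * \<bar>x\<bar> + b * \<bar>s\<bar> * \<bar>z\<bar>)"
  proof (rule AE_I2)
    fix z
    have "b * \<bar>x + s * z\<bar> \<le> b * (\<bar>x\<bar> + \<bar>s\<bar> * \<bar>z\<bar>)"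
      using assms(3) abs_triangle_ineq[of x "s * z"] by (intro mult_left_mono) (auto simp: abs_mult)
    then have "\<bar>g (x + s * z)\<bar> \<le> \<bar>a\<bar> + b * \<bar>x\<bar> + b * \<bar>s\<bar> * \<bar>z\<bar>"
      using g[of "x + s * z"] by (simp add: algebra_simps) linarith
    also have "\<dots> \<le> \<bar>\<bar>a\<bar> + b * \<bar>x\<bar> + b * \<bar>s\<bar> * \<bar>z\<bar>\<bar>" by simp
    finally show "norm (g (x + s * z)) \<le> norm (\<bar>a\<bar> + b * \<bar>x\<bar> + b * \<bar>s\<bar> * \<bar>z\<bar>)" by simp
  qed
qed measurable

lemma gauss_avg_0 [simp]: "gauss_avg 0 g x = g x"
proof -
  interpret prob_space std_normal by (rule prob_space_std_normal)
  show ?thesis by (simp add: gauss_avg_def prob_space)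
qed

lemma distr_std_normal_scale:
  assumes "0 < s"
  shows "distr std_normal borel (\<lambda>z. s * z) = density lborel (normal_density 0 s)"
proof -
  interpret prob_space std_normal by (rule prob_space_std_normal)
  have "distributed std_normal lborel (\<lambda>z. z) std_normal_density"
    unfolding distributed_def by (auto simp: std_normal_def distr_id2)
  from normal_density_affine[OF this _ less_imp_neq[OF assms, symmetric], of 0]
  have "distributed std_normal lborel (\<lambda>z. s * z) (normal_density 0 s)"
    using assms by simp
  then have "distr std_normal lborel (\<lambda>z. s * z) = density lborel (normal_density 0 s)"
    by (simp add: distributed_def)
  moreover have "distr std_normal lborel (\<lambda>z. s * z) = distr std_normal borel (\<lambda>z. s * z)"
    by (intro distr_cong) auto
  ultimately show ?thesis by simp
qed

lemma gauss_avg_alt: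
  assumes "0 < s" and [measurable]: "g \<in> borel_measurable borel"
  shows "gauss_avg s g x = (\<integral>w. g (x + w) \<partial>density lborel (normal_density 0 s))"
  unfolding gauss_avg_def distr_std_normal_scale[OF assms(1), symmetric] by (subst integral_distr) auto

lemma normal_convolution:
  assumes "0 < s" "0 < s'"
  shows "density lborel (normal_density 0 s) \<star> density lborel (normal_density 0 s')
    = density lborel (normal_density 0 (sqrt (s\<^sup>2 + s'\<^sup>2)))"
proof -
  have fin: "finite_measure (density lborel (normal_density 0 \<sigma>))" if "0 < \<sigma>" for \<sigma>
    using prob_space_normal_density[OF that] prob_space.finite_measure by blast
  have "density lborel (normal_density 0 s) \<star> density lborel (normal_density 0 s')
      = density lborel (\<lambda>x. \<integral>\<^sup>+y. ennreal (normal_density 0 s (x - y)) * ennreal (normal_density 0 s' y) \<partial>lborel)"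
    using fin assms by (intro convolution_density) auto
  also have "\<dots> = density lborel (normal_density 0 (sqrt (s\<^sup>2 + s'\<^sup>2)))"
    using conv_normal_density_zero_mean[OF assms] by (simp add: ennreal_mult'[symmetric])
  finally show ?thesis .
qed

text \<open>Convolving centred normal laws adds variances, so Gaussian averages compose. Zero
  variances are treated apart because they have no density.\<close>

lemma gauss_avg_nsm:
  assumes "0 \<le> s" "0 \<le> s'" and [measurable]: "g \<in> borel_measurable borel"
    and g: "\<And>y. \<bar>g y\<bar> \<le> a + b * \<bar>y\<bar>" "0 \<le> b"
  shows "gauss_avg s (gauss_avg s' g) x = gauss_avg (sqrt (s\<^sup>2 + s'\<^sup>2)) g x"
proof (cases "s = 0 \<or> s' = 0")
  case True
  then show ?thesis
  proof
    assume "s' = 0"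
    then have "gauss_avg s' g = g" by auto
    then show ?thesis using \<open>s' = 0\<close> assms by simp
  qed (use assms in simp)
next
  case False
  then have pos: "0 < s" "0 < s'" using assms by auto
  let ?\<nu> = "\<lambda>s. density lborel (normal_density 0 s)"
  have pr: "prob_space (?\<nu> \<sigma>)" if "0 < \<sigma>" for \<sigma>
    using prob_space_normal_density[OF that] .
  interpret A: prob_space "?\<nu> s" by (rule pr[OF pos(1)])
  interpret B: prob_space "?\<nu> s'" by (rule pr[OF pos(2)])
  interpret AB: pair_prob_space "?\<nu> s" "?\<nu> s'" ..
  let ?r = "sqrt (s\<^sup>2 + s'\<^sup>2)"
  have r: "0 < ?r" using pos by (simp add: sum_power2_gt_zero_iff)
  have int: "integrable (?\<nu> ?r) (\<lambda>w. g (x + w))"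
    unfolding distr_std_normal_scale[OF r, symmetric]
    using gauss_avg_integrable[OF assms(3) g, of x ?r] by (subst integrable_distr_eq) auto
  have conv: "?\<nu> ?r = distr (?\<nu> s \<Otimes>\<^sub>M ?\<nu> s') borel (\<lambda>(u, v). u + v)"
    using normal_convolution[OF pos] by (simp add: convolution_def)
  have m[measurable]: "(\<lambda>(u, v). u + v :: real) \<in> borel_measurable (?\<nu> s \<Otimes>\<^sub>M ?\<nu> s')"
    by measurable
  have int2: "integrable (?\<nu> s \<Otimes>\<^sub>M ?\<nu> s') (\<lambda>(u, v). g (x + (u + v)))"
    using int unfolding conv by (subst (asm) integrable_distr_eq) (auto simp: case_prod_unfold)
  have inner: "gauss_avg s' g (x + u) = (\<integral>v. g (x + (u + v)) \<partial>?\<nu> s')" for u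
    using gauss_avg_alt[OF pos(2) assms(3), of "x + u"] by (simp add: add.assoc)
  have [measurable]: "gauss_avg s' g \<in> borel_measurable borel"
  proof -
    interpret N: prob_space std_normal by (rule prob_space_std_normal)
    show ?thesis unfolding gauss_avg_def[abs_def] by measurable
  qed
  have "gauss_avg s (gauss_avg s' g) x = (\<integral>u. gauss_avg s' g (x + u) \<partial>?\<nu> s)"
    by (rule gauss_avg_alt[OF pos(1)]) simp
  also have "\<dots> = (\<integral>u. (\<integral>v. g (x + (u + v)) \<partial>?\<nu> s') \<partial>?\<nu> s)"
    by (simp add: inner)
  also have "\<dots> = (\<integral>(u, v). g (x + (u + v)) \<partial>(?\<nu> s \<Otimes>\<^sub>M ?\<nu> s'))"
    using AB.integral_fst'[OF int2] by simp
  also have "\<dots> = (\<integral>w. g (x + w) \<partial>?\<nu> ?r)"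
    unfolding conv by (subst integral_distr) (auto simp: case_prod_unfold)
  also have "\<dots> = gauss_avg ?r g x"
    by (rule gauss_avg_alt[OF r, symmetric]) simp
  finally show ?thesis .
qed

text \<open>A quadratic expansion with uniform cubic remainder at every point, phrased without
  derivatives. It is exactly what the matching of two moments uses.\<close>

definition third_order :: "real \<Rightarrow> (real \<Rightarrow> real) \<Rightarrow> bool" where
  "third_order B u \<longleftrightarrow> (\<forall>x. \<exists>\<alpha> \<beta>. \<forall>h. \<bar>u (x + h) - u x - \<alpha> * h - \<beta> * h\<^sup>2\<bar> \<le> B * \<bar>h\<bar> ^ 3)"

text \<open>The smoothing of a Lipschitz function at scale \<open>e\<close> is the third difference quotient of a
  third antiderivative: its third derivative is a third difference quotient of the function
  itself, and it is a value of the function at a nearby point.\<close>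

lemma smooth_lipschitz:
  fixes f :: "real \<Rightarrow> real"
  assumes f: "1-lipschitz_on UNIV f" and e: "0 < e"
  obtains g g1 g2 where "\<And>x. \<bar>g x - f x\<bar> \<le> 3 * e" "continuous_on UNIV g" "continuous_on UNIV g1" "continuous_on UNIV g2"
    "\<And>x. \<bar>g1 x\<bar> \<le> 1" "\<And>x. \<bar>g2 x\<bar> \<le> 2 / e"
    "\<And>x h. \<bar>g (x + h) - g x - g1 x * h - g2 x / 2 * h\<^sup>2\<bar> \<le> 1 / e\<^sup>2 * \<bar>h\<bar> ^ 3"
proof -
  have anti: "\<exists>F. \<forall>x::real. (F has_real_derivative u x) (at x)" if "continuous_on UNIV u" for u :: "real \<Rightarrow> real"
  proof -
    have "\<exists>F. \<forall>x::real. (- \<infinity> :: ereal) < x \<longrightarrow> x < \<infinity> \<longrightarrow> (F has_vector_derivative u x) (at x)"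
      using that by (intro einterval_antiderivative) (auto simp: continuous_on_eq_continuous_at)
    then show ?thesis by (simp add: has_real_derivative_iff_has_vector_derivative)
  qed
  have cont: "continuous_on UNIV F" if "\<And>x::real. (F has_real_derivative u x) (at x)" for F u :: "real \<Rightarrow> real"
    using that DERIV_isCont by (auto simp: continuous_on_eq_continuous_at)
  have fc: "continuous_on UNIV f"
    using f by (rule lipschitz_on_continuous_on)
  obtain F1 where F1: "\<And>x. (F1 has_real_derivative f x) (at x)" using anti[OF fc] by blast
  obtain F2 where F2: "\<And>x. (F2 has_real_derivative F1 x) (at x)" using anti[OF cont[OF F1]] by blast
  obtain F3 where F3: "\<And>x. (F3 has_real_derivative F2 x) (at x)" using anti[OF cont[OF F2]] by blast
  define \<Delta> where "\<Delta> u x = u (x + e) - u x" for u :: "real \<Rightarrow> real" and x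
  have D\<Delta>: "(\<Delta> u has_real_derivative \<Delta> v x) (at x)" if "\<And>x. (u has_real_derivative v x) (at x)" for u v x
  proof -
    have "((\<lambda>x. u (x + e)) has_real_derivative v (x + e)) (at x)"
      using that[of "x + e"] by (simp add: DERIV_shift)
    then show ?thesis
      unfolding \<Delta>_def[abs_def] using that[of x] by (rule DERIV_diff)
  qed
  have mv: "\<exists>y. x < y \<and> y < x + e \<and> \<Delta> u x = e * v y" if "\<And>x. (u has_real_derivative v x) (at x)" for u v x
    using MVT2[of x "x + e" u v] that e by (auto simp: \<Delta>_def)
  have lip: "\<bar>f x - f y\<bar> \<le> \<bar>x - y\<bar>" for x y
    using lipschitz_onD[OF f, of x y] by (simp add: dist_real_def)
  let ?T = "\<lambda>u x. \<Delta> (\<Delta> (\<Delta> u)) x / e ^ 3"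
  define g g1 g2 g3 where "g = ?T F3" and "g1 = ?T F2" and "g2 = ?T F1" and "g3 = ?T f"
  have Dg: "(g has_real_derivative g1 x) (at x)" "(g1 has_real_derivative g2 x) (at x)" "(g2 has_real_derivative g3 x) (at x)" for x
    unfolding g_def g1_def g2_def g3_def by (intro DERIV_cdivide D\<Delta> F1 F2 F3)+
  have \<Delta>f: "\<bar>\<Delta> f x\<bar> \<le> e" for x
    using lip[of "x + e" x] e by (simp add: \<Delta>_def)
  have \<Delta>2f: "\<bar>\<Delta> (\<Delta> f) x\<bar> \<le> 2 * e" for x
    using \<Delta>f[of "x + e"] \<Delta>f[of x] by (simp add: \<Delta>_def[of "\<Delta> f"])
  have \<Delta>3f: "\<bar>\<Delta> (\<Delta> (\<Delta> f)) x\<bar> \<le> 4 * e" for x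
    using \<Delta>2f[of "x + e"] \<Delta>2f[of x] by (simp add: \<Delta>_def[of "\<Delta> (\<Delta> f)"])
  \<comment> \<open>Three mean value steps, each moving the argument by less than
    \<open>e\<close>.\<close>
  have close: "\<bar>g x - f x\<bar> \<le> 3 * e" for x
  proof -
    obtain y1 where y1: "x < y1" "y1 < x + e" "\<Delta> (\<Delta> (\<Delta> F3)) x = e * \<Delta> (\<Delta> F2) y1"
      using mv[OF D\<Delta>[OF D\<Delta>[OF F3]]] by blast
    obtain y2 where y2: "y1 < y2" "y2 < y1 + e" "\<Delta> (\<Delta> F2) y1 = e * \<Delta> F1 y2"
      using mv[OF D\<Delta>[OF F2]] by blast
    obtain y3 where y3: "y2 < y3" "y3 < y2 + e" "\<Delta> F1 y2 = e * f y3"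
      using mv[OF F1] by blast
    have "g x = f y3"
      using y1 y2 y3 e by (simp add: g_def power3_eq_cube)
    then show ?thesis
      using lip[of y3 x] y1 y2 y3 by simp
  qed
  have g1b: "\<bar>g1 x\<bar> \<le> 1" for x
  proof -
    obtain y1 where y1: "\<Delta> (\<Delta> (\<Delta> F2)) x = e * \<Delta> (\<Delta> F1) y1"
      using mv[OF D\<Delta>[OF D\<Delta>[OF F2]]] by blast
    obtain y2 where y2: "\<Delta> (\<Delta> F1) y1 = e * \<Delta> f y2"
      using mv[OF D\<Delta>[OF F1]] by blast
    have "g1 x = \<Delta> f y2 / e"
      using y1 y2 e by (simp add: g1_def power3_eq_cube)
    then show ?thesis
      using \<Delta>f[of y2] e by (simp add: abs_divide)
  qed
  have g2b: "\<bar>g2 x\<bar> \<le> 2 / e" for x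
  proof -
    obtain y1 where y1: "\<Delta> (\<Delta> (\<Delta> F1)) x = e * \<Delta> (\<Delta> f) y1"
      using mv[OF D\<Delta>[OF D\<Delta>[OF F1]]] by blast
    have "\<bar>g2 x\<bar> = \<bar>\<Delta> (\<Delta> f) y1\<bar> / e\<^sup>2"
      using y1 e by (simp add: g2_def power3_eq_cube power2_eq_square abs_mult abs_divide)
    also have "\<dots> \<le> 2 * e / e\<^sup>2"
      using \<Delta>2f e by (intro divide_right_mono) auto
    finally show ?thesis using e by (simp add: power2_eq_square)
  qed
  have g3b: "\<bar>g3 x\<bar> \<le> 4 / e\<^sup>2" for x
  proof -
    have "\<bar>g3 x\<bar> \<le> 4 * e / e ^ 3"
      unfolding g3_def abs_divide using \<Delta>3f e by (simp add: divide_right_mono)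
    then show ?thesis using e by (simp add: power3_eq_cube power2_eq_square)
  qed
  have taylor: "\<bar>g (x + h) - g x - g1 x * h - g2 x / 2 * h\<^sup>2\<bar> \<le> 1 / e\<^sup>2 * \<bar>h\<bar> ^ 3" for x h
  proof -
    define diff where "diff m t = (if m = 0 then g (x + t) else if m = 1 then g1 (x + t) else if m = 2 then g2 (x + t) else g3 (x + t))"
      for m :: nat and t
    have sh: "((\<lambda>t. u (x + t)) has_real_derivative v (x + t)) (at t)"
      if "\<And>x. (u has_real_derivative v x) (at x)" for u v t
      using that[of "x + t"] DERIV_shift[of u "v (x + t)" t x] by (simp add: add.commute)
    have "\<exists>t. \<bar>t\<bar> \<le> \<bar>h\<bar> \<and> g (x + h) = (\<Sum>m<3. diff m 0 / fact m * h ^ m) + diff 3 t / fact 3 * h ^ 3"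
    proof (rule Maclaurin_bi_le)
      show "\<forall>m t. m < 3 \<and> \<bar>t\<bar> \<le> \<bar>h\<bar> \<longrightarrow> (diff m has_real_derivative diff (Suc m) t) (at t)"
      proof (intro allI impI)
        fix m :: nat and t assume "m < 3 \<and> \<bar>t\<bar> \<le> \<bar>h\<bar>"
        then have "m = 0 \<or> m = 1 \<or> m = 2" by auto
        then show "(diff m has_real_derivative diff (Suc m) t) (at t)"
          using sh[OF Dg(1), of t] sh[OF Dg(2), of t] sh[OF Dg(3), of t]
          by (auto simp: diff_def[abs_def])
      qed
    qed (simp add: diff_def[abs_def])
    then obtain t where t: "g (x + h) = (\<Sum>m<3. diff m 0 / fact m * h ^ m) + diff 3 t / fact 3 * h ^ 3"
      by blast
    then have eq: "g (x + h) - g x - g1 x * h - g2 x / 2 * h\<^sup>2 = g3 (x + t) / 6 * h ^ 3"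
      by (simp add: diff_def numeral_3_eq_3 fact_numeral power2_eq_square)
    have "\<bar>g (x + h) - g x - g1 x * h - g2 x / 2 * h\<^sup>2\<bar> = \<bar>g3 (x + t)\<bar> / 6 * \<bar>h\<bar> ^ 3"
      unfolding eq by (simp add: abs_mult power_abs)
    also have "\<dots> \<le> 1 / e\<^sup>2 * \<bar>h\<bar> ^ 3"
      using g3b[of "x + t"] by (intro mult_right_mono) auto
    finally show ?thesis .
  qed
  show thesis
    using that[OF close cont[OF Dg(1)] cont[OF Dg(2)] cont[OF Dg(3)] g1b g2b taylor] .
qed

text \<open>Averaging the expansion of \<open>g\<close> over the Gaussian shift keeps the constant
  \<open>B\<close>, and the averages of \<open>g1\<close> and \<open>g2\<close> serve as the
  coefficients. The bounds on \<open>g1\<close> and \<open>g2\<close> supply integrability.\<close>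

lemma third_order_nsm:
  assumes [measurable]: "g \<in> borel_measurable borel" "g1 \<in> borel_measurable borel" "g2 \<in> borel_measurable borel"
    and g: "\<And>y. \<bar>g y\<bar> \<le> a + b * \<bar>y\<bar>" "0 \<le> b" and g1: "\<And>x. \<bar>g1 x\<bar> \<le> c1" and g2: "\<And>x. \<bar>g2 x\<bar> \<le> c2"
    and taylor: "\<And>x h. \<bar>g (x + h) - g x - g1 x * h - g2 x * h\<^sup>2\<bar> \<le> B * \<bar>h\<bar> ^ 3"
  shows "third_order B (gauss_avg s g)"
  unfolding third_order_def
proof (intro allI exI)
  interpret prob_space std_normal by (rule prob_space_std_normal)
  fix x h
  have int: "integrable std_normal (\<lambda>z. g (x' + s * z))" "integrable std_normal (\<lambda>z. g1 (x + s * z))"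
    "integrable std_normal (\<lambda>z. g2 (x + s * z))" for x'
    using gauss_avg_integrable[OF assms(1) g, of x' s] gauss_avg_integrable[OF assms(2), of c1 0 x s]
      gauss_avg_integrable[OF assms(3), of c2 0 x s] g1 g2 by auto
  let ?r = "\<lambda>z. g (x + s * z + h) - g (x + s * z) - g1 (x + s * z) * h - g2 (x + s * z) * h\<^sup>2"
  have eq: "g (x + h + s * z) = g (x + s * z + h)" for z by (simp add: add_ac)
  have i1: "integrable std_normal (\<lambda>z. g (x + s * z + h))"
    using int(1)[of "x + h"] by (simp only: eq)
  have "gauss_avg s g (x + h) - gauss_avg s g x - gauss_avg s g1 x * h - gauss_avg s g2 x * h\<^sup>2 = (\<integral>z. ?r z \<partial>std_normal)"
    using i1 int by (simp add: gauss_avg_def eq)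
  moreover have "\<bar>\<integral>z. ?r z \<partial>std_normal\<bar> \<le> (\<integral>z. \<bar>?r z\<bar> \<partial>std_normal)"
    by (rule integral_abs_bound)
  moreover have "(\<integral>z. \<bar>?r z\<bar> \<partial>std_normal) \<le> (\<integral>z. B * \<bar>h\<bar> ^ 3 \<partial>std_normal)"
    using i1 int taylor by (intro integral_mono) auto
  moreover have "(\<integral>z. B * \<bar>h\<bar> ^ 3 \<partial>std_normal) = B * \<bar>h\<bar> ^ 3" by simp
  ultimately show "\<bar>gauss_avg s g (x + h) - gauss_avg s g x - gauss_avg s g1 x * h - gauss_avg s g2 x * h\<^sup>2\<bar> \<le> B * \<bar>h\<bar> ^ 3"
    by linarith
qed

text \<open>The first two moments agree, so the expansion has the same constant, linear and
  quadratic contributions under both laws. The remainders give \<open>B * t\<close> on one side and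
  at most twice this on the Gaussian side, where the third absolute moment is at most 2.\<close>

lemma third_order_swap:
  assumes u: "third_order B u" "0 \<le> B" and [measurable]: "u \<in> borel_measurable borel"
    and ub: "\<And>y. \<bar>u y\<bar> \<le> a + b * \<bar>y\<bar>" "0 \<le> b"
    and p: "0 \<le> p" "p \<le> 1" "finite \<Lambda>"
    and X: "Ep p \<Lambda> X = 0" "Ep p \<Lambda> (\<lambda>A. (X A)\<^sup>2) = s\<^sup>2" "Ep p \<Lambda> (\<lambda>A. \<bar>X A\<bar> ^ 3) \<le> t" "0 \<le> s" "s ^ 3 \<le> t"
  shows "\<bar>Ep p \<Lambda> (\<lambda>A. u (x + X A)) - gauss_avg s u x\<bar> \<le> 3 * B * t"
proof -
  interpret prob_space std_normal by (rule prob_space_std_normal)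
  obtain \<alpha> \<beta> where ab: "\<And>h. \<bar>u (x + h) - u x - \<alpha> * h - \<beta> * h\<^sup>2\<bar> \<le> B * \<bar>h\<bar> ^ 3"
    using u(1) unfolding third_order_def by blast
  let ?r = "\<lambda>h. u (x + h) - u x - \<alpha> * h - \<beta> * h\<^sup>2"
  have "Ep p \<Lambda> (\<lambda>A. ?r (X A)) = Ep p \<Lambda> (\<lambda>A. u (x + X A)) - u x - \<beta> * s\<^sup>2"
    using p X(1,2) by (simp add: Ep_diff Ep_cmult)
  moreover have "\<bar>Ep p \<Lambda> (\<lambda>A. ?r (X A))\<bar> \<le> B * t"
  proof -
    have "\<bar>Ep p \<Lambda> (\<lambda>A. ?r (X A))\<bar> \<le> Ep p \<Lambda> (\<lambda>A. \<bar>?r (X A)\<bar>)"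
      by (rule Ep_abs_le[OF p(1,2)])
    also have "\<dots> \<le> Ep p \<Lambda> (\<lambda>A. B * \<bar>X A\<bar> ^ 3)"
      by (intro Ep_mono p ab)
    also have "\<dots> \<le> B * t"
      unfolding Ep_cmult using u(2) X(3) by (intro mult_left_mono)
    finally show ?thesis .
  qed
  moreover have "(\<integral>z. ?r (s * z) \<partial>std_normal) = gauss_avg s u x - u x - \<beta> * s\<^sup>2"
    using gauss_avg_integrable[OF assms(3) ub, of x s] std_normal_abs_moments(2)[of 1] std_normal_abs_moments(2)[of 2]
      std_normal_abs_moments(3,4)
    by (simp add: gauss_avg_def prob_space power_mult_distrib)
  moreover have "\<bar>\<integral>z. ?r (s * z) \<partial>std_normal\<bar> \<le> 2 * (B * t)"
  proof -
    have int: "integrable std_normal (\<lambda>z. ?r (s * z))"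
      using gauss_avg_integrable[OF assms(3) ub, of x s] std_normal_abs_moments(2)[of 1] std_normal_abs_moments(2)[of 2]
      by (simp add: power_mult_distrib)
    have "\<bar>\<integral>z. ?r (s * z) \<partial>std_normal\<bar> \<le> (\<integral>z. \<bar>?r (s * z)\<bar> \<partial>std_normal)"
      by (rule integral_abs_bound)
    also have "\<dots> \<le> (\<integral>z. B * s ^ 3 * \<bar>z\<bar> ^ 3 \<partial>std_normal)"
    proof (rule integral_mono)
      show "\<bar>?r (s * z)\<bar> \<le> B * s ^ 3 * \<bar>z\<bar> ^ 3" for z
        using ab[of "s * z"] X(4) by (simp add: abs_mult power_mult_distrib)
    qed (use int std_normal_abs_moments(1)[of 3] in auto)
    also have "\<dots> = B * s ^ 3 * (\<integral>z. \<bar>z\<bar> ^ 3 \<partial>std_normal)" by simp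
    also have "\<dots> \<le> B * t * 2"
    proof (intro mult_mono mult_left_mono)
      have "0 \<le> s ^ 3" using X(4) by simp
      then have "0 \<le> t" using X(5) by linarith
      then show "0 \<le> B * t" using u(2) by simp
    qed (use u(2) X(4,5) std_normal_abs_moments(6) in auto)
    finally show ?thesis by simp
  qed
  ultimately show ?thesis by (simp add: abs_le_iff)
qed

lemma gauss_avg_measurable [measurable]:
  assumes [measurable]: "g \<in> borel_measurable borel"
  shows "gauss_avg s g \<in> borel_measurable borel"
proof -
  interpret prob_space std_normal by (rule prob_space_std_normal)
  show ?thesis unfolding gauss_avg_def[abs_def] by measurable
qed

lemma gauss_avg_growth:
  assumes [measurable]: "g \<in> borel_measurable borel" and g: "\<And>y. \<bar>g y\<bar> \<le> a + b * \<bar>y\<bar>" "0 \<le> b"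
  shows "\<bar>gauss_avg s g x\<bar> \<le> (a + b * \<bar>s\<bar>) + b * \<bar>x\<bar>"
proof -
  interpret prob_space std_normal by (rule prob_space_std_normal)
  have "\<bar>gauss_avg s g x\<bar> \<le> (\<integral>z. \<bar>g (x + s * z)\<bar> \<partial>std_normal)"
    unfolding gauss_avg_def by (rule integral_abs_bound)
  also have "\<dots> \<le> (\<integral>z. (a + b * \<bar>x\<bar>) + b * \<bar>s\<bar> * \<bar>z\<bar> \<partial>std_normal)"
  proof (rule integral_mono)
    fix z
    have "b * \<bar>x + s * z\<bar> \<le> b * (\<bar>x\<bar> + \<bar>s\<bar> * \<bar>z\<bar>)"
      using g(2) abs_triangle_ineq[of x "s * z"] by (intro mult_left_mono) (auto simp: abs_mult)
    then show "\<bar>g (x + s * z)\<bar> \<le> (a + b * \<bar>x\<bar>) + b * \<bar>s\<bar> * \<bar>z\<bar>"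
      using g(1)[of "x + s * z"] by (simp add: algebra_simps)
  qed (use gauss_avg_integrable[OF assms(1) g, of x s] std_normal_abs_moments(1)[of 1] in auto)
  also have "\<dots> = (a + b * \<bar>x\<bar>) + b * \<bar>s\<bar> * (\<integral>z. \<bar>z\<bar> \<partial>std_normal)"
    using std_normal_abs_moments(1)[of 1] by (simp add: prob_space)
  also have "\<dots> \<le> (a + b * \<bar>x\<bar>) + b * \<bar>s\<bar> * 1"
    using std_normal_abs_moments(5) g(2) by (intro add_left_mono mult_left_mono) auto
  finally show ?thesis by (simp add: algebra_simps)
qed

text \<open>One block at a time is exchanged for a Gaussian. The shift \<open>x\<close> is arbitrary
  in the induction, so it can absorb the value of the block \<open>X c\<close> while the other
  blocks are already Gaussian; composing the averages then adds the variances.\<close>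

lemma lindeberg_swap:
  fixes X :: "'i \<Rightarrow> 'a set \<Rightarrow> real" and s t :: "'i \<Rightarrow> real"
  assumes p: "0 \<le> p" "p \<le> 1" and [measurable]: "g \<in> borel_measurable borel"
    and g: "\<And>y. \<bar>g y\<bar> \<le> a + b * \<bar>y\<bar>" "0 \<le> b" and B: "0 \<le> B" "\<And>\<sigma>. third_order B (gauss_avg \<sigma> g)"
    and C: "finite C" "\<And>c. c \<in> C \<Longrightarrow> finite (\<Lambda> c)"
      "\<And>c c'. c \<in> C \<Longrightarrow> c' \<in> C \<Longrightarrow> c \<noteq> c' \<Longrightarrow> \<Lambda> c \<inter> \<Lambda> c' = {}"
    and X: "\<And>c. c \<in> C \<Longrightarrow> Ep p (\<Lambda> c) (X c) = 0" "\<And>c. c \<in> C \<Longrightarrow> Ep p (\<Lambda> c) (\<lambda>A. (X c A)\<^sup>2) = (s c)\<^sup>2"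
      "\<And>c. c \<in> C \<Longrightarrow> Ep p (\<Lambda> c) (\<lambda>A. \<bar>X c A\<bar> ^ 3) \<le> t c" "\<And>c. c \<in> C \<Longrightarrow> 0 \<le> s c" "\<And>c. c \<in> C \<Longrightarrow> (s c) ^ 3 \<le> t c"
  shows "\<bar>Ep p (\<Union>c\<in>C. \<Lambda> c) (\<lambda>A. g (x + (\<Sum>c\<in>C. X c (A \<inter> \<Lambda> c)))) - gauss_avg (sqrt (\<Sum>c\<in>C. (s c)\<^sup>2)) g x\<bar> \<le> 3 * B * (\<Sum>c\<in>C. t c)"
  using C X
proof (induction C arbitrary: x rule: finite_induct)
  case empty
  then show ?case by simp
next
  case (insert c C)
  let ?U = "\<Union>c\<in>C. \<Lambda> c" and ?\<sigma> = "sqrt (\<Sum>c\<in>C. (s c)\<^sup>2)"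
  have fin: "finite (\<Lambda> c)" "finite ?U" using insert by auto
  have disj: "\<Lambda> c \<inter> ?U = {}"
    using insert.prems(2)[of c] insert.hyps(2) by blast
  have IH: "\<bar>Ep p ?U (\<lambda>A. g (y + (\<Sum>c\<in>C. X c (A \<inter> \<Lambda> c)))) - gauss_avg ?\<sigma> g y\<bar> \<le> 3 * B * (\<Sum>c\<in>C. t c)" for y
    using insert.prems by (intro insert.IH) auto
  have "Ep p (\<Union>c\<in>insert c C. \<Lambda> c) (\<lambda>A. g (x + (\<Sum>c\<in>insert c C. X c (A \<inter> \<Lambda> c))))
      = Ep p (\<Lambda> c \<union> ?U) (\<lambda>A. g (x + (\<Sum>c\<in>insert c C. X c (A \<inter> \<Lambda> c))))" by simp
  also have "\<dots> = Ep p (\<Lambda> c) (\<lambda>A. Ep p ?U (\<lambda>A'. g (x + (\<Sum>c\<in>insert c C. X c ((A \<union> A') \<inter> \<Lambda> c)))))"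
    by (rule Ep_Un[OF fin disj])
  also have "\<dots> = Ep p (\<Lambda> c) (\<lambda>A. Ep p ?U (\<lambda>A'. g ((x + X c A) + (\<Sum>c\<in>C. X c (A' \<inter> \<Lambda> c)))))"
  proof (intro Ep_cong)
    fix A A' assume A: "A \<subseteq> \<Lambda> c" and A': "A' \<subseteq> ?U"
    have "(A \<union> A') \<inter> \<Lambda> c = A" using A A' disj by blast
    moreover have "(A \<union> A') \<inter> \<Lambda> c' = A' \<inter> \<Lambda> c'" if "c' \<in> C" for c'
      using A disj that by blast
    ultimately show "g (x + (\<Sum>c\<in>insert c C. X c ((A \<union> A') \<inter> \<Lambda> c))) = g ((x + X c A) + (\<Sum>c\<in>C. X c (A' \<inter> \<Lambda> c)))"
      using insert.hyps by (simp add: add.assoc)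
  qed
  finally have eq: "Ep p (\<Union>c\<in>insert c C. \<Lambda> c) (\<lambda>A. g (x + (\<Sum>c\<in>insert c C. X c (A \<inter> \<Lambda> c))))
      = Ep p (\<Lambda> c) (\<lambda>A. Ep p ?U (\<lambda>A'. g ((x + X c A) + (\<Sum>c\<in>C. X c (A' \<inter> \<Lambda> c)))))" .
  have 1: "\<bar>Ep p (\<Lambda> c) (\<lambda>A. Ep p ?U (\<lambda>A'. g ((x + X c A) + (\<Sum>c\<in>C. X c (A' \<inter> \<Lambda> c))))) - Ep p (\<Lambda> c) (\<lambda>A. gauss_avg ?\<sigma> g (x + X c A))\<bar>
      \<le> 3 * B * (\<Sum>c\<in>C. t c)"
  proof -
    have "\<bar>Ep p (\<Lambda> c) (\<lambda>A. Ep p ?U (\<lambda>A'. g ((x + X c A) + (\<Sum>c\<in>C. X c (A' \<inter> \<Lambda> c)))) - gauss_avg ?\<sigma> g (x + X c A))\<bar>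
        \<le> Ep p (\<Lambda> c) (\<lambda>A. \<bar>Ep p ?U (\<lambda>A'. g ((x + X c A) + (\<Sum>c\<in>C. X c (A' \<inter> \<Lambda> c)))) - gauss_avg ?\<sigma> g (x + X c A)\<bar>)"
      by (rule Ep_abs_le[OF p])
    also have "\<dots> \<le> Ep p (\<Lambda> c) (\<lambda>_. 3 * B * (\<Sum>c\<in>C. t c))"
      by (intro Ep_mono p IH)
    finally show ?thesis using fin by (simp add: Ep_diff)
  qed
  have 2: "\<bar>Ep p (\<Lambda> c) (\<lambda>A. gauss_avg ?\<sigma> g (x + X c A)) - gauss_avg (s c) (gauss_avg ?\<sigma> g) x\<bar> \<le> 3 * B * t c"
    using insert.prems fin
    by (intro third_order_swap[OF B(2) B(1) _ gauss_avg_growth[OF assms(3) g, where s = ?\<sigma>] g(2) p]) auto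
  have "gauss_avg (s c) (gauss_avg ?\<sigma> g) x = gauss_avg (sqrt ((s c)\<^sup>2 + ?\<sigma>\<^sup>2)) g x"
    using insert.prems by (intro gauss_avg_nsm[OF _ _ assms(3) g]) (auto intro: sum_nonneg)
  also have "(s c)\<^sup>2 + ?\<sigma>\<^sup>2 = (\<Sum>c\<in>insert c C. (s c)\<^sup>2)"
    using insert.hyps by (simp add: sum_nonneg)
  finally have 3: "gauss_avg (s c) (gauss_avg ?\<sigma> g) x = gauss_avg (sqrt (\<Sum>c\<in>insert c C. (s c)\<^sup>2)) g x" .
  show ?case
    using 1 2 insert.hyps unfolding eq 3[symmetric] by (simp add: algebra_simps abs_le_iff)
qed

text \<open>Smoothing at scale \<open>e\<close> costs \<open>3 * e\<close> on each side; in exchange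
  the smoothed function has the third-order constant \<open>1 / e\<^sup>2\<close>.\<close>

theorem lindeberg_lipschitz:
  fixes X :: "'i \<Rightarrow> 'a set \<Rightarrow> real" and s t :: "'i \<Rightarrow> real"
  assumes p: "0 \<le> p" "p \<le> 1" and f: "1-lipschitz_on UNIV f" and e: "0 < e"
    and C: "finite C" "\<And>c. c \<in> C \<Longrightarrow> finite (\<Lambda> c)"
      "\<And>c c'. c \<in> C \<Longrightarrow> c' \<in> C \<Longrightarrow> c \<noteq> c' \<Longrightarrow> \<Lambda> c \<inter> \<Lambda> c' = {}"
    and X: "\<And>c. c \<in> C \<Longrightarrow> Ep p (\<Lambda> c) (X c) = 0" "\<And>c. c \<in> C \<Longrightarrow> Ep p (\<Lambda> c) (\<lambda>A. (X c A)\<^sup>2) = (s c)\<^sup>2"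
      "\<And>c. c \<in> C \<Longrightarrow> Ep p (\<Lambda> c) (\<lambda>A. \<bar>X c A\<bar> ^ 3) \<le> t c" "\<And>c. c \<in> C \<Longrightarrow> 0 \<le> s c" "\<And>c. c \<in> C \<Longrightarrow> (s c) ^ 3 \<le> t c"
  shows "\<bar>Ep p (\<Union>c\<in>C. \<Lambda> c) (\<lambda>A. f (\<Sum>c\<in>C. X c (A \<inter> \<Lambda> c))) - (\<integral>z. f (sqrt (\<Sum>c\<in>C. (s c)\<^sup>2) * z) \<partial>std_normal)\<bar>
    \<le> 6 * e + 3 / e\<^sup>2 * (\<Sum>c\<in>C. t c)"
proof -
  interpret prob_space std_normal by (rule prob_space_std_normal)
  obtain g g1 g2 where gf: "\<And>x. \<bar>g x - f x\<bar> \<le> 3 * e"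
    and gc: "continuous_on UNIV g" "continuous_on UNIV g1" "continuous_on UNIV g2"
    and gb: "\<And>x. \<bar>g1 x\<bar> \<le> 1" "\<And>x. \<bar>g2 x\<bar> \<le> 2 / e"
    and taylor: "\<And>x h. \<bar>g (x + h) - g x - g1 x * h - g2 x / 2 * h\<^sup>2\<bar> \<le> 1 / e\<^sup>2 * \<bar>h\<bar> ^ 3"
    using smooth_lipschitz[OF f e] by metis
  note [measurable] = borel_measurable_continuous_onI[OF gc(1)] borel_measurable_continuous_onI[OF gc(2)]
    borel_measurable_continuous_onI[OF gc(3)] borel_measurable_continuous_onI[OF lipschitz_on_continuous_on[OF f]]
  have flip: "\<bar>f y\<bar> \<le> \<bar>f 0\<bar> + 1 * \<bar>y\<bar>" for y
    using lipschitz_onD[OF f, of y 0] by (simp add: dist_real_def)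
  have gg: "\<bar>g y\<bar> \<le> (3 * e + \<bar>f 0\<bar>) + 1 * \<bar>y\<bar>" for y
    using gf[of y] flip[of y] by linarith
  define g2h where "g2h x = g2 x / 2" for x
  have [measurable]: "g2h \<in> borel_measurable borel"
    unfolding g2h_def by measurable
  have g2h: "\<bar>g2h x\<bar> \<le> 2 / e" for x
    using gb(2)[of x] by (simp add: g2h_def)
  have third: "third_order (1 / e\<^sup>2) (gauss_avg \<sigma> g)" for \<sigma>
    by (rule third_order_nsm[OF _ _ _ gg _ gb(1) g2h taylor[folded g2h_def]]) simp_all
  let ?U = "\<Union>c\<in>C. \<Lambda> c" and ?\<sigma> = "sqrt (\<Sum>c\<in>C. (s c)\<^sup>2)" and ?W = "\<lambda>A. \<Sum>c\<in>C. X c (A \<inter> \<Lambda> c)"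
  have finU: "finite ?U" using C by auto
  have "\<bar>Ep p ?U (\<lambda>A. g (0 + ?W A)) - gauss_avg ?\<sigma> g 0\<bar> \<le> 3 * (1 / e\<^sup>2) * (\<Sum>c\<in>C. t c)"
    by (rule lindeberg_swap[OF p _ gg _ _ third C X]) auto
  then have 1: "\<bar>Ep p ?U (\<lambda>A. g (?W A)) - gauss_avg ?\<sigma> g 0\<bar> \<le> 3 / e\<^sup>2 * (\<Sum>c\<in>C. t c)" by simp
  have 2: "\<bar>Ep p ?U (\<lambda>A. f (?W A)) - Ep p ?U (\<lambda>A. g (?W A))\<bar> \<le> 3 * e"
  proof -
    have "\<bar>Ep p ?U (\<lambda>A. f (?W A) - g (?W A))\<bar> \<le> Ep p ?U (\<lambda>A. \<bar>f (?W A) - g (?W A)\<bar>)"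
      by (rule Ep_abs_le[OF p])
    also have "\<dots> \<le> Ep p ?U (\<lambda>_. 3 * e)"
      using gf by (intro Ep_mono p) (simp add: abs_minus_commute)
    finally show ?thesis using finU by (simp add: Ep_diff)
  qed
  have 3: "\<bar>gauss_avg ?\<sigma> g 0 - gauss_avg ?\<sigma> f 0\<bar> \<le> 3 * e"
  proof -
    have int: "integrable std_normal (\<lambda>z. g (0 + ?\<sigma> * z))" "integrable std_normal (\<lambda>z. f (0 + ?\<sigma> * z))"
      by (intro gauss_avg_integrable[OF _ gg] gauss_avg_integrable[OF _ flip]; simp)+
    have "\<bar>gauss_avg ?\<sigma> g 0 - gauss_avg ?\<sigma> f 0\<bar> = \<bar>\<integral>z. g (0 + ?\<sigma> * z) - f (0 + ?\<sigma> * z) \<partial>std_normal\<bar>"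
      unfolding gauss_avg_def by (subst Bochner_Integration.integral_diff[OF int]) simp
    also have "\<dots> \<le> (\<integral>z. \<bar>g (0 + ?\<sigma> * z) - f (0 + ?\<sigma> * z)\<bar> \<partial>std_normal)"
      by (rule integral_abs_bound)
    also have "\<dots> \<le> (\<integral>z. 3 * e \<partial>std_normal)"
      using gf by (intro integral_mono integrable_abs Bochner_Integration.integrable_diff[OF int]) auto
    finally show ?thesis by (simp add: prob_space)
  qed
  have "gauss_avg ?\<sigma> f 0 = (\<integral>z. f (?\<sigma> * z) \<partial>std_normal)" by (simp add: gauss_avg_def)
  then show ?thesis using 1 2 3 by linarith
qed

lemma lipschitz_growth:
  assumes "1-lipschitz_on UNIV (f :: real \<Rightarrow> real)"
  shows "\<bar>f y - f x\<bar> \<le> \<bar>y - x\<bar>" "\<bar>f y\<bar> \<le> \<bar>f 0\<bar> + 1 * \<bar>y\<bar>"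
  using lipschitz_onD[OF assms, of y x] lipschitz_onD[OF assms, of y 0] by (simp_all add: dist_real_def)

lemma std_normal_scale_lipschitz:
  assumes f: "1-lipschitz_on UNIV f"
  shows "\<bar>(\<integral>z. f (\<tau> * z) \<partial>std_normal) - (\<integral>z. f z \<partial>std_normal)\<bar> \<le> \<bar>\<tau> - 1\<bar>"
proof -
  interpret prob_space std_normal by (rule prob_space_std_normal)
  note [measurable] = borel_measurable_continuous_onI[OF lipschitz_on_continuous_on[OF f]]
  have int: "integrable std_normal (\<lambda>z. f (0 + \<tau> * z))" "integrable std_normal (\<lambda>z. f (0 + 1 * z))"
    by (intro gauss_avg_integrable[OF _ lipschitz_growth(2)[OF f]]; simp)+
  have "\<bar>(\<integral>z. f (\<tau> * z) \<partial>std_normal) - (\<integral>z. f z \<partial>std_normal)\<bar> = \<bar>\<integral>z. f (0 + \<tau> * z) - f (0 + 1 * z) \<partial>std_normal\<bar>"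
    by (subst Bochner_Integration.integral_diff[OF int]) simp
  also have "\<dots> \<le> (\<integral>z. \<bar>f (0 + \<tau> * z) - f (0 + 1 * z)\<bar> \<partial>std_normal)"
    by (rule integral_abs_bound)
  also have "\<dots> \<le> (\<integral>z. \<bar>\<tau> - 1\<bar> * \<bar>z\<bar> \<partial>std_normal)"
  proof (rule integral_mono)
    show "\<bar>f (0 + \<tau> * z) - f (0 + 1 * z)\<bar> \<le> \<bar>\<tau> - 1\<bar> * \<bar>z\<bar>" for z
      using lipschitz_growth(1)[OF f, of "\<tau> * z" z] by (simp add: abs_mult[symmetric] algebra_simps)
  qed (use int std_normal_abs_moments(1)[of 1] in \<open>auto intro!: integrable_abs Bochner_Integration.integrable_diff[OF int]\<close>)
  also have "\<dots> = \<bar>\<tau> - 1\<bar> * (\<integral>z. \<bar>z\<bar> \<partial>std_normal)" by simp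
  also have "\<dots> \<le> \<bar>\<tau> - 1\<bar> * 1"
    using std_normal_abs_moments(5) by (intro mult_left_mono) auto
  finally show ?thesis by simp
qed

section \<open>Square-integrable variables and distances of laws\<close>

text \<open>The discriminant criterion behind the Cauchy-Schwarz inequality. In the degenerate case
  the quadratic is affine and, being nonnegative, must be constant.\<close>

lemma discriminant_le:
  fixes a b c :: real
  assumes "\<And>t. 0 \<le> a + 2 * t * b + t\<^sup>2 * c" "0 \<le> c"
  shows "b\<^sup>2 \<le> a * c"
proof (cases "c = 0")
  case True
  have "b = 0"
  proof (rule ccontr)
    assume "b \<noteq> 0"
    then show False
      using assms(1)[of "- (a + 1) / (2 * b)"] True by (simp add: field_simps)
  qed
  then show ?thesis using True by simp
next
  case False
  then have c: "0 < c" using assms(2) by simp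
  have "0 \<le> c * (a + 2 * (- b / c) * b + (- b / c)\<^sup>2 * c)"
    using assms(1)[of "- b / c"] c by simp
  also have "\<dots> = a * c - b\<^sup>2"
    using c by (simp add: power2_eq_square field_simps)
  finally show ?thesis by simp
qed

section \<open>Cauchy-Schwarz and the L2 seminorm\<close>

context prob_space
begin

lemma expectation_mult_sq_le:
  fixes U V :: "'a \<Rightarrow> real"
  assumes [measurable]: "U \<in> borel_measurable M" "V \<in> borel_measurable M"
    and int: "integrable M (\<lambda>w. (U w)\<^sup>2)" "integrable M (\<lambda>w. (V w)\<^sup>2)"
  shows "integrable M (\<lambda>w. U w * V w)"
    and "(expectation (\<lambda>w. U w * V w))\<^sup>2 \<le> expectation (\<lambda>w. (U w)\<^sup>2) * expectation (\<lambda>w. (V w)\<^sup>2)"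
proof -
  show UV: "integrable M (\<lambda>w. U w * V w)"
  proof (rule Bochner_Integration.integrable_bound)
    show "integrable M (\<lambda>w. (U w)\<^sup>2 + (V w)\<^sup>2)" using int by simp
    show "AE w in M. norm (U w * V w) \<le> norm ((U w)\<^sup>2 + (V w)\<^sup>2)"
    proof (rule AE_I2)
      fix w
      have "0 \<le> (\<bar>U w\<bar> - \<bar>V w\<bar>)\<^sup>2" by simp
      then have "2 * (\<bar>U w\<bar> * \<bar>V w\<bar>) \<le> (U w)\<^sup>2 + (V w)\<^sup>2"
        by (simp add: power2_diff)
      moreover have "0 \<le> \<bar>U w\<bar> * \<bar>V w\<bar>" by simp
      ultimately show "norm (U w * V w) \<le> norm ((U w)\<^sup>2 + (V w)\<^sup>2)"
        unfolding real_norm_def abs_mult by linarith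
    qed
  qed measurable
  show "(expectation (\<lambda>w. U w * V w))\<^sup>2 \<le> expectation (\<lambda>w. (U w)\<^sup>2) * expectation (\<lambda>w. (V w)\<^sup>2)"
  proof (rule discriminant_le)
    fix t :: real
    have "0 \<le> expectation (\<lambda>w. (U w + t * V w)\<^sup>2)" by simp
    also have "(\<lambda>w. (U w + t * V w)\<^sup>2) = (\<lambda>w. (U w)\<^sup>2 + 2 * t * (U w * V w) + t\<^sup>2 * (V w)\<^sup>2)"
      by (simp add: power2_eq_square algebra_simps)
    also have "expectation \<dots> = expectation (\<lambda>w. (U w)\<^sup>2) + 2 * t * expectation (\<lambda>w. U w * V w) + t\<^sup>2 * expectation (\<lambda>w. (V w)\<^sup>2)"
      using int UV by simp
    finally show "0 \<le> expectation (\<lambda>w. (U w)\<^sup>2) + 2 * t * expectation (\<lambda>w. U w * V w) + t\<^sup>2 * expectation (\<lambda>w. (V w)\<^sup>2)" .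
  qed simp
qed

definition L2 :: "('a \<Rightarrow> real) \<Rightarrow> real" where
  "L2 U = sqrt (expectation (\<lambda>w. (U w)\<^sup>2))"

definition sq_int :: "('a \<Rightarrow> real) \<Rightarrow> bool" where
  "sq_int U \<longleftrightarrow> U \<in> borel_measurable M \<and> integrable M (\<lambda>w. (U w)\<^sup>2)"

lemma sq_int_integrable:
  assumes "sq_int U"
  shows "integrable M U"
proof -
  have [measurable]: "U \<in> borel_measurable M" using assms by (simp add: sq_int_def)
  show ?thesis
    using expectation_mult_sq_le(1)[of U "\<lambda>_. 1"] assms by (simp add: sq_int_def)
qed

lemma sq_int_const [simp]: "sq_int (\<lambda>_. c)"
  by (simp add: sq_int_def)

lemma sq_int_add:
  assumes "sq_int U" "sq_int V"
  shows "sq_int (\<lambda>w. U w + V w)"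
proof -
  have [measurable]: "U \<in> borel_measurable M" "V \<in> borel_measurable M"
    using assms by (simp_all add: sq_int_def)
  have "integrable M (\<lambda>w. (U w)\<^sup>2 + (2 * (U w * V w) + (V w)\<^sup>2))"
    using assms expectation_mult_sq_le(1)[of U V] by (auto simp: sq_int_def)
  also have "(\<lambda>w. (U w)\<^sup>2 + (2 * (U w * V w) + (V w)\<^sup>2)) = (\<lambda>w. (U w + V w)\<^sup>2)"
    by (simp add: power2_eq_square algebra_simps)
  finally show ?thesis by (simp add: sq_int_def)
qed

lemma sq_int_cmult: "sq_int U \<Longrightarrow> sq_int (\<lambda>w. c * U w)"
  by (auto simp: sq_int_def power_mult_distrib)

lemma sq_int_diff: "sq_int U \<Longrightarrow> sq_int V \<Longrightarrow> sq_int (\<lambda>w. U w - V w)"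
  using sq_int_add[of U "\<lambda>w. (-1) * V w"] sq_int_cmult[of V "-1"] by simp

lemma L2_nonneg [simp]: "0 \<le> L2 U"
  by (simp add: L2_def)

lemma L2_power2: "(L2 U)\<^sup>2 = expectation (\<lambda>w. (U w)\<^sup>2)"
  by (simp add: L2_def)

lemma L2_triangle:
  assumes "sq_int U" "sq_int V"
  shows "L2 (\<lambda>w. U w + V w) \<le> L2 U + L2 V"
proof (rule power2_le_imp_le)
  have [measurable]: "U \<in> borel_measurable M" "V \<in> borel_measurable M"
    and int: "integrable M (\<lambda>w. (U w)\<^sup>2)" "integrable M (\<lambda>w. (V w)\<^sup>2)"
    using assms by (simp_all add: sq_int_def)
  note UV = expectation_mult_sq_le[OF \<open>U \<in> borel_measurable M\<close> \<open>V \<in> borel_measurable M\<close> int]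
  have "(expectation (\<lambda>w. U w * V w))\<^sup>2 \<le> (L2 U * L2 V)\<^sup>2"
    using UV(2) by (simp add: power_mult_distrib L2_power2)
  then have "expectation (\<lambda>w. U w * V w) \<le> L2 U * L2 V"
    by (rule power2_le_imp_le) simp
  moreover have "(L2 (\<lambda>w. U w + V w))\<^sup>2 = (L2 U)\<^sup>2 + 2 * expectation (\<lambda>w. U w * V w) + (L2 V)\<^sup>2"
  proof -
    have "(\<lambda>w. (U w + V w)\<^sup>2) = (\<lambda>w. (U w)\<^sup>2 + 2 * (U w * V w) + (V w)\<^sup>2)"
      by (simp add: power2_eq_square algebra_simps)
    then show ?thesis using int UV(1) by (simp add: L2_power2)
  qed
  ultimately show "(L2 (\<lambda>w. U w + V w))\<^sup>2 \<le> (L2 U + L2 V)\<^sup>2"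
    by (simp add: power2_sum)
qed simp

lemma L2_cmult: "L2 (\<lambda>w. c * U w) = \<bar>c\<bar> * L2 U"
  by (simp add: L2_def power_mult_distrib real_sqrt_mult)

lemma L2_diff_swap: "L2 (\<lambda>w. U w - V w) = L2 (\<lambda>w. V w - U w)"
  by (simp add: L2_def power2_commute)

lemma L2_diff_le:
  assumes "sq_int U" "sq_int V"
  shows "\<bar>L2 U - L2 V\<bar> \<le> L2 (\<lambda>w. U w - V w)"
  using L2_triangle[OF sq_int_diff[OF assms] assms(2)] L2_triangle[OF sq_int_diff[OF assms(2,1)] assms(1)]
    L2_diff_swap[of U V] by (simp add: abs_le_iff)

lemma expectation_abs_le_L2:
  assumes "sq_int U"
  shows "expectation (\<lambda>w. \<bar>U w\<bar>) \<le> L2 U"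
proof (rule power2_le_imp_le)
  have [measurable]: "U \<in> borel_measurable M" using assms by (simp add: sq_int_def)
  show "(expectation (\<lambda>w. \<bar>U w\<bar>))\<^sup>2 \<le> (L2 U)\<^sup>2"
    using expectation_mult_sq_le(2)[of "\<lambda>w. \<bar>U w\<bar>" "\<lambda>_. 1"] assms by (simp add: sq_int_def L2_power2 prob_space)
qed simp

definition cen :: "('a \<Rightarrow> real) \<Rightarrow> 'a \<Rightarrow> real" where
  "cen U w = U w - expectation U"

lemma sq_int_cen: "sq_int U \<Longrightarrow> sq_int (cen U)"
  unfolding cen_def[abs_def] by (intro sq_int_diff) auto

lemma L2_cen: "L2 (cen U) = sqrt (variance U)"
  by (simp add: L2_def cen_def)

lemma L2_cen_le:
  assumes "sq_int U"
  shows "L2 (cen U) \<le> L2 U"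
proof -
  have "variance U \<le> expectation (\<lambda>w. (U w)\<^sup>2)"
    using assms sq_int_integrable[OF assms] by (subst variance_eq) (auto simp: sq_int_def)
  then show ?thesis unfolding L2_def cen_def by simp
qed

lemma cen_diff: "sq_int U \<Longrightarrow> sq_int V \<Longrightarrow> cen U w - cen V w = cen (\<lambda>w. U w - V w) w"
  using sq_int_integrable by (simp add: cen_def)

text \<open>Both variables are divided by the same \<sigma>, so only their centred difference
  matters; that \<open>S\<close> has another variance is corrected separately on the Gaussian
  side.\<close>

lemma normalized_law_lipschitz_cmp:
  fixes f :: "real \<Rightarrow> real"
  assumes X: "sq_int X" and S: "sq_int S" and f: "1-lipschitz_on UNIV f" and \<sigma>: "0 < \<sigma>"
  shows "\<bar>expectation (\<lambda>w. f (cen X w / \<sigma>)) - expectation (\<lambda>w. f (cen S w / \<sigma>))\<bar> \<le> L2 (cen (\<lambda>w. X w - S w)) / \<sigma>"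
proof -
  note [measurable] = borel_measurable_continuous_onI[OF lipschitz_on_continuous_on[OF f]]
  have D: "sq_int (cen (\<lambda>w. X w - S w))" by (intro sq_int_cen sq_int_diff X S)
  have int: "integrable M (\<lambda>w. f (cen Z w / \<sigma>))" if Z: "sq_int Z" for Z
  proof (rule Bochner_Integration.integrable_bound)
    have [measurable]: "cen Z \<in> borel_measurable M" using sq_int_cen[OF Z] by (simp add: sq_int_def)
    show "(\<lambda>w. f (cen Z w / \<sigma>)) \<in> borel_measurable M" by measurable
    show "integrable M (\<lambda>w. \<bar>f 0\<bar> + \<bar>cen Z w\<bar> / \<sigma>)"
      using sq_int_integrable[OF sq_int_cen[OF Z]] by simp
    show "AE w in M. norm (f (cen Z w / \<sigma>)) \<le> norm (\<bar>f 0\<bar> + \<bar>cen Z w\<bar> / \<sigma>)"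
    proof (rule AE_I2)
      fix w
      show "norm (f (cen Z w / \<sigma>)) \<le> norm (\<bar>f 0\<bar> + \<bar>cen Z w\<bar> / \<sigma>)"
        using lipschitz_growth(2)[OF f, of "cen Z w / \<sigma>"] \<sigma> by (simp add: abs_divide)
    qed
  qed
  have "\<bar>expectation (\<lambda>w. f (cen X w / \<sigma>)) - expectation (\<lambda>w. f (cen S w / \<sigma>))\<bar>
      = \<bar>expectation (\<lambda>w. f (cen X w / \<sigma>) - f (cen S w / \<sigma>))\<bar>"
    using int[OF X] int[OF S] by simp
  also have "\<dots> \<le> expectation (\<lambda>w. \<bar>f (cen X w / \<sigma>) - f (cen S w / \<sigma>)\<bar>)"
    by (rule integral_abs_bound)
  also have "\<dots> \<le> expectation (\<lambda>w. \<bar>cen (\<lambda>w. X w - S w) w\<bar> / \<sigma>)"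
  proof (rule integral_mono)
    fix w
    have "\<bar>f (cen X w / \<sigma>) - f (cen S w / \<sigma>)\<bar> \<le> \<bar>cen X w / \<sigma> - cen S w / \<sigma>\<bar>"
      by (rule lipschitz_growth(1)[OF f])
    also have "\<dots> = \<bar>cen (\<lambda>w. X w - S w) w\<bar> / \<sigma>"
      using cen_diff[OF X S, of w] \<sigma> by (simp add: diff_divide_distrib[symmetric] abs_divide)
    finally show "\<bar>f (cen X w / \<sigma>) - f (cen S w / \<sigma>)\<bar> \<le> \<bar>cen (\<lambda>w. X w - S w) w\<bar> / \<sigma>" .
  qed (use int[OF X] int[OF S] sq_int_integrable[OF D] in auto)
  also have "\<dots> = expectation (\<lambda>w. \<bar>cen (\<lambda>w. X w - S w) w\<bar>) / \<sigma>" by simp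
  also have "\<dots> \<le> L2 (cen (\<lambda>w. X w - S w)) / \<sigma>"
    using expectation_abs_le_L2[OF D] \<sigma> by (intro divide_right_mono) auto
  finally show ?thesis .
qed

lemma normalized_law_integral:
  fixes f :: "real \<Rightarrow> real"
  assumes [measurable]: "X \<in> borel_measurable M" "f \<in> borel_measurable borel"
  shows "(\<integral>x. f x \<partial>normalized_law M X) = expectation (\<lambda>w. f (cen X w / sqrt (variance X)))"
  unfolding normalized_law_def cen_def by (subst integral_distr) auto

end

section \<open>From Lipschitz test functions to the two distances\<close>

lemma wasserstein_dist_le:
  assumes "\<And>f. 1-lipschitz_on UNIV f \<Longrightarrow> \<bar>(\<integral>x. f x \<partial>\<mu>) - (\<integral>x. f x \<partial>\<nu>)\<bar> \<le> w"
  shows "wasserstein_dist \<mu> \<nu> \<le> w"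
  unfolding wasserstein_dist_def
proof (rule cSup_least)
  have "1-lipschitz_on UNIV (\<lambda>_::real. 0::real)" by (simp add: lipschitz_on_def)
  then have "\<bar>(\<integral>x. (0::real) \<partial>\<mu>) - (\<integral>x. 0 \<partial>\<nu>)\<bar> \<in> {\<bar>(\<integral>x. f x \<partial>\<mu>) - (\<integral>x. f x \<partial>\<nu>)\<bar> |f. 1-lipschitz_on UNIV f}"
    by (intro CollectI exI[of _ "\<lambda>_. 0"] conjI refl)
  then show "{\<bar>(\<integral>x. (f x :: real) \<partial>\<mu>) - (\<integral>x. f x \<partial>\<nu>)\<bar> |f. 1-lipschitz_on UNIV f} \<noteq> {}"
    by (rule ex_in_conv[THEN iffD1, OF exI])
qed (use assms in auto)

lemma std_normal_interval:
  assumes "0 \<le> \<delta>"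
  shows "measure std_normal {..x + \<delta>} \<le> measure std_normal {..x} + \<delta>"
proof -
  interpret prob_space std_normal by (rule prob_space_std_normal)
  have "measure std_normal {..x + \<delta>} = measure std_normal {..x} + measure std_normal {x<..x + \<delta>}"
    using assms by (subst finite_measure_Union[symmetric]) (auto intro!: arg_cong[where f = "measure std_normal"])
  moreover have "measure std_normal {x<..x + \<delta>} \<le> \<delta>"
  proof -
    have le1: "std_normal_density z \<le> 1" for z
    proof -
      have "1 \<le> sqrt (2 * pi)" using pi_ge_two by simp
      then have "1 / sqrt (2 * pi) * exp (- z\<^sup>2 / 2) \<le> 1 * 1"
        by (intro mult_mono) (auto simp: field_simps)
      then show ?thesis by (simp add: std_normal_density_def)
    qed
    have "measure std_normal {x<..x + \<delta>} = (\<integral>z. indicator {x<..x + \<delta>} z \<partial>std_normal)" by simp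
    also have "\<dots> = (\<integral>z. std_normal_density z * indicator {x<..x + \<delta>} z \<partial>lborel)"
      by (rule std_normal_integral(1)) simp
    also have "\<dots> \<le> (\<integral>z. indicator {x<..x + \<delta>} z \<partial>lborel)"
    proof (rule integral_mono)
      show i: "integrable lborel (indicator {x<..x + \<delta>} :: real \<Rightarrow> real)"
        by (intro integrable_real_indicator) (auto simp: assms)
      show "integrable lborel (\<lambda>z. std_normal_density z * indicator {x<..x + \<delta>} z)"
        using integrable_real_mult_indicator[of "{x<..x + \<delta>}" lborel std_normal_density] by simp
      show "std_normal_density z * indicator {x<..x + \<delta>} z \<le> indicator {x<..x + \<delta>} z" for z
        using le1[of z] by (simp split: split_indicator)
    qed
    also have "\<dots> = \<delta>" using assms by simp
    finally show ?thesis .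
  qed
  ultimately show ?thesis by linarith
qed

text \<open>A ramp of height and width \<delta> is a Lipschitz substitute for \<delta> times the
  indicator of a half line. Dividing by \<delta> leaves \<open>w / \<delta>\<close> from the test
  function and \<delta> from the normal density, which is at most one; the two balance when \<delta>
  is \<open>sqrt w\<close>.\<close>

lemma kolmogorov_dist_le:
  fixes \<mu> :: "real measure"
  assumes \<mu>: "prob_space \<mu>" and sets[measurable_cong]: "sets \<mu> = sets borel" and w: "0 < w"
    and lip: "\<And>f. 1-lipschitz_on UNIV f \<Longrightarrow> \<bar>(\<integral>x. f x \<partial>\<mu>) - (\<integral>x. f x \<partial>std_normal)\<bar> \<le> w"
  shows "kolmogorov_dist \<mu> std_normal \<le> 2 * sqrt w"
  unfolding kolmogorov_dist_def
proof (rule cSUP_least)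
  fix x :: real
  interpret A: prob_space \<mu> by fact
  interpret G: prob_space std_normal by (rule prob_space_std_normal)
  define \<delta> where "\<delta> = sqrt w"
  have \<delta>: "0 < \<delta>" "\<delta> * \<delta> = w" using w by (simp_all add: \<delta>_def)
  define r where "r x y = max 0 (min \<delta> (x + \<delta> - y))" for x y :: real
  have rlip: "1-lipschitz_on UNIV (r x)" for x
    unfolding lipschitz_on_def r_def dist_real_def by (auto simp: max_def min_def)
  note [measurable] = borel_measurable_continuous_onI[OF lipschitz_on_continuous_on[OF rlip]]
  have rb: "\<delta> * indicator {..x} y \<le> r x y" "r x y \<le> \<delta> * indicator {..x + \<delta>} y" for x y
    using \<delta> by (auto simp: r_def split: split_indicator)
  have low: "\<delta> * measure \<nu> {..x} \<le> (\<integral>y. r x y \<partial>\<nu>)" and upp: "(\<integral>y. r x y \<partial>\<nu>) \<le> \<delta> * measure \<nu> {..x + \<delta>}"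
    if \<nu>: "prob_space \<nu>" and [measurable_cong]: "sets \<nu> = sets borel" for \<nu> x
  proof -
    interpret N: prob_space \<nu> by (rule \<nu>)
    have sp: "space \<nu> = UNIV" using sets_eq_imp_space_eq[OF \<open>sets \<nu> = sets borel\<close>] by simp
    have int: "integrable \<nu> (r x)"
      by (rule N.integrable_const_bound[where B = \<delta>]) (use \<delta> in \<open>auto simp: r_def\<close>)
    have ind: "integrable \<nu> (\<lambda>y. \<delta> * indicator {..z} y)" for z
      by (intro integrable_mult_right integrable_real_indicator) (auto simp: N.emeasure_eq_measure)
    have "(\<integral>y. \<delta> * indicator {..x} y \<partial>\<nu>) \<le> (\<integral>y. r x y \<partial>\<nu>)"
      by (intro integral_mono ind int rb)
    then show "\<delta> * measure \<nu> {..x} \<le> (\<integral>y. r x y \<partial>\<nu>)" by (simp add: sp)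
    have "(\<integral>y. r x y \<partial>\<nu>) \<le> (\<integral>y. \<delta> * indicator {..x + \<delta>} y \<partial>\<nu>)"
      by (intro integral_mono ind int rb)
    then show "(\<integral>y. r x y \<partial>\<nu>) \<le> \<delta> * measure \<nu> {..x + \<delta>}" by (simp add: sp)
  qed
  have "\<delta> * measure \<mu> {..x} \<le> \<delta> * measure std_normal {..x + \<delta>} + w"
    using low[OF \<mu> sets, of x] upp[OF prob_space_std_normal sets_std_normal, of x] lip[OF rlip, of x] by linarith
  also have "\<dots> \<le> \<delta> * (measure std_normal {..x} + \<delta>) + w"
    using \<delta> std_normal_interval[of \<delta> x] by (intro add_right_mono mult_left_mono) auto
  finally have "\<delta> * measure \<mu> {..x} \<le> \<delta> * (measure std_normal {..x} + 2 * \<delta>)"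
    using \<delta> by (simp add: algebra_simps)
  then have 1: "measure \<mu> {..x} \<le> measure std_normal {..x} + 2 * \<delta>"
    using \<delta> by (simp only: mult_le_cancel_left_pos)
  have "\<delta> * measure std_normal {..x} \<le> \<delta> * (measure std_normal {..x - \<delta>} + \<delta>)"
    using \<delta> std_normal_interval[of \<delta> "x - \<delta>"] by (intro mult_left_mono) auto
  moreover have "\<delta> * measure std_normal {..x - \<delta>} \<le> \<delta> * measure \<mu> {..x} + w"
    using low[OF prob_space_std_normal sets_std_normal, of "x - \<delta>"] upp[OF \<mu> sets, of "x - \<delta>"] lip[OF rlip, of "x - \<delta>"]
    by simp
  ultimately have "\<delta> * measure std_normal {..x} \<le> \<delta> * (measure \<mu> {..x} + 2 * \<delta>)"
    using \<delta> by (simp add: algebra_simps)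
  then have 2: "measure std_normal {..x} \<le> measure \<mu> {..x} + 2 * \<delta>"
    using \<delta> by (simp only: mult_le_cancel_left_pos)
  show "\<bar>measure \<mu> {..x} - measure std_normal {..x}\<bar> \<le> 2 * sqrt w"
    using 1 2 unfolding \<delta>_def by linarith
qed simp

text \<open>Both laws have first absolute moment at most one, so both integrals are within one of
  \<open>f 0\<close>. This bound serves the finitely many small \<open>n\<close>.\<close>

lemma normalized_law_trivial_bound:
  fixes f :: "real \<Rightarrow> real"
  assumes "prob_space M" "prob_space.sq_int M X" "1-lipschitz_on UNIV f"
  shows "\<bar>(\<integral>x. f x \<partial>normalized_law M X) - (\<integral>x. f x \<partial>std_normal)\<bar> \<le> 2"
proof -
  interpret prob_space M by fact
  interpret G: prob_space std_normal by (rule prob_space_std_normal)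
  note f = assms(3) and X = assms(2)
  have [measurable]: "X \<in> borel_measurable M" using X by (simp add: sq_int_def)
  note [measurable] = borel_measurable_continuous_onI[OF lipschitz_on_continuous_on[OF f]]
  let ?\<sigma> = "sqrt (variance X)"
  have c: "sq_int (\<lambda>w. (1 / ?\<sigma>) * cen X w)"
    by (intro sq_int_cmult sq_int_cen X)
  \<comment> \<open>For zero variance the quotient is zero by the convention for division, and the
    bound still holds.\<close>
  have L: "L2 (\<lambda>w. (1 / ?\<sigma>) * cen X w) \<le> 1"
    unfolding L2_cmult L2_cen by (cases "variance X = 0") auto
  have intf: "integrable M (\<lambda>w. f (cen X w / ?\<sigma>))"
  proof (rule Bochner_Integration.integrable_bound)
    have [measurable]: "cen X \<in> borel_measurable M" using sq_int_cen[OF X] by (simp add: sq_int_def)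
    show "(\<lambda>w. f (cen X w / ?\<sigma>)) \<in> borel_measurable M" by measurable
    show "integrable M (\<lambda>w. \<bar>f 0\<bar> + \<bar>(1 / ?\<sigma>) * cen X w\<bar>)"
      using sq_int_integrable[OF c] by (intro Bochner_Integration.integrable_add integrable_abs) auto
    show "AE w in M. norm (f (cen X w / ?\<sigma>)) \<le> norm (\<bar>f 0\<bar> + \<bar>(1 / ?\<sigma>) * cen X w\<bar>)"
    proof (rule AE_I2)
      fix w
      show "norm (f (cen X w / ?\<sigma>)) \<le> norm (\<bar>f 0\<bar> + \<bar>(1 / ?\<sigma>) * cen X w\<bar>)"
        using lipschitz_growth(2)[OF f, of "cen X w / ?\<sigma>"] by simp
    qed
  qed
  have intg: "integrable std_normal (\<lambda>z. f (0 + 1 * z))"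
    by (intro gauss_avg_integrable[OF _ lipschitz_growth(2)[OF f]]) auto
  have "\<bar>expectation (\<lambda>w. f (cen X w / ?\<sigma>)) - f 0\<bar> = \<bar>expectation (\<lambda>w. f (cen X w / ?\<sigma>) - f 0)\<bar>"
    using intf by (simp add: prob_space)
  also have "\<dots> \<le> expectation (\<lambda>w. \<bar>f (cen X w / ?\<sigma>) - f 0\<bar>)"
    by (rule integral_abs_bound)
  also have "\<dots> \<le> expectation (\<lambda>w. \<bar>(1 / ?\<sigma>) * cen X w\<bar>)"
  proof (rule integral_mono)
    fix w
    show "\<bar>f (cen X w / ?\<sigma>) - f 0\<bar> \<le> \<bar>(1 / ?\<sigma>) * cen X w\<bar>"
      using lipschitz_growth(1)[OF f, of "cen X w / ?\<sigma>" 0] by simp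
  next
    show "integrable M (\<lambda>w. \<bar>f (cen X w / ?\<sigma>) - f 0\<bar>)"
      using intf by (intro integrable_abs Bochner_Integration.integrable_diff) auto
    show "integrable M (\<lambda>w. \<bar>(1 / ?\<sigma>) * cen X w\<bar>)"
      by (rule integrable_abs[OF sq_int_integrable[OF c]])
  qed
  also have "\<dots> \<le> 1"
    using expectation_abs_le_L2[OF c] L by linarith
  finally have 1: "\<bar>(\<integral>x. f x \<partial>normalized_law M X) - f 0\<bar> \<le> 1"
    by (simp add: normalized_law_integral)
  have "\<bar>(\<integral>z. f z \<partial>std_normal) - f 0\<bar> = \<bar>\<integral>z. f z - f 0 \<partial>std_normal\<bar>"
    using intg by simp
  also have "\<dots> \<le> (\<integral>z. \<bar>f z - f 0\<bar> \<partial>std_normal)"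
    by (rule integral_abs_bound)
  also have "\<dots> \<le> (\<integral>z. \<bar>z\<bar> \<partial>std_normal)"
    using intg std_normal_abs_moments(1)[of 1] lipschitz_growth(1)[OF f, of _ 0] by (intro integral_mono) auto
  also have "\<dots> \<le> 1" by (rule std_normal_abs_moments(5))
  finally show ?thesis using 1 by linarith
qed

section \<open>Approximation of the tree weight by block sums\<close>

lemma cube_eq_cbox: "(cube n :: (real^'d) set) = cbox (\<chi> i. - real n) (\<chi> i. real n)"
  by (auto simp: cube_def mem_box_cart abs_le_iff minus_le_iff)

lemma Qbox_subset_cube: "Qbox (real n) \<subseteq> (cube n :: (real^'d) set)"
  unfolding cube_eq_cbox by (rule Qbox_subset_cbox)

lemma measure_cube_minus_Qbox: "measure lborel (cube n - Qbox (real n) :: (real^'d) set) = 0"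
proof -
  let ?a = "(\<chi> i. - real n) :: real^'d" and ?b = "(\<chi> i. real n) :: real^'d"
  have sub: "cube n - Qbox (real n) \<subseteq> cbox ?a ?b - box ?a ?b"
    by (auto simp: cube_eq_cbox Qbox_def mem_box_cart less_imp_le)
  have fm: "cbox ?a ?b \<in> fmeasurable lborel" "box ?a ?b \<in> fmeasurable lborel"
    using emeasure_lborel_cbox_finite[of ?a ?b] emeasure_lborel_box_finite[of ?a ?b]
    by (simp_all add: fmeasurable_def less_top)
  have "measure lborel (cbox ?a ?b - box ?a ?b) = measure lborel (cbox ?a ?b) - measure lborel (box ?a ?b)"
    using fm box_subset_cbox by (intro measurable_measure_Diff) auto
  also have "\<dots> = 0"
    by (simp add: measure_lborel_box_eq measure_lborel_cbox_eq)
  finally have z: "measure lborel (cbox ?a ?b - box ?a ?b) = 0" .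
  have "cube n \<in> sets (borel :: (real^'d) measure)" by (simp add: cube_eq_cbox)
  then have "measure lborel (cube n - Qbox (real n) :: (real^'d) set) \<le> measure lborel (cbox ?a ?b - box ?a ?b)"
    using fm by (intro measure_mono_fmeasurable sub fmeasurable_Diff) auto
  then show ?thesis using z measure_nonneg[of lborel "cube n - Qbox (real n) :: (real^'d) set"] by linarith
qed

lemma cube_dist:
  fixes x y :: "real^'d"
  assumes "x \<in> cube n" "y \<in> cube n"
  shows "dist x y \<le> 2 * real n * CARD('d)"
proof -
  have "\<bar>(x - y) $ i\<bar> \<le> 2 * real n" for i
    using assms by (auto simp: cube_def abs_le_iff dest!: spec[of _ i])
  then have "(\<Sum>i\<in>UNIV. \<bar>(x - y) $ i\<bar>) \<le> (\<Sum>i\<in>(UNIV::'d set). 2 * real n)"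
    by (intro sum_mono)
  then show ?thesis
    using norm_le_l1_cart[of "x - y"] by (simp add: dist_norm mult.commute)
qed

text \<open>The cross terms vanish because the blocks are independent and centred.\<close>

lemma Ep_sum_square_indep:
  fixes X :: "'i \<Rightarrow> 'a set \<Rightarrow> real"
  assumes "finite C" "\<And>c. c \<in> C \<Longrightarrow> finite (\<Lambda> c)"
    "\<And>c c'. c \<in> C \<Longrightarrow> c' \<in> C \<Longrightarrow> c \<noteq> c' \<Longrightarrow> \<Lambda> c \<inter> \<Lambda> c' = {}" "\<And>c. c \<in> C \<Longrightarrow> Ep p (\<Lambda> c) (X c) = 0"
  shows "Ep p (\<Union>c\<in>C. \<Lambda> c) (\<lambda>A. (\<Sum>c\<in>C. X c (A \<inter> \<Lambda> c))\<^sup>2) = (\<Sum>c\<in>C. Ep p (\<Lambda> c) (\<lambda>A. (X c A)\<^sup>2))"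
  using assms
proof (induction C rule: finite_induct)
  case (insert c C)
  let ?U = "\<Union>c\<in>C. \<Lambda> c" and ?W = "\<lambda>A. \<Sum>c\<in>C. X c (A \<inter> \<Lambda> c)"
  have fin: "finite (\<Lambda> c)" "finite ?U" using insert by auto
  have disj: "\<Lambda> c \<inter> ?U = {}"
    using insert.prems(2)[of c] insert.hyps(2) by blast
  have IH: "Ep p ?U (\<lambda>A. (?W A)\<^sup>2) = (\<Sum>c\<in>C. Ep p (\<Lambda> c) (\<lambda>A. (X c A)\<^sup>2))"
    using insert.prems by (intro insert.IH) auto
  have "Ep p (\<Union>c\<in>insert c C. \<Lambda> c) (\<lambda>A. (\<Sum>c\<in>insert c C. X c (A \<inter> \<Lambda> c))\<^sup>2)
      = Ep p (\<Lambda> c \<union> ?U) (\<lambda>A. (\<Sum>c\<in>insert c C. X c (A \<inter> \<Lambda> c))\<^sup>2)" by simp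
  also have "\<dots> = Ep p (\<Lambda> c) (\<lambda>A. Ep p ?U (\<lambda>A'. (\<Sum>c\<in>insert c C. X c ((A \<union> A') \<inter> \<Lambda> c))\<^sup>2))"
    by (rule Ep_Un[OF fin disj])
  also have "\<dots> = Ep p (\<Lambda> c) (\<lambda>A. Ep p ?U (\<lambda>A'. (X c A)\<^sup>2 + (2 * ?W A' * X c A + (?W A')\<^sup>2)))"
  proof (intro Ep_cong)
    fix A A' assume A: "A \<subseteq> \<Lambda> c" and A': "A' \<subseteq> ?U"
    have "(A \<union> A') \<inter> \<Lambda> c = A" using A A' disj by blast
    moreover have "(A \<union> A') \<inter> \<Lambda> c' = A' \<inter> \<Lambda> c'" if "c' \<in> C" for c'
      using A disj that by blast
    ultimately show "(\<Sum>c\<in>insert c C. X c ((A \<union> A') \<inter> \<Lambda> c))\<^sup>2 = (X c A)\<^sup>2 + (2 * ?W A' * X c A + (?W A')\<^sup>2)"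
      using insert.hyps by (simp add: power2_sum algebra_simps)
  qed
  also have "\<dots> = Ep p (\<Lambda> c) (\<lambda>A. (X c A)\<^sup>2 + ((2 * Ep p ?U ?W) * X c A + Ep p ?U (\<lambda>A. (?W A)\<^sup>2)))"
  proof (rule Ep_cong)
    fix A
    have "Ep p ?U (\<lambda>A'. 2 * ?W A' * X c A) = 2 * Ep p ?U ?W * X c A"
      using Ep_cmult[of p ?U "2 * X c A" ?W] by (simp add: mult_ac)
    then show "Ep p ?U (\<lambda>A'. (X c A)\<^sup>2 + (2 * ?W A' * X c A + (?W A')\<^sup>2))
        = (X c A)\<^sup>2 + ((2 * Ep p ?U ?W) * X c A + Ep p ?U (\<lambda>A. (?W A)\<^sup>2))"
      using fin by (simp add: Ep_add)
  qed
  also have "\<dots> = Ep p (\<Lambda> c) (\<lambda>A. (X c A)\<^sup>2) + Ep p ?U (\<lambda>A. (?W A)\<^sup>2)"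
    using fin insert.prems(3)[of c] by (simp add: Ep_add Ep_cmult)
  finally show ?case
    using IH insert.hyps by simp
qed simp

context unit_poisson
begin

lemma cube_borel [simp, measurable]: "(cube n :: (real^'d) set) \<in> sets borel"
  by (simp add: cube_eq_cbox)

lemma bounded_cube [simp]: "bounded (cube n :: (real^'d) set)"
  by (simp add: cube_eq_cbox)

text \<open>The closed cube and the half-open box differ by a Lebesgue null set, which almost surely
  contains no Poisson point. The half-open box is the one that cells tile.\<close>

lemma AE_cube_Qbox: "AE w in M. P w \<inter> cube n = P w \<inter> Qbox (real n)"
proof -
  let ?B = "cube n - Qbox (real n) :: (real^'d) set"
  have B: "?B \<in> sets borel" "bounded ?B" by (auto intro: bounded_diff)
  have "prob {w \<in> space M. card (P w \<inter> ?B) = 0} = 1"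
    using count_zero_prob[OF B] measure_cube_minus_Qbox[of n, where 'd = 'd] by simp
  then have "AE w in M. w \<in> {w \<in> space M. card (P w \<inter> ?B) = 0}"
    by (rule AE_prob_1)
  then show ?thesis
  proof (rule AE_mp, intro AE_I2 impI)
    fix w assume w: "w \<in> space M" "w \<in> {w \<in> space M. card (P w \<inter> ?B) = 0}"
    then have "P w \<inter> ?B = {}"
      using finite_pts[OF w(1) B(2)] by simp
    then show "P w \<inter> cube n = P w \<inter> Qbox (real n)"
      using Qbox_subset_cube by blast
  qed
qed

definition \<rho>max :: "nat \<Rightarrow> real" where
  "\<rho>max n = 2 * real n * CARD('d)"

lemma mst_stat_eq:
  assumes "w \<in> space M"
  shows "mst_stat P n w = (if P w \<inter> cube n = {} then 0 else cint (\<rho>max n) (P w \<inter> cube n) - \<rho>max n)"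
proof (cases "P w \<inter> cube n = {}")
  case False
  have "mst_weight (P w \<inter> cube n) = cint (\<rho>max n) (P w \<inter> cube n) - \<rho>max n"
    using False assms cube_dist[where 'd = 'd]
    by (intro mst_weight_eq_cint finite_pts) (auto simp: \<rho>max_def)
  then show ?thesis using False by (simp add: mst_stat_def)
qed (simp add: mst_stat_def)

lemma mst_measurable [measurable]: "mst_stat P n \<in> borel_measurable M"
proof -
  have r: "0 \<le> \<rho>max n" by (simp add: \<rho>max_def)
  have [measurable]: "(\<lambda>w. cint (\<rho>max n) (P w \<inter> cube n)) \<in> borel_measurable M"
    using cint_measurable[OF r, of "{}" "cube n"] by simp
  have [measurable]: "(\<lambda>w. card (P w \<inter> cube n)) \<in> measurable M (count_space UNIV)"
    by (intro count_measurable) auto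
  have "(\<lambda>w. if card (P w \<inter> cube n) = 0 then 0 else cint (\<rho>max n) (P w \<inter> cube n) - \<rho>max n) \<in> borel_measurable M"
    by measurable
  then show ?thesis
  proof (rule measurable_cong[THEN iffD1, rotated])
    fix w assume w: "w \<in> space M"
    show "(if card (P w \<inter> cube n) = 0 then 0 else cint (\<rho>max n) (P w \<inter> cube n) - \<rho>max n) = mst_stat P n w"
      using mst_stat_eq[OF w] finite_pts[OF w bounded_cube, of n] by simp
  qed
qed

lemma lpts_Qbox_sq_int: "0 < \<eta> \<Longrightarrow> sq_int (\<lambda>w. g (lpts \<eta> (Qbox (\<eta> * real k)) w))"
  using lpts_fun_integrable(1)[of \<eta> "Qbox (\<eta> * real k)" k "\<lambda>A. (g A)\<^sup>2"] lpts_measurable[of \<eta> "Qbox (\<eta> * real k)" g]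
  by (simp add: sq_int_def)

lemma L2_cen_lpts:
  assumes "0 < \<eta>" "1 \<le> k"
  shows "(L2 (cen (\<lambda>w. g (lpts \<eta> (Qbox (\<eta> * real k)) w))))\<^sup>2 = Vp (pocc TYPE('d) \<eta>) (lbox 0 k) g"
proof -
  let ?A = "lpts \<eta> (Qbox (\<eta> * real k))"
  have "(L2 (cen (\<lambda>w. g (?A w))))\<^sup>2 = expectation (\<lambda>w. (g (?A w) - Ep (pocc TYPE('d) \<eta>) (lbox 0 k) g)\<^sup>2)"
    unfolding L2_power2 cen_def using expectation_lpts[OF assms, of g] by simp
  also have "\<dots> = Ep (pocc TYPE('d) \<eta>) (lbox 0 k) (\<lambda>A. (g A - Ep (pocc TYPE('d) \<eta>) (lbox 0 k) g)\<^sup>2)"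
    using expectation_lpts[OF assms, of "\<lambda>A. (g A - Ep (pocc TYPE('d) \<eta>) (lbox 0 k) g)\<^sup>2"] by simp
  also have "\<dots> = Vp (pocc TYPE('d) \<eta>) (lbox 0 k) g"
    by (rule Vp_centered) simp
  finally show ?thesis .
qed

text \<open>The error splits into rounding at the full cutoff and lowering the cutoff from
  \<open>\<rho>max n\<close> to \<rho> on the lattice. The second part vanishes unless some tile is
  empty.\<close>

lemma mst_lattice_pointwise:
  fixes \<eta> \<rho> :: real and m u n :: nat
  assumes \<eta>: "0 < \<eta>" "\<eta> * real (m * u) = real n" and mu: "1 \<le> m" "1 \<le> u"
    and \<rho>: "0 < \<rho>" "\<rho> \<le> \<rho>max n" "CARD('d) * (2 * real u + 1) \<le> \<rho> / \<eta> / 3"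
    and w: "w \<in> space M" "P w \<inter> cube n = P w \<inter> Qbox (real n)"
  shows "\<bar>mst_stat P n w - (\<eta> * cint (\<rho> / \<eta>) (lpts \<eta> (Qbox (real n)) w) - \<rho>)\<bar>
    \<le> CARD('d) * \<eta> * card (P w \<inter> Qbox (real n))
      + (if has_hole m u (lpts \<eta> (Qbox (real n)) w) then \<rho>max n * (1 + card (lpts \<eta> (Qbox (real n)) w)) else 0)"
proof -
  let ?V = "P w \<inter> Qbox (real n)" and ?A = "lpts \<eta> (Qbox (real n)) w"
  have fin: "finite ?V" using w by simp
  have A: "?A = lround \<eta> ` ?V" by (simp add: lpts_def)
  have AL: "?A \<subseteq> lbox 0 (m * u)"
    using lpts_subset[of \<eta> "Qbox (real n)" "m * u" w] \<eta> by simp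
  show ?thesis
  proof (cases "?V = {}")
    case True
    \<comment> \<open>Without points the weight is zero while the lattice expression equals minus
      \<rho>; every tile is then a hole, and the hole term pays for the difference.\<close>
    then have "?A = {}" by (simp add: A)
    moreover have "tile_centers m u \<noteq> ({} :: (real^'d) set)"
      using card_tile_centers[OF mu(2), of m, where 'd = 'd] mu by fastforce
    ultimately show ?thesis
      using True w mst_stat_eq[OF w(1), of n] \<rho> by (auto simp: has_hole_def)
  next
    case False
    have X: "mst_stat P n w = cint (\<rho>max n) ?V - \<rho>max n"
      using mst_stat_eq[OF w(1), of n] w(2) False by simp
    have r: "0 \<le> \<rho>max n" by (simp add: \<rho>max_def)
    have 1: "\<bar>cint (\<rho>max n) ?V - \<eta> * cint (\<rho>max n / \<eta>) ?A\<bar> \<le> CARD('d) * \<eta> * card ?V"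
      unfolding A by (rule cint_lround[OF fin \<eta>(1) r])
    have le: "\<rho> / \<eta> \<le> \<rho>max n / \<eta>" using \<rho> \<eta> by (intro divide_right_mono) auto
    let ?e = "(cint (\<rho>max n / \<eta>) ?A - \<rho>max n / \<eta>) - (cint (\<rho> / \<eta>) ?A - \<rho> / \<eta>)"
    have 2: "\<eta> * \<bar>?e\<bar> \<le> (if has_hole m u ?A then \<rho>max n * (1 + card ?A) else 0)"
    proof (cases "has_hole m u ?A")
      case True
      have "\<bar>?e\<bar> \<le> \<rho>max n / \<eta> * (1 + card ?A)"
        using AL finite_subset[OF AL finite_lbox] \<rho> \<eta> le by (intro cint_tail_abs) auto
      then have "\<eta> * \<bar>?e\<bar> \<le> \<eta> * (\<rho>max n / \<eta> * (1 + card ?A))"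
        using \<eta> by (intro mult_left_mono) auto
      then show ?thesis using True \<eta> by simp
    next
      case False
      have "?e = 0"
        using cint_no_hole[OF mu AL False \<rho>(3) le] by simp
      then show ?thesis using False by simp
    qed
    have "cint (\<rho>max n) ?V - \<rho>max n - (\<eta> * cint (\<rho> / \<eta>) ?A - \<rho>)
        = (cint (\<rho>max n) ?V - \<eta> * cint (\<rho>max n / \<eta>) ?A) + \<eta> * ?e"
      using \<eta>(1) by (simp add: algebra_simps)
    then have "\<bar>mst_stat P n w - (\<eta> * cint (\<rho> / \<eta>) ?A - \<rho>)\<bar>
        \<le> \<bar>cint (\<rho>max n) ?V - \<eta> * cint (\<rho>max n / \<eta>) ?A\<bar> + \<eta> * \<bar>?e\<bar>"
      unfolding X using \<eta>(1) abs_triangle_ineq[of "cint (\<rho>max n) ?V - \<eta> * cint (\<rho>max n / \<eta>) ?A" "\<eta> * ?e"]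
      by (simp add: abs_mult)
    then show ?thesis using 1 2 by linarith
  qed
qed

lemma mst_lattice_L2:
  fixes \<eta> \<rho> :: real and m u n :: nat
  assumes \<eta>: "0 < \<eta>" "\<eta> * real (m * u) = real n" and mu: "1 \<le> m" "1 \<le> u"
    and \<rho>: "0 < \<rho>" "\<rho> \<le> \<rho>max n" "CARD('d) * (2 * real u + 1) \<le> \<rho> / \<eta> / 3"
  shows "sq_int (mst_stat P n)"
    and "(L2 (\<lambda>w. mst_stat P n w - (\<eta> * cint (\<rho> / \<eta>) (lpts \<eta> (Qbox (real n)) w) - \<rho>)))\<^sup>2
      \<le> 2 * (CARD('d) * \<eta>)\<^sup>2 * second_moment TYPE('d) (real n)
        + 2 * (\<rho>max n)\<^sup>2 * (real m ^ CARD('d) * (exp (- ((2 * \<eta> * u) ^ CARD('d))) * (4 * ((2 * real n) ^ CARD('d) + 1)\<^sup>2)))"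
proof -
  let ?p = "pocc TYPE('d) \<eta>" and ?A = "lpts \<eta> (Qbox (real n))" and ?L = "lbox (0::real^'d) (m * u)"
  have n: "0 < real n" unfolding \<eta>(2)[symmetric] using \<eta>(1) mu by simp
  have Q: "Qbox (\<eta> * real (m * u)) = (Qbox (real n) :: (real^'d) set)" by (simp only: \<eta>(2))
  let ?Y = "\<lambda>w. \<eta> * cint (\<rho> / \<eta>) (?A w) - \<rho>" and ?N = "\<lambda>w. real (card (P w \<inter> Qbox (real n)))"
  let ?h = "\<lambda>A::(real^'d) set. if has_hole m u A then (1 + real (card A))\<^sup>2 else 0"
  have sqY: "sq_int ?Y"
    using lpts_Qbox_sq_int[OF \<eta>(1), of "\<lambda>A. \<eta> * cint (\<rho> / \<eta>) A - \<rho>" "m * u"] unfolding Q .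
  have inth: "integrable M (\<lambda>w. ?h (?A w))"
    using lpts_fun_integrable(1)[OF \<eta>(1), of "Qbox (real n)" "m * u" ?h] unfolding \<eta>(2) by simp
  have intN: "integrable M (\<lambda>w. (?N w)\<^sup>2)"
    by (rule count_second_moment(1)[OF n])
  let ?b = "\<lambda>w. 2 * (CARD('d) * \<eta>)\<^sup>2 * (?N w)\<^sup>2 + 2 * (\<rho>max n)\<^sup>2 * ?h (?A w)"
  have intb: "integrable M ?b"
    by (intro Bochner_Integration.integrable_add integrable_mult_right intN inth)
  have pt: "AE w in M. (mst_stat P n w - ?Y w)\<^sup>2 \<le> ?b w"
    using AE_cube_Qbox[of n] AE_space
  proof eventually_elim
    case (elim w)
    let ?x = "CARD('d) * \<eta> * ?N w" and ?y = "if has_hole m u (?A w) then \<rho>max n * (1 + card (?A w)) else 0"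
    have "\<bar>mst_stat P n w - ?Y w\<bar> \<le> ?x + ?y"
      using mst_lattice_pointwise[OF assms elim(2,1)] .
    then have "\<bar>mst_stat P n w - ?Y w\<bar>\<^sup>2 \<le> (?x + ?y)\<^sup>2"
      by (intro power_mono) auto
    also have "\<dots> \<le> 2 * ?x\<^sup>2 + 2 * ?y\<^sup>2"
    proof -
      have "0 \<le> (?x - ?y)\<^sup>2" by simp
      then show ?thesis by (simp add: power2_sum power2_diff)
    qed
    also have "\<dots> = ?b w" by (simp add: power_mult_distrib)
    finally show ?case by simp
  qed
  have [measurable]: "?Y \<in> borel_measurable M" using sqY by (simp add: sq_int_def)
  have intD: "integrable M (\<lambda>w. (mst_stat P n w - ?Y w)\<^sup>2)"
    by (rule Bochner_Integration.integrable_bound[OF intb]) (use pt in \<open>auto elim!: eventually_mono\<close>)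
  then have sqD: "sq_int (\<lambda>w. mst_stat P n w - ?Y w)" by (simp add: sq_int_def)
  show "sq_int (mst_stat P n)"
    using sq_int_add[OF sqD sqY] by simp
  have "(L2 (\<lambda>w. mst_stat P n w - ?Y w))\<^sup>2 \<le> expectation ?b"
    unfolding L2_power2 using intD intb pt by (intro integral_mono_AE)
  also have "\<dots> = 2 * (CARD('d) * \<eta>)\<^sup>2 * expectation (\<lambda>w. (?N w)\<^sup>2) + 2 * (\<rho>max n)\<^sup>2 * expectation (\<lambda>w. ?h (?A w))"
    using intN inth by (subst Bochner_Integration.integral_add) auto
  also have "\<dots> \<le> 2 * (CARD('d) * \<eta>)\<^sup>2 * second_moment TYPE('d) (real n)
        + 2 * (\<rho>max n)\<^sup>2 * (real m ^ CARD('d) * (exp (- ((2 * \<eta> * u) ^ CARD('d))) * (4 * ((2 * real n) ^ CARD('d) + 1)\<^sup>2)))"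
  proof (intro add_mono mult_left_mono)
    show "expectation (\<lambda>w. (?N w)\<^sup>2) \<le> second_moment TYPE('d) (real n)"
      by (rule count_second_moment(2)[OF n])
    have mu1: "1 \<le> m * u" using mu by simp
    have p: "0 \<le> ?p" "?p \<le> 1" using pocc_bounds[where 'd = 'd, of \<eta>] \<eta> by auto
    have "expectation (\<lambda>w. ?h (?A w)) = Ep ?p ?L ?h"
      using expectation_lpts[OF \<eta>(1) mu1, of ?h] unfolding \<eta>(2) .
    also have "\<dots> \<le> real m ^ CARD('d) * ((1 - ?p) ^ ((2 * u) ^ CARD('d)) * (4 * (?p * (2 * real (m * u)) ^ CARD('d) + 1)\<^sup>2))"
      by (rule hole_second_moment[OF p mu(2)])
    also have "\<dots> \<le> real m ^ CARD('d) * (exp (- ((2 * \<eta> * u) ^ CARD('d))) * (4 * ((2 * real n) ^ CARD('d) + 1)\<^sup>2))"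
    proof (intro mult_mono power_mono add_right_mono)
      \<comment> \<open>Since \<open>1 - ?p\<close> is the exact void probability of a cell, this
        power is the void probability of a whole tile.\<close>
      have "(1 - ?p) ^ ((2 * u) ^ CARD('d)) = exp (- (\<eta> ^ CARD('d))) ^ ((2 * u) ^ CARD('d))"
        by (simp add: pocc_def)
      also have "\<dots> = exp (- ((2 * \<eta> * u) ^ CARD('d)))"
        by (simp flip: exp_of_nat_mult add: power_mult_distrib mult_ac)
      finally show "(1 - ?p) ^ ((2 * u) ^ CARD('d)) \<le> exp (- ((2 * \<eta> * u) ^ CARD('d)))" by simp
      have "?p * (2 * real (m * u)) ^ CARD('d) \<le> \<eta> ^ CARD('d) * (2 * real (m * u)) ^ CARD('d)"
        using pocc_bounds(3)[where 'd = 'd, of \<eta>] \<eta> by (intro mult_right_mono) auto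
      also have "\<dots> = (2 * (\<eta> * real (m * u))) ^ CARD('d)"
        unfolding power_mult_distrib[symmetric] by (simp add: mult_ac)
      finally show "?p * (2 * real (m * u)) ^ CARD('d) \<le> (2 * real n) ^ CARD('d)"
        unfolding \<eta>(2) .
    qed (use p in auto)
    finally show "expectation (\<lambda>w. ?h (?A w)) \<le> real m ^ CARD('d) * (exp (- ((2 * \<eta> * u) ^ CARD('d))) * (4 * ((2 * real n) ^ CARD('d) + 1)\<^sup>2))" .
  qed auto
  finally show "(L2 (\<lambda>w. mst_stat P n w - (\<eta> * cint (\<rho> / \<eta>) (?A w) - \<rho>)))\<^sup>2
      \<le> 2 * (CARD('d) * \<eta>)\<^sup>2 * second_moment TYPE('d) (real n)
        + 2 * (\<rho>max n)\<^sup>2 * (real m ^ CARD('d) * (exp (- ((2 * \<eta> * u) ^ CARD('d))) * (4 * ((2 * real n) ^ CARD('d) + 1)\<^sup>2)))" .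
qed

text \<open>The block terms are functions of disjoint sets of sites, hence independent, and each is
  at most the cutoff times the number of its points, which bounds the third moments. The
  normalisation \<sigma> is free so that the standard deviation of the tree weight can be
  inserted.\<close>

lemma block_sum_lindeberg:
  fixes \<eta> \<rho> \<sigma> e :: real and B k :: nat and f :: "real \<Rightarrow> real"
  assumes \<eta>: "0 < \<eta>" and Bk: "1 \<le> B" "1 \<le> k" and \<rho>: "0 < \<rho>" and \<sigma>: "0 < \<sigma>" and e: "0 < e"
    and f: "1-lipschitz_on UNIV f"
  defines "S \<equiv> \<lambda>w. \<eta> * (\<Sum>c\<in>tile_centers B k. cint (\<rho> / \<eta>) (lpts \<eta> (Qbox (\<eta> * real (B * k))) w \<inter> lbox c k))"
  shows "\<bar>expectation (\<lambda>w. f (cen S w / \<sigma>)) - (\<integral>z. f (L2 (cen S) / \<sigma> * z) \<partial>std_normal)\<bar>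
    \<le> 6 * e + 6 / e\<^sup>2 * (real B ^ CARD('d) * (\<rho> * ((2 * \<eta> * real k) ^ CARD('d) + 2) / \<sigma>) ^ 3)"
proof -
  let ?p = "pocc TYPE('d) \<eta>" and ?L = "lbox (0::real^'d) (B * k)" and ?C = "tile_centers B k :: (real^'d) set"
  let ?F = "cint (\<rho> / \<eta>)" and ?\<mu> = "(2 * \<eta> * real k) ^ CARD('d)"
  let ?A = "lpts \<eta> (Qbox (\<eta> * real (B * k)))"
  have p: "0 \<le> ?p" "?p \<le> 1" using pocc_bounds[where 'd = 'd, of \<eta>] \<eta> by auto
  have Bk1: "1 \<le> B * k" using Bk by simp
  define E where "E c = Ep ?p (lbox c k) ?F" for c :: "real^'d"
  define X where "X c A = \<eta> / \<sigma> * (?F A - E c)" for c :: "real^'d" and A :: "(real^'d) set"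
  define s where "s c = sqrt (Ep ?p (lbox c k) (\<lambda>A. (X c A)\<^sup>2))" for c :: "real^'d"
  define T where "T = (\<rho> * (?\<mu> + 2) / \<sigma>) ^ 3"
  have lat: "lattice_pt c" if "c \<in> ?C" for c using that by (rule tile_centers_lattice_pt)
  have sub: "lbox c k \<subseteq> ?L" if "c \<in> ?C" for c using tile_subset[OF Bk(2) that] .
  have pk: "?p * (2 * real k) ^ CARD('d) \<le> ?\<mu>"
  proof -
    have "?p * (2 * real k) ^ CARD('d) \<le> \<eta> ^ CARD('d) * (2 * real k) ^ CARD('d)"
      using pocc_bounds(3)[where 'd = 'd, of \<eta>] \<eta> by (intro mult_right_mono) auto
    also have "\<dots> = ?\<mu>" unfolding power_mult_distrib[symmetric] by (simp add: mult_ac)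
    finally show ?thesis .
  qed
  have \<mu>0: "0 \<le> ?\<mu>" using \<eta> by simp
  have Fnn: "0 \<le> ?F A" if "A \<subseteq> lbox c k" for A and c :: "real^'d"
    using that finite_lbox finite_subset cint_nonneg by metis
  have mom3: "Ep ?p (lbox c k) (\<lambda>A. (?F A) ^ 3) \<le> (\<rho> / \<eta> * (?\<mu> + 2)) ^ 3" if "c \<in> ?C" for c
  proof -
    have "Ep ?p (lbox c k) (\<lambda>A. (?F A) ^ 3) \<le> (\<rho> / \<eta>) ^ 3 * (?p * (2 * real k) ^ CARD('d) + 2) ^ 3"
      using \<rho> \<eta> by (intro block_third_moment[OF p _ lat[OF that]]) auto
    also have "\<dots> \<le> (\<rho> / \<eta>) ^ 3 * (?\<mu> + 2) ^ 3"
      using pk \<rho> \<eta> p by (intro mult_left_mono power_mono add_right_mono) auto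
    finally show ?thesis by (simp only: power_mult_distrib)
  qed
  have Fcard: "?F A \<le> \<rho> / \<eta> * card A" if "A \<subseteq> lbox c k" for A and c :: "real^'d"
    using cint_le[of A "\<rho> / \<eta>"] finite_subset[OF that finite_lbox] \<rho> \<eta> by simp
  have E: "0 \<le> E c" "E c \<le> \<rho> / \<eta> * (?\<mu> + 2)" if "c \<in> ?C" for c
  proof -
    show "0 \<le> E c" unfolding E_def using Fnn by (intro Ep_nonneg p) auto
    have "E c \<le> Ep ?p (lbox c k) (\<lambda>A. \<rho> / \<eta> * card A)"
      unfolding E_def using Fcard by (intro Ep_mono p) auto
    also have "\<dots> = \<rho> / \<eta> * (?p * (2 * real k) ^ CARD('d))"
      unfolding Ep_cmult using Ep_card[OF finite_lbox, of ?p c k] by (simp add: card_lbox[OF lat[OF that]])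
    also have "\<dots> \<le> \<rho> / \<eta> * (?\<mu> + 2)"
      using pk \<rho> \<eta> by (intro mult_left_mono) auto
    finally show "E c \<le> \<rho> / \<eta> * (?\<mu> + 2)" .
  qed
  have scale: "(\<eta> / \<sigma>) ^ 3 * (\<rho> / \<eta> * (?\<mu> + 2)) ^ 3 = T"
    unfolding T_def power_mult_distrib[symmetric] using \<eta> by simp
  have X1: "Ep ?p (lbox c k) (X c) = 0" for c
    unfolding X_def[abs_def] Ep_cmult Ep_diff by (simp add: E_def)
  have X3: "Ep ?p (lbox c k) (\<lambda>A. \<bar>X c A\<bar> ^ 3) \<le> 2 * T" if c: "c \<in> ?C" for c
  proof -
    have "Ep ?p (lbox c k) (\<lambda>A. \<bar>X c A\<bar> ^ 3) \<le> Ep ?p (lbox c k) (\<lambda>A. (\<eta> / \<sigma>) ^ 3 * ((?F A) ^ 3 + (E c) ^ 3))"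
    proof (rule Ep_mono[OF p])
      fix A assume A: "A \<subseteq> lbox c k"
      have "\<bar>?F A - E c\<bar> \<le> max (?F A) (E c)"
        using Fnn[OF A] E(1)[OF c] by (auto simp: abs_le_iff)
      then have "\<bar>?F A - E c\<bar> ^ 3 \<le> (max (?F A) (E c)) ^ 3"
        by (intro power_mono) auto
      also have "\<dots> \<le> (?F A) ^ 3 + (E c) ^ 3"
        using Fnn[OF A] E(1)[OF c] by (auto simp: max_def)
      finally have "(\<eta> / \<sigma>) ^ 3 * \<bar>?F A - E c\<bar> ^ 3 \<le> (\<eta> / \<sigma>) ^ 3 * ((?F A) ^ 3 + (E c) ^ 3)"
        using \<eta> \<sigma> by (intro mult_left_mono) auto
      moreover have "\<bar>X c A\<bar> = \<eta> / \<sigma> * \<bar>?F A - E c\<bar>"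
        using \<eta> \<sigma> unfolding X_def abs_mult by simp
      ultimately show "\<bar>X c A\<bar> ^ 3 \<le> (\<eta> / \<sigma>) ^ 3 * ((?F A) ^ 3 + (E c) ^ 3)"
        by (simp only: power_mult_distrib)
    qed
    also have "\<dots> = (\<eta> / \<sigma>) ^ 3 * (Ep ?p (lbox c k) (\<lambda>A. (?F A) ^ 3) + (E c) ^ 3)"
      by (simp add: Ep_cmult Ep_add)
    also have "\<dots> \<le> (\<eta> / \<sigma>) ^ 3 * ((\<rho> / \<eta> * (?\<mu> + 2)) ^ 3 + (\<rho> / \<eta> * (?\<mu> + 2)) ^ 3)"
      using mom3[OF c] E[OF c] \<eta> \<sigma> by (intro mult_left_mono add_mono power_mono) auto
    also have "\<dots> = 2 * T"
      unfolding scale[symmetric] by simp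
    finally show ?thesis .
  qed
  have T0: "0 \<le> T" using \<rho> \<mu>0 \<sigma> by (simp add: T_def)
  have s2: "(s c)\<^sup>2 = Ep ?p (lbox c k) (\<lambda>A. (X c A)\<^sup>2)" "0 \<le> s c" for c
    unfolding s_def using p by (auto intro!: Ep_nonneg)
  have s3: "(s c) ^ 3 \<le> 2 * T" if c: "c \<in> ?C" for c
  proof -
    have "Ep ?p (lbox c k) (\<lambda>A. (?F A - E c)\<^sup>2) \<le> Ep ?p (lbox c k) (\<lambda>A. (?F A)\<^sup>2)"
      unfolding E_def using Vp_centered[OF finite_lbox, of ?p c k ?F] Vp_le_Ep_square[of ?p "lbox c k" ?F] by simp
    also have "\<dots> \<le> Ep ?p (lbox c k) (\<lambda>A. (\<rho> / \<eta>)\<^sup>2 * real (card A) ^ 2)"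
    proof (rule Ep_mono[OF p])
      fix A assume A: "A \<subseteq> lbox c k"
      have "(?F A)\<^sup>2 \<le> (\<rho> / \<eta> * card A)\<^sup>2"
        using Fnn[OF A] Fcard[OF A] by (intro power_mono) auto
      then show "(?F A)\<^sup>2 \<le> (\<rho> / \<eta>)\<^sup>2 * real (card A) ^ 2" by (simp only: power_mult_distrib)
    qed
    also have "\<dots> \<le> (\<rho> / \<eta>)\<^sup>2 * (?p * card (lbox c k) + 1)\<^sup>2"
      unfolding Ep_cmult using Ep_card_pow(1)[OF p finite_lbox] by (intro mult_left_mono) auto
    also have "\<dots> \<le> (\<rho> / \<eta>)\<^sup>2 * (?\<mu> + 2)\<^sup>2"
      using pk p by (intro mult_left_mono power_mono) (auto simp: card_lbox[OF lat[OF c]])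
    finally have "Ep ?p (lbox c k) (\<lambda>A. (?F A - E c)\<^sup>2) \<le> (\<rho> / \<eta> * (?\<mu> + 2))\<^sup>2"
      by (simp only: power_mult_distrib)
    then have "(\<eta> / \<sigma>)\<^sup>2 * Ep ?p (lbox c k) (\<lambda>A. (?F A - E c)\<^sup>2) \<le> (\<eta> / \<sigma>)\<^sup>2 * (\<rho> / \<eta> * (?\<mu> + 2))\<^sup>2"
      by (intro mult_left_mono) auto
    also have "\<dots> = (\<rho> * (?\<mu> + 2) / \<sigma>)\<^sup>2"
      unfolding power_mult_distrib[symmetric] using \<eta> by simp
    finally have "(s c)\<^sup>2 \<le> (\<rho> * (?\<mu> + 2) / \<sigma>)\<^sup>2"
      unfolding s2(1) X_def power_mult_distrib Ep_cmult .
    moreover have "0 \<le> \<rho> * (?\<mu> + 2) / \<sigma>"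
      by (intro divide_nonneg_nonneg mult_nonneg_nonneg add_nonneg_nonneg \<mu>0) (use \<rho> \<sigma> in auto)
    ultimately have "s c \<le> \<rho> * (?\<mu> + 2) / \<sigma>"
      by (rule power2_le_imp_le)
    then have "(s c) ^ 3 \<le> T"
      unfolding T_def using s2(2) by (intro power_mono) auto
    then show ?thesis using T0 by simp
  qed
  let ?W = "\<lambda>A. \<Sum>c\<in>?C. X c (A \<inter> lbox c k)"
  have UL: "(\<Union>c\<in>?C. lbox c k) = ?L" using tiles_Union[OF Bk(2), of B, where 'd = 'd] by simp
  have lind: "\<bar>Ep ?p (\<Union>c\<in>?C. lbox c k) (\<lambda>A. f (?W A)) - (\<integral>z. f (sqrt (\<Sum>c\<in>?C. (s c)\<^sup>2) * z) \<partial>std_normal)\<bar>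
      \<le> 6 * e + 3 / e\<^sup>2 * (\<Sum>c\<in>?C. 2 * T)"
    by (rule lindeberg_lipschitz[OF p f e])
      (rule finite_tile_centers finite_lbox tiles_disjoint X1 X3 s2(1)[symmetric] s2(2) s3; assumption?)+
  have ES: "expectation S = \<eta> * (\<Sum>c\<in>?C. E c)"
  proof -
    have "expectation S = Ep ?p ?L (\<lambda>A. \<eta> * (\<Sum>c\<in>?C. ?F (A \<inter> lbox c k)))"
      unfolding S_def by (rule expectation_lpts[OF \<eta> Bk1, where f = "\<lambda>A. \<eta> * (\<Sum>c\<in>?C. ?F (A \<inter> lbox c k))"])
    also have "\<dots> = \<eta> * (\<Sum>c\<in>?C. E c)"
      unfolding Ep_cmult Ep_sum E_def using sub by (intro arg_cong[where f = "(*) \<eta>"] sum.cong refl Ep_restrict) auto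
    finally show ?thesis .
  qed
  have cenS: "cen S w / \<sigma> = ?W (?A w)" for w
  proof -
    have "cen S w = \<eta> * (\<Sum>c\<in>?C. ?F (?A w \<inter> lbox c k) - E c)"
      unfolding cen_def ES unfolding S_def sum_subtractf by (simp add: right_diff_distrib)
    then show ?thesis
      unfolding X_def sum_distrib_left[symmetric] by simp
  qed
  have "expectation (\<lambda>w. f (cen S w / \<sigma>)) = Ep ?p ?L (\<lambda>A. f (?W A))"
    unfolding cenS by (rule expectation_lpts[OF \<eta> Bk1, where f = "\<lambda>A. f (?W A)"])
  moreover have "L2 (cen S) / \<sigma> = sqrt (\<Sum>c\<in>?C. (s c)\<^sup>2)"
  proof -
    have "(L2 (cen S) / \<sigma>)\<^sup>2 = expectation (\<lambda>w. (cen S w / \<sigma>)\<^sup>2)"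
      by (simp add: power_divide L2_power2)
    also have "\<dots> = Ep ?p ?L (\<lambda>A. (?W A)\<^sup>2)"
      unfolding cenS by (rule expectation_lpts[OF \<eta> Bk1, where f = "\<lambda>A. (?W A)\<^sup>2"])
    also have "\<dots> = (\<Sum>c\<in>?C. (s c)\<^sup>2)"
      unfolding UL[symmetric] s2(1)
      by (rule Ep_sum_square_indep) (rule finite_tile_centers finite_lbox tiles_disjoint X1; assumption?)+
    finally show ?thesis
      using \<sigma> by (metis L2_nonneg divide_nonneg_pos real_sqrt_unique)
  qed
  moreover have "3 / e\<^sup>2 * (\<Sum>c\<in>?C. 2 * T) = 6 / e\<^sup>2 * (real B ^ CARD('d) * T)"
    using card_tile_centers[OF Bk(2), of B, where 'd = 'd] by simp
  ultimately show ?thesis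
    using lind unfolding UL by (simp only: T_def)
qed

end

context unit_poisson
begin

lemma mst_sq_int:
  assumes "1 \<le> n"
  shows "sq_int (mst_stat P n)"
proof (rule mst_lattice_L2(1))
  show "real n / 5 * real (5 * 1) = real n" by simp
  show "CARD('d) * (2 * real 1 + 1) \<le> \<rho>max n / (real n / 5) / 3"
    using assms by (simp add: \<rho>max_def)
qed (use assms in \<open>auto simp: \<rho>max_def\<close>)

text \<open>Three nested scales: in space, blocks have half side \<open>n / B\<close>, the margin
  inside a block is \<open>R\<close>, and the cubes tested for holes have half side
  \<open>r\<close>; on the lattice these are \<open>k\<close>, \<open>t\<close> and
  \<open>u\<close>. The mesh is \<open>r / u\<close> with \<open>u\<close> large, which makes all
  three exact multiples of it. The discretisation errors go into \<delta> and into the constant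
  32.\<close>

lemma lattice_decomposition:
  fixes n B s s' :: nat and \<rho> c \<delta> R r V \<kappa> :: real
  defines "R \<equiv> real n / (real B * real s)" and "r \<equiv> real n / (real B * real s * real s')"
    and "V \<equiv> (2 * real n) ^ CARD('d)" and "\<kappa> \<equiv> kiss TYPE('d) + 1"
  assumes n: "1 \<le> n" and Bs: "1 \<le> B" "1 \<le> s" "1 \<le> s'"
    and \<rho>: "0 < \<rho>" "2 * \<rho> < R" "\<rho> \<le> \<rho>max n" "2 * real CARD('d) * r < \<rho> / 3"
    and c: "0 < c" "c \<le> poisson_cost \<rho> R" and \<delta>: "0 < \<delta>" and dBs: "CARD('d) / (real B * real s) \<le> 1 / 2"
  shows "\<exists>\<eta> k. 0 < \<eta> \<and> 1 \<le> k \<and> \<eta> * real (B * k) = real n \<and>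
    (let Y = (\<lambda>w. \<eta> * cint (\<rho> / \<eta>) (lpts \<eta> (Qbox (real n)) w) - \<rho>);
         S = (\<lambda>w. \<eta> * (\<Sum>c\<in>tile_centers B k. cint (\<rho> / \<eta>) (lpts \<eta> (Qbox (\<eta> * real (B * k))) w \<inter> lbox c k)))
     in sq_int Y \<and> sq_int S \<and>
       (L2 (\<lambda>w. mst_stat P n w - Y w))\<^sup>2
         \<le> 2 * (\<rho>max n)\<^sup>2 * ((real B * real s * real s') ^ CARD('d) * (exp (- ((2 * r) ^ CARD('d))) * (4 * (V + 1)\<^sup>2))) + \<delta> \<and>
       (L2 (cen (\<lambda>w. Y w - S w)))\<^sup>2 \<le> V * (\<kappa> * \<rho> * (poisson_cost \<rho> (2 * real n) - poisson_cost \<rho> R) + CARD('d) / s * (\<kappa> * \<rho>)\<^sup>2) + \<delta> \<and>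
       V * c\<^sup>2 / 32 \<le> (L2 (cen Y))\<^sup>2)"
proof -
  define sm where "sm = second_moment TYPE('d) (2 * real n)"
  define K where "K = CARD('d) * (2 * sm + 1) + kiss TYPE('d) * \<rho>"
  have n0: "0 < real n" and B0: "0 < real B" "0 < real s" "0 < real s'" using n Bs by auto
  have \<kappa>: "2 \<le> \<kappa>" unfolding \<kappa>_def using kiss_ge_1[where 'd = 'd] by linarith
  have sm0: "0 \<le> sm" unfolding sm_def by (rule second_moment_nonneg)
  have K0: "0 < K" unfolding K_def using sm0 \<rho>(1) kiss_ge_1[where 'd = 'd]
    by (intro add_pos_nonneg) (auto simp: add_nonneg_pos)
  have V0: "0 < V" unfolding V_def using n0 by simp
  \<comment> \<open>One bound on the mesh for each use: the bounds on \<open>p\<close>, the diameter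
    of hole cubes against the cutoff, the rounding error, the loss of at most half of
    \<open>c\<close>, and the error in the block variance.\<close>
  define \<epsilon> where "\<epsilon> = Min {1 / 2, (\<rho> / 3 - 2 * real CARD('d) * r) / CARD('d), \<delta> / (2 * (real CARD('d))\<^sup>2 * sm + 1),
    c / (2 * K), \<delta> / (V * (\<kappa> * \<rho>) * (2 * K))}"
  have \<epsilon>0: "0 < \<epsilon>" unfolding \<epsilon>_def using \<rho> \<delta> c K0 V0 \<kappa> sm0
    by (simp add: divide_pos_pos add_nonneg_pos)
  obtain u :: nat where u: "r / \<epsilon> < real u" using reals_Archimedean2 by blast
  have r0: "0 < r" unfolding r_def using n0 B0 by simp
  have u1: "1 \<le> u" using u divide_pos_pos[OF r0 \<epsilon>0] by (cases u) auto
  have u0: "0 < real u" using u1 by simp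
  define \<eta> where "\<eta> = r / real u"
  have \<eta>0: "0 < \<eta>" using r0 u0 by (simp add: \<eta>_def)
  have \<eta>\<epsilon>: "\<eta> < \<epsilon>" using u \<epsilon>0 u0 by (simp add: \<eta>_def field_simps)
  have h: "\<eta> < 1 / 2" "\<eta> < (\<rho> / 3 - 2 * real CARD('d) * r) / CARD('d)" "\<eta> < \<delta> / (2 * (real CARD('d))\<^sup>2 * sm + 1)"
    "\<eta> < c / (2 * K)" "\<eta> < \<delta> / (V * (\<kappa> * \<rho>) * (2 * K))"
    using \<eta>\<epsilon> by (simp_all add: \<epsilon>_def)
  define t where "t = s' * u"
  define k where "k = s * t"
  have tk: "1 \<le> t" "1 \<le> k" "t \<le> k" using Bs u1 by (auto simp: t_def k_def)
  have \<eta>u: "\<eta> * real u = r" using u0 by (simp add: \<eta>_def)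
  have \<eta>t: "\<eta> * real t = R"
  proof -
    have "\<eta> * real t = (\<eta> * real u) * real s'" by (simp add: t_def)
    also have "\<dots> = R" unfolding \<eta>u R_def r_def using B0 by simp
    finally show ?thesis .
  qed
  have \<eta>Bk: "\<eta> * real (B * k) = real n"
  proof -
    have "\<eta> * real (B * k) = (\<eta> * real t) * (real B * real s)" by (simp add: k_def)
    also have "\<dots> = real n" unfolding \<eta>t R_def using B0 by simp
    finally show ?thesis .
  qed
  have \<eta>m: "\<eta> * real ((B * s * s') * u) = real n"
    using \<eta>Bk by (simp add: k_def t_def mult_ac)
  have m1: "1 \<le> B * s * s'" using Bs by simp
  define p where "p = pocc TYPE('d) \<eta>"
  have p: "0 \<le> p" "p \<le> 1" "p \<le> \<eta> ^ CARD('d)"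
    unfolding p_def using pocc_bounds[where 'd = 'd, of \<eta>] \<eta>0 by auto
  have ph: "\<eta> ^ CARD('d) / 2 \<le> p" unfolding p_def using pocc_ge_half[where 'd = 'd, of \<eta>] \<eta>0 h(1) by simp
  have p2: "p \<le> 1 / 2"
  proof -
    have "\<eta> ^ CARD('d) \<le> \<eta> ^ 1" using \<eta>0 h(1) by (intro power_decreasing) auto
    then show ?thesis using p(3) h(1) by simp
  qed
  let ?A = "lpts \<eta> (Qbox (real n))" and ?a = "lattice_cost TYPE('d) p (\<rho> / \<eta>)"
  define Y where "Y w = \<eta> * cint (\<rho> / \<eta>) (?A w) - \<rho>" for w
  define S where "S w = \<eta> * (\<Sum>c\<in>tile_centers B k. cint (\<rho> / \<eta>) (lpts \<eta> (Qbox (\<eta> * real (B * k))) w \<inter> lbox c k))" for w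
  have Qn: "Qbox (\<eta> * real (B * k)) = (Qbox (real n) :: (real^'d) set)" by (simp only: \<eta>Bk)
  have Bk1: "1 \<le> B * k" using Bs tk by simp
  have sqY: "sq_int Y"
    using lpts_Qbox_sq_int[OF \<eta>0, of "\<lambda>A. \<eta> * cint (\<rho> / \<eta>) A - \<rho>" "B * k"] unfolding Qn Y_def[abs_def] .
  have sqS: "sq_int S"
    using lpts_Qbox_sq_int[OF \<eta>0, of "\<lambda>A. \<eta> * (\<Sum>c\<in>tile_centers B k. cint (\<rho> / \<eta>) (A \<inter> lbox c k))" "B * k"]
    unfolding S_def[abs_def] .
  have approx: "\<bar>poisson_cost \<rho> (\<eta> * real l) - \<eta> * ?a l\<bar> \<le> \<eta> * K" if l: "1 \<le> l" "\<eta> * real l \<le> 2 * real n" for l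
  proof -
    have "\<bar>poisson_cost \<rho> (\<eta> * real l) - \<eta> * ?a l\<bar>
        \<le> \<eta> * (CARD('d) * (2 * second_moment TYPE('d) (\<eta> * real l) + 1) + kiss TYPE('d) * \<rho>)"
      unfolding p_def using \<rho> \<eta>0 h(1) l by (intro poisson_cost_approx) auto
    also have "\<dots> \<le> \<eta> * K"
      unfolding K_def sm_def using \<eta>0 l kiss_ge_1[where 'd = 'd] by (intro mult_left_mono add_mono second_moment_mono) auto
    finally show ?thesis .
  qed
  have Rn: "R \<le> real n"
  proof -
    have "1 * 1 \<le> real B * real s" using Bs by (intro mult_mono) auto
    then show ?thesis unfolding R_def using n0 by (simp add: divide_le_eq mult_le_cancel_left1)
  qed
  have ap1: "\<bar>poisson_cost \<rho> R - \<eta> * ?a t\<bar> \<le> \<eta> * K"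
    using approx[OF tk(1)] Rn n0 unfolding \<eta>t by simp
  have ap2: "\<bar>poisson_cost \<rho> (2 * real n) - \<eta> * ?a (2 * (B * k))\<bar> \<le> \<eta> * K"
  proof -
    have e: "\<eta> * real (2 * (B * k)) = 2 * real n"
      using \<eta>Bk by simp
    show ?thesis using approx[of "2 * (B * k)", unfolded e] Bk1 by simp
  qed
  have VE: "\<eta> ^ CARD('d) * (2 * real (B * k)) ^ CARD('d) = V"
    unfolding power_mult_distrib[symmetric] V_def \<eta>Bk[symmetric] by (simp only: mult.left_commute)
  have b1: "(L2 (\<lambda>w. mst_stat P n w - Y w))\<^sup>2
         \<le> 2 * (\<rho>max n)\<^sup>2 * ((real B * real s * real s') ^ CARD('d) * (exp (- ((2 * r) ^ CARD('d))) * (4 * (V + 1)\<^sup>2))) + \<delta>"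
  proof -
    have "CARD('d) * (2 * real u + 1) \<le> \<rho> / \<eta> / 3"
    proof -
      have "\<eta> * CARD('d) < \<rho> / 3 - 2 * real CARD('d) * r" using h(2) by (simp add: less_divide_eq)
      then have "\<eta> * (CARD('d) * (2 * real u + 1)) \<le> \<rho> / 3"
        unfolding \<eta>u[symmetric] by (simp add: algebra_simps)
      then show ?thesis using \<eta>0 by (simp add: field_simps)
    qed
    then have "(L2 (\<lambda>w. mst_stat P n w - Y w))\<^sup>2 \<le> 2 * (CARD('d) * \<eta>)\<^sup>2 * second_moment TYPE('d) (real n)
        + 2 * (\<rho>max n)\<^sup>2 * (real (B * s * s') ^ CARD('d) * (exp (- ((2 * \<eta> * u) ^ CARD('d))) * (4 * ((2 * real n) ^ CARD('d) + 1)\<^sup>2)))"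
      unfolding Y_def by (intro mst_lattice_L2(2)[OF \<eta>0 \<eta>m m1 u1 \<rho>(1,3)])
    also have "2 * \<eta> * u = 2 * r" using \<eta>u by simp
    also have "2 * (CARD('d) * \<eta>)\<^sup>2 * second_moment TYPE('d) (real n) \<le> \<delta>"
    proof -
      have "\<eta>\<^sup>2 \<le> \<eta>" using \<eta>0 h(1) by (simp add: power2_eq_square mult_le_cancel_left1)
      then have "(2 * (real CARD('d))\<^sup>2) * (\<eta>\<^sup>2 * second_moment TYPE('d) (real n)) \<le> (2 * (real CARD('d))\<^sup>2) * (\<eta> * sm)"
        unfolding sm_def using \<eta>0 n0 second_moment_nonneg[where 'd = 'd, of "real n"]
        by (intro mult_left_mono mult_mono second_moment_mono) auto
      also have "\<dots> \<le> \<eta> * (2 * (real CARD('d))\<^sup>2 * sm + 1)" using \<eta>0 by (simp add: algebra_simps)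
      also have "\<dots> \<le> \<delta>" using h(3) sm0 by (simp add: less_divide_eq add_nonneg_pos less_imp_le)
      finally show ?thesis by (simp add: power_mult_distrib mult_ac)
    qed
    finally show ?thesis by (simp add: V_def)
  qed
  have b2: "(L2 (cen (\<lambda>w. Y w - S w)))\<^sup>2 \<le> V * (\<kappa> * \<rho> * (poisson_cost \<rho> (2 * real n) - poisson_cost \<rho> R) + CARD('d) / s * (\<kappa> * \<rho>)\<^sup>2) + \<delta>"
  proof -
    let ?f = "\<lambda>A::(real^'d) set. cint (\<rho> / \<eta>) A - (\<Sum>c\<in>tile_centers B k. cint (\<rho> / \<eta>) (A \<inter> lbox c k))"
    have "cen (\<lambda>w. Y w - S w) = cen (\<lambda>w. \<eta> * ?f (lpts \<eta> (Qbox (\<eta> * real (B * k))) w))"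
    proof -
      let ?U = "\<lambda>w. \<eta> * ?f (lpts \<eta> (Qbox (\<eta> * real (B * k))) w)"
      have U: "integrable M ?U"
        by (rule sq_int_integrable, rule sq_int_cmult, rule lpts_Qbox_sq_int[OF \<eta>0, where g = ?f])
      have "(\<lambda>w. Y w - S w) = (\<lambda>w. ?U w - \<rho>)"
        by (simp add: Y_def S_def Qn algebra_simps del: of_nat_mult)
      moreover have "cen (\<lambda>w. ?U w - \<rho>) = cen ?U"
        using U by (simp add: cen_def[abs_def] prob_space)
      ultimately show ?thesis by simp
    qed
    then have "(L2 (cen (\<lambda>w. Y w - S w)))\<^sup>2 = Vp p (lbox (0::real^'d) (B * k)) (\<lambda>A. \<eta> * ?f A)"
      unfolding p_def using L2_cen_lpts[OF \<eta>0 Bk1, of "\<lambda>A. \<eta> * ?f A"] by simp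
    also have "\<dots> = \<eta>\<^sup>2 * Vp p (lbox (0::real^'d) (B * k)) ?f" by (rule Vp_cmult)
    also have "\<dots> \<le> \<eta>\<^sup>2 * (p * ((2 * real (B * k)) ^ CARD('d) * (\<kappa> * (\<rho> / \<eta>) * (?a (2 * (B * k)) - ?a t)
      + (CARD('d) * t / k) * (\<kappa> * (\<rho> / \<eta>))\<^sup>2)))"
      unfolding \<kappa>_def
    proof (intro mult_left_mono block_variance p Bs tk)
      show "\<rho> / \<eta> < real t" using \<eta>t \<rho>(1,2) \<eta>0 by (simp add: divide_less_eq mult.commute)
    qed (use \<rho> \<eta>0 in auto)
    also have "\<dots> = p * (2 * real (B * k)) ^ CARD('d) * (\<kappa> * \<rho> * (\<eta> * ?a (2 * (B * k)) - \<eta> * ?a t)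
      + (CARD('d) / s) * (\<kappa> * \<rho>)\<^sup>2)"
    proof -
      have "real (CARD('d) * t) / real k = CARD('d) / s"
        using tk by (simp add: k_def)
      moreover have "\<eta>\<^sup>2 * (\<kappa> * (\<rho> / \<eta>))\<^sup>2 = (\<kappa> * \<rho>)\<^sup>2"
        unfolding power_mult_distrib[symmetric] using \<eta>0 by simp
      moreover have "\<eta>\<^sup>2 * (\<kappa> * (\<rho> / \<eta>) * (?a (2 * (B * k)) - ?a t)) = \<kappa> * \<rho> * (\<eta> * ?a (2 * (B * k)) - \<eta> * ?a t)"
        using \<eta>0 by (simp add: power2_eq_square right_diff_distrib)
      moreover have "x * (p * (N * (y + z * v))) = p * N * (x * y + z * (x * v))" for x N y z v :: real
        by (simp add: algebra_simps)
      ultimately show ?thesis by presburger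
    qed
    also have "\<dots> \<le> V * (\<kappa> * \<rho> * (poisson_cost \<rho> (2 * real n) - poisson_cost \<rho> R + 2 * (\<eta> * K)) + (CARD('d) / s) * (\<kappa> * \<rho>)\<^sup>2)"
    proof -
      have le: "\<eta> * ?a (2 * (B * k)) - \<eta> * ?a t \<le> poisson_cost \<rho> (2 * real n) - poisson_cost \<rho> R + 2 * (\<eta> * K)"
        using ap1 ap2 by linarith
      have "p * (2 * real (B * k)) ^ CARD('d) * (\<kappa> * \<rho> * (\<eta> * ?a (2 * (B * k)) - \<eta> * ?a t) + (CARD('d) / s) * (\<kappa> * \<rho>)\<^sup>2)
        \<le> p * (2 * real (B * k)) ^ CARD('d) * (\<kappa> * \<rho> * (poisson_cost \<rho> (2 * real n) - poisson_cost \<rho> R + 2 * (\<eta> * K)) + (CARD('d) / s) * (\<kappa> * \<rho>)\<^sup>2)"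
        using \<kappa> \<rho> p by (intro add_right_mono mult_left_mono le) auto
      also have "\<dots> \<le> V * (\<kappa> * \<rho> * (poisson_cost \<rho> (2 * real n) - poisson_cost \<rho> R + 2 * (\<eta> * K)) + (CARD('d) / s) * (\<kappa> * \<rho>)\<^sup>2)"
      proof (rule mult_right_mono)
        show "p * (2 * real (B * k)) ^ CARD('d) \<le> V"
          unfolding VE[symmetric] using p by (intro mult_right_mono) auto
        have "poisson_cost \<rho> R \<le> poisson_cost \<rho> (2 * real n)"
          using \<rho> Rn n0 by (intro poisson_cost_mono_window) auto
        then show "0 \<le> \<kappa> * \<rho> * (poisson_cost \<rho> (2 * real n) - poisson_cost \<rho> R + 2 * (\<eta> * K)) + (CARD('d) / s) * (\<kappa> * \<rho>)\<^sup>2"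
          using \<kappa> \<rho> \<eta>0 K0 by (intro add_nonneg_nonneg mult_nonneg_nonneg) auto
      qed
      finally show ?thesis .
    qed
    also have "\<dots> = V * (\<kappa> * \<rho> * (poisson_cost \<rho> (2 * real n) - poisson_cost \<rho> R) + (CARD('d) / s) * (\<kappa> * \<rho>)\<^sup>2) + \<eta> * (V * (\<kappa> * \<rho>) * (2 * K))"
      by (simp add: algebra_simps)
    also have "\<eta> * (V * (\<kappa> * \<rho>) * (2 * K)) \<le> \<delta>"
      using h(5) V0 \<kappa> \<rho> K0 by (simp add: less_divide_eq less_imp_le)
    finally show ?thesis by simp
  qed
  have b3: "V * c\<^sup>2 / 32 \<le> (L2 (cen Y))\<^sup>2"
  proof -
    have "cen Y = cen (\<lambda>w. \<eta> * cint (\<rho> / \<eta>) (lpts \<eta> (Qbox (\<eta> * real (B * k))) w))"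
    proof -
      let ?U = "\<lambda>w. \<eta> * cint (\<rho> / \<eta>) (lpts \<eta> (Qbox (\<eta> * real (B * k))) w)"
      have U: "integrable M ?U"
        by (rule sq_int_integrable, rule sq_int_cmult, rule lpts_Qbox_sq_int[OF \<eta>0, where g = "cint (\<rho> / \<eta>)"])
      have "Y = (\<lambda>w. ?U w - \<rho>)"
        by (simp add: Y_def[abs_def] Qn del: of_nat_mult)
      moreover have "cen (\<lambda>w. ?U w - \<rho>) = cen ?U"
        using U by (simp add: cen_def[abs_def] prob_space)
      ultimately show ?thesis by simp
    qed
    then have "(L2 (cen Y))\<^sup>2 = Vp p (lbox (0::real^'d) (B * k)) (\<lambda>A. \<eta> * cint (\<rho> / \<eta>) A)"
      unfolding p_def using L2_cen_lpts[OF \<eta>0 Bk1, of "\<lambda>A. \<eta> * cint (\<rho> / \<eta>) A"] by simp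
    also have "\<dots> = \<eta>\<^sup>2 * Vp p (lbox (0::real^'d) (B * k)) (cint (\<rho> / \<eta>))" by (rule Vp_cmult)
    finally have eq: "(L2 (cen Y))\<^sup>2 = \<eta>\<^sup>2 * Vp p (lbox (0::real^'d) (B * k)) (cint (\<rho> / \<eta>))" .
    have "\<eta> * K < c / 2" using h(4) K0 by (simp add: field_simps)
    then have "c / 2 \<le> \<eta> * ?a t" using ap1 c(2) by linarith
    then have a: "c / (2 * \<eta>) \<le> ?a t" using \<eta>0 by (simp add: field_simps)
    have "CARD('d) * t / (B * k) = CARD('d) / (real B * real s)"
      using tk by (simp add: k_def)
    then have half: "1 / 2 \<le> 1 - CARD('d) * t / (B * k)" using dBs by simp
    then have half0: "0 \<le> 1 - CARD('d) * t / (B * k)" by linarith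
    have "p * (1 - p) * ((2 * real (B * k)) ^ CARD('d) * (1 - CARD('d) * t / (B * k)) * (c / (2 * \<eta>))\<^sup>2) \<le> Vp p (lbox (0::real^'d) (B * k)) (cint (\<rho> / \<eta>))"
    proof (rule variance_lower[OF p(1,2) _ _ Bk1 _ a])
      show "\<rho> / \<eta> < real t" using \<eta>t \<rho>(1,2) \<eta>0 by (simp add: divide_less_eq mult.commute)
    qed (use \<rho> \<eta>0 c in auto)
    \<comment> \<open>Factors of one half come from \<open>p\<close>, from \<open>1 - p\<close> and
      from the boundary; the square of \<open>c / 2\<close> contributes one quarter, for a total of
      \<open>1 / 32\<close>.\<close>
    moreover have "(\<eta> ^ CARD('d) / 2 * (1 / 2)) * ((2 * real (B * k)) ^ CARD('d) * (1 / 2) * (c / (2 * \<eta>))\<^sup>2)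
      \<le> p * (1 - p) * ((2 * real (B * k)) ^ CARD('d) * (1 - CARD('d) * t / (B * k)) * (c / (2 * \<eta>))\<^sup>2)"
      using half half0 p ph p2 \<eta>0 by (intro mult_mono mult_nonneg_nonneg) auto
    moreover have "\<eta>\<^sup>2 * ((\<eta> ^ CARD('d) / 2 * (1 / 2)) * ((2 * real (B * k)) ^ CARD('d) * (1 / 2) * (c / (2 * \<eta>))\<^sup>2)) = V * c\<^sup>2 / 32"
      unfolding VE[symmetric] using \<eta>0 by (simp add: power_divide power_mult_distrib)
    ultimately show ?thesis
      unfolding eq using mult_left_mono[of _ _ "\<eta>\<^sup>2"] by (smt (verit) zero_le_power2)
  qed
  show ?thesis
    unfolding Let_def
    by (rule exI[of _ \<eta>], rule exI[of _ k])
      (use \<eta>0 tk \<eta>Bk sqY sqS b1 b2 b3 in \<open>simp only: Y_def[abs_def] S_def[abs_def] simp_thms\<close>)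
qed

end

context unit_poisson
begin

text \<open>Up to centring, \<open>sqrt V * \<alpha>\<close> bounds the L2 distance from the tree
  weight to the lattice functional with short cutoff, and \<open>sqrt V * \<beta>\<close> the
  distance from there to the block sum. The condition \<open>\<alpha> \<le> c / 12\<close> keeps the
  standard deviation of the tree weight above \<open>sqrt V * c / 12\<close>. The factor 24 counts
  the error twice: for replacing the tree weight by the block sum, and for the mismatch of their
  standard deviations.\<close>

lemma clt_bound:
  fixes n B s s' :: nat and \<rho> c \<alpha> \<beta> R r V \<kappa> e :: real and f :: "real \<Rightarrow> real"
  defines "R \<equiv> real n / (real B * real s)" and "r \<equiv> real n / (real B * real s * real s')"
    and "V \<equiv> (2 * real n) ^ CARD('d)" and "\<kappa> \<equiv> kiss TYPE('d) + 1"
  assumes n: "1 \<le> n" and Bs: "1 \<le> B" "1 \<le> s" "1 \<le> s'"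
    and \<rho>: "0 < \<rho>" "2 * \<rho> < R" "\<rho> \<le> \<rho>max n" "2 * real CARD('d) * r < \<rho> / 3"
    and c: "0 < c" "c \<le> poisson_cost \<rho> R" and dBs: "CARD('d) / (real B * real s) \<le> 1 / 2"
    and \<alpha>: "0 \<le> \<alpha>" "\<alpha> \<le> c / 12"
      "2 * (\<rho>max n)\<^sup>2 * ((real B * real s * real s') ^ CARD('d) * (exp (- ((2 * r) ^ CARD('d))) * (4 * (V + 1)\<^sup>2))) < V * \<alpha>\<^sup>2"
    and \<beta>: "0 \<le> \<beta>" "\<kappa> * \<rho> * (poisson_cost \<rho> (2 * real n) - poisson_cost \<rho> R) + CARD('d) / s * (\<kappa> * \<rho>)\<^sup>2 < \<beta>\<^sup>2"
    and f: "1-lipschitz_on UNIV f" and e: "0 < e"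
  shows "\<bar>(\<integral>x. f x \<partial>normalized_law M (mst_stat P n)) - (\<integral>x. f x \<partial>std_normal)\<bar>
    \<le> 24 * (\<alpha> + \<beta>) / c + 6 * e
      + 6 / e\<^sup>2 * (real B ^ CARD('d) * (12 * (\<rho> * ((2 * real n / real B) ^ CARD('d) + 2)) / (c * sqrt V)) ^ 3)"
proof -
  let ?e1 = "2 * (\<rho>max n)\<^sup>2 * ((real B * real s * real s') ^ CARD('d) * (exp (- ((2 * r) ^ CARD('d))) * (4 * (V + 1)\<^sup>2)))"
  let ?e2 = "\<kappa> * \<rho> * (poisson_cost \<rho> (2 * real n) - poisson_cost \<rho> R) + CARD('d) / s * (\<kappa> * \<rho>)\<^sup>2"
  have V: "0 < V" unfolding V_def using n by simp
  define \<delta> where "\<delta> = min (V * \<alpha>\<^sup>2 - ?e1) (V * (\<beta>\<^sup>2 - ?e2))"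
  have \<delta>: "0 < \<delta>" using \<alpha>(3) \<beta>(2) V by (simp add: \<delta>_def)
  obtain \<eta> k where \<eta>: "0 < \<eta>" "1 \<le> k" "\<eta> * real (B * k) = real n"
    and dec: "let Y = (\<lambda>w. \<eta> * cint (\<rho> / \<eta>) (lpts \<eta> (Qbox (real n)) w) - \<rho>);
         S = (\<lambda>w. \<eta> * (\<Sum>c\<in>tile_centers B k. cint (\<rho> / \<eta>) (lpts \<eta> (Qbox (\<eta> * real (B * k))) w \<inter> lbox c k)))
     in sq_int Y \<and> sq_int S \<and>
       (L2 (\<lambda>w. mst_stat P n w - Y w))\<^sup>2 \<le> ?e1 + \<delta> \<and>
       (L2 (cen (\<lambda>w. Y w - S w)))\<^sup>2 \<le> V * ?e2 + \<delta> \<and>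
       V * c\<^sup>2 / 32 \<le> (L2 (cen Y))\<^sup>2"
    using lattice_decomposition[OF n Bs, of \<rho> c \<delta>] \<rho> c \<delta> dBs
    unfolding R_def r_def V_def \<kappa>_def by blast
  define X where "X = mst_stat P n"
  define Y where "Y = (\<lambda>w. \<eta> * cint (\<rho> / \<eta>) (lpts \<eta> (Qbox (real n)) w) - \<rho>)"
  define S where "S = (\<lambda>w. \<eta> * (\<Sum>c\<in>tile_centers B k. cint (\<rho> / \<eta>) (lpts \<eta> (Qbox (\<eta> * real (B * k))) w \<inter> lbox c k)))"
  have sq: "sq_int X" "sq_int Y" "sq_int S"
    using dec mst_sq_int[OF n] unfolding Let_def X_def Y_def S_def by auto
  have D1: "(L2 (\<lambda>w. X w - Y w))\<^sup>2 \<le> ?e1 + \<delta>" and D2: "(L2 (cen (\<lambda>w. Y w - S w)))\<^sup>2 \<le> V * ?e2 + \<delta>"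
    and Y32: "V * c\<^sup>2 / 32 \<le> (L2 (cen Y))\<^sup>2"
    using dec unfolding Let_def X_def Y_def S_def by auto
  have "?e1 + \<delta> \<le> (sqrt V * \<alpha>)\<^sup>2" "V * ?e2 + \<delta> \<le> (sqrt V * \<beta>)\<^sup>2"
  proof -
    have "\<delta> \<le> V * \<alpha>\<^sup>2 - ?e1" "\<delta> \<le> V * (\<beta>\<^sup>2 - ?e2)" by (simp_all only: \<delta>_def min.cobounded1 min.cobounded2)
    then show "?e1 + \<delta> \<le> (sqrt V * \<alpha>)\<^sup>2" "V * ?e2 + \<delta> \<le> (sqrt V * \<beta>)\<^sup>2"
      using V by (simp_all add: power_mult_distrib right_diff_distrib)
  qed
  then have le: "(L2 (\<lambda>w. X w - Y w))\<^sup>2 \<le> (sqrt V * \<alpha>)\<^sup>2" "(L2 (cen (\<lambda>w. Y w - S w)))\<^sup>2 \<le> (sqrt V * \<beta>)\<^sup>2"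
    using D1 D2 by linarith+
  have "0 \<le> sqrt V * \<alpha>" "0 \<le> sqrt V * \<beta>"
    using V \<alpha>(1) \<beta>(1) by (auto intro: mult_nonneg_nonneg)
  note XY = power2_le_imp_le[OF le(1) this(1)] and YS = power2_le_imp_le[OF le(2) this(2)]
  \<comment> \<open>The constant 6 is a convenient upper bound for the square root of 32.\<close>
  have Y6: "sqrt V * c / 6 \<le> L2 (cen Y)"
  proof (rule power2_le_imp_le)
    have "(sqrt V * c / 6)\<^sup>2 = V * c\<^sup>2 / 36" using V by (simp add: power_mult_distrib power_divide)
    also have "\<dots> \<le> V * c\<^sup>2 / 32" using V by (intro divide_left_mono) auto
    finally show "(sqrt V * c / 6)\<^sup>2 \<le> (L2 (cen Y))\<^sup>2" using Y32 by linarith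
  qed simp
  have cXY: "L2 (cen (\<lambda>w. X w - Y w)) \<le> sqrt V * \<alpha>"
    using L2_cen_le[OF sq_int_diff[OF sq(1,2)]] XY by linarith
  have DX: "L2 (cen (\<lambda>w. X w - S w)) \<le> sqrt V * (\<alpha> + \<beta>)"
  proof -
    have "cen (\<lambda>w. X w - S w) = (\<lambda>w. cen (\<lambda>w. X w - Y w) w + cen (\<lambda>w. Y w - S w) w)"
    proof
      fix w
      show "cen (\<lambda>w. X w - S w) w = cen (\<lambda>w. X w - Y w) w + cen (\<lambda>w. Y w - S w) w"
        unfolding cen_diff[OF sq(1,3), symmetric] cen_diff[OF sq(1,2), symmetric] cen_diff[OF sq(2,3), symmetric] by simp
    qed
    then have "L2 (cen (\<lambda>w. X w - S w)) \<le> L2 (cen (\<lambda>w. X w - Y w)) + L2 (cen (\<lambda>w. Y w - S w))"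
      using L2_triangle[OF sq_int_cen[OF sq_int_diff[OF sq(1,2)]] sq_int_cen[OF sq_int_diff[OF sq(2,3)]]] by simp
    also have "\<dots> \<le> sqrt V * (\<alpha> + \<beta>)" using cXY YS by (simp add: distrib_left)
    finally show ?thesis .
  qed
  define \<sigma> where "\<sigma> = L2 (cen X)"
  have \<sigma>c: "sqrt V * c / 12 \<le> \<sigma>"
  proof -
    have "\<bar>L2 (cen X) - L2 (cen Y)\<bar> \<le> L2 (\<lambda>w. cen X w - cen Y w)"
      by (intro L2_diff_le sq_int_cen sq)
    also have "\<dots> = L2 (cen (\<lambda>w. X w - Y w))" by (simp only: cen_diff[OF sq(1,2)])
    finally have "L2 (cen Y) - sqrt V * \<alpha> \<le> \<sigma>" using cXY unfolding \<sigma>_def by linarith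
    moreover have "sqrt V * \<alpha> \<le> sqrt V * (c / 12)" using \<alpha> V by (intro mult_left_mono) auto
    ultimately show ?thesis using Y6 by simp
  qed
  have \<sigma>: "0 < \<sigma>" using \<sigma>c V c by (intro less_le_trans[OF _ \<sigma>c]) auto
  have D\<sigma>: "L2 (cen (\<lambda>w. X w - S w)) / \<sigma> \<le> 12 * (\<alpha> + \<beta>) / c"
  proof -
    have "L2 (cen (\<lambda>w. X w - S w)) / \<sigma> \<le> sqrt V * (\<alpha> + \<beta>) / (sqrt V * c / 12)"
      using DX \<sigma>c V c \<alpha> \<beta> by (intro frac_le) auto
    also have "\<dots> = 12 * (\<alpha> + \<beta>) / c" using V by simp
    finally show ?thesis .
  qed
  have "(\<integral>x. f x \<partial>normalized_law M X) = expectation (\<lambda>w. f (cen X w / \<sigma>))"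
    unfolding \<sigma>_def L2_cen using sq(1)
    by (intro normalized_law_integral borel_measurable_continuous_onI[OF lipschitz_on_continuous_on[OF f]])
      (simp add: sq_int_def)
  moreover have "\<bar>expectation (\<lambda>w. f (cen X w / \<sigma>)) - expectation (\<lambda>w. f (cen S w / \<sigma>))\<bar> \<le> 12 * (\<alpha> + \<beta>) / c"
    using normalized_law_lipschitz_cmp[OF sq(1,3) f \<sigma>] D\<sigma> by linarith
  moreover have "\<bar>expectation (\<lambda>w. f (cen S w / \<sigma>)) - (\<integral>z. f (L2 (cen S) / \<sigma> * z) \<partial>std_normal)\<bar>
    \<le> 6 * e + 6 / e\<^sup>2 * (real B ^ CARD('d) * (\<rho> * ((2 * \<eta> * real k) ^ CARD('d) + 2) / \<sigma>) ^ 3)"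
    unfolding S_def by (rule block_sum_lindeberg[OF \<eta>(1) Bs(1) \<eta>(2) \<rho>(1) \<sigma> e f])
  moreover have "\<bar>(\<integral>z. f (L2 (cen S) / \<sigma> * z) \<partial>std_normal) - (\<integral>z. f z \<partial>std_normal)\<bar> \<le> 12 * (\<alpha> + \<beta>) / c"
  proof -
    have "\<bar>L2 (cen X) - L2 (cen S)\<bar> \<le> L2 (\<lambda>w. cen X w - cen S w)"
      by (intro L2_diff_le sq_int_cen sq)
    also have "\<dots> = L2 (cen (\<lambda>w. X w - S w))" by (simp only: cen_diff[OF sq(1,3)])
    finally have "\<bar>L2 (cen S) - \<sigma>\<bar> / \<sigma> \<le> L2 (cen (\<lambda>w. X w - S w)) / \<sigma>"
      using \<sigma> by (intro divide_right_mono) (auto simp: \<sigma>_def)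
    moreover have "\<bar>L2 (cen S) / \<sigma> - 1\<bar> = \<bar>L2 (cen S) - \<sigma>\<bar> / \<sigma>"
    proof -
      have "L2 (cen S) / \<sigma> - 1 = (L2 (cen S) - \<sigma>) / \<sigma>" using \<sigma> by (simp add: diff_divide_distrib)
      then show ?thesis using \<sigma> by (simp only: abs_divide)
    qed
    ultimately show ?thesis
      using std_normal_scale_lipschitz[OF f, of "L2 (cen S) / \<sigma>"] D\<sigma> by linarith
  qed
  moreover have "6 / e\<^sup>2 * (real B ^ CARD('d) * (\<rho> * ((2 * \<eta> * real k) ^ CARD('d) + 2) / \<sigma>) ^ 3)
      \<le> 6 / e\<^sup>2 * (real B ^ CARD('d) * (12 * (\<rho> * ((2 * real n / real B) ^ CARD('d) + 2)) / (c * sqrt V)) ^ 3)"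
  proof -
    have k: "2 * \<eta> * real k = 2 * real n / real B"
      unfolding \<eta>(3)[symmetric] using Bs by simp
    let ?x = "\<rho> * ((2 * real n / real B) ^ CARD('d) + 2)"
    have x: "0 \<le> ?x" using \<rho> by simp
    have "?x / \<sigma> \<le> ?x / (sqrt V * c / 12)"
      using x \<sigma>c V c by (intro divide_left_mono mult_pos_pos) (auto simp: \<sigma>)
    also have "\<dots> = 12 * ?x / (c * sqrt V)" by (simp add: mult_ac)
    finally have "?x / \<sigma> \<le> 12 * ?x / (c * sqrt V)" .
    moreover have "0 \<le> ?x / \<sigma>" using x \<sigma> by simp
    ultimately show ?thesis
      unfolding k by (intro mult_left_mono power_mono) auto
  qed
  ultimately have "\<bar>(\<integral>x. f x \<partial>normalized_law M X) - (\<integral>x. f x \<partial>std_normal)\<bar>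
    \<le> 12 * (\<alpha> + \<beta>) / c + 12 * (\<alpha> + \<beta>) / c + 6 * e
      + 6 / e\<^sup>2 * (real B ^ CARD('d) * (12 * (\<rho> * ((2 * real n / real B) ^ CARD('d) + 2)) / (c * sqrt V)) ^ 3)"
    by linarith
  moreover have "12 * (\<alpha> + \<beta>) / c + 12 * (\<alpha> + \<beta>) / c = 24 * (\<alpha> + \<beta>) / c" by simp
  ultimately show ?thesis unfolding X_def by linarith
qed

end

section \<open>Choice of scales\<close>

text \<open>Beyond one factor \<open>V\<close> the error contains \<open>n\<close> to the power
  \<open>2 + 2 * d\<close>, hence a power of \<open>x\<close>, while the probability that a cube of
  half side \<open>r\<close> is empty is exponentially small in \<open>x\<close>. One further power
  of \<open>x\<close> pays for the target \<open>1 / x\<close>.\<close>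

lemma hole_error_small:
  fixes n x N r V D :: real and d :: nat
  assumes d: "1 \<le> d" "D = real d" and x: "12 * D \<le> x" and n: "1 \<le> n" "n \<le> (2 * x) ^ 50"
    and N: "0 \<le> N" "N \<le> 24 * D * n" and r: "x / (24 * D) \<le> r" and V: "V = (2 * n) ^ d"
    and small: "128 * D\<^sup>2 * (48 * D) ^ d * 2 ^ (50 * (2 + 2 * d)) * (x ^ (50 * (2 + 2 * d) + 1) * exp (- (x / (12 * D)))) < 1"
  shows "2 * (2 * n * D)\<^sup>2 * (N ^ d * (exp (- ((2 * r) ^ d)) * (4 * (V + 1)\<^sup>2))) < V * (1 / x)"
proof -
  have D: "1 \<le> D" using d by simp
  have x0: "0 < x" using x D by linarith
  have V1: "1 \<le> V" unfolding V using n by (intro one_le_power) simp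
  have r12: "x / (12 * D) \<le> 2 * r" using r by (simp add: field_simps)
  have "1 \<le> x / (12 * D)" using x D by (simp add: le_divide_eq)
  then have "x / (12 * D) \<le> (2 * r) ^ 1" "1 \<le> 2 * r" using r12 by simp_all
  then have "x / (12 * D) \<le> (2 * r) ^ d"
    using power_increasing[OF d(1), of "2 * r"] by linarith
  then have ex: "exp (- ((2 * r) ^ d)) \<le> exp (- (x / (12 * D)))" by simp
  have "(V + 1)\<^sup>2 \<le> (2 * V)\<^sup>2" using V1 by (intro power_mono) auto
  then have V16: "4 * (V + 1)\<^sup>2 \<le> 16 * (V * V)" by (simp add: power2_eq_square)
  have "2 * (2 * n * D)\<^sup>2 * (N ^ d * (exp (- ((2 * r) ^ d)) * (4 * (V + 1)\<^sup>2)))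
      \<le> 2 * (2 * n * D)\<^sup>2 * ((24 * D * n) ^ d * (exp (- (x / (12 * D))) * (16 * (V * V))))"
  proof -
    have a: "exp (- ((2 * r) ^ d)) * (4 * (V + 1)\<^sup>2) \<le> exp (- (x / (12 * D))) * (16 * (V * V))"
      by (rule mult_mono[OF ex V16]) auto
    have b: "N ^ d \<le> (24 * D * n) ^ d" using N by (intro power_mono) auto
    have "N ^ d * (exp (- ((2 * r) ^ d)) * (4 * (V + 1)\<^sup>2)) \<le> (24 * D * n) ^ d * (exp (- (x / (12 * D))) * (16 * (V * V)))"
      by (rule mult_mono[OF b a]) (use D n in auto)
    then show ?thesis by (rule mult_left_mono) simp
  qed
  also have "\<dots> = V * (128 * D\<^sup>2 * (48 * D) ^ d * (n ^ (2 + 2 * d)) * exp (- (x / (12 * D))))"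
    unfolding V using power_mult_distrib[of 2 "24::real" d]
    by (simp add: power_mult_distrib power_add power_mult power2_eq_square mult_ac)
  also have "\<dots> \<le> V * (128 * D\<^sup>2 * (48 * D) ^ d * (((2 * x) ^ 50) ^ (2 + 2 * d)) * exp (- (x / (12 * D))))"
    using V1 D n by (intro mult_left_mono mult_right_mono power_mono) auto
  also have "\<dots> = V * ((128 * D\<^sup>2 * (48 * D) ^ d * 2 ^ (50 * (2 + 2 * d)) * (x ^ (50 * (2 + 2 * d) + 1) * exp (- (x / (12 * D))))) / x)"
  proof -
    have "((2 * x) ^ 50) ^ (2 + 2 * d) = 2 ^ (50 * (2 + 2 * d)) * x ^ (50 * (2 + 2 * d))"
      by (simp only: power_mult[symmetric] power_mult_distrib)
    moreover have "x ^ (50 * (2 + 2 * d) + 1) = x ^ (50 * (2 + 2 * d)) * x"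
      by (simp only: power_add power_one_right)
    moreover have "V * (a * (b * c) * e) = V * ((a * b * (c * x * e)) / x)" for a b c e
      using x0 by simp
    ultimately show ?thesis by (simp only:)
  qed
  also have "\<dots> < V * (1 / x)"
    using small x0 V1 by (intro mult_strict_left_mono divide_strict_right_mono) auto
  finally show ?thesis .
qed

text \<open>Inserting \<open>V = (B * L) ^ d\<close> leaves an error of order
  \<open>x ^ 5 * L ^ (2 * d) / sqrt V\<close>. With \<open>L\<close> at most
  \<open>4 * x ^ 7\<close> and \<open>sqrt V\<close> at least \<open>x ^ (25 * d)\<close> this is
  below a multiple of \<open>1 / x\<close>, because \<open>14 * d + 6 \<le> 25 * d\<close>.\<close>

lemma lindeberg_error_small:
  fixes \<rho> B L x V c :: real and d :: nat
  assumes d: "1 \<le> d" and x: "1 \<le> x" and \<rho>: "0 < \<rho>" "\<rho> \<le> 2 * x" and B: "0 < B"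
    and L: "2 \<le> L" "L \<le> 4 * x ^ 7" and V: "V = (B * L) ^ d" "x ^ (50 * d) \<le> V" and c: "0 < c"
  shows "6 / (1 / x)\<^sup>2 * (B ^ d * (12 * (\<rho> * (L ^ d + 2)) / (c * sqrt V)) ^ 3) \<le> 6 * 48 ^ 3 * 16 ^ d / c ^ 3 / x"
proof -
  have x0: "0 < x" using x by simp
  have V0: "0 < V" using V(2) x0 by (intro less_le_trans[OF _ V(2)]) simp
  define v where "v = sqrt V"
  have v: "0 < v" "v * v = V" using V0 by (auto simp: v_def)
  have vx: "x ^ (25 * d) \<le> v"
    unfolding v_def using V(2) by (intro real_le_rsqrt) (simp add: power_mult[symmetric] mult.commute)
  have "L ^ 1 \<le> L ^ d" using L d by (intro power_increasing) auto
  then have L2: "2 \<le> L ^ d" using L by simp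
  have "\<rho> * (L ^ d + 2) \<le> 2 * x * (2 * L ^ d)"
    using \<rho> L2 x by (intro mult_mono) auto
  then have "12 * (\<rho> * (L ^ d + 2)) / (c * v) \<le> 48 * x * L ^ d / (c * v)"
    using c v by (intro divide_right_mono) auto
  then have "(12 * (\<rho> * (L ^ d + 2)) / (c * v)) ^ 3 \<le> (48 * x * L ^ d / (c * v)) ^ 3"
    using \<rho> L2 c v by (intro power_mono) auto
  then have "6 / (1 / x)\<^sup>2 * (B ^ d * (12 * (\<rho> * (L ^ d + 2)) / (c * v)) ^ 3)
      \<le> 6 / (1 / x)\<^sup>2 * (B ^ d * (48 * x * L ^ d / (c * v)) ^ 3)"
    using B by (intro mult_left_mono) auto
  also have "\<dots> = 6 * 48 ^ 3 / c ^ 3 * (x ^ 5 * (L ^ d)\<^sup>2 * (B ^ d * L ^ d) / (v ^ 3))"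
    by (simp add: power_divide power_mult_distrib power2_eq_square power3_eq_cube eval_nat_numeral mult_ac)
  also have "\<dots> = 6 * 48 ^ 3 / c ^ 3 * (x ^ 5 * (L ^ d)\<^sup>2 / v)"
  proof -
    have "B ^ d * L ^ d = v * v" using v V(1) by (simp add: power_mult_distrib)
    then show ?thesis using v(1) by (simp only: power3_eq_cube) simp
  qed
  also have "\<dots> \<le> 6 * 48 ^ 3 / c ^ 3 * (16 ^ d / x)"
  proof (rule mult_left_mono)
    have "(L ^ d)\<^sup>2 \<le> ((4 * x ^ 7) ^ d)\<^sup>2"
      using L x by (intro power_mono) auto
    also have "\<dots> = 16 ^ d * x ^ (14 * d)"
    proof -
      have "((4 * x ^ 7) ^ d)\<^sup>2 = ((4 * x ^ 7)\<^sup>2) ^ d" by (simp only: power_mult[symmetric] mult.commute)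
      also have "(4 * x ^ 7)\<^sup>2 = 16 * x ^ 14" by (simp add: power_mult_distrib flip: power_mult)
      finally show ?thesis by (simp add: power_mult_distrib flip: power_mult)
    qed
    finally have "x ^ 5 * (L ^ d)\<^sup>2 * x \<le> x ^ 5 * (16 ^ d * x ^ (14 * d)) * x"
      using x0 by (intro mult_left_mono mult_right_mono) auto
    also have "\<dots> = 16 ^ d * x ^ (14 * d + 6)"
      by (simp add: power_add eval_nat_numeral)
    also have "\<dots> \<le> 16 ^ d * x ^ (25 * d)"
      using x d by (intro mult_left_mono power_increasing) auto
    also have "\<dots> \<le> 16 ^ d * v" using vx by simp
    finally show "x ^ 5 * (L ^ d)\<^sup>2 / v \<le> 16 ^ d / x"
      using v x0 by (simp add: field_simps)
  qed (use c in simp)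
  finally show ?thesis by (simp add: v_def)
qed

text \<open>The last condition makes the contribution of empty cubes negligible against the volume.\<close>

definition large_scale :: "'d::finite itself \<Rightarrow> real \<Rightarrow> bool" where
  "large_scale _ (x::real) \<longleftrightarrow>
     960 * real CARD('d) * (kiss TYPE('d) + 1) * 2 ^ CARD('d) \<le> x\<^sup>2 \<and> 12 * real CARD('d) \<le> x \<and>
     1 / sqrt x \<le> 1 / (192 * 2 ^ CARD('d)) / 12 \<and>
     128 * (real CARD('d))\<^sup>2 * (48 * real CARD('d)) ^ CARD('d) * 2 ^ (50 * (2 + 2 * CARD('d)))
       * (x ^ (50 * (2 + 2 * CARD('d)) + 1) * exp (- (x / (12 * real CARD('d))))) < 1"

lemma eventually_large_scale: "eventually (large_scale TYPE('d::finite)) at_top"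
  unfolding large_scale_def
proof (intro eventually_conj)
  let ?D = "12 * real CARD('d)" and ?N = "50 * (2 + 2 * CARD('d)) + 1"
  have D: "0 < ?D" by simp
  show "\<forall>\<^sub>F x in at_top. 960 * real CARD('d) * (kiss TYPE('d) + 1) * 2 ^ CARD('d) \<le> x\<^sup>2"
    using filterlim_pow_at_top[OF _ filterlim_ident, of 2] by (simp add: filterlim_at_top)
  show "\<forall>\<^sub>F x in at_top. 12 * real CARD('d) \<le> (x::real)" by (rule eventually_ge_at_top)
  have "((\<lambda>x. 1 / sqrt x) \<longlongrightarrow> 0) at_top"
    by (intro tendsto_divide_0[OF tendsto_const] filterlim_at_top_imp_at_infinity sqrt_at_top)
  then have "\<forall>\<^sub>F x in at_top. 1 / sqrt x < 1 / (192 * 2 ^ CARD('d)) / 12"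
    by (rule order_tendstoD) simp
  then show "\<forall>\<^sub>F x in at_top. 1 / sqrt x \<le> 1 / (192 * 2 ^ CARD('d)) / 12"
    by (rule eventually_mono) simp
  define A where "A = 128 * (real CARD('d))\<^sup>2 * (48 * real CARD('d)) ^ CARD('d) * 2 ^ (50 * (2 + 2 * CARD('d)))"
  have "((\<lambda>y. y ^ ?N / exp y) \<longlongrightarrow> 0) (at_top :: real filter)" by (rule tendsto_power_div_exp_0)
  moreover have "filterlim (\<lambda>x. x / ?D) at_top at_top"
    using D by (intro filterlim_tendsto_pos_mult_at_top[OF tendsto_const, where c = "1 / ?D", simplified]) (auto simp: filterlim_ident)
  ultimately have "((\<lambda>x. (x / ?D) ^ ?N / exp (x / ?D)) \<longlongrightarrow> 0) at_top"
    by (rule filterlim_compose)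
  then have "((\<lambda>x. A * ?D ^ ?N * ((x / ?D) ^ ?N / exp (x / ?D))) \<longlongrightarrow> A * ?D ^ ?N * 0) at_top"
    by (intro tendsto_mult tendsto_const)
  moreover have "A * ?D ^ ?N * ((x / ?D) ^ ?N / exp (x / ?D)) = A * (x ^ ?N * exp (- (x / ?D)))" for x
    using D by (simp only: power_divide exp_minus) (simp add: field_simps)
  ultimately have "((\<lambda>x. A * (x ^ ?N * exp (- (x / ?D)))) \<longlongrightarrow> 0) at_top"
    by simp
  then have "\<forall>\<^sub>F x in at_top. A * (x ^ ?N * exp (- (x / ?D))) < 1"
    by (rule order_tendstoD) simp
  then show "\<forall>\<^sub>F x in at_top. 128 * (real CARD('d))\<^sup>2 * (48 * real CARD('d)) ^ CARD('d) * 2 ^ (50 * (2 + 2 * CARD('d)))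
       * (x ^ (50 * (2 + 2 * CARD('d)) + 1) * exp (- (x / (12 * real CARD('d))))) < 1"
    unfolding A_def .
qed

text \<open>Collects the error terms of \<open>clt_bound\<close> for \<open>c\<close> equal to
  \<open>1 / (192 * 2 ^ CARD('d))\<close>, the lower bound in
  \<open>poisson_cost_positive\<close>.\<close>

definition clt_const :: "'d::finite itself \<Rightarrow> real" where
  "clt_const _ = 24 * (1 + sqrt (2000 * CARD('d)) * (kiss TYPE('d) + 1)) * (192 * 2 ^ CARD('d)) + 6
     + 6 * 48 ^ 3 * 16 ^ CARD('d) * (192 * 2 ^ CARD('d)) ^ 3"

lemma clt_const_pos: "0 < clt_const TYPE('d::finite)"
proof -
  have "0 \<le> sqrt (2000 * CARD('d)) * (kiss TYPE('d) + 1)"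
    using kiss_ge_1[where 'd = 'd] by (intro mult_nonneg_nonneg) auto
  then show ?thesis
    unfolding clt_const_def by (intro add_nonneg_pos add_pos_pos mult_nonneg_nonneg) auto
qed

context unit_poisson
begin

text \<open>For \<open>x\<close> the real number \<open>m\<close>, the cutoff is of order
  \<open>x\<close>, the margin \<open>R\<close> of order \<open>x ^ 4\<close> and the block half
  side of order \<open>x ^ 7\<close>. Then both \<rho> times the rate
  \<open>\<rho>\<^sup>2 / R\<close> and the boundary term \<open>\<rho>\<^sup>2 / s\<close> are of
  order \<open>1 / x\<close>, which is \<open>1 / sqrt x\<close> in L2. The smoothing scale is
  \<open>1 / x\<close>.\<close>

lemma clt_scale:
  fixes n m :: nat and f :: "real \<Rightarrow> real"
  assumes d: "2 \<le> CARD('d)" and m: "1 \<le> m" "m ^ 50 \<le> n" "n < (m + 1) ^ 50"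
    and large: "large_scale TYPE('d) (real m)" and f: "1-lipschitz_on UNIV f"
  shows "\<bar>(\<integral>x. f x \<partial>normalized_law M (mst_stat P n)) - (\<integral>x. f x \<partial>std_normal)\<bar> \<le> clt_const TYPE('d) / sqrt m"
proof -
  define x where "x = real m"
  define D where "D = real CARD('d)"
  define \<kappa> where "\<kappa> = kiss TYPE('d) + 1"
  define c where "c = 1 / (192 * 2 ^ CARD('d) :: real)"
  have D: "2 \<le> D" using d by (simp add: D_def)
  have \<kappa>: "2 \<le> \<kappa>" unfolding \<kappa>_def using kiss_ge_1[where 'd = 'd] by linarith
  have c: "0 < c" by (simp add: c_def)
  have L: "960 * D * \<kappa> * 2 ^ CARD('d) \<le> x\<^sup>2" "12 * D \<le> x" "1 / sqrt x \<le> c / 12"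
    "128 * D\<^sup>2 * (48 * D) ^ CARD('d) * 2 ^ (50 * (2 + 2 * CARD('d))) * (x ^ (50 * (2 + 2 * CARD('d)) + 1) * exp (- (x / (12 * D)))) < 1"
    using large unfolding large_scale_def D_def \<kappa>_def c_def x_def by auto
  have x: "24 \<le> x" using L(2) D by linarith
  have x0: "0 < x" using x by simp
  have n50: "x ^ 50 \<le> real n" unfolding x_def using m(2) by (simp only: of_nat_power[symmetric] of_nat_le_iff)
  have n2: "real n \<le> (2 * x) ^ 50"
  proof -
    have "real n \<le> (x + 1) ^ 50"
      using m(3) unfolding x_def by (metis less_imp_le of_nat_1 of_nat_add of_nat_le_iff of_nat_power)
    also have "\<dots> \<le> (2 * x) ^ 50" using x by (intro power_mono) auto
    finally show ?thesis .
  qed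
  have n7: "m ^ 7 \<le> n"
    using power_increasing[of 7 50 m] m by simp
  have n1: "1 \<le> n" using m n7 one_le_power[of m 7] by linarith
  have n0: "0 < real n" using n1 by simp
  define B where "B = n div m ^ 7"
  have m7: "0 < m ^ 7" using m by simp
  have B1: "1 \<le> B" unfolding B_def using n7 m7 by (simp add: div_greater_zero_iff Suc_le_eq)
  have B0: "0 < real B" using B1 by simp
  have nB: "real B * x ^ 7 \<le> real n" "real n \<le> 2 * (real B * x ^ 7)"
  proof -
    have "B * m ^ 7 \<le> n" by (simp add: B_def)
    then have "real (B * m ^ 7) \<le> real n" by (simp only: of_nat_le_iff)
    then show "real B * x ^ 7 \<le> real n" by (simp add: x_def)
    have "n < B * m ^ 7 + m ^ 7"
      unfolding B_def using div_mult_mod_eq[of n "m ^ 7"] mod_less_divisor[OF m7, of n] by linarith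
    moreover have "m ^ 7 \<le> B * m ^ 7" using B1 by simp
    ultimately have "n \<le> 2 * (B * m ^ 7)" by linarith
    then have "real n \<le> real (2 * (B * m ^ 7))" by (simp only: of_nat_le_iff)
    then show "real n \<le> 2 * (real B * x ^ 7)" by (simp add: x_def)
  qed
  \<comment> \<open>Dividing by \<open>s\<close> leads from the block half side of order
    \<open>x ^ 7\<close> to the margin of order \<open>x ^ 4\<close>; dividing by \<open>s'\<close>
    leads on to hole cubes of half side between \<open>x / (24 * D)\<close> and
    \<open>x / (12 * D)\<close>, small enough for a cutoff of at least \<open>x\<close> to connect
    occupied ones.\<close>
  define s where "s = m ^ 3"
  define s' where "s' = 24 * CARD('d) * m ^ 3"
  have s1: "1 \<le> s" "1 \<le> s'" using m d by (auto simp: s_def s'_def Suc_le_eq)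
  have s: "real s = x ^ 3" "real s' = 24 * D * x ^ 3" by (auto simp: s_def s'_def x_def D_def)
  define R where "R = real n / (real B * real s)"
  define r where "r = real n / (real B * real s * real s')"
  define V where "V = (2 * real n) ^ CARD('d)"
  have R: "x ^ 4 \<le> R" "R \<le> 2 * x ^ 4"
  proof -
    have p: "0 < real B * x ^ 3" using B0 x0 by simp
    have e: "x ^ 4 * (real B * x ^ 3) = real B * x ^ 7" by (simp add: eval_nat_numeral)
    show "x ^ 4 \<le> R" "R \<le> 2 * x ^ 4"
      unfolding R_def s pos_le_divide_eq[OF p] pos_divide_le_eq[OF p] mult.assoc[of 2] e by (rule nB)+
  qed
  have rR: "r = R / (24 * D * x ^ 3)"
    unfolding r_def R_def s by simp
  have r: "x / (24 * D) \<le> r" "r \<le> x / (12 * D)"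
  proof -
    have "x ^ 4 / (24 * D * x ^ 3) = x / (24 * D)" "2 * x ^ 4 / (24 * D * x ^ 3) = x / (12 * D)"
      using x0 D by (simp_all add: field_simps eval_nat_numeral)
    then show "x / (24 * D) \<le> r" "r \<le> x / (12 * D)"
      unfolding rR using R x0 D divide_right_mono[of "x ^ 4" R "24 * D * x ^ 3"] divide_right_mono[of R "2 * x ^ 4" "24 * D * x ^ 3"] by auto
  qed
  have x24: "x\<^sup>2 * x\<^sup>2 = x ^ 4" by (simp add: eval_nat_numeral)
  define K where "K = 192 * D * \<kappa> * 2 ^ CARD('d) * x\<^sup>2"
  have "192 * CARD('d) * (kiss TYPE('d) + 1) * 2 ^ CARD('d) * x\<^sup>2 \<le> K"
    unfolding K_def D_def \<kappa>_def by simp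
  then obtain \<rho> K' where \<rho>: "x \<le> \<rho>" "\<rho> \<le> 2 * x" and K': "2 * K \<le> K'" "K' \<le> 5 * K"
    and aK: "c \<le> poisson_cost \<rho> K'"
    using poisson_cost_positive[OF d, of x K] x unfolding c_def by auto
  have K5: "5 * K \<le> x ^ 4"
  proof -
    have "5 * K = 960 * D * \<kappa> * 2 ^ CARD('d) * x\<^sup>2" by (simp add: K_def)
    also have "\<dots> \<le> x\<^sup>2 * x\<^sup>2" using L(1) by (intro mult_right_mono) auto
    finally show ?thesis by (simp only: x24)
  qed
  have Kx: "x\<^sup>2 \<le> K"
  proof -
    have "1 * 1 * 1 * 1 \<le> 192 * D * \<kappa> * 2 ^ CARD('d)" using D \<kappa> by (intro mult_mono) auto
    then show ?thesis unfolding K_def using mult_right_mono[of 1 _ "x\<^sup>2"] by simp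
  qed
  have xx: "24 * x \<le> x\<^sup>2" using x by (simp add: power2_eq_square)
  have \<rho>0: "0 < \<rho>" using \<rho> x0 by linarith
  have \<rho>R: "2 * \<rho> < R"
    using \<rho> xx Kx K5 R x0 by linarith
  have aR: "c \<le> poisson_cost \<rho> R"
    using poisson_cost_mono_window[of \<rho> K' R] aK \<rho> \<rho>0 xx Kx K5 K' R x0 by linarith
  have xn: "x \<le> real n"
  proof -
    have "x ^ 1 \<le> x ^ 50" using x by (intro power_increasing) auto
    then show ?thesis using n50 by simp
  qed
  have \<rho>n: "\<rho> \<le> \<rho>max n"
  proof -
    have "real n * 1 \<le> real n * D" using D by (intro mult_left_mono) auto
    then show ?thesis using \<rho> xn unfolding \<rho>max_def D_def[symmetric] by linarith
  qed
  have \<rho>r: "2 * real CARD('d) * r < \<rho> / 3"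
  proof -
    have "2 * D * r \<le> 2 * D * (x / (12 * D))" using r(2) D by (intro mult_left_mono) auto
    also have "\<dots> = x / 6" using D by simp
    finally show ?thesis using \<rho> x0 unfolding D_def by linarith
  qed
  have dBs: "CARD('d) / (real B * real s) \<le> 1 / 2"
  proof -
    have "1 * (x ^ 3) \<le> real B * real s" unfolding s using B1 x0 by (intro mult_right_mono) auto
    moreover have "x ^ 1 \<le> x ^ 3" using x by (intro power_increasing) auto
    ultimately have "2 * D \<le> real B * real s" using L(2) D by simp
    then show ?thesis using D unfolding D_def by (simp add: divide_le_eq)
  qed
  have sx: "0 < sqrt x" "(1 / sqrt x)\<^sup>2 = 1 / x" using x0 by (auto simp: power_divide)
  have V1: "1 \<le> V" unfolding V_def using n1 by (intro one_le_power) simp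
  have hole: "2 * (\<rho>max n)\<^sup>2 * ((real B * real s * real s') ^ CARD('d) * (exp (- ((2 * r) ^ CARD('d))) * (4 * (V + 1)\<^sup>2))) < V * (1 / sqrt x)\<^sup>2"
    unfolding sx(2) \<rho>max_def
  proof (rule hole_error_small[OF _ _ _ _ n2 _ _ _ V_def])
    show "real CARD('d) = real CARD('d)" ..
    have "real B * real s * real s' = 24 * D * (real B * x ^ 6)"
      unfolding s by (simp add: eval_nat_numeral)
    also have "\<dots> \<le> 24 * D * real n"
    proof (intro mult_left_mono)
      have "real B * x ^ 6 \<le> real B * x ^ 7" using x by (intro mult_left_mono power_increasing) auto
      then show "real B * x ^ 6 \<le> real n" using nB by linarith
    qed (use D in simp)
    finally show "real B * real s * real s' \<le> 24 * real CARD('d) * real n" by (simp add: D_def)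
  qed (use d L x r n1 in \<open>auto simp: D_def\<close>)
  \<comment> \<open>The number 2000 exceeds 1024 + 4, the sum of the constants of the two variance
    terms below.\<close>
  define \<beta> where "\<beta> = sqrt (2000 * D) * \<kappa> / sqrt x"
  have \<beta>: "0 \<le> \<beta>" "\<beta>\<^sup>2 = 2000 * D * \<kappa>\<^sup>2 / x"
    using D \<kappa> x0 by (auto simp: \<beta>_def power_divide power_mult_distrib)
  have var: "\<kappa> * \<rho> * (poisson_cost \<rho> (2 * real n) - poisson_cost \<rho> R) + CARD('d) / s * (\<kappa> * \<rho>)\<^sup>2 < \<beta>\<^sup>2"
  proof -
    have \<rho>2: "\<rho>\<^sup>2 \<le> 4 * x\<^sup>2" using power_mono[OF \<rho>(2), of 2] \<rho>0 by (simp add: power_mult_distrib)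
    have Rn: "R \<le> 2 * real n"
    proof -
      have "1 * 1 \<le> real B * real s" using B1 s1 by (intro mult_mono) auto
      then show ?thesis unfolding R_def using n0 by (simp add: divide_le_eq mult_le_cancel_left1)
    qed
    have "poisson_cost \<rho> (2 * real n) - poisson_cost \<rho> R \<le> 128 * D * \<kappa> * \<rho>\<^sup>2 / R"
      using poisson_cost_rate[OF \<rho>0 \<rho>R Rn] by (simp add: D_def \<kappa>_def)
    also have "\<dots> \<le> 128 * D * \<kappa> * (4 * x\<^sup>2) / x ^ 4"
      using R x0 D \<kappa> \<rho>2 by (intro frac_le mult_left_mono mult_nonneg_nonneg) auto
    also have "\<dots> = 512 * D * \<kappa> / x\<^sup>2" unfolding x24[symmetric] using x0 by (simp add: field_simps)
    finally have a: "poisson_cost \<rho> (2 * real n) - poisson_cost \<rho> R \<le> 512 * D * \<kappa> / x\<^sup>2" .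
    have "\<kappa> * \<rho> * (poisson_cost \<rho> (2 * real n) - poisson_cost \<rho> R) \<le> \<kappa> * \<rho> * (512 * D * \<kappa> / x\<^sup>2)"
      using \<kappa> \<rho>0 a by (intro mult_left_mono) auto
    also have "\<dots> \<le> \<kappa> * (2 * x) * (512 * D * \<kappa> / x\<^sup>2)"
      using \<kappa> \<rho> D by (intro mult_right_mono mult_left_mono) auto
    also have "\<dots> = 1024 * (D * \<kappa>\<^sup>2 / x)" using x0 by (simp add: power2_eq_square)
    finally have 1: "\<kappa> * \<rho> * (poisson_cost \<rho> (2 * real n) - poisson_cost \<rho> R) \<le> 1024 * (D * \<kappa>\<^sup>2 / x)" .
    have "CARD('d) / s * (\<kappa> * \<rho>)\<^sup>2 \<le> D / x ^ 3 * (\<kappa>\<^sup>2 * (4 * x\<^sup>2))"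
      unfolding s D_def[symmetric] power_mult_distrib using \<rho>2 D x0 by (intro mult_left_mono) auto
    also have "\<dots> = 4 * (D * \<kappa>\<^sup>2 / x)" using x0 by (simp add: eval_nat_numeral)
    finally have 2: "CARD('d) / s * (\<kappa> * \<rho>)\<^sup>2 \<le> 4 * (D * \<kappa>\<^sup>2 / x)" .
    have "0 < D * \<kappa>\<^sup>2 / x" using D \<kappa> x0 by simp
    moreover have "\<beta>\<^sup>2 = 2000 * (D * \<kappa>\<^sup>2 / x)" unfolding \<beta>(2) by simp
    ultimately show ?thesis using 1 2 by linarith
  qed
  have "\<bar>(\<integral>x. f x \<partial>normalized_law M (mst_stat P n)) - (\<integral>x. f x \<partial>std_normal)\<bar>
    \<le> 24 * (1 / sqrt x + \<beta>) / c + 6 * (1 / x)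
      + 6 / (1 / x)\<^sup>2 * (real B ^ CARD('d) * (12 * (\<rho> * ((2 * real n / real B) ^ CARD('d) + 2)) / (c * sqrt V)) ^ 3)"
    unfolding V_def
    by (rule clt_bound[OF n1 B1 s1 \<rho>0 _ \<rho>n _ c _ dBs _ L(3) _ \<beta>(1) _ f])
      (use \<rho>R \<rho>r aR hole var x0 in \<open>simp_all add: R_def r_def V_def \<kappa>_def\<close>)
  also have "6 / (1 / x)\<^sup>2 * (real B ^ CARD('d) * (12 * (\<rho> * ((2 * real n / real B) ^ CARD('d) + 2)) / (c * sqrt V)) ^ 3)
      \<le> 6 * 48 ^ 3 * 16 ^ CARD('d) / c ^ 3 / x"
  proof (rule lindeberg_error_small)
    have "2 * x ^ 7 \<le> 2 * real n / real B" using nB B0 by (simp add: le_divide_eq mult.commute)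
    moreover have "1 \<le> x ^ 7" using x by (intro one_le_power) simp
    ultimately show "2 \<le> 2 * real n / real B" by linarith
    show "2 * real n / real B \<le> 4 * x ^ 7" using nB B0 by (simp add: divide_le_eq mult.commute)
    show "V = (real B * (2 * real n / real B)) ^ CARD('d)" unfolding V_def using B0 by simp
    have "x ^ (50 * CARD('d)) = (x ^ 50) ^ CARD('d)" by (rule power_mult)
    also have "\<dots> \<le> V" unfolding V_def using n50 x0 n0 by (intro power_mono) auto
    finally show "x ^ (50 * CARD('d)) \<le> V" .
  qed (use d x \<rho> \<rho>0 B0 c in auto)
  also have "24 * (1 / sqrt x + \<beta>) / c + 6 * (1 / x) + 6 * 48 ^ 3 * 16 ^ CARD('d) / c ^ 3 / x
    \<le> clt_const TYPE('d) / sqrt x"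
  proof -
    have le: "1 / x \<le> 1 / sqrt x"
    proof -
      have "sqrt x * 1 \<le> sqrt x * sqrt x" using x by (intro mult_left_mono) auto
      then show ?thesis using x0 sx by (intro divide_left_mono) auto
    qed
    have e: "24 * (1 / sqrt x + \<beta>) / c = 24 * (1 + sqrt (2000 * D) * \<kappa>) * (1 / c) * (1 / sqrt x)"
      by (simp add: \<beta>_def add_divide_distrib distrib_left mult_ac)
    have e3: "6 * 48 ^ 3 * 16 ^ CARD('d) / c ^ 3 / x = 6 * 48 ^ 3 * 16 ^ CARD('d) * (1 / c) ^ 3 * (1 / x)"
      by (simp add: power_divide)
    have "6 * 48 ^ 3 * 16 ^ CARD('d) * (1 / c) ^ 3 * (1 / x) \<le> 6 * 48 ^ 3 * 16 ^ CARD('d) * (1 / c) ^ 3 * (1 / sqrt x)"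
      using le c by (intro mult_left_mono) auto
    moreover have "clt_const TYPE('d) / sqrt x = 24 * (1 + sqrt (2000 * D) * \<kappa>) * (1 / c) * (1 / sqrt x)
      + 6 * (1 / sqrt x) + 6 * 48 ^ 3 * 16 ^ CARD('d) * (1 / c) ^ 3 * (1 / sqrt x)"
    proof -
      have "clt_const TYPE('d) = 24 * (1 + sqrt (2000 * D) * \<kappa>) * (1 / c) + 6 + 6 * 48 ^ 3 * 16 ^ CARD('d) * (1 / c) ^ 3"
        by (simp add: clt_const_def D_def \<kappa>_def c_def)
      then show ?thesis by (simp only: times_divide_eq_right mult_1_right add_divide_distrib)
    qed
    ultimately show ?thesis using le unfolding e e3 by linarith
  qed
  finally show ?thesis by (simp add: x_def)
qed

end

section \<open>Rates in terms of n and the stated bounds\<close>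

lemma power_bracket:
  fixes n N :: nat
  assumes "1 \<le> n" "1 \<le> N"
  shows "\<exists>m. m ^ N \<le> n \<and> n < (m + 1) ^ N"
proof -
  have bound: "m \<le> n" if "m ^ N \<le> n" for m
    using self_le_power[of m N] that assms by (cases "m = 0") auto
  define m where "m = Max {m. m ^ N \<le> n}"
  have fin: "finite {m. m ^ N \<le> n}" by (rule finite_subset[of _ "{..n}"]) (use bound in auto)
  have "0 \<in> {m. m ^ N \<le> n}" using assms by (simp add: power_0_left)
  then have "m \<in> {m. m ^ N \<le> n}" unfolding m_def by (intro Max_in fin) auto
  moreover have "\<not> (m + 1) ^ N \<le> n"
  proof
    assume "(m + 1) ^ N \<le> n"
    then have "m + 1 \<le> m" unfolding m_def by (intro Max_ge fin) (simp add: m_def[symmetric])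
    then show False by simp
  qed
  ultimately show ?thesis by auto
qed

text \<open>Placing \<open>n\<close> between consecutive 50th powers turns \<open>1 / sqrt m\<close>
  into a multiple of \<open>n powr (- 1 / 100)\<close>. Below the threshold of large scales the
  trivial bound 2 is absorbed into the constant.\<close>

lemma lipschitz_clt:
  assumes d: "2 \<le> CARD('d::finite)"
  shows "\<exists>C>0. \<forall>(M :: 'w measure) (P :: 'w \<Rightarrow> (real^'d) set) (n::nat) f. poisson_process_1 M P \<longrightarrow> 1 \<le> n \<longrightarrow> 1-lipschitz_on UNIV f
    \<longrightarrow> \<bar>(\<integral>x. f x \<partial>normalized_law M (mst_stat P n)) - (\<integral>x. f x \<partial>std_normal)\<bar> \<le> C * real n powr (- 1 / 100)"
proof -
  obtain x\<^sub>0 where x\<^sub>0: "\<And>x. x\<^sub>0 \<le> x \<Longrightarrow> large_scale TYPE('d) x"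
    using eventually_large_scale[where 'd = 'd] by (auto simp: eventually_at_top_linorder)
  define m\<^sub>0 where "m\<^sub>0 = nat \<lceil>x\<^sub>0\<rceil> + 1"
  have m\<^sub>0: "x\<^sub>0 \<le> real m\<^sub>0" "1 \<le> m\<^sub>0" unfolding m\<^sub>0_def by linarith+
  define C where "C = 2 * sqrt (real m\<^sub>0) + 2 * clt_const TYPE('d)"
  have "\<bar>(\<integral>x. f x \<partial>normalized_law M (mst_stat P n)) - (\<integral>x. f x \<partial>std_normal)\<bar> \<le> C * real n powr (- 1 / 100)"
    if pp: "poisson_process_1 M P" and n: "1 \<le> n" and f: "1-lipschitz_on UNIV f"
    for M :: "'w measure" and P :: "'w \<Rightarrow> (real^'d) set" and n :: nat and f
  proof -
    interpret unit_poisson M P by standard (rule pp)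
    obtain m where m: "m ^ 50 \<le> n" "n < (m + 1) ^ 50" using power_bracket[OF n, of 50] by auto
    have m1: "1 \<le> m"
    proof (rule ccontr)
      assume "\<not> 1 \<le> m"
      then have "m = 0" by simp
      then have "n < 1" using m(2) by simp
      then show False using n by simp
    qed
    have pw: "(x ^ 50) powr (- 1 / 100) = 1 / sqrt x" if "0 < x" for x :: real
    proof -
      have "x ^ 50 = x powr 50" using powr_realpow[OF that, of 50] by simp
      then have "(x ^ 50) powr (- 1 / 100) = x powr (50 * (- 1 / 100))" by (simp only: powr_powr)
      also have "50 * (- 1 / 100) = - (1 / 2 :: real)" by simp
      also have "x powr (- (1 / 2)) = 1 / sqrt x"
        using that powr_half_sqrt[of x] by (simp only: powr_minus inverse_eq_divide)
      finally show ?thesis .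
    qed
    have n0: "0 < real n" using n by simp
    show ?thesis
    proof (cases "m\<^sub>0 \<le> m")
      case True
      have "\<bar>(\<integral>x. f x \<partial>normalized_law M (mst_stat P n)) - (\<integral>x. f x \<partial>std_normal)\<bar> \<le> clt_const TYPE('d) / sqrt m"
        using True m\<^sub>0 by (intro clt_scale d m1 m f x\<^sub>0) linarith
      also have "\<dots> \<le> clt_const TYPE('d) * (2 * real n powr (- 1 / 100))"
      proof -
        \<comment> \<open>Any factor of at least two would do; four has a rational square
          root.\<close>
        have "n < (4 * m) ^ 50"
          using m(2) power_mono[of "m + 1" "4 * m" 50] m1 by linarith
        then have "real n \<le> (4 * real m) ^ 50"
          by (metis less_imp_le of_nat_le_iff of_nat_mult of_nat_numeral of_nat_power)
        then have "((4 * real m) ^ 50) powr (- 1 / 100) \<le> real n powr (- 1 / 100)"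
          using n0 by (intro powr_mono2') auto
        then have "1 / sqrt (4 * real m) \<le> real n powr (- 1 / 100)"
          using pw[of "4 * real m"] m1 by simp
        then have "1 / sqrt m \<le> 2 * real n powr (- 1 / 100)"
          by (simp add: real_sqrt_mult)
        then show ?thesis
          using clt_const_pos[where 'd = 'd] mult_left_mono[of "1 / sqrt m" _ "clt_const TYPE('d)"] by simp
      qed
      also have "\<dots> \<le> C * real n powr (- 1 / 100)"
        unfolding C_def by (simp add: distrib_right)
      finally show ?thesis .
    next
      case False
      have "n < m\<^sub>0 ^ 50"
        using m(2) power_mono[of "m + 1" m\<^sub>0 50] False by linarith
      then have "real n \<le> real m\<^sub>0 ^ 50"
        by (metis less_imp_le of_nat_le_iff of_nat_power)
      then have "(real m\<^sub>0 ^ 50) powr (- 1 / 100) \<le> real n powr (- 1 / 100)"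
        using n0 by (intro powr_mono2') auto
      then have "1 / sqrt m\<^sub>0 \<le> real n powr (- 1 / 100)"
        using pw[of "real m\<^sub>0"] m\<^sub>0 by simp
      then have "2 * sqrt m\<^sub>0 * (1 / sqrt m\<^sub>0) \<le> 2 * sqrt m\<^sub>0 * real n powr (- 1 / 100)"
        by (intro mult_left_mono) auto
      then have "2 \<le> 2 * sqrt m\<^sub>0 * real n powr (- 1 / 100)" using m\<^sub>0 by simp
      also have "\<dots> \<le> C * real n powr (- 1 / 100)"
        unfolding C_def using clt_const_pos[where 'd = 'd] by (intro mult_right_mono) auto
      finally show ?thesis
        using normalized_law_trivial_bound[OF prob_space_axioms mst_sq_int[OF n] f] by linarith
    qed
  qed
  moreover have "0 < C" unfolding C_def using clt_const_pos[where 'd = 'd] by (intro add_nonneg_pos) auto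
  ultimately show ?thesis by blast
qed

text \<open>Passing from test functions to the Kolmogorov distance takes a square root, which halves
  the exponent; the square root of the Wasserstein distance has the same exponent directly.\<close>

lemma distances_polynomial_rate:
  assumes d: "2 \<le> CARD('d::finite)"
  shows "\<exists>C>0. \<forall>(M :: 'w measure) (P :: 'w \<Rightarrow> (real^'d) set) (n::nat). poisson_process_1 M P \<longrightarrow> 1 \<le> n
    \<longrightarrow> kolmogorov_dist (normalized_law M (mst_stat P n)) std_normal \<le> C * real n powr (- 1 / 200) \<and>
      sqrt (wasserstein_dist (normalized_law M (mst_stat P n)) std_normal) \<le> C * real n powr (- 1 / 200)"
proof -
  obtain C :: real where C: "0 < C" "\<And>(M :: 'w measure) (P :: 'w \<Rightarrow> (real^'d) set) n f. poisson_process_1 M P \<Longrightarrow> 1 \<le> n \<Longrightarrow> 1-lipschitz_on UNIV f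
    \<Longrightarrow> \<bar>(\<integral>x. f x \<partial>normalized_law M (mst_stat P n)) - (\<integral>x. f x \<partial>std_normal)\<bar> \<le> C * real n powr (- 1 / 100)"
    using lipschitz_clt[OF d, where 'w = 'w] by blast
  have "kolmogorov_dist (normalized_law M (mst_stat P n)) std_normal \<le> 2 * sqrt C * real n powr (- 1 / 200) \<and>
      sqrt (wasserstein_dist (normalized_law M (mst_stat P n)) std_normal) \<le> 2 * sqrt C * real n powr (- 1 / 200)"
    if pp: "poisson_process_1 M P" and n: "1 \<le> n" for M :: "'w measure" and P :: "'w \<Rightarrow> (real^'d) set" and n
  proof -
    interpret unit_poisson M P by standard (rule pp)
    let ?\<mu> = "normalized_law M (mst_stat P n)" and ?w = "C * real n powr (- 1 / 100)"
    have n0: "0 < real n" using n by simp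
    have w: "0 < ?w" using C n0 by simp
    have "real n powr (- 1 / 100) = (real n powr (- 1 / 200))\<^sup>2"
      using n0 by (simp flip: powr_realpow powr_add add: power2_eq_square)
    then have sw: "sqrt ?w = sqrt C * real n powr (- 1 / 200)"
      by (simp add: real_sqrt_mult)
    have "prob_space ?\<mu>" "sets ?\<mu> = sets borel"
      unfolding normalized_law_def by (auto intro!: prob_space_distr)
    then have "kolmogorov_dist ?\<mu> std_normal \<le> 2 * sqrt ?w"
      using kolmogorov_dist_le[OF _ _ w] C(2)[OF pp n] by blast
    moreover have "wasserstein_dist ?\<mu> std_normal \<le> ?w"
      using C(2)[OF pp n] by (rule wasserstein_dist_le)
    then have "sqrt (wasserstein_dist ?\<mu> std_normal) \<le> sqrt ?w" by simp
    moreover have "sqrt ?w \<le> 2 * sqrt ?w" using w by simp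
    ultimately show ?thesis unfolding sw by (auto simp: mult.assoc)
  qed
  then show ?thesis using C(1) by (intro exI[of _ "2 * sqrt C"]) auto
qed

theorem theorem2p1:
  shows "(CARD('d) = 2 \<longrightarrow>
          (\<exists>\<beta>>0. \<forall>p>1::real. \<exists>c1>0. \<forall>(M::'w measure) (P::'w \<Rightarrow> (real^'d) set).
             poisson_process_1 M P \<longrightarrow> (\<forall>n::nat\<ge>1.
               kolmogorov_dist (normalized_law M (mst_stat P n)) std_normal
                 \<le> c1 * real n powr (- \<beta> / (4 * (\<beta> + p))) \<and>
               sqrt (wasserstein_dist (normalized_law M (mst_stat P n)) std_normal)
                 \<le> c1 * real n powr (- \<beta> / (4 * (\<beta> + p))))))
       \<and> (CARD('d) \<ge> 3 \<longrightarrow>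
          (\<forall>p>1::real. \<exists>c2>0. \<forall>(M::'w measure) (P::'w \<Rightarrow> (real^'d) set).
             poisson_process_1 M P \<longrightarrow> (\<forall>n::nat\<ge>2.
               kolmogorov_dist (normalized_law M (mst_stat P n)) std_normal
                 \<le> c2 * ln (real n) powr (- real CARD('d) / (8 * p)) \<and>
               sqrt (wasserstein_dist (normalized_law M (mst_stat P n)) std_normal)
                 \<le> c2 * ln (real n) powr (- real CARD('d) / (8 * p)))))"
proof (intro conjI impI)
  assume "CARD('d) = 2"
  then have "2 \<le> CARD('d)" by simp
  from distances_polynomial_rate[OF this, where 'w = 'w]
  obtain C where C: "0 < C" "\<And>(M :: 'w measure) (P :: 'w \<Rightarrow> (real^'d) set) n. poisson_process_1 M P \<Longrightarrow> 1 \<le> n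
    \<Longrightarrow> kolmogorov_dist (normalized_law M (mst_stat P n)) std_normal \<le> C * real n powr (- 1 / 200) \<and>
      sqrt (wasserstein_dist (normalized_law M (mst_stat P n)) std_normal) \<le> C * real n powr (- 1 / 200)"
    by blast
  \<comment> \<open>With \<beta> equal to \<open>1 / 50\<close> and \<open>p\<close> above one,
    \<open>\<beta> / (4 * (\<beta> + p))\<close> stays below \<open>1 / 200\<close>, so one constant
    serves all \<open>p\<close>.\<close>
  have le: "C * real n powr (- 1 / 200) \<le> C * real n powr (- (1 / 50) / (4 * (1 / 50 + p)))"
    if "1 < p" "1 \<le> n" for p :: real and n :: nat
    using that C(1) by (intro mult_left_mono powr_mono) (auto simp: field_simps)
  show "\<exists>\<beta>>0. \<forall>p>1::real. \<exists>c1>0. \<forall>(M::'w measure) (P::'w \<Rightarrow> (real^'d) set).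
             poisson_process_1 M P \<longrightarrow> (\<forall>n::nat\<ge>1.
               kolmogorov_dist (normalized_law M (mst_stat P n)) std_normal
                 \<le> c1 * real n powr (- \<beta> / (4 * (\<beta> + p))) \<and>
               sqrt (wasserstein_dist (normalized_law M (mst_stat P n)) std_normal)
                 \<le> c1 * real n powr (- \<beta> / (4 * (\<beta> + p))))"
  proof (rule exI[of _ "1 / 50"], intro conjI allI impI)
    fix p :: real assume p: "1 < p"
    show "\<exists>c1>0. \<forall>(M::'w measure) (P::'w \<Rightarrow> (real^'d) set).
             poisson_process_1 M P \<longrightarrow> (\<forall>n::nat\<ge>1.
               kolmogorov_dist (normalized_law M (mst_stat P n)) std_normal
                 \<le> c1 * real n powr (- (1 / 50) / (4 * (1 / 50 + p))) \<and>
               sqrt (wasserstein_dist (normalized_law M (mst_stat P n)) std_normal)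
                 \<le> c1 * real n powr (- (1 / 50) / (4 * (1 / 50 + p))))"
      using C(1) order_trans[OF _ le[OF p]] C(2) by blast
  qed simp
next
  assume "3 \<le> CARD('d)"
  then have "2 \<le> CARD('d)" by simp
  from distances_polynomial_rate[OF this, where 'w = 'w]
  obtain C where C: "0 < C" "\<And>(M :: 'w measure) (P :: 'w \<Rightarrow> (real^'d) set) n. poisson_process_1 M P \<Longrightarrow> 1 \<le> n
    \<Longrightarrow> kolmogorov_dist (normalized_law M (mst_stat P n)) std_normal \<le> C * real n powr (- 1 / 200) \<and>
      sqrt (wasserstein_dist (normalized_law M (mst_stat P n)) std_normal) \<le> C * real n powr (- 1 / 200)"
    by blast
  show "\<forall>p>1::real. \<exists>c2>0. \<forall>(M::'w measure) (P::'w \<Rightarrow> (real^'d) set).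
             poisson_process_1 M P \<longrightarrow> (\<forall>n::nat\<ge>2.
               kolmogorov_dist (normalized_law M (mst_stat P n)) std_normal
                 \<le> c2 * ln (real n) powr (- real CARD('d) / (8 * p)) \<and>
               sqrt (wasserstein_dist (normalized_law M (mst_stat P n)) std_normal)
                 \<le> c2 * ln (real n) powr (- real CARD('d) / (8 * p)))"
  proof (intro allI impI)
    fix p :: real assume p: "1 < p"
    define q where "q = real CARD('d) / (8 * p)"
    have q: "0 < q" using p by (simp add: q_def)
    define A where "A = (200 * q) powr q"
    have A: "0 < A" using q by (simp add: A_def)
    have le: "C * real n powr (- 1 / 200) \<le> C * A * ln (real n) powr (- real CARD('d) / (8 * p))" if n: "2 \<le> n" for n :: nat
    proof -
      have ln: "0 < ln (real n)" "0 < real n" using n by auto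
      \<comment> \<open>A logarithm is beaten by any power; the exponent
        \<open>1 / (200 * q)\<close> is the one that becomes \<open>1 / 200\<close> after raising to
        the power \<open>q\<close>.\<close>
      have "ln (real n) \<le> real n powr (1 / (200 * q)) / (1 / (200 * q))"
        using n q by (intro ln_powr_bound) auto
      then have "ln (real n) powr q \<le> (200 * q * real n powr (1 / (200 * q))) powr q"
        using ln q by (intro powr_mono2) (auto simp: mult_ac)
      also have "\<dots> = A * real n powr (1 / 200)"
        using q ln by (simp add: A_def powr_mult powr_powr)
      finally have "ln (real n) powr q * (real n powr (- (1 / 200)) * ln (real n) powr (- q))
          \<le> A * real n powr (1 / 200) * (real n powr (- (1 / 200)) * ln (real n) powr (- q))"
        by (rule mult_right_mono) simp
      moreover have "ln (real n) powr q * ln (real n) powr (- q) = 1" "real n powr (1 / 200) * real n powr (- (1 / 200)) = 1"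
        using ln n by (simp_all flip: powr_add)
      moreover have "v \<le> A * w" if "u * (v * w) \<le> A * z * (v * w)" "u * w = 1" "z * v = 1" for u v w z
      proof -
        have eq: "u * (v * w) = v * (u * w)" "A * z * (v * w) = A * (z * v) * w" by (simp_all only: mult_ac)
        show ?thesis using that(1) unfolding eq that(2,3) by simp
      qed
      ultimately have "real n powr (- (1 / 200)) \<le> A * ln (real n) powr (- q)" by blast
      then show ?thesis
        using C(1) by (simp add: q_def mult.assoc)
    qed
    show "\<exists>c2>0. \<forall>(M::'w measure) (P::'w \<Rightarrow> (real^'d) set).
             poisson_process_1 M P \<longrightarrow> (\<forall>n::nat\<ge>2.
               kolmogorov_dist (normalized_law M (mst_stat P n)) std_normal
                 \<le> c2 * ln (real n) powr (- real CARD('d) / (8 * p)) \<and>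
               sqrt (wasserstein_dist (normalized_law M (mst_stat P n)) std_normal)
                 \<le> c2 * ln (real n) powr (- real CARD('d) / (8 * p)))"
    proof (intro exI[of _ "C * A"] conjI allI impI)
      fix M :: "'w measure" and P :: "'w \<Rightarrow> (real^'d) set" and n :: nat
      assume pp: "poisson_process_1 M P" and n: "2 \<le> n"
      have n1: "1 \<le> n" using n by simp
      show "kolmogorov_dist (normalized_law M (mst_stat P n)) std_normal \<le> C * A * ln (real n) powr (- real CARD('d) / (8 * p))"
        using C(2)[OF pp n1] le[OF n] by linarith
      show "sqrt (wasserstein_dist (normalized_law M (mst_stat P n)) std_normal) \<le> C * A * ln (real n) powr (- real CARD('d) / (8 * p))"
        using C(2)[OF pp n1] le[OF n] by linarith
    qed (use C A in simp)
  qed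
qed

end
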